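(* Let $\lambda\in\mathbb{R}\setminus\{0\}$ and consider the real polynomial system $$\dot x=-y+xF_2(x,y,z),\qquad \dot y=x+yF_2(x,y,z),\qquad \dot z=-\lambda z+R_2(x,y,z),$$ where $F_2(x,y,z)=R_2(x,y,z)=\sum_{j+k+l=2}a_{jkl}x^jy^kz^l$ with real coefficients. The two center conditions are $\{a_{200}=a_{110}=a_{020}=0\}$ and $\{a_{020}=-a_{200},\ a_{101}=a_{011}=a_{002}=0\}$ (that is, the origin is a rigid center exactly when one of them holds). The cyclicity of the center under quadratic perturbations is at least $3$ for the first center condition and at least $2$ for the last.
   Context: A system $\dot x=-y+P$, $\dot y=x+Q$, $\dot z=-\lambda z+R$, with $\lambda\neq0$ and $P,Q,R$ real polynomials in $(x,y,z)$ without constant or linear terms, has at the origin a local center manifold $W^c$ (an invariant surface tangent to the $xy$-plane at the origin). The origin is a center on the center manifold if all orbits on $W^c$ near the origin, other than the origin itself, are periodic. The system is rigid if its restriction to a center manifold has constant angular speed, i.e. $(xQ-yP)|_{z=h(x,y)}\equiv 0$ where $z=h(x,y)$ is a local center manifold. A rigid center is a center on the center manifold of a rigid system. The parameter values for which the system has a rigid center at the origin are called center conditions. Quadratic perturbations of such a system are the systems $$\dot x=\lambda_0x-y+P+G_1,\quad \dot y=x+\lambda_0y+Q+G_2,\quad \dot z=-\lambda z+R+G_3,$$ where $\lambda_0\in\mathbb{R}$ and $G_1,G_2,G_3$ are arbitrary homogeneous quadratic polynomials in $(x,y,z)$ with real coefficients; the perturbation parameters are $\lambda_0$ and the coefficients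 of $G_1,G_2,G_3$. The cyclicity of the center at the origin under quadratic perturbations is at least $k$ if for every neighborhood $U$ of the origin and every $\varepsilon>0$ there is a choice of perturbation parameters, all of absolute value less than $\varepsilon$, for which the perturbed system has at least $k$ limit cycles (isolated periodic orbits) contained in $U$. *)

theory Defs
  imports "HOL-Analysis.Analysis"
begin

type_synonym space = "real \<times> real \<times> real"
type_synonym coeffs = "nat \<Rightarrow> nat \<Rightarrow> nat \<Rightarrow> real"

definition hom_quadratic :: "coeffs \<Rightarrow> space \<Rightarrow> real" where
  "hom_quadratic a = (\<lambda>(x, y, z). \<Sum>(j, k, l)\<in>{(j, k, l). j + k + l = 2}. a j k l * x ^ j * y ^ k * z ^ l)"

lemma hom_quadratic_expand:
  "hom_quadratic a (x, y, z) =
     a 2 0 0 * x\<^sup>2 + a 1 1 0 * (x * y) + a 0 2 0 * y\<^sup>2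
     + a 1 0 1 * (x * z) + a 0 1 1 * (y * z) + a 0 0 2 * z\<^sup>2"
proof -
  let ?A = "{(j, k, l). j + k + l = (2::nat)}"
  let ?B = "{(2, 0, 0), (1, 1, 0), (0, 2, 0), (1, 0, 1), (0, 1, 1), (0, 0, 2 :: nat)} :: (nat \<times> nat \<times> nat) set"
  have "(j, k, l) \<in> ?B" if "j + k + l = 2" for j k l
  proof -
    have "j = 0 \<or> j = 1 \<or> j = 2" "k = 0 \<or> k = 1 \<or> k = 2" "l = 2 - j - k"
      using that by linarith+
    with that show ?thesis by (elim disjE) simp_all
  qed
  then have "?A \<subseteq> ?B" by blast
  moreover have "?B \<subseteq> ?A" by simp
  ultimately have "?A = ?B" by (rule subset_antisym)
  then show ?thesis
    unfolding hom_quadratic_def prod.case by (simp only:) simp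
qed

definition system_field ::
    "real \<Rightarrow> real \<Rightarrow> (space \<Rightarrow> real) \<Rightarrow> (space \<Rightarrow> real) \<Rightarrow> (space \<Rightarrow> real) \<Rightarrow> space \<Rightarrow> space" where
  "system_field lam0 lam P Q R =
     (\<lambda>(x, y, z). (lam0 * x - y + P (x, y, z), x + lam0 * y + Q (x, y, z), - lam * z + R (x, y, z)))"

definition solution_on :: "(space \<Rightarrow> space) \<Rightarrow> real set \<Rightarrow> (real \<Rightarrow> space) \<Rightarrow> bool" where
  "solution_on X I \<phi> \<longleftrightarrow> (\<forall>t\<in>I. (\<phi> has_vector_derivative X (\<phi> t)) (at t within I))"

definition periodic_orbit :: "(space \<Rightarrow> space) \<Rightarrow> space set \<Rightarrow> bool" where
  "periodic_orbit X \<Gamma> \<longleftrightarrow>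
     (\<exists>\<phi> T. solution_on X UNIV \<phi> \<and> T > 0 \<and> (\<forall>t. \<phi> (t + T) = \<phi> t)
        \<and> (\<exists>t. \<phi> t \<noteq> \<phi> 0) \<and> \<Gamma> = range \<phi>)"

text \<open>Isolation is among periodic orbits lying entirely near \<open>\<Gamma>\<close>; other periodic orbits
  that merely pass close to \<open>\<Gamma>\<close> are not excluded.\<close>

definition limit_cycle :: "(space \<Rightarrow> space) \<Rightarrow> space set \<Rightarrow> bool" where
  "limit_cycle X \<Gamma> \<longleftrightarrow>
     periodic_orbit X \<Gamma>
     \<and> (\<exists>N. open N \<and> \<Gamma> \<subseteq> N \<and> (\<forall>\<Gamma>'. periodic_orbit X \<Gamma>' \<and> \<Gamma>' \<subseteq> N \<longrightarrow> \<Gamma>' = \<Gamma>))"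

definition graph_over :: "(real \<times> real) set \<Rightarrow> (real \<times> real \<Rightarrow> real) \<Rightarrow> space set" where
  "graph_over V h = {(x, y, h (x, y)) | x y. (x, y) \<in> V}"

text \<open>A local center manifold is the graph \<open>z = h(x, y)\<close> of a \<open>C\<^sup>1\<close> function on an open
  neighborhood \<open>V\<close> of the origin, tangent to the \<open>xy\<close>-plane at the origin and locally
  invariant: a solution meeting the graph stays in it (forwards and backwards) as long as its
  \<open>xy\<close>-projection stays in \<open>V\<close>. Center manifolds need not be unique or smoother than
  finitely differentiable, so no further regularity is imposed.\<close>

definition local_center_manifold ::
    "(space \<Rightarrow> space) \<Rightarrow> (real \<times> real) set \<Rightarrow> (real \<times> real \<Rightarrow> real) \<Rightarrow> bool" where
  "local_center_manifold X V h \<longleftrightarrow>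
     open V \<and> (0, 0) \<in> V
     \<and> (\<exists>h' :: real \<times> real \<Rightarrow> (real \<times> real) \<Rightarrow>\<^sub>L real.
          (\<forall>p\<in>V. (h has_derivative blinfun_apply (h' p)) (at p))
          \<and> continuous_on V h' \<and> h (0, 0) = 0 \<and> h' (0, 0) = 0)
     \<and> (\<forall>\<phi> I. is_interval I \<and> solution_on X I \<phi>
          \<and> (\<exists>t\<in>I. \<phi> t \<in> graph_over V h)
          \<and> (\<forall>t\<in>I. (fst (\<phi> t), fst (snd (\<phi> t))) \<in> V)
          \<longrightarrow> (\<forall>t\<in>I. \<phi> t \<in> graph_over V h))"

definition center_on_graph ::
    "(space \<Rightarrow> space) \<Rightarrow> (real \<times> real) set \<Rightarrow> (real \<times> real \<Rightarrow> real) \<Rightarrow> bool" where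
  "center_on_graph X V h \<longleftrightarrow>
     (\<exists>N. open N \<and> (0, 0, 0) \<in> N
        \<and> (\<forall>p \<in> graph_over V h \<inter> N. p \<noteq> (0, 0, 0)
             \<longrightarrow> (\<exists>\<Gamma>. periodic_orbit X \<Gamma> \<and> p \<in> \<Gamma> \<and> \<Gamma> \<subseteq> graph_over V h)))"

definition rigid_on_graph ::
    "(space \<Rightarrow> real) \<Rightarrow> (space \<Rightarrow> real) \<Rightarrow> (real \<times> real) set \<Rightarrow> (real \<times> real \<Rightarrow> real) \<Rightarrow> bool" where
  "rigid_on_graph P Q V h \<longleftrightarrow>
     (\<forall>(x, y)\<in>V. x * Q (x, y, h (x, y)) - y * P (x, y, h (x, y)) = 0)"

definition rigid_center ::
    "real \<Rightarrow> (space \<Rightarrow> real) \<Rightarrow> (space \<Rightarrow> real) \<Rightarrow> (space \<Rightarrow> real) \<Rightarrow> bool" where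
  "rigid_center lam P Q R \<longleftrightarrow>
     (\<exists>V h. local_center_manifold (system_field 0 lam P Q R) V h
        \<and> rigid_on_graph P Q V h
        \<and> center_on_graph (system_field 0 lam P Q R) V h)"

text \<open>Only the coefficients \<open>g j k l\<close> with \<open>j + k + l = 2\<close> enter \<open>hom_quadratic g\<close>, so
  only these are required to be small.\<close>

definition quadratic_cyclicity_at_least ::
    "nat \<Rightarrow> real \<Rightarrow> (space \<Rightarrow> real) \<Rightarrow> (space \<Rightarrow> real) \<Rightarrow> (space \<Rightarrow> real) \<Rightarrow> bool" where
  "quadratic_cyclicity_at_least n lam P Q R \<longleftrightarrow>
     (\<forall>U \<epsilon>. open U \<and> (0, 0, 0) \<in> U \<and> \<epsilon> > 0 \<longrightarrow>
        (\<exists>(lam0::real) (g1::coeffs) (g2::coeffs) (g3::coeffs).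
           \<bar>lam0\<bar> < \<epsilon>
           \<and> (\<forall>j k l. j + k + l = 2 \<longrightarrow>
                 \<bar>g1 j k l\<bar> < \<epsilon> \<and> \<bar>g2 j k l\<bar> < \<epsilon> \<and> \<bar>g3 j k l\<bar> < \<epsilon>)
           \<and> (\<exists>S. finite S \<and> card S = n
                \<and> (\<forall>\<Gamma>\<in>S. \<Gamma> \<subseteq> U
                     \<and> limit_cycle
                         (system_field lam0 lam
                            (\<lambda>p. P p + hom_quadratic g1 p)
                            (\<lambda>p. Q p + hom_quadratic g2 p)
                            (\<lambda>p. R p + hom_quadratic g3 p)) \<Gamma>))))"

end

theory Submission
 imports Defs
begin

text \<open>
  Since \<open>x Q - y P = 0\<close>, every solution off the \<open>z\<close>-axis turns with unit angular speed, and in polar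
  coordinates the system reads \<open>r' = r F\<close>, \<open>z' = - \<lambda> z + F\<close> with
  \<open>F = f(\<theta>) r\<^sup>2 + l(\<theta>) r z + d z\<^sup>2\<close>.  Rigidity is therefore automatic and only the centre property
  has to be decided.

  Sufficiency.  Under the first condition \<open>z = 0\<close> is invariant and carries circles.  Under the second
  one \<open>F\<close> does not involve \<open>z\<close>; the plane system has the explicit first integral behind
  \<open>planar_rate.pot\<close>, and the centre manifold is the bounded solution of the linear \<open>z\<close>-equation,
  an integral over one period of the plane flow.

  Necessity.  Orbit points returning to the same angle lie on the graph, so a periodic orbit on a centre
  manifold has period \<open>2 \<pi>\<close> (\<open>center_polar_family\<close>).  Let \<open>\<rho>\<close> be the mean radius of
  such an orbit.  The functions \<open>r / \<rho>\<close> and \<open>z\<close> have expansions in the monomials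
  \<open>a\<^sup>i b\<^sup>j\<close> with \<open>a = \<rho> exp (i \<theta>)\<close> and \<open>b = \<rho> exp (- i \<theta>)\<close>; their coefficient arrays satisfy a
  recursion, and the vanishing mean of \<open>F = (ln r)'\<close> forces the diagonal coefficients of \<open>F\<close> to
  vanish (\<open>small_orbits.orbit_balance\<close>).  The coefficient \<open>(1, 1)\<close> says \<open>a\<^sub>0\<^sub>2\<^sub>0 = - a\<^sub>2\<^sub>0\<^sub>0\<close>.
  If \<open>f\<close> is not zero and \<open>l\<close> vanishes, \<open>(2, 2)\<close> gives \<open>d = 0\<close>.  If neither vanishes, \<open>(2, 2)\<close> and
  \<open>(3, 3)\<close> determine the two scale-invariant ratios of the coefficients as functions of \<open>\<lambda>\<close> and
  \<open>e = d / \<lambda>\<close>, after which \<open>(4, 4)\<close>, \<open>(5, 5)\<close>, \<open>(6, 6)\<close> are three polynomials in \<open>\<lambda>\<^sup>2\<close> and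
  \<open>e\<close>.  The first two are quadratic in \<open>e\<close>, and eliminating \<open>e\<close> shows that the three have
  no common real zero with \<open>\<lambda> \<noteq> 0\<close> (\<open>focus_quantities_no_common_zero\<close>).

  Cyclicity.  Small perturbations are chosen so that, after rescaling by \<open>c\<close>, the plane system has a
  polynomial almost first integral whose derivative is a multiple of \<open>H (x\<^sup>2 + y\<^sup>2)\<close> to leading
  order.  A
  periodic solution of the radial equation appears near each simple zero of \<open>H\<close>
 (\<open>averaged_cycle\<close>), and is isolated because the flow is strictly monotone there.  Under the first
 condition \<open>H\<close> has three simple positive zeros, under the second one two.
\<close>

section \<open>Rescaled coefficient arrays of a centre\<close>

text \<open>The value of a scale-invariant ratio of coefficients that is forced by the balance equations of
  order four and six, up to the factor \<open>(L - 1) / 4\<close>.\<close>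

definition weight_poly :: "complex => complex => complex" where
 "weight_poly L e = 3 * L^2 - 17 - 4 * (L - 1) * (L + 2) * e"

text \<open>Structure constants of the Cauchy product after dividing the coefficient in position \<open>i\<close> by a
  weight \<open>w i\<close>: \<open>twist L e i k = w k * w (i - k) / w i\<close>.  The weights contain the small divisors, which
  keeps all rescaled coefficients polynomial in \<open>L\<close> and \<open>e\<close>.\<close>

definition twist :: "complex => complex => nat => nat => complex" where
 "twist L e i k =
  [[1],
  [1,
   1],
  [1,
   2 * (L + 1) * (L - 1) * weight_poly L e,
   1],
  [1,
   6 * (L + 3),
   6 * (L + 3),
   1],
  [1,
   4 * (L + 1) * (L + 2) * (L + 4) * (L - 1) * weight_poly L e,
   12 * (L + 2) * (L + 3) * (L + 4),
   4 * (L + 1) * (L + 2) * (L + 4) * (L - 1) * weight_poly L e,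
   1],
  [1,
   5 * (L + 3) * (L + 5),
   10 * (L + 2) * (L + 3) * (L + 4) * (L + 5),
   10 * (L + 2) * (L + 3) * (L + 4) * (L + 5),
   5 * (L + 3) * (L + 5),
   1],
  [1,
   12 * (L + 1) * (L + 2) * (L + 3) * (L + 4) * (L + 6) * (L - 1) * weight_poly L e,
   30 * (L + 2) * (L + 3)^2 * (L + 4) * (L + 5) * (L + 6),
   20 * (L + 1) * (L + 2)^2 * (L + 3) * (L + 4)^2 * (L + 5) * (L + 6) * (L - 1) * weight_poly L e,
   30 * (L + 2) * (L + 3)^2 * (L + 4) * (L + 5) * (L + 6),
   12 * (L + 1) * (L + 2) * (L + 3) * (L + 4) * (L + 6) * (L - 1) * weight_poly L e,
   1]] ! i ! k"

lemma twist_values: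
 "twist L e 0 0 = 1"
 "twist L e (Suc 0) 0 = 1"
 "twist L e (Suc 0) (Suc 0) = 1"
 "twist L e 2 0 = 1"
 "twist L e 2 (Suc 0) = 2 * (L + 1) * (L - 1) * weight_poly L e"
 "twist L e 2 2 = 1"
 "twist L e 3 0 = 1"
 "twist L e 3 (Suc 0) = 6 * (L + 3)"
 "twist L e 3 2 = 6 * (L + 3)"
 "twist L e 3 3 = 1"
 "twist L e 4 0 = 1"
 "twist L e 4 (Suc 0) = 4 * (L + 1) * (L + 2) * (L + 4) * (L - 1) * weight_poly L e"
 "twist L e 4 2 = 12 * (L + 2) * (L + 3) * (L + 4)"
 "twist L e 4 3 = 4 * (L + 1) * (L + 2) * (L + 4) * (L - 1) * weight_poly L e"
 "twist L e 4 4 = 1"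
 "twist L e 5 0 = 1"
 "twist L e 5 (Suc 0) = 5 * (L + 3) * (L + 5)"
 "twist L e 5 2 = 10 * (L + 2) * (L + 3) * (L + 4) * (L + 5)"
 "twist L e 5 3 = 10 * (L + 2) * (L + 3) * (L + 4) * (L + 5)"
 "twist L e 5 4 = 5 * (L + 3) * (L + 5)"
 "twist L e 5 5 = 1"
 "twist L e 6 0 = 1"
 "twist L e 6 (Suc 0) = 12 * (L + 1) * (L + 2) * (L + 3) * (L + 4) * (L + 6) * (L - 1) * weight_poly L e"
 "twist L e 6 2 = 30 * (L + 2) * (L + 3)^2 * (L + 4) * (L + 5) * (L + 6)"
 "twist L e 6 3 = 20 * (L + 1) * (L + 2)^2 * (L + 3) * (L + 4)^2 * (L + 5) * (L + 6) * (L - 1) * weight_poly L e"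
 "twist L e 6 4 = 30 * (L + 2) * (L + 3)^2 * (L + 4) * (L + 5) * (L + 6)"
 "twist L e 6 5 = 12 * (L + 1) * (L + 2) * (L + 3) * (L + 4) * (L + 6) * (L - 1) * weight_poly L e"
 "twist L e 6 6 = 1"
 by (simp_all add: twist_def)

definition dsum :: "nat => (nat => nat => complex) => complex" where
 "dsum n f = (\<Sum>k\<le>n. f k (n - k))"

lemma dsum_values:
 "dsum 0 f = f 0 0"
 "dsum (Suc 0) f = f 0 (Suc 0) + f (Suc 0) 0"
 "dsum 2 f = f 0 2 + f (Suc 0) (Suc 0) + f 2 0"
 "dsum 3 f = f 0 3 + f (Suc 0) 2 + f 2 (Suc 0) + f 3 0"
 "dsum 4 f = f 0 4 + f (Suc 0) 3 + f 2 2 + f 3 (Suc 0) + f 4 0"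
 "dsum 5 f = f 0 5 + f (Suc 0) 4 + f 2 3 + f 3 2 + f 4 (Suc 0) + f 5 0"
 "dsum 6 f = f 0 6 + f (Suc 0) 5 + f 2 4 + f 3 3 + f 4 2 + f 5 (Suc 0) + f 6 0"
 by (simp_all add: dsum_def numeral_eq_Suc add_ac)

definition tconv :: "(nat => nat => complex) => (nat => nat => complex) =>
  (nat => nat => complex) => (nat => nat => complex) => nat => nat => complex" where
 "tconv t s X Y i j = dsum i (%k k'. dsum j (%l l'. t i k * s j l * (X k l * Y k' l')))"

definition rate_coeff :: "complex => complex => (nat => nat => complex) => (nat => nat => complex) => nat => nat => complex" where
 "rate_coeff L e Z R i j =
  (let t = twist L e; s = twist (- L) e in
   (if 2 <= i then 2 * (L + 1) * (L + 2) * t i 2 * tconv t s R R (i - 2) j else 0)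
   - (if 2 <= j then 2 * (1 - L) * (2 - L) * s j 2 * tconv t s R R i (j - 2) else 0)
   + (if 1 <= i then t i 1 / 2 * tconv t s R Z (i - 1) j else 0)
   - (if 1 <= j then s j 1 / 2 * tconv t s R Z i (j - 1) else 0)
   + L * e * tconv t s Z Z i j)"

definition focus_arrays :: "complex => complex => (nat => nat => complex) => (nat => nat => complex) => bool" where
 "focus_arrays L e Z R \<longleftrightarrow>
  (\<forall>h\<in>{1..6::nat}. L + of_nat h ~= 0 & L - of_nat h ~= 0) &
  R 0 0 = 1 & R 1 0 = 0 & R 0 1 = 0 & Z 0 0 = 0 & Z 1 0 = 0 & Z 0 1 = 0 &
  (\<forall>k\<in>{1..6}. Z k k = 0 & R k k = 0 & rate_coeff L e Z R k k = 0) &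
  (\<forall>i\<le>6. \<forall>j\<le>6. i ~= j -->
    rate_coeff L e Z R i j = (L + of_nat i - of_nat j) * Z i j &
    tconv (twist L e) (twist (- L) e) R (%k l. (L + of_nat k - of_nat l) * Z k l) i j
     = (of_nat i - of_nat j) * R i j)"

text \<open>Complex conjugation of a real expansion exchanges the two indices and reverses the sign of \<open>L\<close>;
  half of the coefficients follow from the other half.\<close>

lemma fa_swap:
 assumes "focus_arrays L e Z R"
 shows "focus_arrays (- L) e (%i j. Z j i) (%i j. R j i)"
proof -
 have tc: "tconv t s (%i j. X j i) (%i j. Y j i) i j = tconv s t X Y j i" for t s X Y i j
  unfolding tconv_def dsum_def by (subst sum.swap) (simp add: mult_ac)
 have rc: "rate_coeff (- L) e (%i j. Z j i) (%i j. R j i) i j = - rate_coeff L e Z R j i" for i j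
  unfolding rate_coeff_def Let_def tc[of _ _ R R] tc[of _ _ R Z] tc[of _ _ Z Z] by (simp add: algebra_simps)
 have neg: "tconv t s X (%k l. (- L + of_nat k - of_nat l) * W k l) i j
   = - tconv t s X (%k l. (L + of_nat l - of_nat k) * W k l) i j" for t s X W i j
  unfolding tconv_def dsum_def by (simp add: sum_negf[symmetric] algebra_simps)
 have tcL: "tconv t s (%i j. R j i) (%k l. (L + of_nat l - of_nat k) * Z l k) i j
   = tconv s t R (%k l. (L + of_nat k - of_nat l) * Z k l) j i" for t s i j
  by (rule tc[where X = R and Y = "%k l. (L + of_nat k - of_nat l) * Z k l"])
 have sw: "focus_arrays (- L) e (%i j. Z j i) (%i j. R j i)"
  if A: "\<forall>h\<in>{1..6::nat}. L + of_nat h ~= 0 & L - of_nat h ~= 0"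
  and B: "R 0 0 = 1 & R 1 0 = 0 & R 0 1 = 0 & Z 0 0 = 0 & Z 1 0 = 0 & Z 0 1 = 0"
  and C: "\<forall>k\<in>{1..6}. Z k k = 0 & R k k = 0 & rate_coeff L e Z R k k = 0"
  and D: "\<forall>i\<le>6. \<forall>j\<le>6. i ~= j -->
    rate_coeff L e Z R i j = (L + of_nat i - of_nat j) * Z i j &
    tconv (twist L e) (twist (- L) e) R (%k l. (L + of_nat k - of_nat l) * Z k l) i j
     = (of_nat i - of_nat j) * R i j"
  unfolding focus_arrays_def rc neg tcL minus_minus
 proof (intro conjI ballI allI impI)
  fix h :: nat assume h: "h \<in> {1..6}"
  show "- L + of_nat h ~= 0" using bspec[OF A h] by (metis add.inverse_inverse add_uminus_conv_diff minus_add_distrib neg_equal_0_iff_equal)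
  show "- L - of_nat h ~= 0" using bspec[OF A h] by (metis add_uminus_conv_diff minus_add_distrib neg_equal_0_iff_equal)
 next
  fix i j :: nat assume ij: "i <= 6" "j <= 6" "i ~= j"
  then have d: "rate_coeff L e Z R j i = (L + of_nat j - of_nat i) * Z j i"
   "tconv (twist L e) (twist (- L) e) R (%k l. (L + of_nat k - of_nat l) * Z k l) j i
    = (of_nat j - of_nat i) * R j i" using D by (blast dest: not_sym)+
  show "- rate_coeff L e Z R j i = (- L + of_nat i - of_nat j) * Z j i"
   unfolding d by (simp add: algebra_simps)
  show "- tconv (twist L e) (twist (- L) e) R (%k l. (L + of_nat k - of_nat l) * Z k l) j i
    = (of_nat i - of_nat j) * R j i"
   unfolding d by (simp add: algebra_simps)
 qed (use B C in \<open>simp_all only: One_nat_def neg_equal_0_iff_equal\<close>)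
 show ?thesis using assms unfolding focus_arrays_def[of L] by (elim conjE) (rule sw, blast+)
qed

lemma fa_init:
 assumes "focus_arrays L e Z R"
 shows "R 0 0 = 1" "R (Suc 0) 0 = 0" "R 0 (Suc 0) = 0" "Z 0 0 = 0" "Z (Suc 0) 0 = 0" "Z 0 (Suc 0) = 0"
  "Z (Suc 0) (Suc 0) = 0" "Z 2 2 = 0" "Z 3 3 = 0" "Z 4 4 = 0" "Z 5 5 = 0" "Z 6 6 = 0"
  "R (Suc 0) (Suc 0) = 0" "R 2 2 = 0" "R 3 3 = 0" "R 4 4 = 0" "R 5 5 = 0" "R 6 6 = 0"
proof -
 have *: "k \<in> {1..6} ==> Z k k = 0 & R k k = 0" for k
  using assms unfolding focus_arrays_def by blast
 show "Z (Suc 0) (Suc 0) = 0" "Z 2 2 = 0" "Z 3 3 = 0" "Z 4 4 = 0" "Z 5 5 = 0" "Z 6 6 = 0"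
  "R (Suc 0) (Suc 0) = 0" "R 2 2 = 0" "R 3 3 = 0" "R 4 4 = 0" "R 5 5 = 0" "R 6 6 = 0"
  using *[of 1] *[of 2] *[of 3] *[of 4] *[of 5] *[of 6] by simp_all
 show "R 0 0 = 1" "R (Suc 0) 0 = 0" "R 0 (Suc 0) = 0" "Z 0 0 = 0" "Z (Suc 0) 0 = 0" "Z 0 (Suc 0) = 0"
  using assms unfolding focus_arrays_def One_nat_def by blast+
qed

lemma fa_nonzero:
 assumes "focus_arrays L e Z R"
 shows "L + 1 ~= 0" "L + 2 ~= 0" "L + 3 ~= 0" "L + 4 ~= 0" "L + 5 ~= 0" "L + 6 ~= 0"
proof -
 have "L + of_nat h ~= 0" if "h \<in> {1..6::nat}" for h using assms that unfolding focus_arrays_def by blast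
 from this[of 1] this[of 2] this[of 3] this[of 4] this[of 5] this[of 6]
 show "L + 1 ~= 0" "L + 2 ~= 0" "L + 3 ~= 0" "L + 4 ~= 0" "L + 5 ~= 0" "L + 6 ~= 0" by simp_all
qed

lemma fa_Z:
 assumes "focus_arrays L e Z R" "i <= 6" "j <= 6" "i ~= j"
 shows "(L + of_nat i - of_nat j) * Z i j = rate_coeff L e Z R i j"
proof -
 have "\<forall>i\<le>6. \<forall>j\<le>6. i ~= j -->
    rate_coeff L e Z R i j = (L + of_nat i - of_nat j) * Z i j &
    tconv (twist L e) (twist (- L) e) R (%k l. (L + of_nat k - of_nat l) * Z k l) i j
     = (of_nat i - of_nat j) * R i j"
  using assms(1) unfolding focus_arrays_def by (elim conjE)
 then show ?thesis using assms(2-) by simp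
qed

lemma fa_R:
 assumes "focus_arrays L e Z R" "i <= 6" "j <= 6" "i ~= j"
 shows "(of_nat i - of_nat j) * R i j =
  tconv (twist L e) (twist (- L) e) R (%k l. (L + of_nat k - of_nat l) * Z k l) i j"
proof -
 have "\<forall>i\<le>6. \<forall>j\<le>6. i ~= j -->
    rate_coeff L e Z R i j = (L + of_nat i - of_nat j) * Z i j &
    tconv (twist L e) (twist (- L) e) R (%k l. (L + of_nat k - of_nat l) * Z k l) i j
     = (of_nat i - of_nat j) * R i j"
  using assms(1) unfolding focus_arrays_def by (elim conjE)
 then show ?thesis using assms(2-) by simp
qed

lemma fa_rate:
 assumes "focus_arrays L e Z R" "k \<in> {1..6}"
 shows "rate_coeff L e Z R k k = 0"
 using assms unfolding focus_arrays_def by blast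

lemma of_nat_Suc_0: "of_nat (Suc 0) = (1::complex)"
 by simp

lemmas focus_clean = mult_zero_left mult_zero_right add_0 add_0_right mult_1 mult_1_right
 of_nat_0 of_nat_numeral of_nat_Suc_0

lemma nat_facts:
 "((2::nat) <= 0) = False"
 "((Suc 0) <= 0) = False"
 "((2::nat) <= (Suc 0)) = False"
 "((Suc 0) <= (Suc 0)) = True"
 "(Suc 0) - Suc 0 = (0::nat)"
 "((2::nat) <= 2) = True"
 "((Suc 0) <= 2) = True"
 "2 - 2 = (0::nat)"
 "2 - Suc 0 = ((Suc 0)::nat)"
 "((2::nat) <= 3) = True"
 "((Suc 0) <= 3) = True"
 "3 - 2 = ((Suc 0)::nat)"
 "3 - Suc 0 = (2::nat)"
 "((2::nat) <= 4) = True"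
 "((Suc 0) <= 4) = True"
 "4 - 2 = (2::nat)"
 "4 - Suc 0 = (3::nat)"
 "((2::nat) <= 5) = True"
 "((Suc 0) <= 5) = True"
 "5 - 2 = (3::nat)"
 "5 - Suc 0 = (4::nat)"
 "((2::nat) <= 6) = True"
 "((Suc 0) <= 6) = True"
 "6 - 2 = (4::nat)"
 "6 - Suc 0 = (5::nat)"
 by simp_all

lemmas focus_expand = rate_coeff_def Let_def One_nat_def nat_facts if_True if_False tconv_def dsum_values twist_values

definition zeta20 :: "complex => complex => complex" where
 "zeta20 L e =
  2 * (L + 1)"

definition rho20 :: "complex => complex => complex" where
 "rho20 L e =
  (L + 1) * (L + 2)"

definition zeta21 :: "complex => complex => complex" where
 "zeta21 L e =
  -1"

definition rho21 :: "complex => complex => complex" where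
 "rho21 L e =
  - ((L + 1))"

definition zeta30 :: "complex => complex => complex" where
 "zeta30 L e =
  6 * (L + 1)"

definition rho30 :: "complex => complex => complex" where
 "rho30 L e =
  2 * (L + 1) * (L + 3)"

definition zeta31 :: "complex => complex => complex" where
 "zeta31 L e =
  - (6)"

definition rho31 :: "complex => complex => complex" where
 "rho31 L e =
  - (3 * (L + 2))"

definition zeta40 :: "complex => complex => complex" where
 "zeta40 L e =
  12 * (L + 1)^2 * (L + 2) * (65 + 47*L + 25*L^2 + 7*L^3 + (-8 + 24*L + 4*L^2 - 4*L^3) * e)"

definition rho40 :: "complex => complex => complex" where
 "rho40 L e =
  3 * (L + 1)^2 * (L + 2) * (L + 4) * (89 + 79*L + 39*L^2 + 9*L^3 + (-8 + 24*L + 4*L^2 - 4*L^3) *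
  e)"

definition zeta32 :: "complex => complex => complex" where
 "zeta32 L e =
  2 * (-9 - 35*L + 27*L^2 + 17*L^3 + (-24 - 12*L - 12*L^3) * e)"

definition rho32 :: "complex => complex => complex" where
 "rho32 L e =
  6 * (L + 1) * (-7 - 13*L + 13*L^2 + 7*L^3 + (-8 - 4*L - 4*L^3) * e)"

definition zeta41 :: "complex => complex => complex" where
 "zeta41 L e =
  6 * (L + 1) * (L + 2) * (-147 - 121*L - 81*L^2 - 23*L^3 + (24 - 72*L - 12*L^2 + 12*L^3) * e)"

definition rho41 :: "complex => complex => complex" where
 "rho41 L e =
  2 * (L + 1) * (L + 2) * (L + 3) * (-195 - 205*L - 123*L^2 - 29*L^3 + (24 - 72*L - 12*L^2 +
  12*L^3) * e)"

definition zeta50 :: "complex => complex => complex" where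
 "zeta50 L e =
  10 * (L + 1)^2 * (L + 2) * (L + 3) * (531 + 505*L + 201*L^2 + 35*L^3 + (-24 + 168*L + 36*L^2 -
  12*L^3) * e)"

definition rho50 :: "complex => complex => complex" where
 "rho50 L e =
  6 * (L + 1)^2 * (L + 2) * (L + 3) * (L + 5) * (257 + 255*L + 97*L^2 + 15*L^3 + (-8 + 56*L +
  12*L^2 - 4*L^3) * e)"

definition zeta42 :: "complex => complex => complex" where
 "zeta42 L e =
  6 * (L + 1) * (L - 1) * (-1595 - 3058*L - 5251*L^2 - 3032*L^3 + 219*L^4 + 586*L^5 + 115*L^6 +
  (2608 + 2980*L + 3348*L^2 + 2228*L^3 - 604*L^4 - 992*L^5 - 224*L^6) * e + (-704 + 352*L +
  1440*L^2 + 64*L^3 - 240*L^4 + 160*L^5 + 80*L^6) * e^2)"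

definition rho42 :: "complex => complex => complex" where
 "rho42 L e =
  (L + 1) * (L - 1) * (L + 2) * (-6585 - 15644*L - 22778*L^2 - 10996*L^3 + 1607*L^4 + 2328*L^5 +
  420*L^6 + (8400 + 11996*L + 14260*L^2 + 7892*L^3 - 2912*L^4 - 3640*L^5 - 764*L^6) * e + (-2112 +
  1056*L + 4320*L^2 + 192*L^3 - 720*L^4 + 480*L^5 + 240*L^6) * e^2)"

definition zeta51 :: "complex => complex => complex" where
 "zeta51 L e =
  60 * (L + 1) * (L + 2) * (L + 3) * (-137 - 157*L - 73*L^2 - 13*L^3 + (8 - 56*L - 12*L^2 + 4*L^3)
  * e)"

definition rho51 :: "complex => complex => complex" where
 "rho51 L e =
  5 * (L + 1) * (L + 2) * (L + 3) * (L + 4) * (-591 - 707*L - 309*L^2 - 49*L^3 + (24 - 168*L -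
  36*L^2 + 12*L^3) * e)"

definition zeta60 :: "complex => complex => complex" where
 "zeta60 L e =
  180 * (L + 1)^3 * (L + 2)^2 * (L + 3) * (L + 4) * (44307 + 65643*L + 49109*L^2 + 29125*L^3 +
  13861*L^4 + 4429*L^5 + 819*L^6 + 67*L^7 + (-10416 + 17652*L + 25304*L^2 + 9304*L^3 - 344*L^4 -
  1628*L^5 - 624*L^6 - 80*L^7) * e + (192 - 3168*L + 4224*L^2 + 3552*L^3 - 912*L^4 - 784*L^5 -
  48*L^6 + 16*L^7) * e^2)"

definition rho60 :: "complex => complex => complex" where
 "rho60 L e =
  10 * (L + 1)^3 * (L + 2)^2 * (L + 3) * (L + 4) * (L + 6) * (224001 + 361815*L + 295756*L^2 +
  177944*L^3 + 79553*L^4 + 23191*L^5 + 3858*L^6 + 282*L^7 + (-45648 + 69996*L + 115376*L^2 +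
  44088*L^3 - 3596*L^4 - 8000*L^5 - 2580*L^6 - 292*L^7) * e + (576 - 9504*L + 12672*L^2 +
  10656*L^3 - 2736*L^4 - 2352*L^5 - 144*L^6 + 48*L^7) * e^2)"

definition zeta43 :: "complex => complex => complex" where
 "zeta43 L e =
  6 * (7773 + 4356*L - 5175*L^2 + 11924*L^3 - 5109*L^4 - 14380*L^5 - 2061*L^6 + 2132*L^7 + 540*L^8
  + (4656 + 18036*L + 7180*L^2 - 2200*L^3 + 3956*L^4 + 7580*L^5 - 532*L^6 - 3256*L^7 - 860*L^8) *
  e + (-6336 - 672*L - 288*L^2 - 5664*L^3 + 5424*L^4 + 5856*L^5 + 960*L^6 + 480*L^7 + 240*L^8) *
  e^2)"

definition rho43 :: "complex => complex => complex" where
 "rho43 L e =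
  6 * (L + 1) * (4125 + 2214*L + 6418*L^2 + 20298*L^3 - 13172*L^4 - 21558*L^5 - 2114*L^6 +
  3078*L^7 + 711*L^8 + (-1488 + 18660*L + 16100*L^2 - 2528*L^3 + 2056*L^4 + 8044*L^5 - 1268*L^6 -
  4016*L^7 - 1000*L^8) * e + (-6336 - 672*L - 288*L^2 - 5664*L^3 + 5424*L^4 + 5856*L^5 + 960*L^6 +
  480*L^7 + 240*L^8) * e^2)"

definition zeta52 :: "complex => complex => complex" where
 "zeta52 L e =
  3 * (L + 1) * (134715 + 71376*L - 199805*L^2 - 259224*L^3 - 10535*L^4 + 143944*L^5 + 93585*L^6 +
  23744*L^7 + 2200*L^8 + (-212400 - 309844*L - 278972*L^2 - 53944*L^3 + 70348*L^4 - 22876*L^5 -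
  62588*L^6 - 25176*L^7 - 3108*L^8) * e + (20160 - 86880*L - 106080*L^2 + 45600*L^3 + 28560*L^4 -
  29280*L^5 - 12480*L^6 + 1440*L^7 + 720*L^8) * e^2)"

definition rho52 :: "complex => complex => complex" where
 "rho52 L e =
  (L + 1) * (L + 3) * (169755 + 24734*L - 404470*L^2 - 359886*L^3 + 101800*L^4 + 280786*L^5 +
  150150*L^6 + 34206*L^7 + 2925*L^8 + (-285360 - 501316*L - 425108*L^2 - 70576*L^3 + 59512*L^4 -
  67084*L^5 - 91292*L^6 - 32064*L^7 - 3672*L^8) * e + (20160 - 86880*L - 106080*L^2 + 45600*L^3 +
  28560*L^4 - 29280*L^5 - 12480*L^6 + 1440*L^7 + 720*L^8) * e^2)"

definition zeta61 :: "complex => complex => complex" where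
 "zeta61 L e =
  30 * (L + 1)^2 * (L + 2)^2 * (L + 3) * (L + 4) * (-463437 - 754695*L - 608216*L^2 - 387172*L^3 -
  202205*L^4 - 70807*L^5 - 13886*L^6 - 1150*L^7 + (127440 - 210492*L - 333568*L^2 - 154968*L^3 -
  8756*L^4 + 24208*L^5 + 10308*L^6 + 1316*L^7) * e + (-2880 + 47520*L - 63360*L^2 - 53280*L^3 +
  13680*L^4 + 11760*L^5 + 720*L^6 - 240*L^7) * e^2)"

definition rho61 :: "complex => complex => complex" where
 "rho61 L e =
  6 * (L + 1)^2 * (L + 2)^2 * (L + 3) * (L + 4) * (L + 5) * (-767277 - 1362825*L - 1209601*L^2 -
  789977*L^3 - 384995*L^4 - 121207*L^5 - 21231*L^6 - 1575*L^7 + (185040 - 270252*L - 505688*L^2 -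
  236568*L^3 - 16*L^4 + 39068*L^5 + 13848*L^6 + 1576*L^7) * e + (-2880 + 47520*L - 63360*L^2 -
  53280*L^3 + 13680*L^4 + 11760*L^5 + 720*L^6 - 240*L^7) * e^2)"

definition zeta53 :: "complex => complex => complex" where
 "zeta53 L e =
  2 * (1413585 + 2554623*L + 2214408*L^2 + 1354108*L^3 - 2390442*L^4 - 3139338*L^5 - 838968*L^6 +
  233652*L^7 + 137097*L^8 + 16475*L^9 + (1885680 + 5686308*L + 5221512*L^2 + 818772*L^3 +
  157032*L^4 + 1309476*L^5 + 505368*L^6 - 257172*L^7 - 166392*L^8 - 23304*L^9) * e + (-492480 +
  756000*L + 1097280*L^2 - 267840*L^3 + 473040*L^4 + 761040*L^5 + 151200*L^6 - 10080*L^7 +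
  15120*L^8 + 5040*L^9) * e^2)"

definition rho53 :: "complex => complex => complex" where
 "rho53 L e =
  3 * (L + 2) * (616635 + 1495083*L + 1508493*L^2 + 125953*L^3 - 1956217*L^4 - 1696013*L^5 -
  316513*L^6 + 148267*L^7 + 66962*L^8 + 7350*L^9 + (709200 + 2402268*L + 2449392*L^2 + 552012*L^3
  + 112812*L^4 + 538056*L^5 + 192408*L^6 - 108132*L^7 - 65412*L^8 - 8844*L^9) * e + (-164160 +
  252000*L + 365760*L^2 - 89280*L^3 + 157680*L^4 + 253680*L^5 + 50400*L^6 - 3360*L^7 + 5040*L^8 +
  1680*L^9) * e^2)"

definition zeta62 :: "complex => complex => complex" where
 "zeta62 L e =
  4 * (L + 1)^2 * (L - 1) * (L + 2) * (L + 3) * (-399181500 - 1061581311*L - 1469440716*L^2 -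
  1498474267*L^3 - 1140507312*L^4 - 532174590*L^5 - 71327040*L^6 + 67626762*L^7 + 43802892*L^8 +
  11826781*L^9 + 1585836*L^10 + 86385*L^11 + (485788320 + 966469608*L + 960698448*L^2 +
  697197880*L^3 + 476299312*L^4 + 235106716*L^5 - 22162464*L^6 - 119793108*L^7 - 75763632*L^8 -
  22737124*L^9 - 3418384*L^10 - 207172*L^11) * e + (-139173120 + 16346304*L + 371315904*L^2 +
  470470896*L^3 + 307321440*L^4 + 64099392*L^5 - 44295168*L^6 - 17244192*L^7 + 10404000*L^8 +
  7713024*L^9 + 1733184*L^10 + 135216*L^11) * e^2 + (4700160 - 53568000*L - 24998400*L^2 +
  109376640*L^3 + 72610560*L^4 - 23466240*L^5 - 17049600*L^6 + 8222400*L^7 + 6289920*L^8 +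
  927360*L^9 - 80640*L^10 - 20160*L^11) * e^3)"

definition rho62 :: "complex => complex => complex" where
 "rho62 L e =
  3 * (L + 1)^2 * (L - 1) * (L + 2) * (L + 3) * (L + 4) * (-218142900 - 617873781*L -
  919915836*L^2 - 970237857*L^3 - 708324872*L^4 - 293573830*L^5 - 18914120*L^6 + 45868202*L^7 +
  24775132*L^8 + 6096971*L^9 + 761316*L^10 + 39015*L^11 + (244067040 + 535859448*L + 590659248*L^2
  + 495136680*L^3 + 348726752*L^4 + 136202996*L^5 - 39264864*L^6 - 78764508*L^7 - 41824992*L^8 -
  11240844*L^9 - 1555184*L^10 - 88172*L^11) * e + (-65283840 - 17996736*L + 161792064*L^2 +
  236456016*L^3 + 141405600*L^4 + 17429952*L^5 - 19730688*L^6 - 2542752*L^7 + 6653280*L^8 +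
  3556224*L^9 + 713664*L^10 + 52176*L^11) * e^2 + (1566720 - 17856000*L - 8332800*L^2 +
  36458880*L^3 + 24203520*L^4 - 7822080*L^5 - 5683200*L^6 + 2740800*L^7 + 2096640*L^8 + 309120*L^9
  - 26880*L^10 - 6720*L^11) * e^3)"

definition zeta54 :: "complex => complex => complex" where
 "zeta54 L e =
  12 * (-77542920 + 79509330*L + 46250433*L^2 - 132475694*L^3 + 44699783*L^4 + 29344796*L^5 -
  8706456*L^6 + 31951508*L^7 + 1289054*L^8 - 15459862*L^9 - 1491527*L^10 + 2420986*L^11 +
  365283*L^12 - 129464*L^13 - 25250*L^14 + (35484480 - 167468688*L + 69679368*L^2 + 32519976*L^3 -
  41075792*L^4 + 30369864*L^5 + 14533412*L^6 - 44763792*L^7 - 7290216*L^8 + 21127056*L^9 +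
  3334232*L^10 - 4078584*L^11 - 768872*L^12 + 274968*L^13 + 61788*L^14) * e + (26472960 +
  75975552*L - 86030784*L^2 - 114758304*L^3 + 70949040*L^4 + 26652480*L^5 - 41604048*L^6 -
  10405392*L^7 + 10888560*L^8 + 1030704*L^9 - 1727952*L^10 + 911856*L^11 + 358560*L^12 -
  142896*L^13 - 42336*L^14) * e^2 + (-10506240 - 875520*L - 6796800*L^2 - 24295680*L^3 +
  23437440*L^4 + 26016000*L^5 - 7294080*L^6 + 2412480*L^7 + 1646400*L^8 - 3700800*L^9 -
  527040*L^10 + 436800*L^11 + 33600*L^12 + 6720*L^13 + 6720*L^14) * e^3)"

definition rho54 :: "complex => complex => complex" where
 "rho54 L e =
  60 * (L + 1) * (-8852184 + 7267962*L + 80349*L^2 - 5831978*L^3 + 8191368*L^4 - 13971916*L^5 +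
  2696121*L^6 + 16444116*L^7 - 941832*L^8 - 5619094*L^9 - 298377*L^10 + 782422*L^11 + 99288*L^12 -
  39192*L^13 - 7053*L^14 + (5684544 - 40069200*L + 19833192*L^2 + 10781304*L^3 - 15779280*L^4 +
  12689404*L^5 + 6653788*L^6 - 15010208*L^7 - 2250912*L^8 + 6268008*L^9 + 825360*L^10 -
  1137496*L^11 - 190672*L^12 + 74348*L^13 + 15660*L^14) * e + (2280960 + 15661440*L - 12464832*L^2
  - 25371808*L^3 + 14142128*L^4 + 8810976*L^5 - 10741008*L^6 - 3937760*L^7 + 2974912*L^8 +
  531616*L^9 - 404864*L^10 + 192000*L^11 + 75024*L^12 - 33664*L^13 - 9520*L^14) * e^2 + (-2101248
  - 175104*L - 1359360*L^2 - 4859136*L^3 + 4687488*L^4 + 5203200*L^5 - 1458816*L^6 + 482496*L^7 +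
  329280*L^8 - 740160*L^9 - 105408*L^10 + 87360*L^11 + 6720*L^12 + 1344*L^13 + 1344*L^14) * e^3)"

definition zeta63 :: "complex => complex => complex" where
 "zeta63 L e =
  36 * (L + 1) * (L + 2) * (294868620 + 373249395*L - 661051584*L^2 - 1295737122*L^3 -
  243448939*L^4 + 1247691453*L^5 + 1072970653*L^6 - 100889436*L^7 - 509038122*L^8 - 220799571*L^9
  + 2207506*L^10 + 29024958*L^11 + 9552041*L^12 + 1329123*L^13 + 71025*L^14 + (849039840 +
  2592874872*L + 2661117120*L^2 + 250618296*L^3 - 689092352*L^4 - 616121468*L^5 - 745394160*L^6 -
  195333952*L^7 + 324187064*L^8 + 195667920*L^9 - 25114600*L^10 - 52505944*L^11 - 18282552*L^12 -
  2758124*L^13 - 159560*L^14) * e + (-559630080 - 276156864*L + 982294848*L^2 + 1045191120*L^3 -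
  347267520*L^4 - 963129648*L^5 - 36029664*L^6 + 573564240*L^7 + 280371120*L^8 - 2854512*L^9 -
  16781136*L^10 + 9096480*L^11 + 6603600*L^12 + 1361184*L^13 + 96432*L^14) * e^2 + (36218880 -
  263370240*L - 80202240*L^2 + 391236480*L^3 - 68544000*L^4 - 249644160*L^5 + 118759680*L^6 +
  142176000*L^7 - 6737280*L^8 - 22763520*L^9 + 316800*L^10 + 2459520*L^11 + 201600*L^12 -
  94080*L^13 - 13440*L^14) * e^3)"

definition rho63 :: "complex => complex => complex" where
 "rho63 L e =
  4 * (L + 1) * (L + 2) * (L + 3) * (863740260 + 875177433*L - 4167918684*L^2 - 6575889690*L^3 +
  1284991036*L^4 + 8639435391*L^5 + 4810396628*L^6 - 2005419060*L^7 - 3042992652*L^8 -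
  996333921*L^9 + 104294996*L^10 + 158767950*L^11 + 45586156*L^12 + 5868297*L^13 + 295860*L^14 +
  (3242604960 + 10138118760*L + 12118897728*L^2 + 4799106648*L^3 - 1697504848*L^4 - 4873045048*L^5
  - 4143063288*L^6 - 20097296*L^7 + 1821680656*L^8 + 669430776*L^9 - 273771968*L^10 -
  265906952*L^11 - 80225568*L^12 - 11178088*L^13 - 611272*L^14) * e + (-2244568320 - 1925432640*L
  + 3070745280*L^2 + 4065024240*L^3 - 1357977600*L^4 - 3499308720*L^5 + 344685600*L^6 +
  2432683200*L^7 + 1114151520*L^8 + 37817280*L^9 - 23744160*L^10 + 45585360*L^11 + 25351200*L^12 +
  4847280*L^13 + 329280*L^14) * e^2 + (108656640 - 790110720*L - 240606720*L^2 + 1173709440*L^3 -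
  205632000*L^4 - 748932480*L^5 + 356279040*L^6 + 426528000*L^7 - 20211840*L^8 - 68290560*L^9 +
  950400*L^10 + 7378560*L^11 + 604800*L^12 - 282240*L^13 - 40320*L^14) * e^3)"

definition zeta64 :: "complex => complex => complex" where
 "zeta64 L e =
  24 * (L + 1) * (L - 1) * (859944457440 + 1125906846768*L - 134338227462*L^2 - 953267532393*L^3 -
  757183812530*L^4 + 266584060946*L^5 + 419538791394*L^6 - 526032386059*L^7 - 534166226958*L^8 +
  171100861196*L^9 + 283643209042*L^10 + 28770903337*L^11 - 55229301534*L^12 - 17622949982*L^13 +
  2957074302*L^14 + 2169701395*L^15 + 199531582*L^16 - 66326928*L^17 - 16119276*L^18 -
  1034280*L^19 + (-520222279680 + 1211091550848*L + 2446552647360*L^2 + 908982828024*L^3 +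
  171262097572*L^4 - 188760988848*L^5 - 438182454968*L^6 + 537698447456*L^7 + 635207606188*L^8 -
  351079408840*L^9 - 497660816752*L^10 - 18948947608*L^11 + 132653945948*L^12 + 38709129952*L^13 -
  10023177112*L^14 - 6289851728*L^15 - 502624428*L^16 + 237710488*L^17 + 56739072*L^18 +
  3741456*L^19) * e + (-313178296320 - 1935977518080*L - 1325489409792*L^2 + 1042375665984*L^3 +
  724216204480*L^4 - 75765685232*L^5 + 663713940432*L^6 + 519885746736*L^7 - 248418507664*L^8 -
  124695329696*L^9 + 150246133728*L^10 + 28862033168*L^11 - 66794738272*L^12 - 23967172592*L^13 +
  7799710096*L^14 + 5199113360*L^15 + 383088176*L^16 - 263289600*L^17 - 64940864*L^18 -
  4540048*L^19) * e^2 + (221467115520 + 348330516480*L - 358609121280*L^2 - 725378711040*L^3 +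
  94108796160*L^4 + 409687739520*L^5 - 273419830080*L^6 - 488241192000*L^7 + 22885749120*L^8 +
  257891404800*L^9 + 72946978560*L^10 - 42450065280*L^11 - 18234107520*L^12 + 2488227840*L^13 +
  622501440*L^14 - 698473920*L^15 - 74849280*L^16 + 87000960*L^17 + 25244160*L^18 + 2029440*L^19)
  * e^3 + (-25108807680 + 56923914240*L + 98461163520*L^2 - 79469199360*L^3 + 12694487040*L^4 +
  153484277760*L^5 - 85069048320*L^6 - 164157442560*L^7 - 131005440*L^8 + 34079339520*L^9 -
  5609134080*L^10 - 2098725120*L^11 + 5366983680*L^12 + 1492715520*L^13 - 583349760*L^14 -
  251735040*L^15 - 19353600*L^16 - 2903040*L^17 - 1935360*L^18 - 241920*L^19) * e^4)"

definition rho64 :: "complex => complex => complex" where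
 "rho64 L e =
  12 * (L + 1) * (L - 1) * (L + 2) * (700432362720 + 834575528304*L - 82238135526*L^2 -
  241534794261*L^3 + 338023901490*L^4 + 447218287343*L^5 - 966523908666*L^6 - 1805495756452*L^7 -
  450447984810*L^8 + 759442260917*L^9 + 485041189014*L^10 - 42152347028*L^11 - 111235597170*L^12 -
  22497130919*L^13 + 7516670634*L^14 + 3503400616*L^15 + 203101770*L^16 - 118197645*L^17 -
  24591456*L^18 - 1474875*L^19 + (-542812907520 + 1189485509760*L + 2553771784896*L^2 +
  1304077402968*L^3 + 474950898852*L^4 - 138021310936*L^5 + 151801447040*L^6 + 1332474863728*L^7 +
  502917971780*L^8 - 995522540996*L^9 - 728751288160*L^10 + 100128916764*L^11 + 224940072844*L^12
  + 45387963440*L^13 - 19670659904*L^14 - 9139090504*L^15 - 483786356*L^16 + 368084332*L^17 +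
  78661728*L^18 + 4924644*L^19) * e + (-301499781120 - 2108166939648*L - 1834452981504*L^2 +
  338623895616*L^3 + 135722271936*L^4 + 18864868112*L^5 + 1287803250640*L^6 + 822619985024*L^7 -
  294474822928*L^8 - 111224669312*L^9 + 188883724832*L^10 - 1307913696*L^11 - 99015486432*L^12 -
  26646678960*L^13 + 12743116432*L^14 + 6826775936*L^15 + 365437744*L^16 - 354653792*L^17 -
  81385600*L^18 - 5485280*L^19) * e^2 + (239091056640 + 481165664256*L - 165955497984*L^2 -
  743728854528*L^3 - 39541998336*L^4 + 380821206144*L^5 - 358735636800*L^6 - 634435442880*L^7 +
  10993227648*L^8 + 324646144512*L^9 + 96876071424*L^10 - 48533245632*L^11 - 21437505408*L^12 +
  2511106560*L^13 + 473694528*L^14 - 831562944*L^15 - 73254144*L^16 + 101228928*L^17 +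
  28319232*L^18 + 2232384*L^19) * e^3 + (-25108807680 + 56923914240*L + 98461163520*L^2 -
  79469199360*L^3 + 12694487040*L^4 + 153484277760*L^5 - 85069048320*L^6 - 164157442560*L^7 -
  131005440*L^8 + 34079339520*L^9 - 5609134080*L^10 - 2098725120*L^11 + 5366983680*L^12 +
  1492715520*L^13 - 583349760*L^14 - 251735040*L^15 - 19353600*L^16 - 2903040*L^17 - 1935360*L^18
  - 241920*L^19) * e^4)"

definition zeta65 :: "complex => complex => complex" where
 "zeta65 L e =
  60 * (7738986512160 - 7345260331920*L - 16588234692522*L^2 - 6416861329737*L^3 +
  9325603098423*L^4 + 37691385273072*L^5 + 11568689287008*L^6 - 31220877290169*L^7 -
  16847738579827*L^8 + 6967158293055*L^9 + 5511287403633*L^10 + 212636862249*L^11 -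
  293198096697*L^12 - 177953397477*L^13 - 149249765767*L^14 - 8362785843*L^15 + 28113352383*L^16 +
  6074144301*L^17 - 1641182787*L^18 - 583672500*L^19 + 7529558*L^20 + 17802969*L^21 + 1566435*L^22
  + (-11018059499520 + 37235313947520*L + 28031548927680*L^2 - 15298217033112*L^3 -
  26081903950764*L^4 - 25422544893084*L^5 - 6562133768684*L^6 + 14992605455124*L^7 +
  11165812737156*L^8 - 31702778248*L^9 - 2641678656944*L^10 - 2103718063140*L^11 -
  823063676204*L^12 + 497612467608*L^13 + 480604149216*L^14 + 9860565356*L^15 - 80962748804*L^16 -
  15148733736*L^17 + 5208742336*L^18 + 1689203772*L^19 - 46701864*L^20 - 59002060*L^21 -
  5233604*L^22) * e + (1395285626880 - 31414667996160*L + 7783195620096*L^2 + 56384774039232*L^3 +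
  35272475083392*L^4 + 8597270785392*L^5 - 12463353340096*L^6 - 17230448180128*L^7 -
  3559883746928*L^8 + 3093143520480*L^9 + 1451072379600*L^10 + 592648817232*L^11 +
  327487861472*L^12 - 217786318192*L^13 - 238867448384*L^14 + 2195582592*L^15 + 52065025872*L^16 +
  9192624576*L^17 - 4442260528*L^18 - 1395570928*L^19 + 70597312*L^20 + 62519904*L^21 +
  5769312*L^22) * e^2 + (1854017372160 + 5711593512960*L - 13483317915648*L^2 - 11241959348736*L^3
  + 11713014238464*L^4 - 3140518198656*L^5 - 2684545892160*L^6 + 12907644807936*L^7 +
  3793182936576*L^8 - 5405192504064*L^9 - 1560450299328*L^10 + 1408878282048*L^11 +
  483139939008*L^12 - 249280625472*L^13 - 125004965376*L^14 + 7867762560*L^15 + 9539084160*L^16 +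
  790823040*L^17 + 462709056*L^18 + 197539392*L^19 - 34920768*L^20 - 22051008*L^21 - 2286144*L^22)
  * e^3 + (-376632115200 + 1911029760*L - 618243563520*L^2 - 1415771136000*L^3 + 1792493936640*L^4
  + 2156079605760*L^5 - 392949480960*L^6 + 228820101120*L^7 - 89936179200*L^8 - 1265554022400*L^9
  - 458920097280*L^10 + 285245026560*L^11 + 138913816320*L^12 + 10945739520*L^13 + 9401322240*L^14
  - 816238080*L^15 - 4298918400*L^16 - 921070080*L^17 + 164505600*L^18 + 59270400*L^19 +
  6531840*L^20 + 1693440*L^21 + 241920*L^22) * e^4)"

definition rho65 :: "complex => complex => complex" where
 "rho65 L e =
  180 * (L + 1) * (2079083103840 - 2804103915120*L - 6357712944366*L^2 - 1329946101783*L^3 +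
  6788863461969*L^4 + 11199453868849*L^5 - 130669483581*L^6 - 8356097480134*L^7 -
  2911572931066*L^8 + 763951272418*L^9 + 346685611394*L^10 + 533373461660*L^11 + 410444026184*L^12
  - 97943551788*L^13 - 145465452236*L^14 - 9598822186*L^15 + 18852484954*L^16 + 3676944126*L^17 -
  971826356*L^18 - 316929557*L^19 + 5326119*L^20 + 9109515*L^21 + 767145*L^22 + (-2579895982080 +
  14159086830720*L + 10673283306816*L^2 - 3837136276008*L^3 - 11346374719332*L^4 -
  12571791586604*L^5 - 1529677294036*L^6 + 5577461941260*L^7 + 2547209741140*L^8 +
  885418681764*L^9 + 293364388396*L^10 - 1158276448372*L^11 - 815489117988*L^12 +
  231603857692*L^13 + 289805299508*L^14 + 8985117796*L^15 - 43068705316*L^16 - 7564707060*L^17 +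
  2645204260*L^18 + 803681324*L^19 - 26336424*L^20 - 27380512*L^21 - 2344944*L^22) * e +
  (505624965120 - 10833316254720*L + 1667081652480*L^2 + 17818292471616*L^3 + 13520227958400*L^4 +
  6847963543120*L^5 - 4628679324608*L^6 - 9486817046160*L^7 - 1816636303008*L^8 +
  2340323752176*L^9 + 721386908640*L^10 - 35246239856*L^11 + 112113068224*L^12 - 47719033488*L^13
  - 95849261952*L^14 - 1713273072*L^15 + 21635786976*L^16 + 3776180368*L^17 - 1904497184*L^18 -
  573576528*L^19 + 33756288*L^20 + 26084544*L^21 + 2346624*L^22) * e^2 + (379764080640 +
  1968109608960*L - 4149320159232*L^2 - 4084389656064*L^3 + 4162613726976*L^4 - 379772947584*L^5 -
  1513326974400*L^6 + 3718627726464*L^7 + 1540346569344*L^8 - 1623024464256*L^9 -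
  552208915392*L^10 + 497187303552*L^11 + 177901901952*L^12 - 101190423168*L^13 - 50189369664*L^14
  + 4035772800*L^15 + 4289950080*L^16 + 361468800*L^17 + 144318144*L^18 + 63819648*L^19 -
  14289792*L^20 - 8209152*L^21 - 838656*L^22) * e^3 + (-125544038400 + 637009920*L -
  206081187840*L^2 - 471923712000*L^3 + 597497978880*L^4 + 718693201920*L^5 - 130983160320*L^6 +
  76273367040*L^7 - 29978726400*L^8 - 421851340800*L^9 - 152973365760*L^10 + 95081675520*L^11 +
  46304605440*L^12 + 3648579840*L^13 + 3133774080*L^14 - 272079360*L^15 - 1432972800*L^16 -
  307023360*L^17 + 54835200*L^18 + 19756800*L^19 + 2177280*L^20 + 564480*L^21 + 80640*L^22) * e^4)"

lemmas closed_forms = zeta20_def rho20_def zeta21_def rho21_def zeta30_def rho30_def zeta31_def rho31_def zeta40_def rho40_def zeta32_def rho32_def zeta41_def rho41_def zeta50_def rho50_def zeta42_def rho42_def zeta51_def rho51_def zeta60_def rho60_def zeta43_def rho43_def zeta52_def rho52_def zeta61_def rho61_def zeta53_def rho53_def zeta62_def rho62_def zeta54_def rho54_def zeta63_def rho63_def zeta64_def rho64_def zeta65_def rho65_def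

lemma fv_2_0:
 assumes s: "focus_arrays L e Z R"
 shows "Z 2 0 = zeta20 L e" "R 2 0 = rho20 L e"
proof -
 note s' = fa_swap[OF s]
 have "rate_coeff L e Z R 2 0 = (L + 2) * zeta20 L e"
  unfolding focus_expand fa_init[OF s] focus_clean
  unfolding weight_poly_def zeta20_def  by algebra
 moreover have "(L + 2) * Z 2 0 = rate_coeff L e Z R 2 0"
  using fa_Z[OF s, of 2 0] by (simp add: add.commute)
 ultimately have "(L + 2) * Z 2 0 = (L + 2) * zeta20 L e" by (rule trans[rotated])
 then show Z: "Z 2 0 = zeta20 L e"
  using fa_nonzero[OF s] by (simp only: mult_cancel_left) simp
 have "tconv (twist L e) (twist (- L) e) R (%k l. (L + of_nat k - of_nat l) * Z k l) 2 0
   = 2 * rho20 L e"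
  unfolding focus_expand fa_init[OF s] focus_clean Z
  unfolding weight_poly_def zeta20_def rho20_def  by algebra
 then show "R 2 0 = rho20 L e"
  using fa_R[OF s, of 2 0] by (simp add: add.commute)
qed

lemma fv_2_1:
 assumes s: "focus_arrays L e Z R"
 shows "Z 2 (Suc 0) = zeta21 L e" "R 2 (Suc 0) = rho21 L e"
proof -
 note s' = fa_swap[OF s]
 have "rate_coeff L e Z R 2 (Suc 0) = (L + 1) * zeta21 L e"
  unfolding focus_expand fa_init[OF s] focus_clean
  unfolding fv_2_0[OF s] unfolding weight_poly_def closed_forms by algebra
 moreover have "(L + 1) * Z 2 (Suc 0) = rate_coeff L e Z R 2 (Suc 0)"
  using fa_Z[OF s, of 2 1] by (simp add: add.commute)
 ultimately have "(L + 1) * Z 2 (Suc 0) = (L + 1) * zeta21 L e" by (rule trans[rotated])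
 then show Z: "Z 2 (Suc 0) = zeta21 L e"
  using fa_nonzero[OF s] by (simp only: mult_cancel_left) simp
 have "tconv (twist L e) (twist (- L) e) R (%k l. (L + of_nat k - of_nat l) * Z k l) 2 (Suc 0)
   = 1 * rho21 L e"
  unfolding focus_expand fa_init[OF s] focus_clean Z
  unfolding fv_2_0[OF s] unfolding weight_poly_def closed_forms by algebra
 then show "R 2 (Suc 0) = rho21 L e"
  using fa_R[OF s, of 2 1] by (simp add: add.commute)
qed

lemma fv_3_0:
 assumes s: "focus_arrays L e Z R"
 shows "Z 3 0 = zeta30 L e" "R 3 0 = rho30 L e"
proof -
 note s' = fa_swap[OF s]
 have "rate_coeff L e Z R 3 0 = (L + 3) * zeta30 L e"
  unfolding focus_expand fa_init[OF s] focus_clean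
  unfolding fv_2_0[OF s] unfolding weight_poly_def closed_forms by algebra
 moreover have "(L + 3) * Z 3 0 = rate_coeff L e Z R 3 0"
  using fa_Z[OF s, of 3 0] by (simp add: add.commute)
 ultimately have "(L + 3) * Z 3 0 = (L + 3) * zeta30 L e" by (rule trans[rotated])
 then show Z: "Z 3 0 = zeta30 L e"
  using fa_nonzero[OF s] by (simp only: mult_cancel_left) simp
 have "tconv (twist L e) (twist (- L) e) R (%k l. (L + of_nat k - of_nat l) * Z k l) 3 0
   = 3 * rho30 L e"
  unfolding focus_expand fa_init[OF s] focus_clean Z
  unfolding fv_2_0[OF s] unfolding weight_poly_def closed_forms by algebra
 then show "R 3 0 = rho30 L e"
  using fa_R[OF s, of 3 0] by (simp add: add.commute)
qed

lemma fv_3_1: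
 assumes s: "focus_arrays L e Z R"
 shows "Z 3 (Suc 0) = zeta31 L e" "R 3 (Suc 0) = rho31 L e"
proof -
 note s' = fa_swap[OF s]
 have "rate_coeff L e Z R 3 (Suc 0) = (L + 2) * zeta31 L e"
  unfolding focus_expand fa_init[OF s] focus_clean
  unfolding fv_2_0[OF s] fv_2_1[OF s] fv_3_0[OF s] unfolding weight_poly_def closed_forms by algebra
 moreover have "(L + 2) * Z 3 (Suc 0) = rate_coeff L e Z R 3 (Suc 0)"
  using fa_Z[OF s, of 3 1] by (simp add: add.commute)
 ultimately have "(L + 2) * Z 3 (Suc 0) = (L + 2) * zeta31 L e" by (rule trans[rotated])
 then show Z: "Z 3 (Suc 0) = zeta31 L e"
  using fa_nonzero[OF s] by (simp only: mult_cancel_left) simp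
 have "tconv (twist L e) (twist (- L) e) R (%k l. (L + of_nat k - of_nat l) * Z k l) 3 (Suc 0)
   = 2 * rho31 L e"
  unfolding focus_expand fa_init[OF s] focus_clean Z
  unfolding fv_2_0[OF s] fv_2_1[OF s] fv_3_0[OF s] unfolding weight_poly_def closed_forms by algebra
 then show "R 3 (Suc 0) = rho31 L e"
  using fa_R[OF s, of 3 1] by (simp add: add.commute)
qed

lemma fv_4_0:
 assumes s: "focus_arrays L e Z R"
 shows "Z 4 0 = zeta40 L e" "R 4 0 = rho40 L e"
proof -
 note s' = fa_swap[OF s]
 have "rate_coeff L e Z R 4 0 = (L + 4) * zeta40 L e"
  unfolding focus_expand fa_init[OF s] focus_clean
  unfolding fv_2_0[OF s] fv_3_0[OF s] unfolding weight_poly_def closed_forms by algebra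
 moreover have "(L + 4) * Z 4 0 = rate_coeff L e Z R 4 0"
  using fa_Z[OF s, of 4 0] by (simp add: add.commute)
 ultimately have "(L + 4) * Z 4 0 = (L + 4) * zeta40 L e" by (rule trans[rotated])
 then show Z: "Z 4 0 = zeta40 L e"
  using fa_nonzero[OF s] by (simp only: mult_cancel_left) simp
 have "tconv (twist L e) (twist (- L) e) R (%k l. (L + of_nat k - of_nat l) * Z k l) 4 0
   = 4 * rho40 L e"
  unfolding focus_expand fa_init[OF s] focus_clean Z
  unfolding fv_2_0[OF s] fv_3_0[OF s] unfolding weight_poly_def closed_forms by algebra
 then show "R 4 0 = rho40 L e"
  using fa_R[OF s, of 4 0] by (simp add: add.commute)
qed

lemma fv_3_2:
 assumes s: "focus_arrays L e Z R"
 shows "Z 3 2 = zeta32 L e" "R 3 2 = rho32 L e"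
proof -
 note s' = fa_swap[OF s]
 have "rate_coeff L e Z R 3 2 = (L + 1) * zeta32 L e"
  unfolding focus_expand fa_init[OF s] focus_clean
  unfolding fv_2_0[OF s'] fv_2_1[OF s'] fv_2_0[OF s] fv_2_1[OF s] fv_3_0[OF s] fv_3_1[OF s] unfolding weight_poly_def closed_forms by algebra
 moreover have "(L + 1) * Z 3 2 = rate_coeff L e Z R 3 2"
  using fa_Z[OF s, of 3 2] by (simp add: add.commute)
 ultimately have "(L + 1) * Z 3 2 = (L + 1) * zeta32 L e" by (rule trans[rotated])
 then show Z: "Z 3 2 = zeta32 L e"
  using fa_nonzero[OF s] by (simp only: mult_cancel_left) simp
 have "tconv (twist L e) (twist (- L) e) R (%k l. (L + of_nat k - of_nat l) * Z k l) 3 2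
   = 1 * rho32 L e"
  unfolding focus_expand fa_init[OF s] focus_clean Z
  unfolding fv_2_0[OF s'] fv_2_1[OF s'] fv_2_0[OF s] fv_2_1[OF s] fv_3_0[OF s] fv_3_1[OF s] unfolding weight_poly_def closed_forms by algebra
 then show "R 3 2 = rho32 L e"
  using fa_R[OF s, of 3 2] by (simp add: add.commute)
qed

lemma fv_4_1:
 assumes s: "focus_arrays L e Z R"
 shows "Z 4 (Suc 0) = zeta41 L e" "R 4 (Suc 0) = rho41 L e"
proof -
 note s' = fa_swap[OF s]
 have "rate_coeff L e Z R 4 (Suc 0) = (L + 3) * zeta41 L e"
  unfolding focus_expand fa_init[OF s] focus_clean
  unfolding fv_2_0[OF s] fv_2_1[OF s] fv_3_0[OF s] fv_3_1[OF s] fv_4_0[OF s] unfolding weight_poly_def closed_forms by algebra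
 moreover have "(L + 3) * Z 4 (Suc 0) = rate_coeff L e Z R 4 (Suc 0)"
  using fa_Z[OF s, of 4 1] by (simp add: add.commute)
 ultimately have "(L + 3) * Z 4 (Suc 0) = (L + 3) * zeta41 L e" by (rule trans[rotated])
 then show Z: "Z 4 (Suc 0) = zeta41 L e"
  using fa_nonzero[OF s] by (simp only: mult_cancel_left) simp
 have "tconv (twist L e) (twist (- L) e) R (%k l. (L + of_nat k - of_nat l) * Z k l) 4 (Suc 0)
   = 3 * rho41 L e"
  unfolding focus_expand fa_init[OF s] focus_clean Z
  unfolding fv_2_0[OF s] fv_2_1[OF s] fv_3_0[OF s] fv_3_1[OF s] fv_4_0[OF s] unfolding weight_poly_def closed_forms by algebra
 then show "R 4 (Suc 0) = rho41 L e"
  using fa_R[OF s, of 4 1] by (simp add: add.commute)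
qed

lemma fv_4_2:
 assumes s: "focus_arrays L e Z R"
 shows "Z 4 2 = zeta42 L e" "R 4 2 = rho42 L e"
proof -
 note s' = fa_swap[OF s]
 have "rate_coeff L e Z R 4 2 = (L + 2) * zeta42 L e"
  unfolding focus_expand fa_init[OF s] focus_clean
  unfolding fv_2_0[OF s'] fv_2_1[OF s'] fv_2_0[OF s] fv_2_1[OF s] fv_3_0[OF s] fv_3_1[OF s] fv_3_2[OF s] fv_4_0[OF s] fv_4_1[OF s] unfolding weight_poly_def closed_forms by algebra
 moreover have "(L + 2) * Z 4 2 = rate_coeff L e Z R 4 2"
  using fa_Z[OF s, of 4 2] by (simp add: add.commute)
 ultimately have "(L + 2) * Z 4 2 = (L + 2) * zeta42 L e" by (rule trans[rotated])
 then show Z: "Z 4 2 = zeta42 L e"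
  using fa_nonzero[OF s] by (simp only: mult_cancel_left) simp
 have "tconv (twist L e) (twist (- L) e) R (%k l. (L + of_nat k - of_nat l) * Z k l) 4 2
   = 2 * rho42 L e"
  unfolding focus_expand fa_init[OF s] focus_clean Z
  unfolding fv_2_0[OF s'] fv_2_1[OF s'] fv_2_0[OF s] fv_2_1[OF s] fv_3_0[OF s] fv_3_1[OF s] fv_3_2[OF s] fv_4_0[OF s] fv_4_1[OF s] unfolding weight_poly_def closed_forms by algebra
 then show "R 4 2 = rho42 L e"
  using fa_R[OF s, of 4 2] by (simp add: add.commute)
qed

lemma fv_4_3:
 assumes s: "focus_arrays L e Z R"
 shows "Z 4 3 = zeta43 L e" "R 4 3 = rho43 L e"
proof -
 note s' = fa_swap[OF s]
 have "rate_coeff L e Z R 4 3 = (L + 1) * zeta43 L e"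
  unfolding focus_expand fa_init[OF s] focus_clean
  unfolding fv_2_0[OF s'] fv_3_0[OF s'] fv_2_1[OF s'] fv_3_1[OF s'] fv_2_0[OF s] fv_2_1[OF s] fv_3_2[OF s'] fv_3_0[OF s] fv_3_1[OF s] fv_3_2[OF s] fv_4_0[OF s] fv_4_1[OF s] fv_4_2[OF s] unfolding weight_poly_def closed_forms by algebra
 moreover have "(L + 1) * Z 4 3 = rate_coeff L e Z R 4 3"
  using fa_Z[OF s, of 4 3] by (simp add: add.commute)
 ultimately have "(L + 1) * Z 4 3 = (L + 1) * zeta43 L e" by (rule trans[rotated])
 then show Z: "Z 4 3 = zeta43 L e"
  using fa_nonzero[OF s] by (simp only: mult_cancel_left) simp
 have "tconv (twist L e) (twist (- L) e) R (%k l. (L + of_nat k - of_nat l) * Z k l) 4 3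
   = 1 * rho43 L e"
  unfolding focus_expand fa_init[OF s] focus_clean Z
  unfolding fv_2_0[OF s'] fv_3_0[OF s'] fv_2_1[OF s'] fv_3_1[OF s'] fv_2_0[OF s] fv_2_1[OF s] fv_3_2[OF s'] fv_3_0[OF s] fv_3_1[OF s] fv_3_2[OF s] fv_4_0[OF s] fv_4_1[OF s] fv_4_2[OF s] unfolding weight_poly_def closed_forms by algebra
 then show "R 4 3 = rho43 L e"
  using fa_R[OF s, of 4 3] by (simp add: add.commute)
qed

lemma focus_quantity_4:
 assumes s: "focus_arrays L e Z R"
 shows "48 * L * (L + 1) * (L - 1) * (84609 - 489962*L^2 + 369990*L^4 - 94308*L^6 + 8921*L^8 - 210*L^10
  + (1001712 + 556634*L^2 - 797318*L^4 + 239718*L^6 - 25034*L^8 + 608*L^10) * e + (-550848 +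
  505008*L^2 + 150672*L^4 - 121488*L^6 + 17136*L^8 - 480*L^10) * e^2) = 0"
proof -
 note s' = fa_swap[OF s]
 have "rate_coeff L e Z R 4 4 = 48 * L * (L + 1) * (L - 1) * (84609 - 489962*L^2 + 369990*L^4 - 94308*L^6 + 8921*L^8 - 210*L^10
  + (1001712 + 556634*L^2 - 797318*L^4 + 239718*L^6 - 25034*L^8 + 608*L^10) * e + (-550848 +
  505008*L^2 + 150672*L^4 - 121488*L^6 + 17136*L^8 - 480*L^10) * e^2)"
  unfolding focus_expand fa_init[OF s] focus_clean
  unfolding fv_2_0[OF s'] fv_3_0[OF s'] fv_4_0[OF s'] fv_2_1[OF s'] fv_3_1[OF s'] fv_4_1[OF s'] fv_2_0[OF s] fv_2_1[OF s] fv_3_2[OF s'] fv_4_2[OF s'] fv_3_0[OF s] fv_3_1[OF s] fv_3_2[OF s] fv_4_3[OF s'] fv_4_0[OF s] fv_4_1[OF s] fv_4_2[OF s] fv_4_3[OF s] unfolding weight_poly_def closed_forms by algebra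
 moreover have "rate_coeff L e Z R 4 4 = 0" by (rule fa_rate[OF s]) simp
 ultimately show ?thesis by simp
qed

lemma fv_5_0:
 assumes s: "focus_arrays L e Z R"
 shows "Z 5 0 = zeta50 L e" "R 5 0 = rho50 L e"
proof -
 note s' = fa_swap[OF s]
 have "rate_coeff L e Z R 5 0 = (L + 5) * zeta50 L e"
  unfolding focus_expand fa_init[OF s] focus_clean
  unfolding fv_2_0[OF s] fv_3_0[OF s] fv_4_0[OF s] unfolding weight_poly_def closed_forms by algebra
 moreover have "(L + 5) * Z 5 0 = rate_coeff L e Z R 5 0"
  using fa_Z[OF s, of 5 0] by (simp add: add.commute)
 ultimately have "(L + 5) * Z 5 0 = (L + 5) * zeta50 L e" by (rule trans[rotated])
 then show Z: "Z 5 0 = zeta50 L e"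
  using fa_nonzero[OF s] by (simp only: mult_cancel_left) simp
 have "tconv (twist L e) (twist (- L) e) R (%k l. (L + of_nat k - of_nat l) * Z k l) 5 0
   = 5 * rho50 L e"
  unfolding focus_expand fa_init[OF s] focus_clean Z
  unfolding fv_2_0[OF s] fv_3_0[OF s] fv_4_0[OF s] unfolding weight_poly_def closed_forms by algebra
 then show "R 5 0 = rho50 L e"
  using fa_R[OF s, of 5 0] by (simp add: add.commute)
qed

lemma fv_5_1:
 assumes s: "focus_arrays L e Z R"
 shows "Z 5 (Suc 0) = zeta51 L e" "R 5 (Suc 0) = rho51 L e"
proof -
 note s' = fa_swap[OF s]
 have "rate_coeff L e Z R 5 (Suc 0) = (L + 4) * zeta51 L e"
  unfolding focus_expand fa_init[OF s] focus_clean
  unfolding fv_2_0[OF s] fv_2_1[OF s] fv_3_0[OF s] fv_3_1[OF s] fv_4_0[OF s] fv_4_1[OF s] fv_5_0[OF s] unfolding weight_poly_def closed_forms by algebra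
 moreover have "(L + 4) * Z 5 (Suc 0) = rate_coeff L e Z R 5 (Suc 0)"
  using fa_Z[OF s, of 5 1] by (simp add: add.commute)
 ultimately have "(L + 4) * Z 5 (Suc 0) = (L + 4) * zeta51 L e" by (rule trans[rotated])
 then show Z: "Z 5 (Suc 0) = zeta51 L e"
  using fa_nonzero[OF s] by (simp only: mult_cancel_left) simp
 have "tconv (twist L e) (twist (- L) e) R (%k l. (L + of_nat k - of_nat l) * Z k l) 5 (Suc 0)
   = 4 * rho51 L e"
  unfolding focus_expand fa_init[OF s] focus_clean Z
  unfolding fv_2_0[OF s] fv_2_1[OF s] fv_3_0[OF s] fv_3_1[OF s] fv_4_0[OF s] fv_4_1[OF s] fv_5_0[OF s] unfolding weight_poly_def closed_forms by algebra
 then show "R 5 (Suc 0) = rho51 L e"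
  using fa_R[OF s, of 5 1] by (simp add: add.commute)
qed

lemma fv_5_2:
 assumes s: "focus_arrays L e Z R"
 shows "Z 5 2 = zeta52 L e" "R 5 2 = rho52 L e"
proof -
 note s' = fa_swap[OF s]
 have "rate_coeff L e Z R 5 2 = (L + 3) * zeta52 L e"
  unfolding focus_expand fa_init[OF s] focus_clean
  unfolding fv_2_0[OF s'] fv_2_1[OF s'] fv_2_0[OF s] fv_2_1[OF s] fv_3_0[OF s] fv_3_1[OF s] fv_3_2[OF s] fv_4_0[OF s] fv_4_1[OF s] fv_4_2[OF s] fv_5_0[OF s] fv_5_1[OF s] unfolding weight_poly_def closed_forms by algebra
 moreover have "(L + 3) * Z 5 2 = rate_coeff L e Z R 5 2"
  using fa_Z[OF s, of 5 2] by (simp add: add.commute)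
 ultimately have "(L + 3) * Z 5 2 = (L + 3) * zeta52 L e" by (rule trans[rotated])
 then show Z: "Z 5 2 = zeta52 L e"
  using fa_nonzero[OF s] by (simp only: mult_cancel_left) simp
 have "tconv (twist L e) (twist (- L) e) R (%k l. (L + of_nat k - of_nat l) * Z k l) 5 2
   = 3 * rho52 L e"
  unfolding focus_expand fa_init[OF s] focus_clean Z
  unfolding fv_2_0[OF s'] fv_2_1[OF s'] fv_2_0[OF s] fv_2_1[OF s] fv_3_0[OF s] fv_3_1[OF s] fv_3_2[OF s] fv_4_0[OF s] fv_4_1[OF s] fv_4_2[OF s] fv_5_0[OF s] fv_5_1[OF s] unfolding weight_poly_def closed_forms by algebra
 then show "R 5 2 = rho52 L e"
  using fa_R[OF s, of 5 2] by (simp add: add.commute)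
qed

lemma fv_5_3:
 assumes s: "focus_arrays L e Z R"
 shows "Z 5 3 = zeta53 L e" "R 5 3 = rho53 L e"
proof -
 note s' = fa_swap[OF s]
 have "rate_coeff L e Z R 5 3 = (L + 2) * zeta53 L e"
  unfolding focus_expand fa_init[OF s] focus_clean
  unfolding fv_2_0[OF s'] fv_3_0[OF s'] fv_2_1[OF s'] fv_3_1[OF s'] fv_2_0[OF s] fv_2_1[OF s] fv_3_2[OF s'] fv_3_0[OF s] fv_3_1[OF s] fv_3_2[OF s] fv_4_0[OF s] fv_4_1[OF s] fv_4_2[OF s] fv_4_3[OF s] fv_5_0[OF s] fv_5_1[OF s] fv_5_2[OF s] unfolding weight_poly_def closed_forms by algebra
 moreover have "(L + 2) * Z 5 3 = rate_coeff L e Z R 5 3"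
  using fa_Z[OF s, of 5 3] by (simp add: add.commute)
 ultimately have "(L + 2) * Z 5 3 = (L + 2) * zeta53 L e" by (rule trans[rotated])
 then show Z: "Z 5 3 = zeta53 L e"
  using fa_nonzero[OF s] by (simp only: mult_cancel_left) simp
 have "tconv (twist L e) (twist (- L) e) R (%k l. (L + of_nat k - of_nat l) * Z k l) 5 3
   = 2 * rho53 L e"
  unfolding focus_expand fa_init[OF s] focus_clean Z
  unfolding fv_2_0[OF s'] fv_3_0[OF s'] fv_2_1[OF s'] fv_3_1[OF s'] fv_2_0[OF s] fv_2_1[OF s] fv_3_2[OF s'] fv_3_0[OF s] fv_3_1[OF s] fv_3_2[OF s] fv_4_0[OF s] fv_4_1[OF s] fv_4_2[OF s] fv_4_3[OF s] fv_5_0[OF s] fv_5_1[OF s] fv_5_2[OF s] unfolding weight_poly_def closed_forms by algebra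
 then show "R 5 3 = rho53 L e"
  using fa_R[OF s, of 5 3] by (simp add: add.commute)
qed

lemma fv_5_4:
 assumes s: "focus_arrays L e Z R"
 shows "Z 5 4 = zeta54 L e" "R 5 4 = rho54 L e"
proof -
 note s' = fa_swap[OF s]
 have "rate_coeff L e Z R 5 4 = (L + 1) * zeta54 L e"
  unfolding focus_expand fa_init[OF s] focus_clean
  unfolding fv_2_0[OF s'] fv_3_0[OF s'] fv_4_0[OF s'] fv_2_1[OF s'] fv_3_1[OF s'] fv_4_1[OF s'] fv_2_0[OF s] fv_2_1[OF s] fv_3_2[OF s'] fv_4_2[OF s'] fv_3_0[OF s] fv_3_1[OF s] fv_3_2[OF s] fv_4_3[OF s'] fv_4_0[OF s] fv_4_1[OF s] fv_4_2[OF s] fv_4_3[OF s] fv_5_0[OF s] fv_5_1[OF s] fv_5_2[OF s] fv_5_3[OF s] unfolding weight_poly_def closed_forms by algebra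
 moreover have "(L + 1) * Z 5 4 = rate_coeff L e Z R 5 4"
  using fa_Z[OF s, of 5 4] by (simp add: add.commute)
 ultimately have "(L + 1) * Z 5 4 = (L + 1) * zeta54 L e" by (rule trans[rotated])
 then show Z: "Z 5 4 = zeta54 L e"
  using fa_nonzero[OF s] by (simp only: mult_cancel_left) simp
 have "tconv (twist L e) (twist (- L) e) R (%k l. (L + of_nat k - of_nat l) * Z k l) 5 4
   = 1 * rho54 L e"
  unfolding focus_expand fa_init[OF s] focus_clean Z
  unfolding fv_2_0[OF s'] fv_3_0[OF s'] fv_4_0[OF s'] fv_2_1[OF s'] fv_3_1[OF s'] fv_4_1[OF s'] fv_2_0[OF s] fv_2_1[OF s] fv_3_2[OF s'] fv_4_2[OF s'] fv_3_0[OF s] fv_3_1[OF s] fv_3_2[OF s] fv_4_3[OF s'] fv_4_0[OF s] fv_4_1[OF s] fv_4_2[OF s] fv_4_3[OF s] fv_5_0[OF s] fv_5_1[OF s] fv_5_2[OF s] fv_5_3[OF s] unfolding weight_poly_def closed_forms by algebra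
 then show "R 5 4 = rho54 L e"
  using fa_R[OF s, of 5 4] by (simp add: add.commute)
qed

lemma focus_quantity_5:
 assumes s: "focus_arrays L e Z R"
 shows "600 * L * (L + 3) * (L - 3) * (21073323 - 33351827*L^2 + 20892422*L^4 - 6722682*L^6 +
  1087571*L^8 - 77171*L^10 + 1404*L^12 + (-23075760 - 18106274*L^2 + 1285360*L^4 + 6405220*L^6 -
  1926736*L^8 + 170174*L^10 - 3184*L^12) * e + (13202112 - 794928*L^2 - 16287456*L^4 + 3604608*L^6
  + 347808*L^8 - 73680*L^10 + 1536*L^12) * e^2) = 0"
proof -
 note s' = fa_swap[OF s]
 have "rate_coeff L e Z R 5 5 = 600 * L * (L + 3) * (L - 3) * (21073323 - 33351827*L^2 + 20892422*L^4 - 6722682*L^6 +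
  1087571*L^8 - 77171*L^10 + 1404*L^12 + (-23075760 - 18106274*L^2 + 1285360*L^4 + 6405220*L^6 -
  1926736*L^8 + 170174*L^10 - 3184*L^12) * e + (13202112 - 794928*L^2 - 16287456*L^4 + 3604608*L^6
  + 347808*L^8 - 73680*L^10 + 1536*L^12) * e^2)"
  unfolding focus_expand fa_init[OF s] focus_clean
  unfolding fv_2_0[OF s'] fv_3_0[OF s'] fv_4_0[OF s'] fv_5_0[OF s'] fv_2_1[OF s'] fv_3_1[OF s'] fv_4_1[OF s'] fv_5_1[OF s'] fv_2_0[OF s] fv_2_1[OF s] fv_3_2[OF s'] fv_4_2[OF s'] fv_5_2[OF s'] fv_3_0[OF s] fv_3_1[OF s] fv_3_2[OF s] fv_4_3[OF s'] fv_5_3[OF s'] fv_4_0[OF s] fv_4_1[OF s] fv_4_2[OF s] fv_4_3[OF s] fv_5_4[OF s'] fv_5_0[OF s] fv_5_1[OF s] fv_5_2[OF s] fv_5_3[OF s] fv_5_4[OF s] unfolding weight_poly_def closed_forms by algebra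
 moreover have "rate_coeff L e Z R 5 5 = 0" by (rule fa_rate[OF s]) simp
 ultimately show ?thesis by simp
qed

lemma fv_6_0:
 assumes s: "focus_arrays L e Z R"
 shows "Z 6 0 = zeta60 L e" "R 6 0 = rho60 L e"
proof -
 note s' = fa_swap[OF s]
 have "rate_coeff L e Z R 6 0 = (L + 6) * zeta60 L e"
  unfolding focus_expand fa_init[OF s] focus_clean
  unfolding fv_2_0[OF s] fv_3_0[OF s] fv_4_0[OF s] fv_5_0[OF s] unfolding weight_poly_def closed_forms by algebra
 moreover have "(L + 6) * Z 6 0 = rate_coeff L e Z R 6 0"
  using fa_Z[OF s, of 6 0] by (simp add: add.commute)
 ultimately have "(L + 6) * Z 6 0 = (L + 6) * zeta60 L e" by (rule trans[rotated])
 then show Z: "Z 6 0 = zeta60 L e"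
  using fa_nonzero[OF s] by (simp only: mult_cancel_left) simp
 have "tconv (twist L e) (twist (- L) e) R (%k l. (L + of_nat k - of_nat l) * Z k l) 6 0
   = 6 * rho60 L e"
  unfolding focus_expand fa_init[OF s] focus_clean Z
  unfolding fv_2_0[OF s] fv_3_0[OF s] fv_4_0[OF s] fv_5_0[OF s] unfolding weight_poly_def closed_forms by algebra
 then show "R 6 0 = rho60 L e"
  using fa_R[OF s, of 6 0] by (simp add: add.commute)
qed

lemma fv_6_1:
 assumes s: "focus_arrays L e Z R"
 shows "Z 6 (Suc 0) = zeta61 L e" "R 6 (Suc 0) = rho61 L e"
proof -
 note s' = fa_swap[OF s]
 have "rate_coeff L e Z R 6 (Suc 0) = (L + 5) * zeta61 L e"
  unfolding focus_expand fa_init[OF s] focus_clean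
  unfolding fv_2_0[OF s] fv_2_1[OF s] fv_3_0[OF s] fv_3_1[OF s] fv_4_0[OF s] fv_4_1[OF s] fv_5_0[OF s] fv_5_1[OF s] fv_6_0[OF s] unfolding weight_poly_def closed_forms by algebra
 moreover have "(L + 5) * Z 6 (Suc 0) = rate_coeff L e Z R 6 (Suc 0)"
  using fa_Z[OF s, of 6 1] by (simp add: add.commute)
 ultimately have "(L + 5) * Z 6 (Suc 0) = (L + 5) * zeta61 L e" by (rule trans[rotated])
 then show Z: "Z 6 (Suc 0) = zeta61 L e"
  using fa_nonzero[OF s] by (simp only: mult_cancel_left) simp
 have "tconv (twist L e) (twist (- L) e) R (%k l. (L + of_nat k - of_nat l) * Z k l) 6 (Suc 0)
   = 5 * rho61 L e"
  unfolding focus_expand fa_init[OF s] focus_clean Z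
  unfolding fv_2_0[OF s] fv_2_1[OF s] fv_3_0[OF s] fv_3_1[OF s] fv_4_0[OF s] fv_4_1[OF s] fv_5_0[OF s] fv_5_1[OF s] fv_6_0[OF s] unfolding weight_poly_def closed_forms by algebra
 then show "R 6 (Suc 0) = rho61 L e"
  using fa_R[OF s, of 6 1] by (simp add: add.commute)
qed

lemma fv_6_2:
 assumes s: "focus_arrays L e Z R"
 shows "Z 6 2 = zeta62 L e" "R 6 2 = rho62 L e"
proof -
 note s' = fa_swap[OF s]
 have "rate_coeff L e Z R 6 2 = (L + 4) * zeta62 L e"
  unfolding focus_expand fa_init[OF s] focus_clean
  unfolding fv_2_0[OF s'] fv_2_1[OF s'] fv_2_0[OF s] fv_2_1[OF s] fv_3_0[OF s] fv_3_1[OF s] fv_3_2[OF s] fv_4_0[OF s] fv_4_1[OF s] fv_4_2[OF s] fv_5_0[OF s] fv_5_1[OF s] fv_5_2[OF s] fv_6_0[OF s] fv_6_1[OF s] unfolding weight_poly_def closed_forms by algebra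
 moreover have "(L + 4) * Z 6 2 = rate_coeff L e Z R 6 2"
  using fa_Z[OF s, of 6 2] by (simp add: add.commute)
 ultimately have "(L + 4) * Z 6 2 = (L + 4) * zeta62 L e" by (rule trans[rotated])
 then show Z: "Z 6 2 = zeta62 L e"
  using fa_nonzero[OF s] by (simp only: mult_cancel_left) simp
 have "tconv (twist L e) (twist (- L) e) R (%k l. (L + of_nat k - of_nat l) * Z k l) 6 2
   = 4 * rho62 L e"
  unfolding focus_expand fa_init[OF s] focus_clean Z
  unfolding fv_2_0[OF s'] fv_2_1[OF s'] fv_2_0[OF s] fv_2_1[OF s] fv_3_0[OF s] fv_3_1[OF s] fv_3_2[OF s] fv_4_0[OF s] fv_4_1[OF s] fv_4_2[OF s] fv_5_0[OF s] fv_5_1[OF s] fv_5_2[OF s] fv_6_0[OF s] fv_6_1[OF s] unfolding weight_poly_def closed_forms by algebra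
 then show "R 6 2 = rho62 L e"
  using fa_R[OF s, of 6 2] by (simp add: add.commute)
qed

lemma fv_6_3:
 assumes s: "focus_arrays L e Z R"
 shows "Z 6 3 = zeta63 L e" "R 6 3 = rho63 L e"
proof -
 note s' = fa_swap[OF s]
 have "rate_coeff L e Z R 6 3 = (L + 3) * zeta63 L e"
  unfolding focus_expand fa_init[OF s] focus_clean
  unfolding fv_2_0[OF s'] fv_3_0[OF s'] fv_2_1[OF s'] fv_3_1[OF s'] fv_2_0[OF s] fv_2_1[OF s] fv_3_2[OF s'] fv_3_0[OF s] fv_3_1[OF s] fv_3_2[OF s] fv_4_0[OF s] fv_4_1[OF s] fv_4_2[OF s] fv_4_3[OF s] fv_5_0[OF s] fv_5_1[OF s] fv_5_2[OF s] fv_5_3[OF s] fv_6_0[OF s] fv_6_1[OF s] fv_6_2[OF s] unfolding weight_poly_def closed_forms by algebra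
 moreover have "(L + 3) * Z 6 3 = rate_coeff L e Z R 6 3"
  using fa_Z[OF s, of 6 3] by (simp add: add.commute)
 ultimately have "(L + 3) * Z 6 3 = (L + 3) * zeta63 L e" by (rule trans[rotated])
 then show Z: "Z 6 3 = zeta63 L e"
  using fa_nonzero[OF s] by (simp only: mult_cancel_left) simp
 have "tconv (twist L e) (twist (- L) e) R (%k l. (L + of_nat k - of_nat l) * Z k l) 6 3
   = 3 * rho63 L e"
  unfolding focus_expand fa_init[OF s] focus_clean Z
  unfolding fv_2_0[OF s'] fv_3_0[OF s'] fv_2_1[OF s'] fv_3_1[OF s'] fv_2_0[OF s] fv_2_1[OF s] fv_3_2[OF s'] fv_3_0[OF s] fv_3_1[OF s] fv_3_2[OF s] fv_4_0[OF s] fv_4_1[OF s] fv_4_2[OF s] fv_4_3[OF s] fv_5_0[OF s] fv_5_1[OF s] fv_5_2[OF s] fv_5_3[OF s] fv_6_0[OF s] fv_6_1[OF s] fv_6_2[OF s] unfolding weight_poly_def closed_forms by algebra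
 then show "R 6 3 = rho63 L e"
  using fa_R[OF s, of 6 3] by (simp add: add.commute)
qed

lemma fv_6_4:
 assumes s: "focus_arrays L e Z R"
 shows "Z 6 4 = zeta64 L e" "R 6 4 = rho64 L e"
proof -
 note s' = fa_swap[OF s]
 have "rate_coeff L e Z R 6 4 = (L + 2) * zeta64 L e"
  unfolding focus_expand fa_init[OF s] focus_clean
  unfolding fv_2_0[OF s'] fv_3_0[OF s'] fv_4_0[OF s'] fv_2_1[OF s'] fv_3_1[OF s'] fv_4_1[OF s'] fv_2_0[OF s] fv_2_1[OF s] fv_3_2[OF s'] fv_4_2[OF s'] fv_3_0[OF s] fv_3_1[OF s] fv_3_2[OF s] fv_4_3[OF s'] fv_4_0[OF s] fv_4_1[OF s] fv_4_2[OF s] fv_4_3[OF s] fv_5_0[OF s] fv_5_1[OF s] fv_5_2[OF s] fv_5_3[OF s] fv_5_4[OF s] fv_6_0[OF s] fv_6_1[OF s] fv_6_2[OF s] fv_6_3[OF s] unfolding weight_poly_def closed_forms by algebra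
 moreover have "(L + 2) * Z 6 4 = rate_coeff L e Z R 6 4"
  using fa_Z[OF s, of 6 4] by (simp add: add.commute)
 ultimately have "(L + 2) * Z 6 4 = (L + 2) * zeta64 L e" by (rule trans[rotated])
 then show Z: "Z 6 4 = zeta64 L e"
  using fa_nonzero[OF s] by (simp only: mult_cancel_left) simp
 have "tconv (twist L e) (twist (- L) e) R (%k l. (L + of_nat k - of_nat l) * Z k l) 6 4
   = 2 * rho64 L e"
  unfolding focus_expand fa_init[OF s] focus_clean Z
  unfolding fv_2_0[OF s'] fv_3_0[OF s'] fv_4_0[OF s'] fv_2_1[OF s'] fv_3_1[OF s'] fv_4_1[OF s'] fv_2_0[OF s] fv_2_1[OF s] fv_3_2[OF s'] fv_4_2[OF s'] fv_3_0[OF s] fv_3_1[OF s] fv_3_2[OF s] fv_4_3[OF s'] fv_4_0[OF s] fv_4_1[OF s] fv_4_2[OF s] fv_4_3[OF s] fv_5_0[OF s] fv_5_1[OF s] fv_5_2[OF s] fv_5_3[OF s] fv_5_4[OF s] fv_6_0[OF s] fv_6_1[OF s] fv_6_2[OF s] fv_6_3[OF s] unfolding weight_poly_def closed_forms by algebra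
 then show "R 6 4 = rho64 L e"
  using fa_R[OF s, of 6 4] by (simp add: add.commute)
qed

lemma fv_6_5:
 assumes s: "focus_arrays L e Z R"
 shows "Z 6 5 = zeta65 L e" "R 6 5 = rho65 L e"
proof -
 note s' = fa_swap[OF s]
 have "rate_coeff L e Z R 6 5 = (L + 1) * zeta65 L e"
  unfolding focus_expand fa_init[OF s] focus_clean
  unfolding fv_2_0[OF s'] fv_3_0[OF s'] fv_4_0[OF s'] fv_5_0[OF s'] fv_2_1[OF s'] fv_3_1[OF s'] fv_4_1[OF s'] fv_5_1[OF s'] fv_2_0[OF s] fv_2_1[OF s] fv_3_2[OF s'] fv_4_2[OF s'] fv_5_2[OF s'] fv_3_0[OF s] fv_3_1[OF s] fv_3_2[OF s] fv_4_3[OF s'] fv_5_3[OF s'] fv_4_0[OF s] fv_4_1[OF s] fv_4_2[OF s] fv_4_3[OF s] fv_5_4[OF s'] fv_5_0[OF s] fv_5_1[OF s] fv_5_2[OF s] fv_5_3[OF s] fv_5_4[OF s] fv_6_0[OF s] fv_6_1[OF s] fv_6_2[OF s] fv_6_3[OF s] fv_6_4[OF s] unfolding weight_poly_def closed_forms by algebra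
 moreover have "(L + 1) * Z 6 5 = rate_coeff L e Z R 6 5"
  using fa_Z[OF s, of 6 5] by (simp add: add.commute)
 ultimately have "(L + 1) * Z 6 5 = (L + 1) * zeta65 L e" by (rule trans[rotated])
 then show Z: "Z 6 5 = zeta65 L e"
  using fa_nonzero[OF s] by (simp only: mult_cancel_left) simp
 have "tconv (twist L e) (twist (- L) e) R (%k l. (L + of_nat k - of_nat l) * Z k l) 6 5
   = 1 * rho65 L e"
  unfolding focus_expand fa_init[OF s] focus_clean Z
  unfolding fv_2_0[OF s'] fv_3_0[OF s'] fv_4_0[OF s'] fv_5_0[OF s'] fv_2_1[OF s'] fv_3_1[OF s'] fv_4_1[OF s'] fv_5_1[OF s'] fv_2_0[OF s] fv_2_1[OF s] fv_3_2[OF s'] fv_4_2[OF s'] fv_5_2[OF s'] fv_3_0[OF s] fv_3_1[OF s] fv_3_2[OF s] fv_4_3[OF s'] fv_5_3[OF s'] fv_4_0[OF s] fv_4_1[OF s] fv_4_2[OF s] fv_4_3[OF s] fv_5_4[OF s'] fv_5_0[OF s] fv_5_1[OF s] fv_5_2[OF s] fv_5_3[OF s] fv_5_4[OF s] fv_6_0[OF s] fv_6_1[OF s] fv_6_2[OF s] fv_6_3[OF s] fv_6_4[OF s] unfolding weight_poly_def closed_forms by algebra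
 then show "R 6 5 = rho65 L e"
  using fa_R[OF s, of 6 5] by (simp add: add.commute)
qed

lemma focus_quantity_6:
 assumes s: "focus_arrays L e Z R"
 shows "4320 * L * (L + 1) * (L - 1) * (L + 3) * (L - 3) * (418249019845440 - 35758819785924*L^2 -
  1288626250061223*L^4 + 1707165163938707*L^6 - 1060541168656418*L^8 + 389369086085172*L^10 -
  91452444509338*L^12 + 14163153837082*L^14 - 1450450729248*L^16 + 96158461112*L^18 -
  3908338343*L^20 + 86263851*L^22 - 750870*L^24 + (-1754519280076800 + 1223361634026240*L^2 +
  258282447296376*L^4 - 1501542019419662*L^6 + 1489424919866508*L^8 - 747788312566172*L^10 +
  221334338124988*L^12 - 40900950252312*L^14 + 4800218311828*L^16 - 353244265412*L^18 +
  15520298268*L^20 - 361282682*L^22 + 3218832*L^24) * e + (1986629523333120 - 2151103110317568*L^2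
  + 869838828153984*L^4 - 338719450927552*L^6 - 87001721568160*L^8 + 233842687165168*L^10 -
  125464075442400*L^12 + 33076717807088*L^14 - 4933631725280*L^16 + 429570124368*L^18 -
  21237838240*L^20 + 533988496*L^22 - 4913024*L^24) * e^2 + (-830140126986240 +
  833888026902528*L^2 + 188171169639936*L^4 - 22089773286656*L^6 - 319184939434272*L^8 +
  181587924491424*L^10 - 31810482317472*L^12 - 1515351381216*L^14 + 1258137513888*L^16 -
  175300685856*L^18 + 11029555488*L^20 - 317080224*L^22 + 3068672*L^24) * e^3 + (110460174336000 -
  36358671974400*L^2 - 388377107435520*L^4 + 442188363064320*L^6 - 110413030321920*L^8 -
  36970889145600*L^10 + 23549170156800*L^12 - 4383232792320*L^14 + 303801227520*L^16 +
  2720636160*L^18 - 1353596160*L^20 + 56451840*L^22 - 606720*L^24) * e^4) = 0"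
proof -
 note s' = fa_swap[OF s]
 have "rate_coeff L e Z R 6 6 = 4320 * L * (L + 1) * (L - 1) * (L + 3) * (L - 3) * (418249019845440 - 35758819785924*L^2 -
  1288626250061223*L^4 + 1707165163938707*L^6 - 1060541168656418*L^8 + 389369086085172*L^10 -
  91452444509338*L^12 + 14163153837082*L^14 - 1450450729248*L^16 + 96158461112*L^18 -
  3908338343*L^20 + 86263851*L^22 - 750870*L^24 + (-1754519280076800 + 1223361634026240*L^2 +
  258282447296376*L^4 - 1501542019419662*L^6 + 1489424919866508*L^8 - 747788312566172*L^10 +
  221334338124988*L^12 - 40900950252312*L^14 + 4800218311828*L^16 - 353244265412*L^18 +
  15520298268*L^20 - 361282682*L^22 + 3218832*L^24) * e + (1986629523333120 - 2151103110317568*L^2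
  + 869838828153984*L^4 - 338719450927552*L^6 - 87001721568160*L^8 + 233842687165168*L^10 -
  125464075442400*L^12 + 33076717807088*L^14 - 4933631725280*L^16 + 429570124368*L^18 -
  21237838240*L^20 + 533988496*L^22 - 4913024*L^24) * e^2 + (-830140126986240 +
  833888026902528*L^2 + 188171169639936*L^4 - 22089773286656*L^6 - 319184939434272*L^8 +
  181587924491424*L^10 - 31810482317472*L^12 - 1515351381216*L^14 + 1258137513888*L^16 -
  175300685856*L^18 + 11029555488*L^20 - 317080224*L^22 + 3068672*L^24) * e^3 + (110460174336000 -
  36358671974400*L^2 - 388377107435520*L^4 + 442188363064320*L^6 - 110413030321920*L^8 -
  36970889145600*L^10 + 23549170156800*L^12 - 4383232792320*L^14 + 303801227520*L^16 +
  2720636160*L^18 - 1353596160*L^20 + 56451840*L^22 - 606720*L^24) * e^4)"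
  unfolding focus_expand fa_init[OF s] focus_clean
  unfolding fv_2_0[OF s'] fv_3_0[OF s'] fv_4_0[OF s'] fv_5_0[OF s'] fv_6_0[OF s'] fv_2_1[OF s'] fv_3_1[OF s'] fv_4_1[OF s'] fv_5_1[OF s'] fv_6_1[OF s'] fv_2_0[OF s] fv_2_1[OF s] fv_3_2[OF s'] fv_4_2[OF s'] fv_5_2[OF s'] fv_6_2[OF s'] fv_3_0[OF s] fv_3_1[OF s] fv_3_2[OF s] fv_4_3[OF s'] fv_5_3[OF s'] fv_6_3[OF s'] fv_4_0[OF s] fv_4_1[OF s] fv_4_2[OF s] fv_4_3[OF s] fv_5_4[OF s'] fv_6_4[OF s'] fv_5_0[OF s] fv_5_1[OF s] fv_5_2[OF s] fv_5_3[OF s] fv_5_4[OF s] fv_6_5[OF s'] fv_6_0[OF s] fv_6_1[OF s] fv_6_2[OF s] fv_6_3[OF s] fv_6_4[OF s] fv_6_5[OF s] unfolding weight_poly_def closed_forms by algebra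
 moreover have "rate_coeff L e Z R 6 6 = 0" by (rule fa_rate[OF s]) simp
 ultimately show ?thesis by simp
qed

section \<open>Elimination of the focus quantities\<close>

lemma positive_of_scaled: "4 * A * q = w ==> 0 < w ==> 0 < A ==> 0 < q" for A q w :: real
 by (auto simp: zero_less_mult_iff)

text \<open>The two quadratics determine \<open>e\<close> rationally in \<open>x\<close>.  Substituting it back leaves polynomials in
  \<open>x\<close> alone; on either side of \<open>x = 5 / 4\<close> one of them is shown to be nonzero by moving that point
  to the origin.\<close>

lemma focus_quantities_no_common_zero:
 fixes x e :: real
 assumes x: "x > 0"
  and p: "(84609 + 489962*x + 369990*x^2 + 94308*x^3 + 8921*x^4 + 210*x^5)
    + (1001712 - 556634*x - 797318*x^2 - 239718*x^3 - 25034*x^4 - 608*x^5) * e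
    + (-550848 - 505008*x + 150672*x^2 + 121488*x^3 + 17136*x^4 + 480*x^5) * e^2 = 0"
  and q: "(21073323 + 33351827*x + 20892422*x^2 + 6722682*x^3 + 1087571*x^4 + 77171*x^5 + 1404*x^6)
    + (-23075760 + 18106274*x + 1285360*x^2 - 6405220*x^3 - 1926736*x^4 - 170174*x^5 - 3184*x^6) * e
    + (13202112 + 794928*x - 16287456*x^2 - 3604608*x^3 + 347808*x^4 + 73680*x^5 + 1536*x^6) * e^2 = 0"
  and s: "(418249019845440 + 35758819785924*x - 1288626250061223*x^2 - 1707165163938707*x^3 -
     1060541168656418*x^4 - 389369086085172*x^5 - 91452444509338*x^6 - 14163153837082*x^7 -
     1450450729248*x^8 - 96158461112*x^9 - 3908338343*x^10 - 86263851*x^11 - 750870*x^12)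
    + (-1754519280076800 - 1223361634026240*x + 258282447296376*x^2 + 1501542019419662*x^3 +
     1489424919866508*x^4 + 747788312566172*x^5 + 221334338124988*x^6 + 40900950252312*x^7 +
     4800218311828*x^8 + 353244265412*x^9 + 15520298268*x^10 + 361282682*x^11 + 3218832*x^12) * e
    + (1986629523333120 + 2151103110317568*x + 869838828153984*x^2 + 338719450927552*x^3 -
     87001721568160*x^4 - 233842687165168*x^5 - 125464075442400*x^6 - 33076717807088*x^7 -
     4933631725280*x^8 - 429570124368*x^9 - 21237838240*x^10 - 533988496*x^11 - 4913024*x^12) * e^2
    + (-830140126986240 - 833888026902528*x + 188171169639936*x^2 + 22089773286656*x^3 -
     319184939434272*x^4 - 181587924491424*x^5 - 31810482317472*x^6 + 1515351381216*x^7 +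
     1258137513888*x^8 + 175300685856*x^9 + 11029555488*x^10 + 317080224*x^11 + 3068672*x^12) * e^3
    + (110460174336000 + 36358671974400*x - 388377107435520*x^2 - 442188363064320*x^3 -
     110413030321920*x^4 + 36970889145600*x^5 + 23549170156800*x^6 + 4383232792320*x^7 +
     303801227520*x^8 - 2720636160*x^9 - 1353596160*x^10 - 56451840*x^11 - 606720*x^12) * e^4 = 0"
 shows False
proof -
 define a0 where "a0 = 84609 + 489962*x + 369990*x^2 + 94308*x^3 + 8921*x^4 + 210*x^5"
 define a1 where "a1 = 1001712 - 556634*x - 797318*x^2 - 239718*x^3 - 25034*x^4 - 608*x^5"
 define a2 where "a2 = -550848 - 505008*x + 150672*x^2 + 121488*x^3 + 17136*x^4 + 480*x^5"
 define b0 where "b0 = 21073323 + 33351827*x + 20892422*x^2 + 6722682*x^3 + 1087571*x^4 + 77171*x^5 + 1404*x^6"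
 define b1 where "b1 = -23075760 + 18106274*x + 1285360*x^2 - 6405220*x^3 - 1926736*x^4 - 170174*x^5 - 3184*x^6"
 define b2 where "b2 = 13202112 + 794928*x - 16287456*x^2 - 3604608*x^3 + 347808*x^4 + 73680*x^5 + 1536*x^6"
 define c0 where "c0 = 418249019845440 + 35758819785924*x - 1288626250061223*x^2 - 1707165163938707*x^3 -
   1060541168656418*x^4 - 389369086085172*x^5 - 91452444509338*x^6 - 14163153837082*x^7 -
   1450450729248*x^8 - 96158461112*x^9 - 3908338343*x^10 - 86263851*x^11 - 750870*x^12"
 define c1 where "c1 = -1754519280076800 - 1223361634026240*x + 258282447296376*x^2 + 1501542019419662*x^3 +
   1489424919866508*x^4 + 747788312566172*x^5 + 221334338124988*x^6 + 40900950252312*x^7 +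
   4800218311828*x^8 + 353244265412*x^9 + 15520298268*x^10 + 361282682*x^11 + 3218832*x^12"
 define c2 where "c2 = 1986629523333120 + 2151103110317568*x + 869838828153984*x^2 + 338719450927552*x^3 -
   87001721568160*x^4 - 233842687165168*x^5 - 125464075442400*x^6 - 33076717807088*x^7 -
   4933631725280*x^8 - 429570124368*x^9 - 21237838240*x^10 - 533988496*x^11 - 4913024*x^12"
 define c3 where "c3 = -830140126986240 - 833888026902528*x + 188171169639936*x^2 + 22089773286656*x^3 -
   319184939434272*x^4 - 181587924491424*x^5 - 31810482317472*x^6 + 1515351381216*x^7 +
   1258137513888*x^8 + 175300685856*x^9 + 11029555488*x^10 + 317080224*x^11 + 3068672*x^12"
 define c4 where "c4 = 110460174336000 + 36358671974400*x - 388377107435520*x^2 - 442188363064320*x^3 -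
   110413030321920*x^4 + 36970889145600*x^5 + 23549170156800*x^6 + 4383232792320*x^7 +
   303801227520*x^8 - 2720636160*x^9 - 1353596160*x^10 - 56451840*x^11 - 606720*x^12"
 have p': "a0 + a1 * e + a2 * e^2 = 0" using p unfolding a0_def a1_def a2_def .
 have q': "b0 + b1 * e + b2 * e^2 = 0" using q unfolding b0_def b1_def b2_def .
 have s': "c0 + c1 * e + c2 * e^2 + c3 * e^3 + c4 * e^4 = 0"
  using s unfolding c0_def c1_def c2_def c3_def c4_def .
 define n where "n = -132554326272 - 370310157956*x - 302837470493*x^2 + 805862129*x^3 + 116009507497*x^4 +
   64835257145*x^5 + 17031549331*x^6 + 2531626007*x^7 + 224871379*x^8 + 11873015*x^9 +
   332558*x^10 + 3660*x^11"
 define d where "d = 5348726784 - 85750980000*x - 145368578088*x^2 - 11948830440*x^3 + 88813644474*x^4 +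
   63267438888*x^5 + 19839697890*x^6 + 3379312536*x^7 + 331691310*x^8 + 18787224*x^9 +
   552030*x^10 + 6192*x^11"
 define m where "m = 5765454376704 + 7863272259324*x - 3720262398749*x^2 - 10287414469846*x^3 -
   6627267944942*x^4 - 2173457487118*x^5 - 419555126360*x^6 - 50229880570*x^7 -
   3793007378*x^8 - 176673142*x^9 - 4481675*x^10 - 46248*x^11"
 have n: "96 * n = a2 * b0 - a0 * b2" unfolding n_def a0_def a2_def b0_def b2_def by algebra
 have d: "96 * d = a1 * b2 - a2 * b1" unfolding d_def a1_def a2_def b1_def b2_def by algebra
 have m: "4 * m = a1 * b0 - a0 * b1" unfolding m_def a1_def a0_def b1_def b0_def by algebra
 have "96 * (d * e - n) = b2 * (a0 + a1 * e + a2 * e^2) - a2 * (b0 + b1 * e + b2 * e^2)"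
  using n d by algebra
 then have de: "d * e = n" unfolding p' q' by simp
 have "a0 > 0" unfolding a0_def using x by (intro add_pos_pos mult_pos_pos zero_less_power) simp_all
 then have e0: "e ~= 0" using p' by auto
 have "e * (96 * n * e + 4 * m) = b0 * (a0 + a1 * e + a2 * e^2) - a0 * (b0 + b1 * e + b2 * e^2)"
  using n m by algebra
 then have ne: "96 * n * e + 4 * m = 0" unfolding p' q' using e0 by simp
 have "96 * (n * n) + 4 * (d * m) = n * (96 * (n - d * e)) + d * (96 * n * e + 4 * m)" by algebra
 then have nm: "96 * (n * n) + 4 * (d * m) = 0" unfolding ne de by simp
 define r where "r = 75422237694796436078592 + 317300563328896062062592*x + 614274808285147572265984*x^2 +
   738300507010672503997504*x^3 + 542369584192099546455552*x^4 + 112238176390196627694352*x^5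
   - 232535184193872565071463*x^6 - 299918214486964494160434*x^7 -
   193671023829560758566397*x^8 - 82136658604038208937972*x^9 - 24765495424641187530639*x^10
   - 5499470368520063210910*x^11 - 914329142856218969165*x^12 - 114258315825862616232*x^13 -
   10638548707261984349*x^14 - 717811382028065230*x^15 - 32678233504828479*x^16 -
   781779389534164*x^17 + 8446446236755*x^18 + 1413051608094*x^19 + 50546059145*x^20 +
   857162400*x^21 + 5854464*x^22"
 have "24 * r = 96 * (n * n) + 4 * (d * m)" unfolding r_def n_def d_def m_def by algebra
 then have r0: "r = 0" using nm by simp
 show False
 proof (cases "x <= 5/4")
  case True
  define w where "w = 5/4 - x"
  have w: "w >= 0" and xw: "4 * (x + w) / 5 = 1" using True by (simp_all add: w_def)
  have "2384185791015625 * r = 2384185791015625 * (75422237694796436078592 * x^0 * (4 * (x + w) / 5)^22 + 317300563328896062062592 * x^1 * (4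
   * (x + w) / 5)^21 + 614274808285147572265984 * x^2 * (4 * (x + w) / 5)^20 +
   738300507010672503997504 * x^3 * (4 * (x + w) / 5)^19 + 542369584192099546455552 * x^4 *
   (4 * (x + w) / 5)^18 + 112238176390196627694352 * x^5 * (4 * (x + w) / 5)^17 +
   -232535184193872565071463 * x^6 * (4 * (x + w) / 5)^16 - 299918214486964494160434 * x^7 *
   (4 * (x + w) / 5)^15 - 193671023829560758566397 * x^8 * (4 * (x + w) / 5)^14 +
   -82136658604038208937972 * x^9 * (4 * (x + w) / 5)^13 - 24765495424641187530639 * x^10 *
   (4 * (x + w) / 5)^12 - 5499470368520063210910 * x^11 * (4 * (x + w) / 5)^11 +
   -914329142856218969165 * x^12 * (4 * (x + w) / 5)^10 - 114258315825862616232 * x^13 * (4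
   * (x + w) / 5)^9 - 10638548707261984349 * x^14 * (4 * (x + w) / 5)^8 +
   -717811382028065230 * x^15 * (4 * (x + w) / 5)^7 - 32678233504828479 * x^16 * (4 * (x +
   w) / 5)^6 - 781779389534164 * x^17 * (4 * (x + w) / 5)^5 + 8446446236755 * x^18 * (4 * (x
   + w) / 5)^4 + 1413051608094 * x^19 * (4 * (x + w) / 5)^3 + 50546059145 * x^20 * (4 * (x +
   w) / 5)^2 + 857162400 * x^21 * (4 * (x + w) / 5)^1 + 5854464 * x^22 * (4 * (x + w) / 5)^0)"
   unfolding xw r_def by simp
  also have "... = 1326842037413024245083779586978742272 * (x^0 * w^22) +
   36168038000686459040954287911887437824 * (x^1 * w^21) +
   469913344730991862704350628074406019072 * (x^2 * w^20) +
   3871683464349586649936718335504055009280 * (x^3 * w^19) +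
   22699385957254912467988414570076968058880 * (x^4 * w^18) +
   100713664340477936050634140507415666229248 * (x^5 * w^17) +
   351025499227636689726994279922226897616896 * (x^6 * w^16) +
   984577342743479173630453853113463370416128 * (x^7 * w^15) +
   2258179910382008550529218575755039620464640 * (x^8 * w^14) +
   4279314752669641580551566355405081505955840 * (x^9 * w^13) +
   6742028944046029602178917277800897982758912 * (x^10 * w^12) +
   8855556399706433919882529595025622453714944 * (x^11 * w^11) +
   9694428392491404951837808169577113428426752 * (x^12 * w^10) +
   8815654546416601990174595467931912440381440 * (x^13 * w^9) +
   6614527944040745388917462550676064797655040 * (x^14 * w^8) +
   4051102402767569211611073991630724703879168 * (x^15 * w^7) +
   1992719777350497160652798538958886393450496 * (x^16 * w^6) +
   768539187364029724054713983914242588561408 * (x^17 * w^5) +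
   224019344829493830745723960575532982926080 * (x^18 * w^4) +
   46492467200824124116380409170633161758080 * (x^19 * w^3) +
   6157624124358468344363931017251053257232 * (x^20 * w^2) +
   402028520275041684328422736586783214624 * (x^21 * w^1) +
   2580595485014590986888681159607181712 * x^22" by algebra
  finally have "2384185791015625 * r = ..." .
  moreover have "... > 0" using x w
   by (intro add_nonneg_pos add_nonneg_nonneg mult_nonneg_nonneg mult_pos_pos zero_less_power zero_le_power) simp_all
  ultimately show False using r0 by simp
 next
  case False
  define u where "u = 4 * x - 5"
  have u: "u > 0" and xu: "x = (u + 5) / 4" using False by (simp_all add: u_def)
  have du: "4194304 * d = 635477359456426536 + 1497573453717233280*u + 749749832830249128*u^2 +
   166949585285586480*u^3 + 20391482733723216*u^4 + 1496851755824448*u^5 + 68909270731920*u^6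
   + 2019168688416*u^7 + 37366890120*u^8 + 419515584*u^9 + 2548680*u^10 + 6192*u^11"
   unfolding d_def u_def by algebra
  have nu: "4194304 * n = -2128566942793622268 + 1009613909432606724*u + 751355301980039868*u^2 +
   165016583223380604*u^3 + 18624265212247848*u^4 + 1245801299072040*u^5 + 52372456911864*u^6
   + 1415446759032*u^7 + 24512337556*u^8 + 261512340*u^9 + 1531532*u^10 + 3660*u^11"
   unfolding n_def u_def by algebra
  have c0u: "16777216 * c0 = -152473145930944383768930 - 110478772904932808604684*u - 31108325499504847752768*u^2 -
   4759845396341718503268*u^3 - 451793557944019770498*u^4 - 28366839733259765688*u^5 -
   1215452427725222928*u^6 - 35905439639367688*u^7 - 725950912977798*u^8 - 9775912291068*u^9
   - 82750396208*u^10 - 390107604*u^11 - 750870*u^12"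
   unfolding c0_def u_def by algebra
  have c1u: "16777216 * c1 = 118139300106662186011800 + 136622797576263233537400*u + 47984992872980296668696*u^2 +
   8838569968116914198088*u^3 + 990627740773665847488*u^4 + 72026207310847424688*u^5 +
   3504780279577604528*u^6 + 115414574665387408*u^7 + 2556366388453528*u^8 +
   37099444231768*u^9 + 333118035128*u^10 + 1638260648*u^11 + 3218832*u^12"
   unfolding c1_def u_def by algebra
  have c2u: "16777216 * c2 = 85580818774212749762880 - 4253957937438969117888*u - 11077039827643054504896*u^2 -
   3269167930236922811712*u^3 - 509633071650533986560*u^4 - 48319768821489213312*u^5 -
   2919902523615976320*u^6 - 114683968486122112*u^7 - 2928026785891520*u^8 -
   47554803439552*u^9 - 465389370560*u^10 - 2430735424*u^11 - 4913024*u^12"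
   unfolding c2_def u_def by algebra
  have c3u: "16777216 * c3 = -49894954881121267344000 - 22875509628931800500352*u - 7516449124314731800704*u^2 -
   1375323671622843029376*u^3 - 118247583357404232192*u^4 - 2782939873198392576*u^5 +
   292312270084777728*u^6 + 27448646927003904*u^7 + 1052589666484608*u^8 + 21871217997184*u^9
   + 251293845888*u^10 + 1452441216*u^11 + 3068672*u^12"
   unfolding c3_def u_def by algebra
  have c4u: "16777216 * c4 = -22796975619685358784000 - 11991764653535821593600*u - 1242266697069554718720*u^2 +
   243286992984753515520*u^3 + 66972667116890810880*u^4 + 6367855919953766400*u^5 +
   302988055879065600*u^6 + 7069708827924480*u^7 + 40727970424320*u^8 - 1584167562240*u^9 -
   35078031360*u^10 - 262210560*u^11 - 606720*u^12"
   unfolding c4_def u_def by algebra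
  have "c0 * d^4 + c1 * n * d^3 + c2 * n^2 * d^2 + c3 * n^3 * d + c4 * n^4
    = d^4 * (c0 + c1 * e + c2 * e^2 + c3 * e^3 + c4 * e^4)"
   unfolding de[symmetric] by algebra
  then have S: "c0 * d^4 + c1 * n * d^3 + c2 * n^2 * d^2 + c3 * n^3 * d + c4 * n^4 = 0" unfolding s' by simp
  have "(16777216 * c0) * (4194304 * d)^4 + (16777216 * c1) * (4194304 * n) * (4194304 * d)^3
    + (16777216 * c2) * (4194304 * n)^2 * (4194304 * d)^2 + (16777216 * c3) * (4194304 * n)^3 * (4194304 * d)
    + (16777216 * c4) * (4194304 * n)^4
   = 16777216 * 4194304^4 * (c0 * d^4 + c1 * n * d^3 + c2 * n^2 * d^2 + c3 * n^3 * d + c4 * n^4)"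
   by algebra
  then have "(16777216 * c0) * (4194304 * d)^4 + (16777216 * c1) * (4194304 * n) * (4194304 * d)^3
    + (16777216 * c2) * (4194304 * n)^2 * (4194304 * d)^2 + (16777216 * c3) * (4194304 * n)^3 * (4194304 * d)
    + (16777216 * c4) * (4194304 * n)^4 = 0" unfolding S by simp
  moreover have "(16777216 * c0) * (4194304 * d)^4 + (16777216 * c1) * (4194304 * n) * (4194304 * d)^3
    + (16777216 * c2) * (4194304 * n)^2 * (4194304 * d)^2 + (16777216 * c3) * (4194304 * n)^3 * (4194304 * d)
    + (16777216 * c4) * (4194304 * n)^4
   = - (24576 * (
   3865776141655376468748884878119335528083398179634466617099581025438049051143406892062676385
   -
   36476192247408062631991450352053329952346721893584636327210576228102998069143596950696631938*u
   +
   98634695643081519277652951816816700742134922814342226002303224673099576653371716543489505876*u^2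
   +
   304463453153346379938070242451906201441477670372915093145319046800261937428532307893835859938*u^3
   +
   345326411697321150190268446391069640045608077338356369977355534727903812386314190159685226375*u^4
   +
   240041327969346325322615250998999465567436033919268903514228871998450648341785163491022137368*u^5
   +
   121031089849871652719587044189419994116779920142511217666285505967217523255803146376907088160*u^6
   +
   48988304838263864645192396107890722749967769576712491622878991455031547979899258180449952760*u^7
   +
   17160892077660575587114572893127426185107077575162421975060318611433497477334849870266819742*u^8
   +
   5461932597447827326001188621323384083845287099183947972318451902880177815808046923775015212*u^9
   +
   1602998950250940855880695197659988400272081070390548231233480704245550133425234861481013592*u^10
   +
   429021718451049792220867680213097985096086107723216738567951998170176738703459887833970612*u^11
   +
   102806978233452867278839755113851213105989746101758554436063450263764826124315702009390282*u^12
   +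
   21768046110797647179813865807656058379137905417810538744556202909856854629570085054001032*u^13
   +
   4049137642368976214748032773072508565263989705971883769662038839439558280900022546783520*u^14
   +
   661411550757448016706804459892484851860932511077036268894735420594972452976068244845304*u^15
   +
   95111296130649867895378721968535829728332902152105607252159385106000021930063092333563*u^16
   +
   12085901535455713250050938273009532252886964397699993972660043218174002625866390721074*u^17
   +
   1362712003009721829816674458181915284995681165222392334123621076888090731279484302396*u^18
   +
   136886369446465735171335829692522500895029022888048639090807174300126770148184949454*u^19
   + 12296372038570080169361845651221082102408088242685010635472967662214106448843980133*u^20
   + 991131483944106857295416670759189876895753779874575382573445271103848814384739616*u^21 +
   71902635275163277525297166015145843046490575038169996298685154973965299921742944*u^22 +
   4707543757915891592448421497842486676780455072208665916219101605865388338088048*u^23 +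
   278821870132172431202076171808507174126860677380460770058606328184549837826388*u^24 +
   14971867479544931568307143381353387212150332597925371899581065864565744648872*u^25 +
   730262686916981193079767432595015110647948607229265106255610812708088712208*u^26 +
   32411044538751874202980862426751855373403192128526807475010956561380804376*u^27 +
   1311017502658447747066697819217693933083393417892777890344102016353072380*u^28 +
   48401946910012526197192625177716573942694792453008667779532592058237776*u^29 +
   1633238899547964735960578656944874604275976353023937593043976909730240*u^30 +
   50434153640683389083274161246633446239886654102086584088278553196080*u^31 +
   1426937752089947894696011132109867396141039270792644332188548928391*u^32 +
   37030590282417237512448982417207730651499341444405510122413342402*u^33 +
   882257595999923427528058581971485830572224525671545704052276748*u^34 +
   19311488598032339434180500926066194147205175609828523120808094*u^35 +
   388496575374538691367888809454399588952350072821703281165025*u^36 +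
   7182589908651035866281905593973119935554815600932061756056*u^37 +
   121959754790676857195096946176025210979464285642793479264*u^38 +
   1899350697342649943506427645508607360812571387248568728*u^39 +
   27071064801503274511828714261282977191808331532888878*u^40 +
   352039587713596868747706054111737562809849802910444*u^41 +
   4160426284552254070131939370987698848789253057048*u^42 +
   44464235442527745781662900939373161248420558964*u^43 +
   427228701660389630540395844249167982689770650*u^44 +
   3665190258085068573276243885022194125043240*u^45 +
   27850750158871961728236308715071629617184*u^46 +
   185699446904797059820843514206149364184*u^47 + 1074476693289908524120726567775983293*u^48
   + 5323152275114144246901495546894030*u^49 + 22206704601111695531299428223972*u^50 +
   76351158298792125431237590386*u^51 + 210177497065311505406216659*u^52 +
   444377729016073140096816*u^53 + 676079082021326778144*u^54 + 657520742178531072*u^55 +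
   306421301410560*u^56))"
   unfolding c0u c1u c2u c3u c4u nu du by algebra
  ultimately have "3865776141655376468748884878119335528083398179634466617099581025438049051143406892062676385 - 36476192247408062631991450352053329952346721893584636327210576228102998069143596950696631938 * u + 98634695643081519277652951816816700742134922814342226002303224673099576653371716543489505876 * u^2 + (
   304463453153346379938070242451906201441477670372915093145319046800261937428532307893835859938
   * u^3 +
   345326411697321150190268446391069640045608077338356369977355534727903812386314190159685226375
   * u^4 +
   240041327969346325322615250998999465567436033919268903514228871998450648341785163491022137368
   * u^5 +
   121031089849871652719587044189419994116779920142511217666285505967217523255803146376907088160
   * u^6 +
   48988304838263864645192396107890722749967769576712491622878991455031547979899258180449952760
   * u^7 +
   17160892077660575587114572893127426185107077575162421975060318611433497477334849870266819742
   * u^8 +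
   5461932597447827326001188621323384083845287099183947972318451902880177815808046923775015212
   * u^9 +
   1602998950250940855880695197659988400272081070390548231233480704245550133425234861481013592
   * u^10 +
   429021718451049792220867680213097985096086107723216738567951998170176738703459887833970612
   * u^11 +
   102806978233452867278839755113851213105989746101758554436063450263764826124315702009390282
   * u^12 +
   21768046110797647179813865807656058379137905417810538744556202909856854629570085054001032
   * u^13 +
   4049137642368976214748032773072508565263989705971883769662038839439558280900022546783520 *
   u^14 +
   661411550757448016706804459892484851860932511077036268894735420594972452976068244845304 *
   u^15 +
   95111296130649867895378721968535829728332902152105607252159385106000021930063092333563 *
   u^16 +
   12085901535455713250050938273009532252886964397699993972660043218174002625866390721074 *
   u^17 +
   1362712003009721829816674458181915284995681165222392334123621076888090731279484302396 *
   u^18 +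
   136886369446465735171335829692522500895029022888048639090807174300126770148184949454 *
   u^19 + 12296372038570080169361845651221082102408088242685010635472967662214106448843980133
   * u^20 + 991131483944106857295416670759189876895753779874575382573445271103848814384739616
   * u^21 + 71902635275163277525297166015145843046490575038169996298685154973965299921742944
   * u^22 + 4707543757915891592448421497842486676780455072208665916219101605865388338088048 *
   u^23 + 278821870132172431202076171808507174126860677380460770058606328184549837826388 *
   u^24 + 14971867479544931568307143381353387212150332597925371899581065864565744648872 *
   u^25 + 730262686916981193079767432595015110647948607229265106255610812708088712208 * u^26
   + 32411044538751874202980862426751855373403192128526807475010956561380804376 * u^27 +
   1311017502658447747066697819217693933083393417892777890344102016353072380 * u^28 +
   48401946910012526197192625177716573942694792453008667779532592058237776 * u^29 +
   1633238899547964735960578656944874604275976353023937593043976909730240 * u^30 +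
   50434153640683389083274161246633446239886654102086584088278553196080 * u^31 +
   1426937752089947894696011132109867396141039270792644332188548928391 * u^32 +
   37030590282417237512448982417207730651499341444405510122413342402 * u^33 +
   882257595999923427528058581971485830572224525671545704052276748 * u^34 +
   19311488598032339434180500926066194147205175609828523120808094 * u^35 +
   388496575374538691367888809454399588952350072821703281165025 * u^36 +
   7182589908651035866281905593973119935554815600932061756056 * u^37 +
   121959754790676857195096946176025210979464285642793479264 * u^38 +
   1899350697342649943506427645508607360812571387248568728 * u^39 +
   27071064801503274511828714261282977191808331532888878 * u^40 +
   352039587713596868747706054111737562809849802910444 * u^41 +
   4160426284552254070131939370987698848789253057048 * u^42 +
   44464235442527745781662900939373161248420558964 * u^43 +
   427228701660389630540395844249167982689770650 * u^44 +
   3665190258085068573276243885022194125043240 * u^45 +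
   27850750158871961728236308715071629617184 * u^46 + 185699446904797059820843514206149364184
   * u^47 + 1074476693289908524120726567775983293 * u^48 + 5323152275114144246901495546894030
   * u^49 + 22206704601111695531299428223972 * u^50 + 76351158298792125431237590386 * u^51 +
   210177497065311505406216659 * u^52 + 444377729016073140096816 * u^53 +
   676079082021326778144 * u^54 + 657520742178531072 * u^55 + 306421301410560 * u^56) = 0" by simp
  moreover have "
   304463453153346379938070242451906201441477670372915093145319046800261937428532307893835859938
   * u^3 +
   345326411697321150190268446391069640045608077338356369977355534727903812386314190159685226375
   * u^4 +
   240041327969346325322615250998999465567436033919268903514228871998450648341785163491022137368
   * u^5 +
   121031089849871652719587044189419994116779920142511217666285505967217523255803146376907088160
   * u^6 +
   48988304838263864645192396107890722749967769576712491622878991455031547979899258180449952760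
   * u^7 +
   17160892077660575587114572893127426185107077575162421975060318611433497477334849870266819742
   * u^8 +
   5461932597447827326001188621323384083845287099183947972318451902880177815808046923775015212
   * u^9 +
   1602998950250940855880695197659988400272081070390548231233480704245550133425234861481013592
   * u^10 +
   429021718451049792220867680213097985096086107723216738567951998170176738703459887833970612
   * u^11 +
   102806978233452867278839755113851213105989746101758554436063450263764826124315702009390282
   * u^12 +
   21768046110797647179813865807656058379137905417810538744556202909856854629570085054001032
   * u^13 +
   4049137642368976214748032773072508565263989705971883769662038839439558280900022546783520 *
   u^14 +
   661411550757448016706804459892484851860932511077036268894735420594972452976068244845304 *
   u^15 +
   95111296130649867895378721968535829728332902152105607252159385106000021930063092333563 *
   u^16 +
   12085901535455713250050938273009532252886964397699993972660043218174002625866390721074 *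
   u^17 +
   1362712003009721829816674458181915284995681165222392334123621076888090731279484302396 *
   u^18 +
   136886369446465735171335829692522500895029022888048639090807174300126770148184949454 *
   u^19 + 12296372038570080169361845651221082102408088242685010635472967662214106448843980133
   * u^20 + 991131483944106857295416670759189876895753779874575382573445271103848814384739616
   * u^21 + 71902635275163277525297166015145843046490575038169996298685154973965299921742944
   * u^22 + 4707543757915891592448421497842486676780455072208665916219101605865388338088048 *
   u^23 + 278821870132172431202076171808507174126860677380460770058606328184549837826388 *
   u^24 + 14971867479544931568307143381353387212150332597925371899581065864565744648872 *
   u^25 + 730262686916981193079767432595015110647948607229265106255610812708088712208 * u^26
   + 32411044538751874202980862426751855373403192128526807475010956561380804376 * u^27 +
   1311017502658447747066697819217693933083393417892777890344102016353072380 * u^28 +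
   48401946910012526197192625177716573942694792453008667779532592058237776 * u^29 +
   1633238899547964735960578656944874604275976353023937593043976909730240 * u^30 +
   50434153640683389083274161246633446239886654102086584088278553196080 * u^31 +
   1426937752089947894696011132109867396141039270792644332188548928391 * u^32 +
   37030590282417237512448982417207730651499341444405510122413342402 * u^33 +
   882257595999923427528058581971485830572224525671545704052276748 * u^34 +
   19311488598032339434180500926066194147205175609828523120808094 * u^35 +
   388496575374538691367888809454399588952350072821703281165025 * u^36 +
   7182589908651035866281905593973119935554815600932061756056 * u^37 +
   121959754790676857195096946176025210979464285642793479264 * u^38 +
   1899350697342649943506427645508607360812571387248568728 * u^39 +
   27071064801503274511828714261282977191808331532888878 * u^40 +
   352039587713596868747706054111737562809849802910444 * u^41 +
   4160426284552254070131939370987698848789253057048 * u^42 +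
   44464235442527745781662900939373161248420558964 * u^43 +
   427228701660389630540395844249167982689770650 * u^44 +
   3665190258085068573276243885022194125043240 * u^45 +
   27850750158871961728236308715071629617184 * u^46 + 185699446904797059820843514206149364184
   * u^47 + 1074476693289908524120726567775983293 * u^48 + 5323152275114144246901495546894030
   * u^49 + 22206704601111695531299428223972 * u^50 + 76351158298792125431237590386 * u^51 +
   210177497065311505406216659 * u^52 + 444377729016073140096816 * u^53 +
   676079082021326778144 * u^54 + 657520742178531072 * u^55 + 306421301410560 * u^56 >= 0" using u
   by (intro add_nonneg_nonneg mult_nonneg_nonneg zero_le_power) simp_all
  moreover have "3865776141655376468748884878119335528083398179634466617099581025438049051143406892062676385 - 36476192247408062631991450352053329952346721893584636327210576228102998069143596950696631938 * u + 98634695643081519277652951816816700742134922814342226002303224673099576653371716543489505876 * u^2 > 0"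
  proof -
   have "4 * 98634695643081519277652951816816700742134922814342226002303224673099576653371716543489505876 * (3865776141655376468748884878119335528083398179634466617099581025438049051143406892062676385 - 36476192247408062631991450352053329952346721893584636327210576228102998069143596950696631938 * u + 98634695643081519277652951816816700742134922814342226002303224673099576653371716543489505876 * u^2) = (2 * 98634695643081519277652951816816700742134922814342226002303224673099576653371716543489505876 * u - 36476192247408062631991450352053329952346721893584636327210576228102998069143596950696631938)^2 + (4 * 98634695643081519277652951816816700742134922814342226002303224673099576653371716543489505876 * 3865776141655376468748884878119335528083398179634466617099581025438049051143406892062676385 - 36476192247408062631991450352053329952346721893584636327210576228102998069143596950696631938^2)"
    by algebra
   moreover have "(2 * 98634695643081519277652951816816700742134922814342226002303224673099576653371716543489505876 * u - 36476192247408062631991450352053329952346721893584636327210576228102998069143596950696631938)^2 + (4 * 98634695643081519277652951816816700742134922814342226002303224673099576653371716543489505876 * 3865776141655376468748884878119335528083398179634466617099581025438049051143406892062676385 - 36476192247408062631991450352053329952346721893584636327210576228102998069143596950696631938^2) > 0"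
    by (rule add_nonneg_pos) simp_all
   ultimately show ?thesis by (rule positive_of_scaled) simp
  qed
  ultimately show False by linarith
 qed
qed

section \<open>Periodic solutions of scalar equations\<close>

lemma periodic_int_shift:
 fixes f :: "real => 'a"
 assumes "!!t. f (t + p) = f t"
 shows "f (t + of_int n * p) = f t"
proof (induction n rule: int_induct[where k = 0])
 case (step1 i)
 then show ?case using assms[of "t + of_int i * p"] by (simp add: algebra_simps)
next
 case (step2 i)
 then show ?case using assms[of "t + of_int (i - 1) * p"] by (simp add: algebra_simps)
qed simp

lemma periodic_representative:
 fixes f :: "real => 'a"
 assumes "!!t. f (t + p) = f t" "p > 0"
 obtains s where "s \<in> {0..p}" "f s = f t"
proof
 let ?n = "- \<lfloor>t / p\<rfloor>"
 have "of_int \<lfloor>t / p\<rfloor> * p <= t / p * p" "t / p * p < (of_int \<lfloor>t / p\<rfloor> + 1) * p"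
  using assms(2) by (intro mult_right_mono mult_strict_right_mono; linarith)+
 then show "t + of_int ?n * p \<in> {0..p}" using assms(2) by (auto simp: algebra_simps)
 show "f (t + of_int ?n * p) = f t" by (rule periodic_int_shift) (rule assms)
qed

lemma periodic_attains_max:
 fixes f :: "real => real"
 assumes "!!t. f (t + p) = f t" "p > 0" "continuous_on UNIV f"
 obtains s where "!!t. f t <= f s"
proof -
 have "compact {0..p}" "{0..p} ~= {}" "continuous_on {0..p} f"
  using assms by (auto intro: continuous_on_subset)
 from continuous_attains_sup[OF this] obtain s where s: "\<forall>t\<in>{0..p}. f t <= f s" by blast
 show thesis
 proof
  fix t
  obtain u where "u \<in> {0..p}" "f u = f t" using periodic_representative[of f p t] assms by blast
  then show "f t <= f s" using s by metis
 qed
qed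

lemma periodic_relaxation_le:
 fixes y :: "real => real"
 assumes y: "!!t. (y has_real_derivative g t - m * y t) (at t)"
  and per: "!!t. y (t + p) = y t" "p > 0" and "m > 0" and g: "!!t. g t <= B"
 shows "y t <= B / m"
proof -
 have "continuous_on UNIV y"
  by (meson y DERIV_isCont continuous_at_imp_continuous_on)
 then obtain s where s: "!!t. y t <= y s" using periodic_attains_max[of y p] per by blast
 have "g s - m * y s = 0"
  by (rule DERIV_local_max[OF y, of 1]) (use s in auto)
 then have "m * y s <= B" using g[of s] by simp
 then show ?thesis using s[of t] \<open>m > 0\<close> by (simp add: field_simps) (smt (verit) mult_left_mono)
qed

lemma periodic_relaxation_ge:
 fixes y :: "real => real"
 assumes y: "!!t. (y has_real_derivative g t - m * y t) (at t)"
  and per: "!!t. y (t + p) = y t" "p > 0" and "m > 0" and g: "!!t. g t >= B"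
 shows "y t >= B / m"
proof -
 have "- y t <= (- B) / m"
  by (rule periodic_relaxation_le[of "%t. - y t" "%t. - g t" m p])
   (use assms in \<open>auto intro!: derivative_eq_intros\<close>)
 then show ?thesis by simp
qed

lemma periodic_relaxation_abs_le:
 fixes y :: "real => real"
 assumes y: "!!t. (y has_real_derivative g t - m * y t) (at t)"
  and per: "!!t. y (t + p) = y t" "p > 0" and "m ~= 0" and g: "!!t. \<bar>g t\<bar> <= B"
 shows "\<bar>y t\<bar> <= B / (abs m)"
proof (cases "m > 0")
 case True
 have "y t <= B / m" by (rule periodic_relaxation_le[OF y per True]) (use g in \<open>auto simp: abs_le_iff\<close>)
 moreover have "y t >= (- B) / m"
  by (rule periodic_relaxation_ge[OF y per True]) (use g in \<open>auto simp: abs_le_iff minus_le_iff\<close>)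
 ultimately show ?thesis using True by (simp add: abs_le_iff)
next
 case False
 with \<open>m ~= 0\<close> have m: "- m > 0" by simp
 have y': "((%t. y (- t)) has_real_derivative (- g (- t)) - (- m) * y (- t)) (at t)" for t
  using y[of "- t"] by (subst (asm) DERIV_mirror) (simp add: algebra_simps)
 have per': "y (- (t + p)) = y (- t)" for t using per(1)[of "- t - p"] by simp
 have "y (- (- t)) <= B / (- m)"
  by (rule periodic_relaxation_le[OF y' per' per(2) m]) (use g in \<open>auto simp: abs_le_iff\<close>)
 moreover have "y (- (- t)) >= (- B) / (- m)"
  by (rule periodic_relaxation_ge[OF y' per' per(2) m]) (use g in \<open>auto simp: abs_le_iff\<close>)
 ultimately show ?thesis using m by (simp add: abs_le_iff)
qed

lemma linear_decay_zero:
 fixes u :: "real => real"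
 assumes "!!t. (u has_real_derivative m * u t) (at t)"
 shows "u t = u 0 * exp (m * t)"
proof -
 have "((%t. u t * exp (- m * t)) has_real_derivative 0) (at t)" for t
  using assms[of t] by (auto intro!: derivative_eq_intros simp: algebra_simps)
 then have "u t * exp (- m * t) = u 0 * exp (- m * 0)"
  using DERIV_isconst_all[of "%t. u t * exp (- m * t)" t 0] by blast
 then show ?thesis by (simp add: exp_minus field_simps)
qed

lemma continuous_has_antiderivative:
 fixes g :: "real => real"
 assumes "continuous_on UNIV g"
 obtains G where "!!t. (G has_real_derivative g t) (at t)"
proof -
 have "EX G. \<forall>x::real. -\<infinity> < ereal x --> ereal x < \<infinity> --> (G has_vector_derivative g x) (at x)"
  by (rule einterval_antiderivative)
   (use assms in \<open>auto simp: continuous_on_eq_continuous_at\<close>)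
 then show thesis using that by (auto simp: has_real_derivative_iff_has_vector_derivative)
qed

lemma periodic_relaxation_exists:
 fixes g :: "real => real"
 assumes g: "continuous_on UNIV g" "!!t. g (t + p) = g t" and "p > 0" "m ~= 0"
 obtains y where "!!t. (y has_real_derivative g t - m * y t) (at t)" "!!t. y (t + p) = y t"
proof -
 have "continuous_on UNIV (%t. exp (m * t) * g t)" by (intro continuous_intros g)
 then obtain G where G: "!!t. (G has_real_derivative exp (m * t) * g t) (at t)"
  by (rule continuous_has_antiderivative) blast
 define C where "C = (exp (- m * p) * G p - G 0) / (1 - exp (- m * p))"
 define y where "y t = exp (- m * t) * (C + G t)" for t
 have y: "(y has_real_derivative g t - m * y t) (at t)" for t
 proof -
  have "(y has_real_derivative - m * exp (- m * t) * (C + G t) + exp (- m * t) * (exp (m * t) * g t)) (at t)"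
   unfolding y_def using G[of t] by (auto intro!: derivative_eq_intros simp: algebra_simps)
  moreover have "- m * exp (- m * t) * (C + G t) + exp (- m * t) * (exp (m * t) * g t) = g t - m * y t"
   by (simp add: y_def exp_minus field_simps)
  ultimately show ?thesis by simp
 qed
 have "exp (- m * p) ~= 1" using assms by simp
 then have y0: "y p = y 0" unfolding y_def C_def by (simp add: field_simps)
 have "((%t. y (t + p) - y t) has_real_derivative (- m) * (y (t + p) - y t)) (at t)" for t
 proof -
  have "((%t. y (t + p)) has_real_derivative g (t + p) - m * y (t + p)) (at t)"
   using DERIV_shift[THEN iffD1, OF y[of "t + p"]] .
  from DERIV_diff[OF this y[of t]] show ?thesis unfolding g by (simp add: algebra_simps)
 qed
 from linear_decay_zero[OF this] have "y (t + p) = y t" for t using y0 by simp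
 with y show thesis by (rule that)
qed

text \<open>A strictly decreasing right-hand side makes the periodic relaxation operator a contraction of the
  continuous periodic functions.\<close>

lemma periodic_monotone_ode:
 fixes K :: "real => real => real"
 assumes cont: "continuous_on ({a..b} \<times> UNIV) (%(s, th). K s th)"
  and per: "!!s th. s \<in> {a..b} ==> K s (th + p) = K s th" and p: "p > 0"
  and k: "k > 0" and ab: "a <= b"
  and low: "!!s s' th. a <= s ==> s <= s' ==> s' <= b ==> K s' th - K s th >= - M * (s' - s)"
  and up: "!!s s' th. a <= s ==> s <= s' ==> s' <= b ==> K s' th - K s th <= - k * (s' - s)"
  and ends: "!!th. K a th >= 0" "!!th. K b th <= 0"
 obtains S where "!!th. S th \<in> {a..b}" "!!th. S (th + p) = S th"
  "!!th. (S has_real_derivative K (S th) th) (at th)"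
proof -
 define m where "m = max M k"
 have m: "m > 0" "k <= m" using k by (auto simp: m_def)
 have low': "K s' th - K s th >= - m * (s' - s)" if "a <= s" "s <= s'" "s' <= b" for s s' th
 proof -
  have "M * (s' - s) <= m * (s' - s)" using that by (intro mult_right_mono) (auto simp: m_def)
  with low[OF that, of th] show ?thesis by simp
 qed
 define Q :: "(real \<Rightarrow>\<^sub>C real) set" where
  "Q = {f. ALL t. apply_bcontfun f (t + p) = apply_bcontfun f t & a <= apply_bcontfun f t & apply_bcontfun f t <= b}"
 have ode: "EX F. (ALL t. (apply_bcontfun F has_real_derivative (K (apply_bcontfun f t) t + m * apply_bcontfun f t)
   - m * apply_bcontfun F t) (at t)) & F \<in> Q" if "f \<in> Q" for f
 proof -
  have f: "apply_bcontfun f (t + p) = apply_bcontfun f t" "a <= apply_bcontfun f t" "apply_bcontfun f t <= b" for t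
   using that by (auto simp: Q_def)
  have fc: "continuous_on UNIV (apply_bcontfun f)" using continuous_on_apply_bcontfun by blast
  have "continuous_on UNIV (%t. (%(s, th). K s th) (apply_bcontfun f t, t))"
   by (rule continuous_on_compose2[OF cont]) (use f fc in \<open>auto intro!: continuous_intros\<close>)
  then have "continuous_on UNIV (%t. K (apply_bcontfun f t) t + m * apply_bcontfun f t)"
   using fc by (auto intro!: continuous_intros)
  moreover have "K (apply_bcontfun f (t + p)) (t + p) + m * apply_bcontfun f (t + p)
    = K (apply_bcontfun f t) t + m * apply_bcontfun f t" for t
   using per f by auto
  ultimately obtain y where y: "!!t. (y has_real_derivative (K (apply_bcontfun f t) t + m * apply_bcontfun f t) - m * y t) (at t)"
   "!!t. y (t + p) = y t"
   using periodic_relaxation_exists[of "%t. K (apply_bcontfun f t) t + m * apply_bcontfun f t" p m] p m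
   by (metis less_irrefl)
  have yb: "a <= y t & y t <= b" for t
  proof
   have "K (apply_bcontfun f t) t + m * apply_bcontfun f t <= m * b" for t
    using low'[of "apply_bcontfun f t" b t] f[of t] ends(2)[of t] by (simp add: algebra_simps)
   then have "y t <= (m * b) / m" by (rule periodic_relaxation_le[OF y p m(1)])
   then show "y t <= b" using m by simp
   have "K (apply_bcontfun f t) t + m * apply_bcontfun f t >= m * a" for t
    using low'[of a "apply_bcontfun f t" t] f[of t] ends(1)[of t] by (simp add: algebra_simps)
   then have "y t >= (m * a) / m" by (rule periodic_relaxation_ge[OF y p m(1)])
   then show "a <= y t" using m by simp
  qed
  have "y \<in> bcontfun"
   by (rule bcontfun_normI[where b = "max (abs a) (abs b)"])
    (use yb y(1) in \<open>auto simp: abs_le_iff max_def minus_le_iff intro!: DERIV_continuous_on continuous_at_imp_continuous_on DERIV_isCont, (smt (verit))+\<close>)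
  then have "apply_bcontfun (Bcontfun y) = y" by (simp add: Bcontfun_inverse)
  then show ?thesis using y yb by (intro exI[of _ "Bcontfun y"]) (auto simp: Q_def)
 qed
 then obtain T where T: "!!f t. f \<in> Q ==> (apply_bcontfun (T f) has_real_derivative
    (K (apply_bcontfun f t) t + m * apply_bcontfun f t) - m * apply_bcontfun (T f) t) (at t)"
  and TQ: "!!f. f \<in> Q ==> T f \<in> Q"
  by metis
 have "closed Q"
 proof -
  have [continuous_intros]: "continuous_on UNIV (%f. apply_bcontfun f t)" for t :: real
   unfolding continuous_on_iff using dist_bounded by (metis le_less_trans)
  have "closed {f. apply_bcontfun f (t + p) = apply_bcontfun f t & a <= apply_bcontfun f t & apply_bcontfun f t <= b}" for t
   by (intro closed_Collect_conj closed_Collect_eq closed_Collect_le continuous_intros)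
  then have "closed (\<Inter>t. {f. apply_bcontfun f (t + p) = apply_bcontfun f t & a <= apply_bcontfun f t & apply_bcontfun f t <= b})"
   by blast
  moreover have "Q = (\<Inter>t. {f. apply_bcontfun f (t + p) = apply_bcontfun f t & a <= apply_bcontfun f t & apply_bcontfun f t <= b})"
   by (auto simp: Q_def)
  ultimately show ?thesis by simp
 qed
 have "\<exists>!f\<in>Q. T f = f"
 proof (rule Banach_fix)
  show "complete Q" using \<open>closed Q\<close> by (simp add: complete_eq_closed)
  have "const_bcontfun a \<in> Q" using ab by (auto simp: Q_def const_bcontfun.rep_eq)
  then show "Q ~= {}" by blast
  show "0 <= (m - k) / m" "(m - k) / m < 1" using m k by (auto simp: field_simps)
  show "T ` Q \<subseteq> Q" using TQ by blast
  fix f g assume fg: "f \<in> Q" "g \<in> Q"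
  have fb: "a <= apply_bcontfun f t & apply_bcontfun f t <= b" "a <= apply_bcontfun g t & apply_bcontfun g t <= b" for t
   using fg by (auto simp: Q_def)
  define G where "G t = (K (apply_bcontfun f t) t + m * apply_bcontfun f t) - (K (apply_bcontfun g t) t + m * apply_bcontfun g t)" for t
  have one: "\<bar>(K s' th + m * s') - (K s th + m * s)\<bar> <= (m - k) * \<bar>s' - s\<bar>" if "a <= s" "s <= s'" "s' <= b" for s s' th
   using low'[OF that, of th] up[OF that, of th] that by (simp add: abs_if algebra_simps)
  have two: "\<bar>(K s' th + m * s') - (K s th + m * s)\<bar> <= (m - k) * \<bar>s' - s\<bar>"
   if "a <= s" "s <= b" "a <= s'" "s' <= b" for s s' th
   using one[of s s' th] one[of s' s th] that by (cases "s <= s'") (auto simp: abs_minus_commute)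
  have G: "\<bar>G t\<bar> <= (m - k) * dist f g" for t
  proof -
   have "\<bar>G t\<bar> <= (m - k) * \<bar>apply_bcontfun f t - apply_bcontfun g t\<bar>"
    unfolding G_def by (rule two) (use fb in auto)
   also have "... <= (m - k) * dist f g"
    using dist_bounded[of f t g] m by (intro mult_left_mono) (auto simp: dist_real_def)
   finally show ?thesis .
  qed
  have D: "((%t. apply_bcontfun (T f) t - apply_bcontfun (T g) t) has_real_derivative
    G t - m * (apply_bcontfun (T f) t - apply_bcontfun (T g) t)) (at t)" for t
   using DERIV_diff[OF T[OF fg(1), of t] T[OF fg(2), of t]] by (simp add: G_def algebra_simps)
  have "\<bar>apply_bcontfun (T f) t - apply_bcontfun (T g) t\<bar> <= ((m - k) * dist f g) / (abs m)" for t
   by (rule periodic_relaxation_abs_le[OF D _ p _ G]) (use TQ[OF fg(1)] TQ[OF fg(2)] m in \<open>auto simp: Q_def\<close>)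
  then show "dist (T f) (T g) <= (m - k) / m * dist f g"
   using m by (intro dist_bound) (auto simp: dist_real_def)
 qed
 then obtain f where f: "f \<in> Q" "T f = f" by blast
 show thesis
 proof (rule that[of "apply_bcontfun f"])
  show "apply_bcontfun f t \<in> {a..b}" "apply_bcontfun f (t + p) = apply_bcontfun f t" for t using f by (auto simp: Q_def)
  show "(apply_bcontfun f has_real_derivative K (apply_bcontfun f t) t) (at t)" for t
   using T[OF f(1), of t] unfolding f(2) by simp
 qed
qed

lemma real_derivative_along_curve2:
 fixes f :: "real => real => real"
 assumes f: "((%(x, y). f x y) has_derivative (%(h, k). A * h + B * k)) (at (a t, b t))"
  and a: "(a has_real_derivative a') (at t)" and b: "(b has_real_derivative b') (at t)"
 shows "((%s. f (a s) (b s)) has_real_derivative A * a' + B * b') (at t)"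
proof -
 have "((%s. (a s, b s)) has_derivative (%h. (a' * h, b' * h))) (at t)"
  using a b by (intro has_derivative_Pair) (simp_all add: has_field_derivative_def)
 from has_derivative_compose[OF this f]
 have "((%s. f (a s) (b s)) has_derivative (%h. A * (a' * h) + B * (b' * h))) (at t)" by simp
 also have "(%h. A * (a' * h) + B * (b' * h)) = (*) (A * a' + B * b')"
  by (auto simp: algebra_simps)
 finally show ?thesis by (simp only: has_field_derivative_def)
qed

locale monotone_strip =
 fixes V Vr Vt R D :: "real => real => real" and r1 r2 m M k k' p sg :: real
 assumes r12: "r1 < r2" and p: "p > 0" and m: "m > 0" and k: "k > 0" and sg: "sg = 1 | sg = - 1"
  and V: "!!r th. r \<in> {r1..r2} ==>
    ((%(r, th). V r th) has_derivative (%(h, k). Vr r th * h + Vt r th * k)) (at (r, th))"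
  and Vr: "!!r th. r \<in> {r1..r2} ==> m <= Vr r th & Vr r th <= M"
  and D_cont: "continuous_on ({r1..r2} \<times> UNIV) (%(r, th). D r th)"
  and D: "!!r th. r \<in> {r1..r2} ==> EX d. ((%r. D r th) has_real_derivative d) (at r) & k <= - sg * d & - sg * d <= k'"
  and rate: "!!r th. r \<in> {r1..r2} ==> Vr r th * R r th + Vt r th = D r th"
  and per: "!!r th. V r (th + p) = V r th" "!!r th. D r (th + p) = D r th"
begin

lemma V_increase:
 assumes "r1 <= r" "r <= r'" "r' <= r2"
 shows "m * (r' - r) <= V r' th - V r th" "V r' th - V r th <= M * (r' - r)"
proof -
 have d: "((%r. V r th) has_real_derivative Vr r th) (at r)" if "r \<in> {r1..r2}" for r
  using real_derivative_along_curve2[of V "Vr r th" "Vt r th" "%r. r" r "%_. th" 1 0] V[OF that, of th] by simp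
 have "EX z. r <= z & z <= r' & V r' th - V r th = (r' - r) * Vr z th"
 proof (cases "r = r'")
  case False
  then have "r < r'" using assms by simp
  then obtain z where "r < z" "z < r'" "V r' th - V r th = (r' - r) * Vr z th"
   using MVT2[of r r' "%r. V r th" "%r. Vr r th"] d assms by force
  then show ?thesis by (intro exI[of _ z]) simp
 qed (use assms in auto)
 then obtain z where z: "r <= z" "z <= r'" "V r' th - V r th = (r' - r) * Vr z th" by blast
 then have "m <= Vr z th" "Vr z th <= M" using Vr[of z th] assms by auto
 then have "(r' - r) * m <= (r' - r) * Vr z th" "(r' - r) * Vr z th <= (r' - r) * M"
  using assms by (auto intro!: mult_left_mono)
 then show "m * (r' - r) <= V r' th - V r th" "V r' th - V r th <= M * (r' - r)"
  using z by (auto simp: mult.commute)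
qed

lemma D_decrease:
 assumes "r1 <= r" "r <= r'" "r' <= r2"
 shows "sg * (D r' th - D r th) <= - k * (r' - r)" "sg * (D r' th - D r th) >= - k' * (r' - r)"
proof -
 obtain d where d: "!!r. r \<in> {r1..r2} ==> ((%r. D r th) has_real_derivative d r) (at r)"
  "!!r. r \<in> {r1..r2} ==> k <= - sg * d r & - sg * d r <= k'"
  using D[of _ th] by metis
 have "EX z. r <= z & z <= r' & D r' th - D r th = (r' - r) * d z"
 proof (cases "r = r'")
  case False
  then have "r < r'" using assms by simp
  then obtain z where "r < z" "z < r'" "D r' th - D r th = (r' - r) * d z"
   using MVT2[of r r' "%r. D r th" d] d(1) assms by force
  then show ?thesis by (intro exI[of _ z]) simp
 qed (use assms in auto)
 then obtain z where z: "r <= z" "z <= r'" "D r' th - D r th = (r' - r) * d z" by blast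
 have "(r' - r) * k <= (r' - r) * (- sg * d z)" "(r' - r) * (- sg * d z) <= (r' - r) * k'"
  using assms d(2)[of z] z by (intro mult_left_mono; simp)+
 then show "sg * (D r' th - D r th) <= - k * (r' - r)" "sg * (D r' th - D r th) >= - k' * (r' - r)"
  unfolding z(3) by (simp_all add: mult_ac)
qed

lemma solution_level:
 assumes rho: "!!th. rho th \<in> {r1..r2}" "!!th. (rho has_real_derivative R (rho th) th) (at th)"
 shows "((%th. V (rho th) th) has_real_derivative D (rho th) th) (at th)"
proof -
 have "((%th. V (rho th) th) has_real_derivative Vr (rho th) th * R (rho th) th + Vt (rho th) th * 1) (at th)"
  by (rule real_derivative_along_curve2[OF V[OF rho(1)] rho(2)]) simp
 then show ?thesis using rate[OF rho(1)] by simp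
qed

text \<open>Two solutions that remain in the strip for all angles coincide: the level difference decays
  exponentially in one direction, yet it is bounded.\<close>

lemma bounded_solution_unique:
 assumes rho: "!!th. rho th \<in> {r1..r2}" "!!th. (rho has_real_derivative R (rho th) th) (at th)"
  and rho': "!!th. rho' th \<in> {r1..r2}" "!!th. (rho' has_real_derivative R (rho' th) th) (at th)"
 shows "rho th = rho' th"
proof -
 have "m <= M" using Vr[of r1] r12 by force
 then have M: "M > 0" using m by simp
 define w where "w th = V (rho th) th - V (rho' th) th" for th
 define d where "d th = D (rho th) th - D (rho' th) th" for th
 have wd: "(w has_real_derivative d th) (at th)" for th
  unfolding w_def d_def by (intro DERIV_diff solution_level rho rho')
 have contr: "sg * (w th * d th) <= - (k / M) * (w th)\<^sup>2" for th
 proof -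
  have one: "sg * ((V a th - V b th) * (D a th - D b th)) <= - (k / M) * (V a th - V b th)\<^sup>2"
   if ab: "r1 <= b" "b <= a" "a <= r2" for a b
  proof -
   let ?v = "V a th - V b th"
   have "0 <= m * (a - b)" using m ab by simp
   then have v: "0 <= ?v" "?v <= M * (a - b)" using V_increase[OF ab, of th] by linarith+
   have "sg * (D a th - D b th) <= - k * (a - b)" using D_decrease[OF ab] by blast
   also have "k / M * ?v <= k / M * (M * (a - b))" using v k M by (intro mult_left_mono) auto
   then have "- k * (a - b) <= - (k / M) * ?v" using M by simp
   finally have "?v * (sg * (D a th - D b th)) <= ?v * (- (k / M) * ?v)" using v by (intro mult_left_mono)
   moreover have "sg * (?v * (D a th - D b th)) = ?v * (sg * (D a th - D b th))" by (simp only: mult_ac)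
   moreover have "- (k / M) * ?v\<^sup>2 = ?v * (- (k / M) * ?v)" by (simp only: power2_eq_square mult_ac)
   ultimately show ?thesis by (simp only:)
  qed
  show ?thesis
  proof (cases "rho' th <= rho th")
   case True
   then show ?thesis unfolding w_def d_def using one[of "rho' th" "rho th"] rho(1)[of th] rho'(1)[of th] by simp
  next
   case False
   have "w th * d th = (V (rho' th) th - V (rho th) th) * (D (rho' th) th - D (rho th) th)"
    "(w th)\<^sup>2 = (V (rho' th) th - V (rho th) th)\<^sup>2"
    unfolding w_def d_def by (simp_all add: algebra_simps power2_eq_square)
   then show ?thesis using False one[of "rho th" "rho' th"] rho(1)[of th] rho'(1)[of th] by simp
  qed
 qed
 define c where "c = 2 * k / M"
 have c: "c > 0" using k M by (simp add: c_def)
 define u where "u t = (w (sg * t))\<^sup>2 * exp (c * t)" for t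
 have sg2: "sg * sg = 1" using sg by auto
 have u_dec: "u t <= u s" if "s <= t" for s t
 proof (rule DERIV_nonpos_imp_nonincreasing[OF that])
  fix x
  have "((%t. w (sg * t)) has_real_derivative d (sg * x) * sg) (at x)"
   by (rule DERIV_chain2[OF wd]) (auto intro!: derivative_eq_intros)
  then have "(u has_real_derivative 2 * w (sg * x) * (d (sg * x) * sg) * exp (c * x) + (w (sg * x))\<^sup>2 * (exp (c * x) * c)) (at x)"
   unfolding u_def by (auto intro!: derivative_eq_intros)
  moreover have "2 * w (sg * x) * (d (sg * x) * sg) * exp (c * x) + (w (sg * x))\<^sup>2 * (exp (c * x) * c)
   = exp (c * x) * (2 * (sg * (w (sg * x) * d (sg * x))) + c * (w (sg * x))\<^sup>2)"
   by (simp add: algebra_simps)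
  moreover have "2 * (sg * (w (sg * x) * d (sg * x))) + c * (w (sg * x))\<^sup>2 <= 0"
   using contr[of "sg * x"] by (simp add: c_def field_simps)
  ultimately show "EX y. (u has_real_derivative y) (at x) & y <= 0"
   by (metis exp_ge_zero mult_nonneg_nonpos)
 qed
 define B where "B = (M * (r2 - r1))\<^sup>2"
 have wB: "(w th)\<^sup>2 <= B" for th
 proof -
  have "\<bar>V a th - V b th\<bar> <= M * (r2 - r1)" if "r1 <= b" "b <= a" "a <= r2" for a b
  proof -
   have "0 <= m * (a - b)" using m that by simp
   then have "0 <= V a th - V b th" "V a th - V b th <= M * (a - b)" using V_increase[OF that, of th] by linarith+
   moreover have "M * (a - b) <= M * (r2 - r1)" using M that by (intro mult_left_mono) auto
   ultimately show ?thesis by simp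
  qed
  from this[of "rho th" "rho' th"] this[of "rho' th" "rho th"]
  have "\<bar>w th\<bar> <= M * (r2 - r1)"
   unfolding w_def using rho(1)[of th] rho'(1)[of th] by (cases "rho th <= rho' th") (auto simp: abs_minus_commute)
  then show ?thesis unfolding B_def by (metis abs_ge_zero power2_abs power_mono)
 qed
 have w0: "(w (sg * t))\<^sup>2 = 0" for t
 proof -
  have bound: "(w (sg * t))\<^sup>2 <= B * exp (- (c * s))" if "s >= 0" for s
  proof -
   have "(w (sg * t))\<^sup>2 * exp (c * t) <= (w (sg * (t - s)))\<^sup>2 * exp (c * (t - s))"
    using u_dec[of "t - s" t] that unfolding u_def by simp
   also have "... <= B * exp (c * (t - s))" by (intro mult_right_mono wB) simp
   also have "... = B * exp (- (c * s)) * exp (c * t)" by (simp add: exp_diff exp_minus field_simps right_diff_distrib)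
   finally show ?thesis by simp
  qed
  have "((%s. B * exp (- (c * s))) \<longlongrightarrow> B * 0) at_top"
   using c by (intro tendsto_mult tendsto_const filterlim_compose[OF exp_at_bot])
        (auto simp: filterlim_uminus_at_bot intro!: filterlim_tendsto_pos_mult_at_top filterlim_ident)
  then have "(w (sg * t))\<^sup>2 <= B * 0"
   by (rule tendsto_lowerbound) (use bound in \<open>auto intro!: eventually_mono[OF eventually_ge_at_top[of 0]]\<close>)
  then show ?thesis by simp
 qed
 have "w th = 0" using w0[of "sg * th"] sg2 by (simp add: mult.assoc[symmetric])
 then have "V (rho th) th = V (rho' th) th" by (simp add: w_def)
 moreover have "a = b" if "r1 <= b" "b <= a" "a <= r2" "V a th = V b th" for a b
  using V_increase(1)[OF that(1-3), of th] that m by (simp add: mult_le_0_iff)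
 ultimately show ?thesis using rho(1)[of th] rho'(1)[of th] by (cases "rho th <= rho' th") force+
qed

lemma periodic_solution_exists:
 fixes s1 s2 :: real
 assumes s12: "s1 <= s2" and lo: "!!th. V r1 th < s1" and hi: "!!th. s2 < V r2 th"
  and in1: "!!r th. r \<in> {r1..r2} ==> V r th = s1 ==> sg * D r th >= 0"
  and in2: "!!r th. r \<in> {r1..r2} ==> V r th = s2 ==> sg * D r th <= 0"
 obtains rho where "!!th. rho th \<in> {r1<..<r2}" "!!th. rho (th + p) = rho th"
  "!!th. (rho has_real_derivative R (rho th) th) (at th)"
proof -
 define T where "T = {(s, th). V r1 th < s & s < V r2 th}"
 have Vc: "continuous_on ({r1..r2} \<times> UNIV) (%(r, th). V r th)"
  by (rule continuous_at_imp_continuous_on) (use V has_derivative_continuous in \<open>fastforce simp: isCont_def[symmetric]\<close>)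
 have Vc1: "continuous_on UNIV (%th. V r th)" if "r \<in> {r1..r2}" for r
 proof -
  have "continuous_on UNIV (%th. (%(r, th). V r th) (r, th))"
   by (rule continuous_on_compose2[OF Vc]) (use that in \<open>auto intro!: continuous_intros\<close>)
  then show ?thesis by simp
 qed
 have Vc2: "continuous_on {r1..r2} (%r. V r th)" for th
 proof -
  have "continuous_on {r1..r2} (%r. (%(r, th). V r th) (r, th))"
   by (rule continuous_on_compose2[OF Vc]) (auto intro!: continuous_intros)
  then show ?thesis by simp
 qed
 have "open {x. V r1 (snd x) < fst x & fst x < V r2 (snd x)}"
  using r12 by (intro open_Collect_conj open_Collect_less continuous_intros continuous_on_compose2[OF Vc1]) auto
 then have openT: "open T" unfolding T_def by (simp add: case_prod_unfold)
 have "EX r. r1 < r & r < r2 & V r th = s" if "(s, th) \<in> T" for s th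
 proof -
  have "V r1 th <= s" "s <= V r2 th" "r1 <= r2" using that r12 by (auto simp: T_def)
  from IVT'[OF this Vc2] obtain r where "r1 <= r" "r <= r2" "V r th = s" by blast
  moreover have "r ~= r1" "r ~= r2" using calculation that by (auto simp: T_def)
  ultimately show ?thesis by force
 qed
 then obtain ph where ph: "!!s th. (s, th) \<in> T ==> r1 < ph s th & ph s th < r2 & V (ph s th) th = s" by metis
 have lips: "m * \<bar>a - b\<bar> <= \<bar>V a th - V b th\<bar>" if "a \<in> {r1..r2}" "b \<in> {r1..r2}" for a b th
  using V_increase(1)[of a b th] V_increase(1)[of b a th] that by (cases "a <= b") (auto simp: abs_if)
 have ph_cont: "continuous (at (s, th)) (%(s, th). ph s th)" if st: "(s, th) \<in> T" for s th
 proof -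
  have "((%x. (1 / m) * (\<bar>fst x - s\<bar> + \<bar>V (ph s th) th - V (ph s th) (snd x)\<bar>)) \<longlongrightarrow> (1 / m) * (\<bar>s - s\<bar> + \<bar>V (ph s th) th - V (ph s th) th\<bar>)) (at (s, th))"
  proof (intro tendsto_intros)
   show "(fst \<longlongrightarrow> s) (at (s, th))" using tendsto_fst[OF tendsto_ident_at, of "(s, th)" UNIV] by simp
   have "isCont (V (ph s th)) th" using Vc1[of "ph s th"] ph[OF st] by (auto simp: continuous_on_eq_continuous_at)
   moreover have "(snd \<longlongrightarrow> th) (at (s, th))" using tendsto_snd[OF tendsto_ident_at, of "(s, th)" UNIV] by simp
   ultimately show "((%x. V (ph s th) (snd x)) \<longlongrightarrow> V (ph s th) th) (at (s, th))" by (rule isCont_tendsto_compose)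
  qed
  then have lim0: "((%x. (1 / m) * (\<bar>fst x - s\<bar> + \<bar>V (ph s th) th - V (ph s th) (snd x)\<bar>)) \<longlongrightarrow> 0) (at (s, th))" by simp
  have ev: "\<forall>\<^sub>F x in at (s, th). norm ((%(s, th). ph s th) x - ph s th) <= (1 / m) * (\<bar>fst x - s\<bar> + \<bar>V (ph s th) th - V (ph s th) (snd x)\<bar>)"
  proof -
   have "\<forall>\<^sub>F x in at (s, th). x \<in> T" using openT st by (rule eventually_at_in_open')
   then show ?thesis
   proof (rule eventually_mono)
    fix x assume "x \<in> T"
    then obtain s' t' where x: "x = (s', t')" "(s', t') \<in> T" by (cases x) auto
    have "m * \<bar>ph s' t' - ph s th\<bar> <= \<bar>V (ph s' t') t' - V (ph s th) t'\<bar>"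
     by (rule lips) (use ph[OF x(2)] ph[OF st] in auto)
    also have "... = \<bar>(s' - s) + (V (ph s th) th - V (ph s th) t')\<bar>" using ph[OF x(2)] ph[OF st] by simp
    also have "... <= \<bar>s' - s\<bar> + \<bar>V (ph s th) th - V (ph s th) t'\<bar>" by (rule abs_triangle_ineq)
    finally show "norm ((%(s, th). ph s th) x - ph s th) <= (1 / m) * (\<bar>fst x - s\<bar> + \<bar>V (ph s th) th - V (ph s th) (snd x)\<bar>)"
     using m x by (simp add: field_simps)
   qed
  qed
  have "((%x. (%(s, th). ph s th) x - ph s th) \<longlongrightarrow> 0) (at (s, th))"
   by (rule Lim_null_comparison[OF ev lim0])
  then show ?thesis by (simp add: continuous_at LIM_zero_iff)
 qed
 have ph_deriv: "((%(s, th). ph s th) has_derivative (%(h, k). (h - Vt (ph s th) th * k) / Vr (ph s th) th)) (at (s, th))"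
  if st: "(s, th) \<in> T" for s th
 proof -
  let ?g = "%x. (ph (fst x) (snd x), snd x)" and ?f = "%x. (V (fst x) (snd x), snd x)"
  let ?a = "Vr (ph s th) th" and ?b = "Vt (ph s th) th"
  let ?g' = "%x. ((fst x - ?b * snd x) / ?a, snd x)" and ?f' = "%x. (?a * fst x + ?b * snd x, snd x)"
  have a: "?a > 0" using Vr[of "ph s th" th] m ph[OF st] by force
  have gc: "continuous (at (s, th)) ?g"
   using ph_cont[OF st] unfolding case_prod_unfold by (intro continuous_intros)
  have "(?g has_derivative ?g') (at (s, th))"
  proof (rule has_derivative_inverse_basic[where f = ?f and f' = ?f' and T = T])
   show "(?f has_derivative ?f') (at (?g (s, th)))"
    using V[of "ph s th" th] ph[OF st] unfolding case_prod_unfold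
    by (auto intro!: derivative_eq_intros)
   show "bounded_linear ?g'" by (intro bounded_linear_Pair bounded_linear_snd bounded_linear_divide
      [THEN bounded_linear_compose] bounded_linear_sub bounded_linear_fst bounded_linear_const_mult)
   show "?g' \<circ> ?f' = id" using a by (auto simp: fun_eq_iff)
   show "continuous (at (s, th)) ?g" by (rule gc)
   show "open T" "(s, th) \<in> T" by fact+
   show "?f (?g z) = z" if "z \<in> T" for z using ph[of "fst z" "snd z"] that by simp
  qed
  from has_derivative_fst[OF this] show ?thesis by (simp add: case_prod_unfold)
 qed
 have Tin: "(s, th) \<in> T" if "s \<in> {s1..s2}" for s th using that lo[of th] hi[of th] by (auto simp: T_def)
 define K where "K s th = sg * D (ph s (sg * th)) (sg * th)" for s th
 have M0: "m <= M" using Vr[of r1] r12 by force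
 have mono: "ph s th <= ph s' th & m * (ph s' th - ph s th) <= s' - s & s' - s <= M * (ph s' th - ph s th)"
  if "s1 <= s" "s <= s'" "s' <= s2" for s s' th
 proof -
  have a: "r1 < ph s th & ph s th < r2 & V (ph s th) th = s" "r1 < ph s' th & ph s' th < r2 & V (ph s' th) th = s'"
   using ph[OF Tin] that by auto
  have "ph s th <= ph s' th"
  proof (rule ccontr)
   assume "~ ?thesis"
   then have "m * (ph s th - ph s' th) <= s - s'" "m * (ph s th - ph s' th) > 0"
    using V_increase(1)[of "ph s' th" "ph s th" th] a m by auto
   then show False using that by simp
  qed
  then show ?thesis using V_increase[of "ph s th" "ph s' th" th] a by auto
 qed
 obtain S where S: "!!th. S th \<in> {s1..s2}" "!!th. S (th + p) = S th"
  "!!th. (S has_real_derivative K (S th) th) (at th)"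
 proof (rule periodic_monotone_ode[of s1 s2 K p "k / M" "k' / m"])
  have "continuous_on ({s1..s2} \<times> UNIV) (%x. (%(r, th). D r th) (ph (fst x) (sg * snd x), sg * snd x))"
  proof (rule continuous_on_compose2[OF D_cont])
   have "continuous_on T (%x. ph (fst x) (snd x))"
    by (rule continuous_at_imp_continuous_on) (use ph_cont in \<open>auto simp: case_prod_unfold\<close>)
   then have "continuous_on ({s1..s2} \<times> UNIV) (%x. (%x. ph (fst x) (snd x)) (fst x, sg * snd x))"
    by (rule continuous_on_compose2) (use Tin in \<open>auto intro!: continuous_intros\<close>)
   then show "continuous_on ({s1..s2} \<times> UNIV) (%x. (ph (fst x) (sg * snd x), sg * snd x))"
    by (auto intro!: continuous_intros)
   show "(%x. (ph (fst x) (sg * snd x), sg * snd x)) ` ({s1..s2} \<times> UNIV) \<subseteq> {r1..r2} \<times> UNIV"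
    using ph[OF Tin] by (force intro: less_imp_le)
  qed
  then show "continuous_on ({s1..s2} \<times> UNIV) (%(s, th). K s th)"
   unfolding K_def case_prod_unfold by (auto intro!: continuous_intros)
  have pers: "V r (th + sg * p) = V r th" "D r (th + sg * p) = D r th" for r th
   using sg per[of r th] per[of r "th - p"] by auto
  show "K s (th + p) = K s th" if "s \<in> {s1..s2}" for s th
  proof -
   let ?t = "sg * th"
   have "V (ph s (?t + sg * p)) (?t + sg * p) = s" "V (ph s ?t) ?t = s" using ph[OF Tin[OF that]] by auto
   then have "V (ph s (?t + sg * p)) ?t = V (ph s ?t) ?t" using pers by simp
   then have "m * \<bar>ph s (?t + sg * p) - ph s ?t\<bar> <= 0"
    using lips[of "ph s (?t + sg * p)" "ph s ?t" ?t] ph[OF Tin[OF that]] by (simp add: less_imp_le)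
   then have "ph s (?t + sg * p) = ph s ?t" using m by (simp add: mult_le_0_iff)
   then show ?thesis unfolding K_def distrib_left using pers by simp
  qed
  show "p > 0" "k / M > 0" "s1 <= s2" using p k m M0 s12 by auto
  fix s s' th assume s: "s1 <= s" "s <= s'" "s' <= s2"
  let ?t = "sg * th"
  note mo = mono[OF s, of ?t]
  have rr: "r1 <= ph s ?t" "ph s ?t <= ph s' ?t" "ph s' ?t <= r2"
   using mo ph[OF Tin, of s ?t] ph[OF Tin, of s' ?t] s by auto
  have "k' >= 0" using D[of r1 0] r12 k by force
  have "K s' th - K s th = sg * (D (ph s' ?t) ?t - D (ph s ?t) ?t)" by (simp add: K_def algebra_simps)
  moreover have "k' * (ph s' ?t - ph s ?t) <= k' / m * (s' - s)"
  proof -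
   have "k' * (ph s' ?t - ph s ?t) = k' / m * (m * (ph s' ?t - ph s ?t))" using m by simp
   also have "... <= k' / m * (s' - s)" using mo m \<open>k' >= 0\<close> by (intro mult_left_mono) auto
   finally show ?thesis .
  qed
  moreover have "k / M * (s' - s) <= k * (ph s' ?t - ph s ?t)"
  proof -
   have "k / M * (s' - s) <= k / M * (M * (ph s' ?t - ph s ?t))" using mo m M0 k by (intro mult_left_mono) auto
   also have "... = k * (ph s' ?t - ph s ?t)" using m M0 by simp
   finally show ?thesis .
  qed
  ultimately show "K s' th - K s th >= - (k' / m) * (s' - s)" "K s' th - K s th <= - (k / M) * (s' - s)"
   using D_decrease[OF rr, of ?t] by auto
 next
  show "0 <= K s1 th" for th unfolding K_def using in1[of "ph s1 (sg * th)"] ph[OF Tin, of s1 "sg * th"] s12 by simp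
  show "K s2 th <= 0" for th unfolding K_def using in2[of "ph s2 (sg * th)"] ph[OF Tin, of s2 "sg * th"] s12 by simp
 qed (rule that)
 have sg2: "sg * (sg * x) = x" for x using sg by auto
 define rho where "rho th = ph (S (sg * th)) th" for th
 show thesis
 proof (rule that[of rho])
  fix th
  have st: "(S (sg * th), th) \<in> T" using S(1) by (rule Tin)
  show "rho th \<in> {r1<..<r2}" using ph[OF st] by (simp add: rho_def)
  have Vrho: "V (rho th) th = S (sg * th)" "rho th \<in> {r1..r2}" using ph[OF st] by (auto simp: rho_def)
  have "S (sg * th + sg * p) = S (sg * th)" using sg S(2)[of "sg * th"] S(2)[of "sg * th - p"] by auto
  then have "S (sg * (th + p)) = S (sg * th)" by (simp add: distrib_left)
  moreover have "V (rho (th + p)) (th + p) = S (sg * (th + p))" "rho (th + p) \<in> {r1..r2}"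
   using ph[OF Tin[OF S(1)], of "sg * (th + p)" "th + p"] by (auto simp: rho_def)
  ultimately have "m * \<bar>rho (th + p) - rho th\<bar> <= 0" using lips[of "rho (th + p)" "rho th" th] Vrho per(1) by simp
  then show "rho (th + p) = rho th" using m by (simp add: mult_le_0_iff)
  have "((%th. S (sg * th)) has_real_derivative K (S (sg * th)) (sg * th) * sg) (at th)"
   by (rule DERIV_chain2[OF S(3)]) (auto intro!: derivative_eq_intros)
  also have "K (S (sg * th)) (sg * th) * sg = D (rho th) th"
   unfolding K_def rho_def sg2 using sg by auto
  finally have Sd: "((%th. S (sg * th)) has_real_derivative D (rho th) th) (at th)" .
  have "((%(s, th). ph s th) has_derivative
    (%(h, k). 1 / Vr (rho th) th * h + (- Vt (rho th) th / Vr (rho th) th) * k)) (at (S (sg * th), th))"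
   using ph_deriv[OF st] by (simp add: rho_def case_prod_unfold diff_divide_distrib algebra_simps)
  from real_derivative_along_curve2[OF this Sd DERIV_ident]
  have "(rho has_real_derivative (D (rho th) th - Vt (rho th) th) / Vr (rho th) th) (at th)"
   by (simp add: rho_def[abs_def] diff_divide_distrib)
  moreover have "Vr (rho th) th > 0" using Vr[OF Vrho(2), of th] m by linarith
  moreover have "D (rho th) th - Vt (rho th) th = R (rho th) th * Vr (rho th) th"
   using rate[OF Vrho(2), of th] by (simp add: algebra_simps)
  ultimately show "(rho has_real_derivative R (rho th) th) (at th)" by simp
 qed
qed

end

section \<open>Plane cycles in polar coordinates\<close>

lemma real_diffeo_inverse:
 fixes tau w :: "real => real"
 assumes d: "!!th. (tau has_real_derivative w th) (at th)" and c: "c > 0" "!!th. w th >= c"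
 obtains th where "!!t. tau (th t) = t" "!!a. th (tau a) = a"
  "!!t. (th has_real_derivative 1 / w (th t)) (at t)"
proof -
 have grow: "c * (b - a) <= tau b - tau a" if ab: "a <= b" for a b
 proof -
  have "tau a - c * a <= tau b - c * b"
   by (rule DERIV_nonneg_imp_nondecreasing[OF ab])
    (use d c in \<open>auto intro!: exI[of _ "w _ - c"] derivative_eq_intros\<close>)
  then show ?thesis by (simp add: algebra_simps)
 qed
 have lips: "c * \<bar>b - a\<bar> <= \<bar>tau b - tau a\<bar>" for a b
  using grow[of a b] grow[of b a] c(1) by (cases "a <= b") (auto simp: abs_if)
 have cont: "continuous_on S tau" for S
  by (meson d DERIV_isCont continuous_at_imp_continuous_on)
 have "EX a. tau a = t" for t
 proof -
  define b where "b = \<bar>t - tau 0\<bar> / c"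
  have b: "b >= 0" "c * b = \<bar>t - tau 0\<bar>" using c by (auto simp: b_def)
  have "tau (- b) <= t" "t <= tau b" using grow[of "- b" 0] grow[of 0 b] b by auto
  with IVT'[of tau "- b" t b] b cont show ?thesis by auto
 qed
 then obtain th where th: "!!t. tau (th t) = t" by metis
 have inj: "a = b" if "tau a = tau b" for a b
  using lips[of a b] that c(1) by (simp add: mult_le_0_iff)
 have "isCont th t" for t
 proof -
  have "((%s. (1 / c) * \<bar>s - t\<bar>) \<longlongrightarrow> (1 / c) * \<bar>t - t\<bar>) (at t)" by (intro tendsto_intros)
  then have "((%s. (1 / c) * \<bar>s - t\<bar>) \<longlongrightarrow> 0) (at t)" by simp
  moreover have "norm (th s - th t) <= (1 / c) * \<bar>s - t\<bar>" for s
   using lips[of "th s" "th t"] c(1) th by (simp add: field_simps abs_minus_commute)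
  ultimately have "((%s. th s - th t) \<longlongrightarrow> 0) (at t)"
   by (metis (no_types, lifting) Lim_null_comparison always_eventually)
  then show ?thesis by (simp add: isCont_def LIM_zero_iff)
 qed
 then have "(th has_real_derivative inverse (w (th t))) (at t)" for t
  using DERIV_inverse_function[of tau "w (th t)" th t "t - 1" "t + 1"] d[of "th t"] c(2)[of "th t"] c(1) th by auto
 then show thesis using that[of th] th inj by (simp add: inverse_eq_divide)
qed

definition radial_speed :: "(real => real => real) => (real => real => real) => real => real => real" where
 "radial_speed f g r th = f (r * cos th) (r * sin th) * cos th + g (r * cos th) (r * sin th) * sin th"

definition angular_speed :: "(real => real => real) => (real => real => real) => real => real => real" where
 "angular_speed f g r th = (g (r * cos th) (r * sin th) * cos th - f (r * cos th) (r * sin th) * sin th) / r"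

definition plane_solution :: "(real => real => real) => (real => real => real) => (real => real) => (real => real) => bool" where
 "plane_solution f g x y \<longleftrightarrow> (ALL t. (x has_real_derivative f (x t) (y t)) (at t) & (y has_real_derivative g (x t) (y t)) (at t))"

lemma polar_lift:
 assumes sol: "plane_solution f g x y" and nz: "!!t. 0 < (x t)\<^sup>2 + (y t)\<^sup>2"
  and cont: "continuous_on UNIV (%t. f (x t) (y t))" "continuous_on UNIV (%t. g (x t) (y t))"
 obtains r th where "!!t. r t = sqrt ((x t)\<^sup>2 + (y t)\<^sup>2)" "!!t. x t = r t * cos (th t)" "!!t. y t = r t * sin (th t)"
  "!!t. (r has_real_derivative radial_speed f g (r t) (th t)) (at t)"
  "!!t. (th has_real_derivative angular_speed f g (r t) (th t)) (at t)"
proof -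
 define r where "r t = sqrt ((x t)\<^sup>2 + (y t)\<^sup>2)" for t
 have r: "r t > 0" "(r t)\<^sup>2 = (x t)\<^sup>2 + (y t)\<^sup>2" for t using nz[of t] by (simp_all add: r_def)
 have xd: "(x has_real_derivative f (x t) (y t)) (at t)" and yd: "(y has_real_derivative g (x t) (y t)) (at t)" for t
  using sol by (auto simp: plane_solution_def)
 have xc: "continuous_on UNIV x" "continuous_on UNIV y"
  by (meson xd yd DERIV_isCont continuous_at_imp_continuous_on)+
 define \<omega> where "\<omega> t = (x t * g (x t) (y t) - y t * f (x t) (y t)) / (r t)\<^sup>2" for t
 have "continuous_on UNIV \<omega>"
  unfolding \<omega>_def r(2) by (intro continuous_intros cont xc) (metis nz less_irrefl)
 then obtain W where W: "!!t. (W has_real_derivative \<omega> t) (at t)" by (rule continuous_has_antiderivative) blast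
 have "(x 0 / r 0)\<^sup>2 + (y 0 / r 0)\<^sup>2 = 1"
  unfolding power_divide r(2) add_divide_distrib[symmetric] using nz[of 0] by (metis divide_self less_irrefl)
 then obtain a where a: "x 0 / r 0 = cos a" "y 0 / r 0 = sin a" using sincos_total_2pi by metis
 define th where "th t = W t - W 0 + a" for t
 have thd: "(th has_real_derivative \<omega> t) (at t)" for t
  unfolding th_def using W[of t] by (auto intro!: derivative_eq_intros)
 define r' where "r' t = (x t * f (x t) (y t) + y t * g (x t) (y t)) / r t" for t
 have rd: "(r has_real_derivative r' t) (at t)" for t
 proof -
  let ?q = "x t * f (x t) (y t) + y t * g (x t) (y t)"
  have "((%t. (x t)\<^sup>2 + (y t)\<^sup>2) has_real_derivative 2 * ?q) (at t)"
   using xd[of t] yd[of t] by (auto intro!: derivative_eq_intros simp: algebra_simps)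
  from DERIV_chain2[OF DERIV_real_sqrt[OF nz[of t]] this]
  have "(r has_real_derivative inverse (r t) / 2 * (2 * ?q)) (at t)" unfolding r_def .
  moreover have "inverse (r t) / 2 * (2 * ?q) = r' t" unfolding r'_def using r(1)[of t] by (simp add: field_simps)
  ultimately show ?thesis by simp
 qed
 define P where "P t = (x t * cos (th t) + y t * sin (th t)) / r t" for t
 define Q where "Q t = (y t * cos (th t) - x t * sin (th t)) / r t" for t
 have "P t = P 0" "Q t = Q 0" for t
 proof -
  have key1: "(f' * c + g' * s + w * (y' * c - x' * s)) * r0 - (x' * c + y' * s) * q = 0"
   if "r0 * q = x' * f' + y' * g'" "r0\<^sup>2 * w = x' * g' - y' * f'" "r0\<^sup>2 = x'\<^sup>2 + y'\<^sup>2" "r0 ~= 0"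
   for f' g' c s w x' y' r0 q :: real
  proof -
   have "r0 * ((f' * c + g' * s + w * (y' * c - x' * s)) * r0 - (x' * c + y' * s) * q)
    = (f' * c + g' * s) * r0\<^sup>2 + (r0\<^sup>2 * w) * (y' * c - x' * s) - (x' * c + y' * s) * (r0 * q)"
    by (simp add: algebra_simps power2_eq_square)
   also have "... = 0" unfolding that(1,2) unfolding that(3) by (simp add: algebra_simps power2_eq_square)
   finally show ?thesis using that(4) by simp
  qed
  have key2: "(g' * c - f' * s - w * (y' * s + x' * c)) * r0 - (y' * c - x' * s) * q = 0"
   if "r0 * q = x' * f' + y' * g'" "r0\<^sup>2 * w = x' * g' - y' * f'" "r0\<^sup>2 = x'\<^sup>2 + y'\<^sup>2" "r0 ~= 0"
   for f' g' c s w x' y' r0 q :: real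
  proof -
   have "r0 * ((g' * c - f' * s - w * (y' * s + x' * c)) * r0 - (y' * c - x' * s) * q)
    = (g' * c - f' * s) * r0\<^sup>2 - (r0\<^sup>2 * w) * (y' * s + x' * c) - (y' * c - x' * s) * (r0 * q)"
    by (simp add: algebra_simps power2_eq_square)
   also have "... = 0" unfolding that(1,2) unfolding that(3) by (simp add: algebra_simps power2_eq_square)
   finally show ?thesis using that(4) by simp
  qed
  have rel: "r t * r' t = x t * f (x t) (y t) + y t * g (x t) (y t)"
   "(r t)\<^sup>2 * \<omega> t = x t * g (x t) (y t) - y t * f (x t) (y t)" "r t ~= 0" for t
   using r(1)[of t] by (auto simp: r'_def \<omega>_def)
  have "(P has_real_derivative 0) (at t)" for t
  proof -
   have "(P has_real_derivative ((f (x t) (y t) * cos (th t) + g (x t) (y t) * sin (th t)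
     + \<omega> t * (y t * cos (th t) - x t * sin (th t))) * r t - (x t * cos (th t) + y t * sin (th t)) * r' t) / (r t * r t)) (at t)"
    unfolding P_def using xd[of t] yd[of t] thd[of t] rd[of t] rel(3)[of t]
    by (auto intro!: derivative_eq_intros simp: algebra_simps)
   then show ?thesis unfolding key1[OF rel(1,2) r(2) rel(3)] by simp
  qed
  then show "P t = P 0" using DERIV_isconst_all[of P t 0] by blast
  have "(Q has_real_derivative 0) (at t)" for t
  proof -
   have "(Q has_real_derivative ((g (x t) (y t) * cos (th t) - f (x t) (y t) * sin (th t)
     - \<omega> t * (y t * sin (th t) + x t * cos (th t))) * r t - (y t * cos (th t) - x t * sin (th t)) * r' t) / (r t * r t)) (at t)"
    unfolding Q_def using xd[of t] yd[of t] thd[of t] rd[of t] rel(3)[of t]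
    by (auto intro!: derivative_eq_intros simp: algebra_simps)
   then show ?thesis unfolding key2[OF rel(1,2) r(2) rel(3)] by simp
  qed
  then show "Q t = Q 0" using DERIV_isconst_all[of Q t 0] by blast
 qed
 moreover have "P 0 = 1" "Q 0 = 0"
 proof -
  have xs: "x 0 = r 0 * cos a" "y 0 = r 0 * sin a" using a r(1)[of 0] by (auto simp: field_simps)
  have th0: "th 0 = a" by (simp add: th_def)
  have "(cos a)\<^sup>2 + (sin a)\<^sup>2 = 1" by simp
  then have "x 0 * cos (th 0) + y 0 * sin (th 0) = r 0" unfolding th0 xs by algebra
  moreover have "y 0 * cos (th 0) - x 0 * sin (th 0) = 0" unfolding th0 xs by simp
  ultimately have "P 0 = r 0 / r 0" "Q 0 = 0" unfolding P_def Q_def by simp_all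
  then show "P 0 = 1" "Q 0 = 0" using r(1)[of 0] by simp_all
 qed
 ultimately have PQ: "x t * cos (th t) + y t * sin (th t) = r t" "y t * cos (th t) - x t * sin (th t) = 0" for t
  using r(1)[of t] unfolding P_def Q_def by (auto simp: field_simps) (metis less_irrefl mult_eq_0_iff divide_eq_0_iff right_minus_eq)+
 have xy: "x t = r t * cos (th t)" "y t = r t * sin (th t)" for t
 proof -
  have "r t * cos (th t) = (x t * cos (th t) + y t * sin (th t)) * cos (th t) - (y t * cos (th t) - x t * sin (th t)) * sin (th t)"
   unfolding PQ by simp
  also have "... = x t * ((cos (th t))\<^sup>2 + (sin (th t))\<^sup>2)" by algebra
  finally show "x t = r t * cos (th t)" by simp
  have "r t * sin (th t) = (x t * cos (th t) + y t * sin (th t)) * sin (th t) + (y t * cos (th t) - x t * sin (th t)) * cos (th t)"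
   unfolding PQ by simp
  also have "... = y t * ((cos (th t))\<^sup>2 + (sin (th t))\<^sup>2)" by algebra
  finally show "y t = r t * sin (th t)" by simp
 qed
 have rs: "r' t = radial_speed f g (r t) (th t)" "\<omega> t = angular_speed f g (r t) (th t)" for t
  unfolding r'_def \<omega>_def radial_speed_def angular_speed_def xy[symmetric]
  using r(1)[of t] xy[of t] by (simp_all add: field_simps power2_eq_square)
 show thesis
  by (rule that[of r th, OF r_def xy rd[unfolded rs] thd[unfolded rs]])
qed

lemma plane_cycle_of_polar_solution:
 assumes r1: "0 < r1" and rho: "!!th. rho th \<in> {r1<..<r2}" "!!th. rho (th + 2 * pi) = rho th"
  "!!th. (rho has_real_derivative radial_speed f g (rho th) th / angular_speed f g (rho th) th) (at th)"
  and h: "h > 0" "!!r th. r \<in> {r1..r2} ==> h <= angular_speed f g r th"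
  and cont: "continuous_on UNIV (%(x, y). f x y)" "continuous_on UNIV (%(x, y). g x y)"
  and uniq: "!!rho'. (!!th. rho' th \<in> {r1..r2}) ==>
   (!!th. (rho' has_real_derivative radial_speed f g (rho' th) th / angular_speed f g (rho' th) th) (at th)) ==> rho' = rho"
 obtains x y T where "plane_solution f g x y" "T > 0" "!!t. x (t + T) = x t" "!!t. y (t + T) = y t"
  "!!t. (x t)\<^sup>2 + (y t)\<^sup>2 \<in> {r1\<^sup>2<..<r2\<^sup>2}" "EX t. x t ~= x 0"
  "ALL u v. plane_solution f g u v --> (ALL t. (u t)\<^sup>2 + (v t)\<^sup>2 \<in> {r1\<^sup>2..r2\<^sup>2}) --> (EX c. ALL t. u t = x (t + c) & v t = y (t + c))"
proof -
 have fc: "continuous_on S (%t. f (a t) (b t))" "continuous_on S (%t. g (a t) (b t))"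
  if "continuous_on S a" "continuous_on S b" for S :: "real set" and a b
  using continuous_on_compose2[OF cont(1), of S "%t. (a t, b t)"] continuous_on_compose2[OF cont(2), of S "%t. (a t, b t)"] that
  by (auto intro!: continuous_intros)
 define w where "w th = angular_speed f g (rho th) th" for th
 have rhoc: "continuous_on UNIV rho" by (meson rho(3) DERIV_isCont continuous_at_imp_continuous_on)
 have rho0: "rho th > 0" "rho th \<in> {r1..r2}" for th using rho(1)[of th] r1 by auto
 have wc: "continuous_on UNIV w"
  unfolding w_def angular_speed_def by (intro continuous_intros fc rhoc) (metis rho0(1) less_irrefl)
 have wh: "w th >= h" for th unfolding w_def using h(2) rho0(2) by blast
 have wp: "w (th + 2 * pi) = w th" for th unfolding w_def angular_speed_def rho(2) by simp
 obtain s where s: "!!th. w th <= w s" using periodic_attains_max[of w "2 * pi"] wp wc by auto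
 have "continuous_on UNIV (%th. 1 / w th)" using wc wh h(1) by (intro continuous_intros) (auto, metis not_le)
 then obtain tau where tau: "!!th. (tau has_real_derivative 1 / w th) (at th)" by (rule continuous_has_antiderivative) blast
 have w0: "w th > 0" for th using wh[of th] h(1) by linarith
 have "1 / w s <= 1 / w th" for th using s[of th] w0[of th] by (intro divide_left_mono) auto
 moreover have "0 < 1 / w s" using w0[of s] by simp
 ultimately obtain th where th: "!!t. tau (th t) = t" "!!a. th (tau a) = a"
  "!!t. (th has_real_derivative 1 / (1 / w (th t))) (at t)"
  using real_diffeo_inverse[of tau "%th. 1 / w th" "1 / w s"] tau by metis
 have thd: "(th has_real_derivative w (th t)) (at t)" for t using th(3)[of t] by simp
 define T where "T = tau (2 * pi) - tau 0"
 have tauT: "tau (a + 2 * pi) = tau a + T" for a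
 proof -
  have "((%a. tau (a + 2 * pi) - tau a) has_real_derivative 0) (at a)" for a
   using DERIV_diff[OF DERIV_shift[THEN iffD1, OF tau[of "a + 2 * pi"]] tau[of a]] wp by simp
  then have "tau (a + 2 * pi) - tau a = tau (0 + 2 * pi) - tau 0"
   using DERIV_isconst_all[of "%a. tau (a + 2 * pi) - tau a" a 0] by blast
  then show ?thesis by (simp add: T_def)
 qed
 have "tau 0 < tau (2 * pi)"
  by (rule DERIV_pos_imp_increasing) (use tau w0 in \<open>auto intro!: exI[of _ "1 / w _"]\<close>)
 then have T: "T > 0" by (simp add: T_def)
 have thT: "th (t + T) = th t + 2 * pi" for t using tauT[of "th t"] th(1)[of t] th(2)[of "th t + 2 * pi"] by simp
 define x where "x t = rho (th t) * cos (th t)" for t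
 define y where "y t = rho (th t) * sin (th t)" for t
 have r2: "(x t)\<^sup>2 + (y t)\<^sup>2 = (rho (th t))\<^sup>2" for t
  unfolding x_def y_def power_mult_distrib distrib_left[symmetric] by simp
 have sol: "plane_solution f g x y"
  unfolding plane_solution_def
 proof (intro allI conjI)
  fix t
  let ?f = "f (x t) (y t)" and ?g = "g (x t) (y t)" and ?c = "cos (th t)" and ?s = "sin (th t)"
  have wt: "w (th t) * rho (th t) = ?g * ?c - ?f * ?s"
   using rho0(1)[of "th t"] by (simp add: w_def angular_speed_def x_def y_def)
  have "((%t. rho (th t)) has_real_derivative radial_speed f g (rho (th t)) (th t) / w (th t) * w (th t)) (at t)"
   unfolding w_def[of "th t", symmetric] by (rule DERIV_chain2[OF rho(3)[of "th t", folded w_def] thd])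
  then have rd: "((%t. rho (th t)) has_real_derivative ?f * ?c + ?g * ?s) (at t)"
   using w0[of "th t"] by (simp add: radial_speed_def x_def y_def)
  have cs: "?c\<^sup>2 + ?s\<^sup>2 = 1" by simp
  have "(x has_real_derivative (?f * ?c + ?g * ?s) * ?c - (w (th t) * rho (th t)) * ?s) (at t)"
   unfolding x_def[abs_def] using rd thd[of t] by (auto intro!: derivative_eq_intros simp: x_def y_def)
  also have "(?f * ?c + ?g * ?s) * ?c - (w (th t) * rho (th t)) * ?s = ?f * (?c\<^sup>2 + ?s\<^sup>2)"
   unfolding wt by algebra
  finally show "(x has_real_derivative ?f) (at t)" unfolding cs by simp
  have "(y has_real_derivative (?f * ?c + ?g * ?s) * ?s + (w (th t) * rho (th t)) * ?c) (at t)"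
   unfolding y_def[abs_def] using rd thd[of t] by (auto intro!: derivative_eq_intros simp: x_def y_def)
  also have "(?f * ?c + ?g * ?s) * ?s + (w (th t) * rho (th t)) * ?c = ?g * (?c\<^sup>2 + ?s\<^sup>2)"
   unfolding wt by algebra
  finally show "(y has_real_derivative ?g) (at t)" unfolding cs by simp
 qed
 show thesis
 proof (rule that[OF sol T])
  show "x (t + T) = x t" "y (t + T) = y t" for t unfolding x_def y_def thT rho(2) by simp_all
  show "(x t)\<^sup>2 + (y t)\<^sup>2 \<in> {r1\<^sup>2<..<r2\<^sup>2}" for t
   unfolding r2 using rho(1)[of "th t"] r1 by (auto intro!: power_strict_mono)
  have "x (tau 0) > 0" "x (tau pi) < 0" unfolding x_def th(2) using rho0(1) by auto
  then show "EX t. x t ~= x 0" by (metis less_asym)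
  show "ALL u v. plane_solution f g u v --> (ALL t. (u t)\<^sup>2 + (v t)\<^sup>2 \<in> {r1\<^sup>2..r2\<^sup>2}) --> (EX c. ALL t. u t = x (t + c) & v t = y (t + c))"
  proof (intro allI impI)
  fix u v assume uv1: "plane_solution f g u v" and uv2: "ALL t. (u t)\<^sup>2 + (v t)\<^sup>2 \<in> {r1\<^sup>2..r2\<^sup>2}"
  note uv = uv1 uv2[rule_format]
  have uc: "continuous_on UNIV u" "continuous_on UNIV v"
   using uv(1) unfolding plane_solution_def by (meson DERIV_isCont continuous_at_imp_continuous_on)+
  have nz: "0 < (u t)\<^sup>2 + (v t)\<^sup>2" for t using uv(2)[of t] r1 by (auto intro: less_le_trans[of 0 "r1\<^sup>2"])
  obtain r \<alpha> where lift: "!!t. r t = sqrt ((u t)\<^sup>2 + (v t)\<^sup>2)" "!!t. u t = r t * cos (\<alpha> t)" "!!t. v t = r t * sin (\<alpha> t)"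
   "!!t. (r has_real_derivative radial_speed f g (r t) (\<alpha> t)) (at t)"
   "!!t. (\<alpha> has_real_derivative angular_speed f g (r t) (\<alpha> t)) (at t)"
   using polar_lift[OF uv(1) nz fc(1)[OF uc] fc(2)[OF uc]] by blast
  have r12: "r1 <= r2" using rho(1)[of 0] by auto
  have rr: "r t \<in> {r1..r2}" for t
  proof -
   have "sqrt (r1\<^sup>2) <= r t" "r t <= sqrt (r2\<^sup>2)" unfolding lift(1) by (intro real_sqrt_le_mono; use uv(2)[of t] in simp)+
   then show ?thesis using r1 r12 by simp
  qed
  obtain \<sigma> where \<sigma>: "!!t. \<alpha> (\<sigma> t) = t" "!!a. \<sigma> (\<alpha> a) = a"
   "!!t. (\<sigma> has_real_derivative 1 / angular_speed f g (r (\<sigma> t)) (\<alpha> (\<sigma> t))) (at t)"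
   using real_diffeo_inverse[of \<alpha> "%t. angular_speed f g (r t) (\<alpha> t)" h] lift(5) h rr by metis
  have "(%th. r (\<sigma> th)) = rho"
  proof (rule uniq)
   show "r (\<sigma> th) \<in> {r1..r2}" for th by (rule rr)
   show "((%th. r (\<sigma> th)) has_real_derivative radial_speed f g (r (\<sigma> th)) th / angular_speed f g (r (\<sigma> th)) th) (at th)" for th
    using DERIV_chain2[OF lift(4) \<sigma>(3), of th] unfolding \<sigma>(1) by simp
  qed
  then have rrho: "r t = rho (\<alpha> t)" for t using \<sigma>(2)[of t] by metis
  have "((%t. tau (\<alpha> t) - t) has_real_derivative 0) (at t)" for t
  proof -
   have "((%t. tau (\<alpha> t)) has_real_derivative 1 / w (\<alpha> t) * w (\<alpha> t)) (at t)"
    using DERIV_chain2[OF tau lift(5), of t] unfolding rrho w_def .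
   from DERIV_diff[OF this DERIV_ident] show ?thesis using w0[of "\<alpha> t"] by simp
  qed
  then have shift: "tau (\<alpha> t) - t = tau (\<alpha> 0) - 0" for t
   using DERIV_isconst_all[of "%t. tau (\<alpha> t) - t" t 0] by blast
  have ash: "th (t + tau (\<alpha> 0)) = \<alpha> t" for t
  proof -
   have "tau (\<alpha> t) = t + tau (\<alpha> 0)" using shift[of t] by linarith
   then have "th (tau (\<alpha> t)) = th (t + tau (\<alpha> 0))" by (rule arg_cong)
   then show ?thesis unfolding th(2) by (rule sym)
  qed
  have "u t = x (t + tau (\<alpha> 0)) & v t = y (t + tau (\<alpha> 0))" for t
   unfolding x_def y_def lift(2,3) rrho ash by simp
  then show "EX c. ALL t. u t = x (t + c) & v t = y (t + c)" by blast
  qed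
 qed
qed

section \<open>Averaging to arbitrary order\<close>

inductive poly2 :: "(real => real => real) => bool" where
 poly2_const: "poly2 (%x y. c)"
| poly2_fst: "poly2 (%x y. x)"
| poly2_snd: "poly2 (%x y. y)"
| poly2_add: "poly2 f ==> poly2 g ==> poly2 (%x y. f x y + g x y)"
| poly2_mult: "poly2 f ==> poly2 g ==> poly2 (%x y. f x y * g x y)"

lemma poly2_minus: "poly2 f ==> poly2 (%x y. - f x y)"
 using poly2_mult[OF poly2_const[of "-1"]] by simp

lemma poly2_diff: "poly2 f ==> poly2 g ==> poly2 (%x y. f x y - g x y)"
 using poly2_add[OF _ poly2_minus] by simp

lemma poly2_power: "poly2 f ==> poly2 (%x y. f x y ^ n)"
 by (induction n) (auto intro: poly2_const poly2_mult)

lemma poly2_sum: "(!!i. i \<in> I ==> poly2 (f i)) ==> poly2 (%x y. \<Sum>i\<in>I. f i x y)"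
 by (induction I rule: infinite_finite_induct) (auto intro: poly2_const poly2_add)

lemmas poly2_intros = poly2_const poly2_fst poly2_snd poly2_add poly2_mult poly2_minus poly2_diff poly2_power poly2_sum

lemma poly2_continuous_on:
 fixes a b :: "'a :: topological_space => real"
 assumes "poly2 f" "continuous_on S a" "continuous_on S b"
 shows "continuous_on S (%t. f (a t) (b t))"
 using assms by induction (auto intro!: continuous_intros)

definition has_partials :: "(real => real => real) => (real => real => real) => (real => real => real) => bool" where
 "has_partials f fx fy \<longleftrightarrow>
  (ALL x y. ((%(x, y). f x y) has_derivative (%(h, k). fx x y * h + fy x y * k)) (at (x, y)))"

lemma has_partials_const: "has_partials (%x y. c) (%x y. 0) (%x y. 0)"
 by (auto simp: has_partials_def case_prod_unfold)

lemma has_partials_fst: "has_partials (%x y. x) (%x y. 1) (%x y. 0)"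
 by (auto simp: has_partials_def case_prod_unfold intro!: derivative_eq_intros)

lemma has_partials_snd: "has_partials (%x y. y) (%x y. 0) (%x y. 1)"
 by (auto simp: has_partials_def case_prod_unfold intro!: derivative_eq_intros)

lemma has_partials_add:
 "has_partials f fx fy ==> has_partials g gx gy ==>
 has_partials (%x y. f x y + g x y) (%x y. fx x y + gx x y) (%x y. fy x y + gy x y)"
 unfolding has_partials_def case_prod_unfold
 by (auto intro!: derivative_eq_intros simp: algebra_simps)

lemma has_partials_mult:
 "has_partials f fx fy ==> has_partials g gx gy ==>
 has_partials (%x y. f x y * g x y) (%x y. fx x y * g x y + f x y * gx x y) (%x y. fy x y * g x y + f x y * gy x y)"
 unfolding has_partials_def case_prod_unfold
 by (auto intro!: derivative_eq_intros simp: algebra_simps)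

lemma has_partials_sum:
 "(!!i. i \<in> I ==> has_partials (f i) (fx i) (fy i)) ==>
 has_partials (%x y. \<Sum>i\<in>I. f i x y) (%x y. \<Sum>i\<in>I. fx i x y) (%x y. \<Sum>i\<in>I. fy i x y)"
 by (induction I rule: infinite_finite_induct) (auto intro: has_partials_const has_partials_add)

lemma poly2_partials:
 assumes "poly2 f"
 shows "EX fx fy. poly2 fx & poly2 fy & has_partials f fx fy"
 using assms
proof induction
 case (poly2_add f g)
 then show ?case by (blast intro: has_partials_add poly2.poly2_add)
next
 case (poly2_mult f g)
 then obtain fx fy gx gy where "poly2 fx" "poly2 fy" "has_partials f fx fy" "poly2 gx" "poly2 gy" "has_partials g gx gy"
  by blast
 then show ?case using poly2_mult.hyps
  by (intro exI[of _ "%x y. fx x y * g x y + f x y * gx x y"] exI[of _ "%x y. fy x y * g x y + f x y * gy x y"])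
   (auto intro: has_partials_mult poly2_intros)
qed (blast intro: has_partials_const has_partials_fst has_partials_snd poly2_const)+

lemma has_partials_polar:
 assumes "has_partials f fx fy"
 shows "((%(r, th). f (r * cos th) (r * sin th)) has_derivative
  (%(h, k). (fx (r * cos th) (r * sin th) * cos th + fy (r * cos th) (r * sin th) * sin th) * h
   + r * (fy (r * cos th) (r * sin th) * cos th - fx (r * cos th) (r * sin th) * sin th) * k)) (at (r, th))"
proof -
 have inner: "((%p. (fst p * cos (snd p), fst p * sin (snd p))) has_derivative
   (%q. (fst q * cos th - r * sin th * snd q, fst q * sin th + r * cos th * snd q))) (at (r, th))"
  by (auto intro!: derivative_eq_intros simp: algebra_simps)
 have outer: "((%p. f (fst p) (snd p)) has_derivative
   (%q. fx (r * cos th) (r * sin th) * fst q + fy (r * cos th) (r * sin th) * snd q))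
   (at (fst (r, th) * cos (snd (r, th)), fst (r, th) * sin (snd (r, th))))"
  using assms unfolding has_partials_def case_prod_unfold by simp
 show ?thesis
  unfolding case_prod_unfold
  by (rule has_derivative_eq_rhs[OF has_derivative_compose[OF inner outer, unfolded fst_conv snd_conv]])
   (auto simp: algebra_simps)
qed

lemma has_partials_radial:
 assumes "has_partials f fx fy"
 shows "((%r. f (r * cos th) (r * sin th)) has_real_derivative
  fx (r * cos th) (r * sin th) * cos th + fy (r * cos th) (r * sin th) * sin th) (at r)"
proof -
 have "((%r. (%x y. f x y) (r * cos th) (r * sin th)) has_real_derivative
  fx (r * cos th) (r * sin th) * cos th + fy (r * cos th) (r * sin th) * sin th) (at r)"
  by (rule real_derivative_along_curve2[where a = "%r. r * cos th" and b = "%r. r * sin th"])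
   (use assms in \<open>auto simp: has_partials_def intro!: derivative_eq_intros\<close>)
 then show ?thesis .
qed

lemma uniform_near_zero:
 fixes F :: "real => real => real => real"
 assumes cont: "continuous_on ({a..b} \<times> {0..2 * pi} \<times> {0..e1}) (%(r, th, eps). F r th eps)"
  and per: "!!r th eps. F r (th + 2 * pi) eps = F r th eps" and "eta > 0" "e1 > 0"
 obtains e0 where "0 < e0" "e0 <= e1" "!!r th eps. r \<in> {a..b} ==> 0 <= eps ==> eps <= e0 ==> \<bar>F r th eps - F r th 0\<bar> < eta"
proof -
 have "compact ({a..b} \<times> {0..2 * pi} \<times> {0..e1})" by (intro compact_Times compact_Icc)
 from compact_uniformly_continuous[OF cont this] \<open>eta > 0\<close>
 obtain d where d: "d > 0" "!!p q. p \<in> {a..b} \<times> {0..2 * pi} \<times> {0..e1} ==> q \<in> {a..b} \<times> {0..2 * pi} \<times> {0..e1} ==>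
   dist q p < d ==> dist ((%(r, th, eps). F r th eps) q) ((%(r, th, eps). F r th eps) p) < eta"
  unfolding uniformly_continuous_on_def by metis
 show thesis
 proof (rule that[of "min e1 (d / 2)"])
  fix r th eps :: real assume r: "r \<in> {a..b}" and e: "0 <= eps" "eps <= min e1 (d / 2)"
  define t where "t = th + of_int (- \<lfloor>th / (2 * pi)\<rfloor>) * (2 * pi)"
  have "(%th. (F r th eps, F r th 0, th - th)) (th + of_int (- \<lfloor>th / (2 * pi)\<rfloor>) * (2 * pi)) = (%th. (F r th eps, F r th 0, th - th)) th"
   by (rule periodic_int_shift) (simp add: per)
  then have F: "F r t eps = F r th eps" "F r t 0 = F r th 0" by (simp_all add: t_def)
  have "of_int \<lfloor>th / (2 * pi)\<rfloor> <= th / (2 * pi)" "th / (2 * pi) <= of_int \<lfloor>th / (2 * pi)\<rfloor> + 1" by linarith+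
  then have "of_int \<lfloor>th / (2 * pi)\<rfloor> * (2 * pi) <= th" "th <= (of_int \<lfloor>th / (2 * pi)\<rfloor> + 1) * (2 * pi)"
   by (simp_all only: pos_le_divide_eq[of "2 * pi"] pos_divide_le_eq[of "2 * pi"] pi_gt_zero zero_less_mult_iff zero_less_numeral simp_thms)
  then have t: "t \<in> {0..2 * pi}" unfolding t_def by (auto simp: algebra_simps)
  have "dist (r, t, eps) (r, t, 0) < d" using e d(1) by (simp add: dist_Pair_Pair dist_real_def)
  from d(2)[OF _ _ this] show "\<bar>F r th eps - F r th 0\<bar> < eta"
   using r t e \<open>e1 > 0\<close> F by (simp add: dist_real_def)
 qed (use d \<open>e1 > 0\<close> in auto)
qed


text \<open>The almost first integral serves as radial coordinate.  Its derivative along the flow is, up to a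
  smaller error, a multiple of \<open>H\<close>, so near a simple zero the radial equation is strictly monotone and
  has a periodic solution that is unique in a strip.\<close>

theorem averaged_cycle:
 fixes f g V Vx Vy :: "nat => real => real => real" and H H' :: "real => real"
 assumes f: "!!n. poly2 (f n)" "f 0 = (%x y. - y)" and g: "!!n. poly2 (g n)" "g 0 = (%x y. x)"
  and V: "!!n. has_partials (V n) (Vx n) (Vy n)" "!!n. poly2 (V n)" "!!n. poly2 (Vx n)" "!!n. poly2 (Vy n)"
  and V0: "V 0 = (%x y. x\<^sup>2 + y\<^sup>2)"
  and lie: "!!n x y. n < m ==> (\<Sum>i\<le>n. f i x y * Vx (n - i) x y + g i x y * Vy (n - i) x y) = 0"
  and lie_m: "!!x y. (\<Sum>i\<le>m. f i x y * Vx (m - i) x y + g i x y * Vy (m - i) x y) = H (x\<^sup>2 + y\<^sup>2)"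
  and H: "!!s. (H has_real_derivative H' s) (at s)" "continuous_on UNIV H'" "poly2 (%x y. H (x\<^sup>2 + y\<^sup>2))"
  and s0: "s0 > 0" "H s0 = 0" "H' s0 ~= 0" and dlt: "dlt > 0"
 obtains e0 where "e0 > 0" "!!eps. 0 < eps ==> eps < e0 ==>
  EX r1 r2 x y T. 0 < r1 & r1 < r2 & s0 - dlt < r1\<^sup>2 & r2\<^sup>2 < s0 + dlt &
  (let F = (%x y. \<Sum>n\<le>m. eps ^ n * f n x y); G = (%x y. \<Sum>n\<le>m. eps ^ n * g n x y) in
   plane_solution F G x y & T > 0 & (ALL t. x (t + T) = x t & y (t + T) = y t) &
   (ALL t. (x t)\<^sup>2 + (y t)\<^sup>2 \<in> {r1\<^sup>2<..<r2\<^sup>2}) & (EX t. x t ~= x 0) &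
   (ALL u v. plane_solution F G u v --> (ALL t. (u t)\<^sup>2 + (v t)\<^sup>2 \<in> {r1\<^sup>2..r2\<^sup>2}) -->
    (EX c. ALL t. u t = x (t + c) & v t = y (t + c))))"
proof -
 define sg where "sg = - sgn (H' s0)"
 have sg: "sg = 1 | sg = - 1" "sg * H' s0 < 0" using s0(3) by (auto simp: sg_def sgn_if)
 \<comment> \<open>a radius interval around the simple zero on which H decreases in the sign-adjusted sense\<close>
 obtain q where q: "q > 0" "!!s. \<bar>s - s0\<bar> < q ==> - sg * H' s > \<bar>H' s0\<bar> / 2"
 proof -
  have "isCont H' s0" using H(2) by (simp add: continuous_on_eq_continuous_at)
  then obtain q where q: "q > 0" "!!s. \<bar>s - s0\<bar> < q ==> \<bar>H' s - H' s0\<bar> < \<bar>H' s0\<bar> / 2"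
   using s0(3) unfolding continuous_at_eps_delta dist_real_def by (metis half_gt_zero zero_less_abs_iff)
  show thesis
  proof (rule that[OF q(1)])
   fix s assume "\<bar>s - s0\<bar> < q"
   from q(2)[OF this] show "- sg * H' s > \<bar>H' s0\<bar> / 2"
    using s0(3) by (auto simp: sg_def sgn_if abs_if split: if_splits)
  qed
 qed
 define w where "w = min (min q dlt) s0 / 2"
 have w: "w > 0" "w < q" "w < dlt" "w < s0" using q(1) dlt s0(1) by (auto simp: w_def min_def)
 define r1 where "r1 = sqrt (s0 - w)"
 define r2 where "r2 = sqrt (s0 + w)"
 have r12: "0 < r1" "r1 < r2" "r1\<^sup>2 = s0 - w" "r2\<^sup>2 = s0 + w" using w s0(1) by (auto simp: r1_def r2_def)
 have rsq: "r\<^sup>2 \<in> {s0 - w..s0 + w}" if "r \<in> {r1..r2}" for r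
  using that r12 power_mono[of r1 r 2] power_mono[of r r2 2] by auto
 define \<kappa> where "\<kappa> = \<bar>H' s0\<bar>"
 have \<kappa>: "\<kappa> > 0" using s0(3) by (simp add: \<kappa>_def)
 have H'neg: "- sg * H' s > \<kappa> / 2" if "s \<in> {s0 - w..s0 + w}" for s
  unfolding \<kappa>_def by (rule q(2)) (use that w in auto)
 have Hmono: "sg * (H a - H b) >= \<kappa> / 2 * (b - a)" if ab: "s0 - w <= a" "a <= b" "b <= s0 + w" for a b
 proof -
  have "sg * H b + \<kappa> / 2 * b <= sg * H a + \<kappa> / 2 * a"
  proof (rule DERIV_nonpos_imp_nonincreasing[OF ab(2)])
   fix s assume "a <= s" "s <= b"
   then show "EX y. ((%s. sg * H s + \<kappa> / 2 * s) has_real_derivative y) (at s) & y <= 0"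
    using H'neg[of s] ab by (intro exI[of _ "sg * H' s + \<kappa> / 2"]) (auto intro!: derivative_eq_intros H)
  qed
  then show ?thesis by (simp add: algebra_simps diff_divide_distrib)
 qed
 \<comment> \<open>partial derivatives of the remainder\<close>
 define e where "e i j = (%x y. f i x y * Vx j x y + g i x y * Vy j x y)" for i j
 have ep: "poly2 (e i j)" for i j unfolding e_def by (intro poly2_intros f g V)
 obtain ex ey where e': "!!i j. poly2 (ex i j)" "!!i j. poly2 (ey i j)" "!!i j. has_partials (e i j) (ex i j) (ey i j)"
  using poly2_partials[OF ep] by metis
 obtain fx fy where f': "!!i. poly2 (fx i)" "!!i. poly2 (fy i)" "!!i. has_partials (f i) (fx i) (fy i)"
  using poly2_partials[OF f(1)] by metis
 obtain gx gy where g': "!!i. poly2 (gx i)" "!!i. poly2 (gy i)" "!!i. has_partials (g i) (gx i) (gy i)"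
  using poly2_partials[OF g(1)] by metis
 define J where "J = {(i, j). i <= m & j <= m & m < i + j}"
 have J: "finite J" by (rule finite_subset[of _ "{..m} \<times> {..m}"]) (auto simp: J_def)
 define N where "N eps x y = H (x\<^sup>2 + y\<^sup>2) + eps * (\<Sum>(i, j)\<in>J. eps ^ (i + j - m - 1) * e i j x y)" for eps x y
 define Nx where "Nx eps x y = H' (x\<^sup>2 + y\<^sup>2) * (2 * x) + eps * (\<Sum>(i, j)\<in>J. eps ^ (i + j - m - 1) * ex i j x y)" for eps x y
 define Ny where "Ny eps x y = H' (x\<^sup>2 + y\<^sup>2) * (2 * y) + eps * (\<Sum>(i, j)\<in>J. eps ^ (i + j - m - 1) * ey i j x y)" for eps x y
 define F where "F eps x y = (\<Sum>n\<le>m. eps ^ n * f n x y)" for eps x y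
 define G where "G eps x y = (\<Sum>n\<le>m. eps ^ n * g n x y)" for eps x y
 define Fx where "Fx eps x y = (\<Sum>n\<le>m. eps ^ n * fx n x y)" for eps x y
 define Fy where "Fy eps x y = (\<Sum>n\<le>m. eps ^ n * fy n x y)" for eps x y
 define Gx where "Gx eps x y = (\<Sum>n\<le>m. eps ^ n * gx n x y)" for eps x y
 define Gy where "Gy eps x y = (\<Sum>n\<le>m. eps ^ n * gy n x y)" for eps x y
 define W where "W eps x y = (\<Sum>n\<le>m. eps ^ n * V n x y)" for eps x y
 define Wx where "Wx eps x y = (\<Sum>n\<le>m. eps ^ n * Vx n x y)" for eps x y
 define Wy where "Wy eps x y = (\<Sum>n\<le>m. eps ^ n * Vy n x y)" for eps x y
 have scaled: "has_partials (%x y. c * h x y) (%x y. c * hx x y) (%x y. c * hy x y)" if "has_partials h hx hy" for c h hx hy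
  using has_partials_mult[OF has_partials_const that, of c] by simp
 have partials: "has_partials (F eps) (Fx eps) (Fy eps)" "has_partials (G eps) (Gx eps) (Gy eps)" "has_partials (W eps) (Wx eps) (Wy eps)" for eps
  unfolding F_def Fx_def Fy_def G_def Gx_def Gy_def W_def Wx_def Wy_def
  by (intro has_partials_sum scaled f' g' V)+
 have "has_partials (%x y. H (x\<^sup>2 + y\<^sup>2)) (%x y. H' (x\<^sup>2 + y\<^sup>2) * (2 * x)) (%x y. H' (x\<^sup>2 + y\<^sup>2) * (2 * y))"
  unfolding has_partials_def
 proof (intro allI)
  fix x y :: real
  have "((%p. (fst p)\<^sup>2 + (snd p)\<^sup>2) has_derivative (%q. 2 * x * fst q + 2 * y * snd q)) (at (x, y))"
   by (auto intro!: derivative_eq_intros simp: algebra_simps)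
  moreover have "(H has_derivative (%h. H' (x\<^sup>2 + y\<^sup>2) * h)) (at ((fst (x, y))\<^sup>2 + (snd (x, y))\<^sup>2))"
   using H(1) by (simp add: has_field_derivative_def)
  ultimately have "((%p. H ((fst p)\<^sup>2 + (snd p)\<^sup>2)) has_derivative (%q. H' (x\<^sup>2 + y\<^sup>2) * (2 * x * fst q + 2 * y * snd q))) (at (x, y))"
   by (rule has_derivative_compose)
  then show "((%(x, y). H (x\<^sup>2 + y\<^sup>2)) has_derivative (%(h, k). H' (x\<^sup>2 + y\<^sup>2) * (2 * x) * h + H' (x\<^sup>2 + y\<^sup>2) * (2 * y) * k)) (at (x, y))"
   unfolding case_prod_unfold by (rule has_derivative_eq_rhs) (auto simp: algebra_simps)
 qed
 then have N_part: "has_partials (N eps) (Nx eps) (Ny eps)" for eps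
  unfolding N_def Nx_def Ny_def case_prod_unfold
  by (intro has_partials_add scaled has_partials_sum e')
 \<comment> \<open>the derivative of the level function along the field\<close>
 have rate: "F eps x y * Wx eps x y + G eps x y * Wy eps x y = eps ^ m * N eps x y" for eps x y
 proof -
  have "F eps x y * Wx eps x y + G eps x y * Wy eps x y = (\<Sum>i\<le>m. \<Sum>j\<le>m. eps ^ (i + j) * e i j x y)"
   unfolding F_def G_def Wx_def Wy_def sum_product e_def
   by (simp add: sum.distrib[symmetric] power_add algebra_simps)
  also have "... = (\<Sum>(i, j)\<in>{..m} \<times> {..m}. eps ^ (i + j) * e i j x y)" by (simp add: sum.cartesian_product)
  also have "{..m} \<times> {..m} = {(i, j). i + j <= m} \<union> J" by (auto simp: J_def)
  also have "(\<Sum>(i, j)\<in>{(i, j). i + j <= m} \<union> J. eps ^ (i + j) * e i j x y)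
   = (\<Sum>(i, j)\<in>{(i, j). i + j <= m}. eps ^ (i + j) * e i j x y) + (\<Sum>(i, j)\<in>J. eps ^ (i + j) * e i j x y)"
   by (rule sum.union_disjoint[OF _ J])
    (auto simp: J_def intro: finite_subset[of _ "{..m} \<times> {..m}"])
  also have "(\<Sum>(i, j)\<in>{(i, j). i + j <= m}. eps ^ (i + j) * e i j x y) = (\<Sum>n\<le>m. \<Sum>i\<le>n. eps ^ (i + (n - i)) * e i (n - i) x y)"
   by (rule sum.triangle_reindex_eq)
  also have "... = (\<Sum>n\<le>m. eps ^ n * (\<Sum>i\<le>n. e i (n - i) x y))"
   by (intro sum.cong refl) (simp add: sum_distrib_left)
  also have "... = (\<Sum>n\<in>{m}. eps ^ n * (\<Sum>i\<le>n. e i (n - i) x y))"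
   by (rule sum.mono_neutral_right) (use lie in \<open>auto simp: e_def\<close>)
  also have "... = eps ^ m * H (x\<^sup>2 + y\<^sup>2)" using lie_m by (simp add: e_def)
  also have "(\<Sum>(i, j)\<in>J. eps ^ (i + j) * e i j x y) = eps ^ m * (eps * (\<Sum>(i, j)\<in>J. eps ^ (i + j - m - 1) * e i j x y))"
   unfolding sum_distrib_left
  proof (intro sum.cong refl, clarify)
   fix i j assume "(i, j) \<in> J"
   then have "i + j = m + (Suc (i + j - m - 1))" by (auto simp: J_def)
   then have "eps ^ (i + j) = eps ^ m * (eps * eps ^ (i + j - m - 1))" by (metis power_Suc power_add)
   then show "eps ^ (i + j) * e i j x y = eps ^ m * (eps * (eps ^ (i + j - m - 1) * e i j x y))" by (simp add: mult_ac)
  qed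
  finally show ?thesis by (simp add: N_def algebra_simps)
 qed
 \<comment> \<open>polar coordinates\<close>
 define \<Theta> where "\<Theta> r th eps = angular_speed (F eps) (G eps) r th" for r th eps
 define pr where "pr h r th eps = h eps (r * cos th) (r * sin th)" for h :: "real => real => real => real" and r th eps :: real
 define Wr where "Wr r th eps = pr Wx r th eps * cos th + pr Wy r th eps * sin th" for r th eps
 define Wt where "Wt r th eps = r * (pr Wy r th eps * cos th - pr Wx r th eps * sin th)" for r th eps
 define Nr where "Nr r th eps = pr Nx r th eps * cos th + pr Ny r th eps * sin th" for r th eps
 define \<Theta>r where "\<Theta>r r th eps = (((pr Gx r th eps * cos th + pr Gy r th eps * sin th) * cos th
   - (pr Fx r th eps * cos th + pr Fy r th eps * sin th) * sin th) * r
   - (pr G r th eps * cos th - pr F r th eps * sin th)) / (r * r)" for r th eps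
 define Dq where "Dq r th eps = (Nr r th eps * \<Theta> r th eps - pr N r th eps * \<Theta>r r th eps) / (\<Theta> r th eps * \<Theta> r th eps)" for r th eps
 have pr_cont: "continuous_on S (%(r, th, eps). pr h r th eps)" if "!!S a b (c :: real \<times> real \<times> real => real). continuous_on S a ==> continuous_on S b ==> continuous_on S c ==> continuous_on S (%t. h (c t) (a t) (b t))" for h S
  unfolding pr_def case_prod_unfold by (intro that continuous_intros)
 have H'c: "continuous_on S (%t. H' (a t))" if "continuous_on S a" for S and a :: "real \<times> real \<times> real => real"
  by (rule continuous_on_compose2[OF H(2) that]) auto
 have Hc: "continuous_on S (%t. H (a t))" if "continuous_on S a" for S and a :: "real \<times> real \<times> real => real"
  by (rule continuous_on_compose2[OF _ that, of UNIV]) (auto intro: DERIV_continuous_on H(1))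
 note pc = poly2_continuous_on[OF f(1)] poly2_continuous_on[OF g(1)] poly2_continuous_on[OF V(2)] poly2_continuous_on[OF V(3)]
  poly2_continuous_on[OF V(4)] poly2_continuous_on[OF f'(1)] poly2_continuous_on[OF f'(2)] poly2_continuous_on[OF g'(1)]
  poly2_continuous_on[OF g'(2)] poly2_continuous_on[OF ep] poly2_continuous_on[OF e'(1)] poly2_continuous_on[OF e'(2)]
 have cF: "continuous_on S (%(r, th, eps). pr F r th eps)" "continuous_on S (%(r, th, eps). pr G r th eps)"
  "continuous_on S (%(r, th, eps). pr Fx r th eps)" "continuous_on S (%(r, th, eps). pr Fy r th eps)"
  "continuous_on S (%(r, th, eps). pr Gx r th eps)" "continuous_on S (%(r, th, eps). pr Gy r th eps)"
  "continuous_on S (%(r, th, eps). pr W r th eps)" "continuous_on S (%(r, th, eps). pr Wx r th eps)" "continuous_on S (%(r, th, eps). pr Wy r th eps)"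
  "continuous_on S (%(r, th, eps). pr N r th eps)" "continuous_on S (%(r, th, eps). pr Nx r th eps)" "continuous_on S (%(r, th, eps). pr Ny r th eps)" for S
  by (rule pr_cont; unfold F_def G_def Fx_def Fy_def Gx_def Gy_def W_def Wx_def Wy_def N_def Nx_def Ny_def case_prod_unfold;
    intro continuous_intros pc H'c Hc; assumption)+
 note cF' = cF[unfolded case_prod_unfold]
 have \<Theta>_eq: "\<Theta> r th eps = (pr G r th eps * cos th - pr F r th eps * sin th) / r" for r th eps
  by (simp add: \<Theta>_def angular_speed_def pr_def)
 have c\<Theta>: "continuous_on S (%(r, th, eps). \<Theta> r th eps)" if "S \<subseteq> {r1..r2} \<times> UNIV" for S
  unfolding \<Theta>_eq case_prod_unfold by (intro continuous_intros cF') (use that r12 in force)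
 have at0: "F 0 = (%x y. - y)" "G 0 = (%x y. x)" "W 0 = (%x y. x\<^sup>2 + y\<^sup>2)"
  unfolding F_def G_def W_def by (simp_all add: power_0_left if_distrib[of "%z. z * _"] sum.If_cases f(2) g(2) V0 cong: if_cong)
 have N0: "N 0 x y = H (x\<^sup>2 + y\<^sup>2)" "Nx 0 x y = H' (x\<^sup>2 + y\<^sup>2) * (2 * x)" "Ny 0 x y = H' (x\<^sup>2 + y\<^sup>2) * (2 * y)" for x y
  by (simp_all add: N_def Nx_def Ny_def)
 have polar_sq: "(r * cos th)\<^sup>2 + (r * sin th)\<^sup>2 = r\<^sup>2" for r th :: real
  by (simp add: power_mult_distrib distrib_left[symmetric])
 have cs: "cos th * cos th + sin th * sin th = 1" for th :: real
  by (metis power2_eq_square sin_cos_squared_add2)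
 have \<Theta>0: "\<Theta> r th 0 = 1" if "r ~= 0" for r th
 proof -
  have "\<Theta> r th 0 = (r * (cos th * cos th + sin th * sin th)) / r"
   unfolding \<Theta>_def angular_speed_def at0 by (rule arg_cong[of _ _ "%z. z / r"]) algebra
  then show ?thesis using that unfolding cs by simp
 qed
 have W_uniq: "Wx 0 x y = 2 * x" "Wy 0 x y = 2 * y" for x y
 proof -
  have "((%p. (fst p)\<^sup>2 + (snd p)\<^sup>2) has_derivative (%q. 2 * x * fst q + 2 * y * snd q)) (at (x, y))"
   by (auto intro!: derivative_eq_intros simp: algebra_simps)
  moreover have "((%p. (fst p)\<^sup>2 + (snd p)\<^sup>2) has_derivative (%q. Wx 0 x y * fst q + Wy 0 x y * snd q)) (at (x, y))"
   using partials(3)[of 0] unfolding has_partials_def at0 case_prod_unfold by blast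
  ultimately have "(%q. 2 * x * fst q + 2 * y * snd q) = (%q. Wx 0 x y * fst q + Wy 0 x y * snd q)"
   by (rule has_derivative_unique)
  from fun_cong[OF this, of "(1, 0)"] fun_cong[OF this, of "(0, 1)"]
  show "Wx 0 x y = 2 * x" "Wy 0 x y = 2 * y" by simp_all
 qed
 have per: "pr h r (th + 2 * pi) eps = pr h r th eps" "cos (th + 2 * pi) = cos th" "sin (th + 2 * pi) = sin th" for h r th eps
  by (simp_all add: pr_def)
 \<comment> \<open>uniform smallness\<close>
 have per\<Theta>: "\<Theta> r (th + 2 * pi) eps = \<Theta> r th eps" for r th eps
  unfolding \<Theta>_eq per by simp
 have "continuous_on ({r1..r2} \<times> {0..2 * pi} \<times> {0..1}) (%(r, th, eps). \<Theta> r th eps)" by (rule c\<Theta>) auto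
 from uniform_near_zero[OF this per\<Theta>, of "1 / 2"]
 obtain e1 where e1: "0 < e1" "!!r th eps. r \<in> {r1..r2} ==> 0 <= eps ==> eps <= e1 ==> \<bar>\<Theta> r th eps - \<Theta> r th 0\<bar> < 1 / 2"
  by (metis half_gt_zero zero_less_one)
 have \<Theta>_half: "\<Theta> r th eps >= 1 / 2" if "r \<in> {r1..r2}" "0 <= eps" "eps <= e1" for r th eps
 proof -
  have "r ~= 0" using that r12 by auto
  then have "\<bar>\<Theta> r th eps - 1\<bar> < 1 / 2" using e1(2)[OF that, of th] \<Theta>0[of r th] by simp
  then show ?thesis by arith
 qed
 let ?box = "{r1..r2} \<times> {0..2 * pi} \<times> {0..e1}"
 have \<Theta>nz: "\<Theta> (fst p) (fst (snd p)) (snd (snd p)) ~= 0" "fst p ~= 0" if "p \<in> ?box" for p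
  using \<Theta>_half[of "fst p" "snd (snd p)" "fst (snd p)"] that r12 by auto
 have cNr: "continuous_on ?box (%(r, th, eps). Wr r th eps)" "continuous_on ?box (%(r, th, eps). Dq r th eps)"
  "continuous_on ?box (%(r, th, eps). pr N r th eps / \<Theta> r th eps)"
  unfolding Wr_def Dq_def Nr_def \<Theta>r_def case_prod_unfold
  by (intro continuous_intros cF' c\<Theta>[unfolded case_prod_unfold]; use \<Theta>nz in force)+
 have Wr0: "Wr r th 0 = 2 * r" for r th
 proof -
  have "Wr r th 0 = 2 * r * (cos th * cos th + sin th * sin th)"
   unfolding Wr_def pr_def W_uniq by algebra
  then show ?thesis unfolding cs by simp
 qed
 have \<Theta>r0: "\<Theta>r r th 0 = 0" for r th
 proof -
  have Fx0: "Fx 0 x y = 0" "Fy 0 x y = -1" "Gx 0 x y = 1" "Gy 0 x y = 0" for x y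
  proof -
   have "((%p. - snd p) has_derivative (%q. - snd q)) (at (x, y))" "((%p. fst p) has_derivative (%q. fst q)) (at (x, y))"
    by (auto intro!: derivative_eq_intros)
   moreover have "((%p. - snd p) has_derivative (%q. Fx 0 x y * fst q + Fy 0 x y * snd q)) (at (x, y))"
    "((%p. fst p) has_derivative (%q. Gx 0 x y * fst q + Gy 0 x y * snd q)) (at (x, y))"
    using partials(1,2)[of 0] unfolding has_partials_def at0 case_prod_unfold by blast+
   ultimately have "(%q. - snd q) = (%q. Fx 0 x y * fst q + Fy 0 x y * snd q)" "(%q. fst q) = (%q. Gx 0 x y * fst q + Gy 0 x y * snd q)"
    using has_derivative_unique by blast+
   from fun_cong[OF this(1), of "(1, 0)"] fun_cong[OF this(1), of "(0, 1)"] fun_cong[OF this(2), of "(1, 0)"] fun_cong[OF this(2), of "(0, 1)"]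
   show "Fx 0 x y = 0" "Fy 0 x y = -1" "Gx 0 x y = 1" "Gy 0 x y = 0" by simp_all
  qed
  show ?thesis unfolding \<Theta>r_def pr_def Fx0 at0
   by (rule divide_eq_0_iff[THEN iffD2], rule disjI1) algebra
 qed
 have Dq0: "Dq r th 0 = 2 * r * H' (r\<^sup>2)" if "r ~= 0" for r th
 proof -
  have "Nr r th 0 = 2 * r * H' (r\<^sup>2) * (cos th * cos th + sin th * sin th)"
   unfolding Nr_def pr_def N0 polar_sq by algebra
  then show ?thesis using \<Theta>0[OF that] \<Theta>r0 unfolding Dq_def cs by simp
 qed
 have perW: "Wr r (th + 2 * pi) eps = Wr r th eps" "Dq r (th + 2 * pi) eps = Dq r th eps"
  "pr N r (th + 2 * pi) eps / \<Theta> r (th + 2 * pi) eps = pr N r th eps / \<Theta> r th eps" for r th eps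
  unfolding Wr_def Dq_def Nr_def \<Theta>r_def \<Theta>_eq per by simp_all
 define eta where "eta = min (w / 4) (\<kappa> * w / 16)"
 have eta: "eta > 0" "eta <= w / 4" "eta <= \<kappa> * w / 16" using w \<kappa> by (auto simp: eta_def)
 obtain ea where ea: "0 < ea" "ea <= e1" "!!r th eps. r \<in> {r1..r2} ==> 0 <= eps ==> eps <= ea ==> \<bar>Wr r th eps - Wr r th 0\<bar> < r1"
  using uniform_near_zero[OF cNr(1) perW(1) r12(1) e1(1)] by blast
 have "0 < \<kappa> * r1 / 2" using \<kappa> r12 by simp
 from uniform_near_zero[OF cNr(2) perW(2) this e1(1)]
 obtain eb where eb: "0 < eb" "eb <= e1" "!!r th eps. r \<in> {r1..r2} ==> 0 <= eps ==> eps <= eb ==> \<bar>Dq r th eps - Dq r th 0\<bar> < \<kappa> * r1 / 2"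
  by blast
 obtain ec where ec: "0 < ec" "ec <= e1" "!!r th eps. r \<in> {r1..r2} ==> 0 <= eps ==> eps <= ec ==>
   \<bar>pr N r th eps / \<Theta> r th eps - pr N r th 0 / \<Theta> r th 0\<bar> < eta"
  using uniform_near_zero[OF cNr(3) perW(3) eta(1) e1(1)] by blast
 obtain ed where ed: "0 < ed" "ed <= e1" "!!r th eps. r \<in> {r1..r2} ==> 0 <= eps ==> eps <= ed ==> \<bar>pr W r th eps - pr W r th 0\<bar> < eta"
  using uniform_near_zero[OF cF(7) per(1)[of W] eta(1) e1(1), of r1 r2] by blast
 obtain B where B: "!!s. s \<in> {s0 - w..s0 + w} ==> \<bar>H' s\<bar> <= B"
 proof -
  have "compact (H' ` {s0 - w..s0 + w})" by (intro compact_continuous_image continuous_on_subset[OF H(2)]) auto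
  from compact_imp_bounded[OF this] obtain a where "\<forall>s\<in>{s0 - w..s0 + w}. \<bar>H' s\<bar> <= a" by (auto simp: bounded_iff)
  then show thesis by (intro that[of a]) blast
 qed
 show thesis
 proof (rule that[of "min (min ea eb) (min ec ed)"])
  show "0 < min (min ea eb) (min ec ed)" using ea eb ec ed by simp
  fix eps assume eps: "0 < eps" "eps < min (min ea eb) (min ec ed)"
  have E: "eps ^ m > 0" using eps by simp
  have \<Theta>h: "1 / 2 <= \<Theta> r th eps" if "r \<in> {r1..r2}" for r th using \<Theta>_half[OF that, of eps th] eps ea by simp
  define R where "R r th = radial_speed (F eps) (G eps) r th / angular_speed (F eps) (G eps) r th" for r th
  define D where "D r th = eps ^ m * (pr N r th eps / \<Theta> r th eps)" for r th
  interpret strip: monotone_strip "%r th. pr W r th eps" "%r th. Wr r th eps" "%r th. Wt r th eps" R D r1 r2 r1 "2 * r2 + r1"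
   "eps ^ m * (\<kappa> * r1 / 2)" "eps ^ m * (2 * r2 * B + \<kappa> * r1 / 2)" "2 * pi" sg
  proof
   show "r1 < r2" "(0::real) < 2 * pi" "0 < r1" "sg = 1 | sg = - 1" using r12 sg by auto
   show "0 < eps ^ m * (\<kappa> * r1 / 2)" using E \<kappa> r12 by simp
   fix r th assume r: "r \<in> {r1..r2}"
   have r0: "r > 0" using r r12 by auto
   show "((%(r, th). pr W r th eps) has_derivative (%(h, k). Wr r th eps * h + Wt r th eps * k)) (at (r, th))"
    using has_partials_polar[OF partials(3)[of eps], of r th] unfolding Wr_def Wt_def pr_def .
   have "\<bar>Wr r th eps - 2 * r\<bar> < r1" using ea(3)[OF r, of eps th] eps unfolding Wr0 by simp
   then show "r1 <= Wr r th eps & Wr r th eps <= 2 * r2 + r1" using r by (auto simp: abs_less_iff)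
   have \<Theta>d: "((%r. \<Theta> r th eps) has_real_derivative \<Theta>r r th eps) (at r)"
   proof -
    have dF: "((%r. pr F r th eps) has_real_derivative pr Fx r th eps * cos th + pr Fy r th eps * sin th) (at r)"
     unfolding pr_def by (rule has_partials_radial[OF partials(1)])
    have dG: "((%r. pr G r th eps) has_real_derivative pr Gx r th eps * cos th + pr Gy r th eps * sin th) (at r)"
     unfolding pr_def by (rule has_partials_radial[OF partials(2)])
    have "((%r. pr G r th eps * cos th - pr F r th eps * sin th) has_real_derivative
     (pr Gx r th eps * cos th + pr Gy r th eps * sin th) * cos th - (pr Fx r th eps * cos th + pr Fy r th eps * sin th) * sin th) (at r)"
     by (intro DERIV_diff DERIV_cmult_right dF dG)
    from DERIV_divide[OF this DERIV_ident] r0 show ?thesis unfolding \<Theta>_eq \<Theta>r_def by simp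
   qed
   have dN: "((%r. pr N r th eps) has_real_derivative Nr r th eps) (at r)"
    unfolding pr_def Nr_def by (rule has_partials_radial[OF N_part])
   have \<Theta>0': "\<Theta> r th eps ~= 0" using \<Theta>h[OF r, of th] by auto
   have dD: "((%r. D r th) has_real_derivative eps ^ m * Dq r th eps) (at r)"
    unfolding D_def Dq_def by (intro DERIV_cmult DERIV_divide dN \<Theta>d \<Theta>0')
   have d1: "\<bar>Dq r th eps - 2 * r * H' (r\<^sup>2)\<bar> < \<kappa> * r1 / 2"
    using eb(3)[OF r, of eps th] eps Dq0[of r th] r0 by simp
   have "\<kappa> / 2 * (2 * r) <= - sg * H' (r\<^sup>2) * (2 * r)" using H'neg[OF rsq[OF r]] r0 by (intro mult_right_mono) auto
   moreover have "\<kappa> * r1 <= \<kappa> * r" using r \<kappa> by (intro mult_left_mono) auto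
   ultimately have d2: "\<kappa> * r1 <= - sg * (2 * r * H' (r\<^sup>2))" by (simp add: algebra_simps)
   have "- sg * H' (r\<^sup>2) <= \<bar>H' (r\<^sup>2)\<bar>" using sg(1) by auto
   then have "2 * r * (- sg * H' (r\<^sup>2)) <= 2 * r * \<bar>H' (r\<^sup>2)\<bar>" by (rule mult_left_mono) (use r0 in simp)
   moreover have "2 * r * (- sg * H' (r\<^sup>2)) = - sg * (2 * r * H' (r\<^sup>2))" by (simp only: mult_ac)
   ultimately have "- sg * (2 * r * H' (r\<^sup>2)) <= 2 * r * \<bar>H' (r\<^sup>2)\<bar>" by (simp only:)
   also have "... <= 2 * r2 * B" using B[OF rsq[OF r]] r r0 by (intro mult_mono) auto
   finally have d3: "- sg * (2 * r * H' (r\<^sup>2)) <= 2 * r2 * B" .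
   have d4: "- sg * Dq r th eps >= \<kappa> * r1 / 2 & - sg * Dq r th eps <= 2 * r2 * B + \<kappa> * r1 / 2"
   proof -
    have "\<bar>sg * Dq r th eps - sg * (2 * r * H' (r\<^sup>2))\<bar> = \<bar>Dq r th eps - 2 * r * H' (r\<^sup>2)\<bar>"
     using sg(1) by (auto simp: abs_minus_commute)
    then have "\<bar>sg * Dq r th eps - sg * (2 * r * H' (r\<^sup>2))\<bar> < \<kappa> * r1 / 2" using d1 by simp
    then show ?thesis using d2 d3 unfolding abs_less_iff minus_mult_left[symmetric] by linarith
   qed
   have "eps ^ m * (\<kappa> * r1 / 2) <= eps ^ m * (- sg * Dq r th eps)" "eps ^ m * (- sg * Dq r th eps) <= eps ^ m * (2 * r2 * B + \<kappa> * r1 / 2)"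
    using d4 E by (intro mult_left_mono; simp)+
   then show "EX d. ((%r. D r th) has_real_derivative d) (at r) & eps ^ m * (\<kappa> * r1 / 2) <= - sg * d & - sg * d <= eps ^ m * (2 * r2 * B + \<kappa> * r1 / 2)"
    using dD by (intro exI[of _ "eps ^ m * Dq r th eps"]) (simp add: mult_ac)
   have "Wt r th eps * \<Theta> r th eps = (pr Wy r th eps * cos th - pr Wx r th eps * sin th) * (pr G r th eps * cos th - pr F r th eps * sin th)"
    unfolding Wt_def \<Theta>_eq using r0 by simp
   then have "Wr r th eps * radial_speed (F eps) (G eps) r th + Wt r th eps * \<Theta> r th eps
    = (pr F r th eps * pr Wx r th eps + pr G r th eps * pr Wy r th eps) * (cos th * cos th + sin th * sin th)"
    unfolding Wr_def radial_speed_def pr_def[symmetric] by algebra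
   also have "... = eps ^ m * pr N r th eps" unfolding cs pr_def rate by simp
   finally have "(Wr r th eps * radial_speed (F eps) (G eps) r th + Wt r th eps * \<Theta> r th eps) / \<Theta> r th eps = D r th"
    unfolding D_def by simp
   then show "Wr r th eps * R r th + Wt r th eps = D r th"
    using \<Theta>0' unfolding R_def \<Theta>_def[symmetric] by (simp add: add_divide_distrib)
  next
   show "continuous_on ({r1..r2} \<times> UNIV) (%(r, th). D r th)"
   proof -
    have "continuous_on ({r1..r2} \<times> UNIV \<times> {eps}) (%p. eps ^ m * (pr N (fst p) (fst (snd p)) (snd (snd p)) / \<Theta> (fst p) (fst (snd p)) (snd (snd p))))"
    proof (intro continuous_intros cF' c\<Theta>[unfolded case_prod_unfold] ballI)
     show "{r1..r2} \<times> UNIV \<times> {eps} \<subseteq> {r1..r2} \<times> UNIV" by auto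
     fix p assume "p \<in> {r1..r2} \<times> (UNIV :: real set) \<times> {eps}"
     then have "fst p \<in> {r1..r2}" "snd (snd p) = eps" by auto
     then show "\<Theta> (fst p) (fst (snd p)) (snd (snd p)) ~= 0" using \<Theta>h[of "fst p" "fst (snd p)"] by auto
    qed
    from continuous_on_compose2[OF this, of "{r1..r2} \<times> UNIV" "%p. (fst p, snd p, eps)"]
    show ?thesis unfolding D_def case_prod_unfold by (force intro!: continuous_intros)
   qed
   show "pr W r (th + 2 * pi) eps = pr W r th eps" "D r (th + 2 * pi) = D r th" for r th
    unfolding D_def per perW per\<Theta> by simp_all
  qed
  have Wclose: "\<bar>pr W r th eps - r\<^sup>2\<bar> < eta" if "r \<in> {r1..r2}" for r th
   using ed(3)[OF that, of eps th] eps unfolding pr_def at0 polar_sq by simp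
  have Nclose: "\<bar>pr N r th eps / \<Theta> r th eps - H (r\<^sup>2)\<bar> < eta" if "r \<in> {r1..r2}" for r th
  proof -
   have "r ~= 0" using that r12(1) by auto
   from ec(3)[OF that, of eps th] eps show ?thesis unfolding \<Theta>0[OF \<open>r ~= 0\<close>] pr_def N0 polar_sq by simp
  qed
  have sgD: "sg * D r th >= 0" if "r \<in> {r1..r2}" "r\<^sup>2 <= s0 - w / 4" for r th
  proof -
   have "\<kappa> / 2 * (s0 - r\<^sup>2) <= sg * (H (r\<^sup>2) - H s0)" using rsq[OF that(1)] w that by (intro Hmono) auto
   moreover have "\<kappa> / 2 * (w / 4) <= \<kappa> / 2 * (s0 - r\<^sup>2)" using that \<kappa> by (intro mult_left_mono) auto
   ultimately have "sg * H (r\<^sup>2) >= \<kappa> * w / 8" using s0 by simp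
   moreover have "\<bar>sg * (pr N r th eps / \<Theta> r th eps) - sg * H (r\<^sup>2)\<bar> < eta"
    using Nclose[OF that(1), of th] sg(1) by (auto simp: abs_minus_commute)
   moreover have "\<kappa> * w > 0" using \<kappa> w by simp
   ultimately have "sg * (pr N r th eps / \<Theta> r th eps) >= 0" using eta by (simp add: abs_less_iff)
   from mult_nonneg_nonneg[OF less_imp_le[OF E] this]
   have "eps ^ m * (sg * (pr N r th eps / \<Theta> r th eps)) >= 0" .
   moreover have "sg * D r th = eps ^ m * (sg * (pr N r th eps / \<Theta> r th eps))" unfolding D_def by (rule mult.left_commute)
   ultimately show ?thesis by (simp only:)
  qed
  have sgD': "sg * D r th <= 0" if "r \<in> {r1..r2}" "r\<^sup>2 >= s0 + w / 4" for r th
  proof -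
   have "\<kappa> / 2 * (r\<^sup>2 - s0) <= sg * (H s0 - H (r\<^sup>2))" using rsq[OF that(1)] w that by (intro Hmono) auto
   moreover have "\<kappa> / 2 * (w / 4) <= \<kappa> / 2 * (r\<^sup>2 - s0)" using that \<kappa> by (intro mult_left_mono) auto
   ultimately have "sg * H (r\<^sup>2) <= - \<kappa> * w / 8" using s0 by simp
   moreover have "\<bar>sg * (pr N r th eps / \<Theta> r th eps) - sg * H (r\<^sup>2)\<bar> < eta"
    using Nclose[OF that(1), of th] sg(1) by (auto simp: abs_minus_commute)
   moreover have "\<kappa> * w > 0" using \<kappa> w by simp
   ultimately have "sg * (pr N r th eps / \<Theta> r th eps) <= 0" using eta by (simp add: abs_less_iff)
   from mult_nonneg_nonpos[OF less_imp_le[OF E] this]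
   have "eps ^ m * (sg * (pr N r th eps / \<Theta> r th eps)) <= 0" .
   moreover have "sg * D r th = eps ^ m * (sg * (pr N r th eps / \<Theta> r th eps))" unfolding D_def by (rule mult.left_commute)
   ultimately show ?thesis by (simp only:)
  qed
  obtain rho where rho: "!!th. rho th \<in> {r1<..<r2}" "!!th. rho (th + 2 * pi) = rho th"
   "!!th. (rho has_real_derivative R (rho th) th) (at th)"
  proof (rule strip.periodic_solution_exists[where ?s1.0 = "s0 - w / 2" and ?s2.0 = "s0 + w / 2"])
   show "s0 - w / 2 <= s0 + w / 2" using w by simp
   show "pr W r1 th eps < s0 - w / 2" for th using Wclose[of r1 th] r12 eta w by (simp add: abs_less_iff)
   show "s0 + w / 2 < pr W r2 th eps" for th using Wclose[of r2 th] r12 eta w by (simp add: abs_less_iff)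
   fix r th assume r: "r \<in> {r1..r2}"
   show "sg * D r th >= 0" if "pr W r th eps = s0 - w / 2"
    by (rule sgD[OF r]) (use Wclose[OF r, of th] that eta in \<open>simp add: abs_less_iff\<close>)
   show "sg * D r th <= 0" if "pr W r th eps = s0 + w / 2"
    by (rule sgD'[OF r]) (use Wclose[OF r, of th] that eta in \<open>simp add: abs_less_iff\<close>)
  qed (rule that)
  have Fc: "continuous_on UNIV (%(x, y). F eps x y)" "continuous_on UNIV (%(x, y). G eps x y)"
   unfolding F_def G_def case_prod_unfold by (intro continuous_intros pc)+
  have uniq: "rho' = rho" if "!!th. rho' th \<in> {r1..r2}" "!!th. (rho' has_real_derivative R (rho' th) th) (at th)" for rho'
  proof
   show "rho' th = rho th" for th
    by (rule strip.bounded_solution_unique[OF that _ rho(3)]) (use rho(1) in \<open>auto simp: less_imp_le\<close>)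
  qed
  obtain x y T where xy: "plane_solution (F eps) (G eps) x y" "T > 0" "!!t. x (t + T) = x t" "!!t. y (t + T) = y t"
   "!!t. (x t)\<^sup>2 + (y t)\<^sup>2 \<in> {r1\<^sup>2<..<r2\<^sup>2}" "EX t. x t ~= x 0"
   "ALL u v. plane_solution (F eps) (G eps) u v --> (ALL t. (u t)\<^sup>2 + (v t)\<^sup>2 \<in> {r1\<^sup>2..r2\<^sup>2}) --> (EX c. ALL t. u t = x (t + c) & v t = y (t + c))"
  proof (rule plane_cycle_of_polar_solution[OF r12(1) rho(1,2) rho(3)[unfolded R_def] _ _ Fc])
   show "(0::real) < 1 / 2" by simp
   show "1 / 2 <= angular_speed (F eps) (G eps) r th" if "r \<in> {r1..r2}" for r th
    using \<Theta>h[OF that, of th] unfolding \<Theta>_def .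
   show "rho' = rho" if "!!th. rho' th \<in> {r1..r2}"
     "!!th. (rho' has_real_derivative radial_speed (F eps) (G eps) (rho' th) th / angular_speed (F eps) (G eps) (rho' th) th) (at th)" for rho'
    by (rule uniq[unfolded R_def]) (rule that)+
  qed (rule that)
  have "s0 - dlt < r1\<^sup>2" "r2\<^sup>2 < s0 + dlt" unfolding r12 using w by auto
  with xy r12(1,2) show "EX r1 r2 x y T. 0 < r1 & r1 < r2 & s0 - dlt < r1\<^sup>2 & r2\<^sup>2 < s0 + dlt &
  (let F = (%x y. \<Sum>n\<le>m. eps ^ n * f n x y); G = (%x y. \<Sum>n\<le>m. eps ^ n * g n x y) in
   plane_solution F G x y & T > 0 & (ALL t. x (t + T) = x t & y (t + T) = y t) &
   (ALL t. (x t)\<^sup>2 + (y t)\<^sup>2 \<in> {r1\<^sup>2<..<r2\<^sup>2}) & (EX t. x t ~= x 0) &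
   (ALL u v. plane_solution F G u v --> (ALL t. (u t)\<^sup>2 + (v t)\<^sup>2 \<in> {r1\<^sup>2..r2\<^sup>2}) -->
    (EX c. ALL t. u t = x (t + c) & v t = y (t + c))))"
   unfolding Let_def F_def[symmetric] G_def[symmetric]
   by (intro exI[of _ r1] exI[of _ r2] exI[of _ x] exI[of _ y] exI[of _ T]) blast
 qed
qed

section \<open>Limit cycles on attracting and invariant surfaces\<close>

definition bipoly :: "(real \<times> nat \<times> nat) list => real => real => real" where
 "bipoly l x y = (\<Sum>(c, a, b)\<leftarrow>l. c * x ^ a * y ^ b)"

definition bipoly_dx :: "(real \<times> nat \<times> nat) list => real => real => real" where
 "bipoly_dx l x y = (\<Sum>(c, a, b)\<leftarrow>l. c * (of_nat a * x ^ (a - 1)) * y ^ b)"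

definition bipoly_dy :: "(real \<times> nat \<times> nat) list => real => real => real" where
 "bipoly_dy l x y = (\<Sum>(c, a, b)\<leftarrow>l. c * x ^ a * (of_nat b * y ^ (b - 1)))"

lemma poly2_bipoly: "poly2 (bipoly l)" "poly2 (bipoly_dx l)" "poly2 (bipoly_dy l)"
 unfolding bipoly_def[abs_def] bipoly_dx_def[abs_def] bipoly_dy_def[abs_def]
 by (induction l) (auto intro!: poly2_intros)

lemma has_partials_bipoly: "has_partials (bipoly l) (bipoly_dx l) (bipoly_dy l)"
proof (induction l)
 case Nil
 then show ?case by (simp add: bipoly_def[abs_def] bipoly_dx_def[abs_def] bipoly_dy_def[abs_def] has_partials_const)
next
 case (Cons u l)
 obtain c a b where u: "u = (c, a, b)" by (cases u)
 have "has_partials (%x y. c * x ^ a * y ^ b) (%x y. c * (of_nat a * x ^ (a - 1)) * y ^ b) (%x y. c * x ^ a * (of_nat b * y ^ (b - 1)))"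
  unfolding has_partials_def case_prod_unfold
  by (intro allI) (auto intro!: derivative_eq_intros simp: algebra_simps)
 from has_partials_add[OF this Cons] show ?case
  by (simp add: u bipoly_def[abs_def] bipoly_dx_def[abs_def] bipoly_dy_def[abs_def])
qed

definition term_at :: "'a list list => nat => 'a list" where
 "term_at Ls n = (if n < length Ls then Ls ! n else [])"

definition plane_family :: "(real \<times> nat \<times> nat) list list => real => real => real => real" where
 "plane_family Fs eps x y = (\<Sum>n\<le>length Fs - 1. eps ^ n * bipoly (term_at Fs n) x y)"

lemma bounded_exponential_zero:
 fixes d :: "real => real"
 assumes "!!t. (d has_real_derivative - m * d t) (at t)" "m ~= 0" "!!t. \<bar>d t\<bar> <= B"
 shows "d t = 0"
proof -
 have d: "d s = d 0 * exp (- m * s)" for s using linear_decay_zero[of d "- m" s] assms(1) by simp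
 have "\<bar>d 0\<bar> * (1 + a) <= B" if "a >= 0" for a
 proof -
  have "\<bar>d 0\<bar> * (1 + a) <= \<bar>d 0\<bar> * exp a" by (intro mult_left_mono) auto
  also have "... = \<bar>d (- a / m)\<bar>" unfolding d[of "- a / m"] using assms(2) by (simp add: abs_mult)
  also have "... <= B" by (rule assms)
  finally show ?thesis .
 qed
 note bound = this
 have "d 0 = 0"
 proof (rule ccontr)
  assume "d 0 ~= 0"
  then have "\<bar>d 0\<bar> * (1 + B / \<bar>d 0\<bar>) = \<bar>d 0\<bar> + B" by (simp add: distrib_left)
  moreover have "B >= 0" using assms(3)[of 0] by linarith
  ultimately show False using bound[of "B / \<bar>d 0\<bar>"] \<open>d 0 ~= 0\<close> by simp
 qed
 then show ?thesis using d[of t] by simp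
qed

lemma bounded_dissipation_zero:
 fixes w w' :: "real => real"
 assumes w: "!!t. (w has_real_derivative w' t) (at t)" and pos: "!!t. 0 <= w t" "!!t. w t <= B"
  and sg: "sg = 1 | sg = - (1::real)" and c: "c > 0" "!!t. sg * w' t <= - c * w t"
 shows "w t = 0"
proof -
 define u where "u s = w (sg * s) * exp (c * s)" for s
 have ud: "(u has_real_derivative (sg * w' (sg * s) + c * w (sg * s)) * exp (c * s)) (at s)" for s
 proof -
  have "((%s. w (sg * s)) has_real_derivative w' (sg * s) * sg) (at s)"
   by (rule DERIV_chain2[OF w]) (auto intro!: derivative_eq_intros)
  then show ?thesis unfolding u_def by (auto intro!: derivative_eq_intros simp: algebra_simps)
 qed
 have dec: "u t <= u s" if "s <= t" for s t
 proof (rule DERIV_nonpos_imp_nonincreasing[OF that])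
  fix x
  have "(sg * w' (sg * x) + c * w (sg * x)) * exp (c * x) <= 0"
   using c(2)[of "sg * x"] by (intro mult_nonpos_nonneg) auto
  then show "EX y. (u has_real_derivative y) (at x) & y <= 0" using ud by blast
 qed
 have sg2: "sg * (sg * t) = t" using sg by auto
 have bound: "w t * (1 + a) <= B" if a: "a >= 0" for a
 proof -
  have "w t * exp (c * (sg * t)) <= w (sg * (sg * t - a / c)) * exp (c * (sg * t - a / c))"
   using dec[of "sg * t - a / c" "sg * t"] a c(1) unfolding u_def sg2 by simp
  also have "... <= B * exp (c * (sg * t - a / c))" by (intro mult_right_mono pos) simp
  also have "exp (c * (sg * t - a / c)) = exp (- a) * exp (c * (sg * t))"
   using c(1) by (simp add: exp_add[symmetric] right_diff_distrib)
  finally have "w t <= B * exp (- a)" by simp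
  then have "w t * exp a <= B" by (simp add: exp_minus field_simps)
  moreover have "w t * (1 + a) <= w t * exp a" using pos by (intro mult_left_mono) auto
  ultimately show ?thesis by simp
 qed
 show ?thesis
 proof (rule ccontr)
  assume "w t ~= 0"
  then have "w t > 0" using pos(1)[of t] by simp
  moreover have "B >= 0" using pos(1)[of t] pos(2)[of t] by simp
  moreover from \<open>w t > 0\<close> have "w t * (1 + B / w t) = w t + B" by (simp add: distrib_left)
  ultimately show False using bound[of "B / w t"] by simp
 qed
qed

lemma solution_on_components:
 "solution_on X UNIV ph \<longleftrightarrow> (ALL t. ((%t. fst (ph t)) has_real_derivative fst (X (ph t))) (at t)
  & ((%t. fst (snd (ph t))) has_real_derivative fst (snd (X (ph t)))) (at t)
  & ((%t. snd (snd (ph t))) has_real_derivative snd (snd (X (ph t)))) (at t))"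
proof
 assume s: "solution_on X UNIV ph"
 show "ALL t. ((%t. fst (ph t)) has_real_derivative fst (X (ph t))) (at t)
  & ((%t. fst (snd (ph t))) has_real_derivative fst (snd (X (ph t)))) (at t)
  & ((%t. snd (snd (ph t))) has_real_derivative snd (snd (X (ph t)))) (at t)"
 proof
  fix t
  have d: "(ph has_vector_derivative X (ph t)) (at t)" using s by (simp add: solution_on_def)
  have d1: "((%t. fst (ph t)) has_vector_derivative fst (X (ph t))) (at t)"
   by (rule bounded_linear.has_vector_derivative[OF bounded_linear_fst d])
  have d2: "((%t. snd (ph t)) has_vector_derivative snd (X (ph t))) (at t)"
   by (rule bounded_linear.has_vector_derivative[OF bounded_linear_snd d])
  show "((%t. fst (ph t)) has_real_derivative fst (X (ph t))) (at t)
  & ((%t. fst (snd (ph t))) has_real_derivative fst (snd (X (ph t)))) (at t)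
  & ((%t. snd (snd (ph t))) has_real_derivative snd (snd (X (ph t)))) (at t)"
   using d1 bounded_linear.has_vector_derivative[OF bounded_linear_fst d2] bounded_linear.has_vector_derivative[OF bounded_linear_snd d2]
   by (simp add: has_real_derivative_iff_has_vector_derivative)
 qed
next
 assume s: "ALL t. ((%t. fst (ph t)) has_real_derivative fst (X (ph t))) (at t)
  & ((%t. fst (snd (ph t))) has_real_derivative fst (snd (X (ph t)))) (at t)
  & ((%t. snd (snd (ph t))) has_real_derivative snd (snd (X (ph t)))) (at t)"
 show "solution_on X UNIV ph"
  unfolding solution_on_def
 proof
  fix t
  have "((%t. (fst (ph t), fst (snd (ph t)), snd (snd (ph t)))) has_vector_derivative
   (fst (X (ph t)), fst (snd (X (ph t))), snd (snd (X (ph t))))) (at t)"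
   using s by (intro has_vector_derivative_Pair) (simp_all add: has_real_derivative_iff_has_vector_derivative)
  then show "(ph has_vector_derivative X (ph t)) (at t)" by simp
 qed
qed

lemma limit_cycle_of_plane_cycle:
 fixes X :: "space => space" and c lam eta :: real
 assumes c: "c > 0" and lam: "lam ~= 0"
  and cyc: "plane_solution F G x y" "T > 0" "ALL t. x (t + T) = x t & y (t + T) = y t"
   "ALL t. (x t)\<^sup>2 + (y t)\<^sup>2 \<in> {r1\<^sup>2<..<r2\<^sup>2}" "EX t. x t ~= x 0"
  and uniq: "ALL u v. plane_solution F G u v --> (ALL t. (u t)\<^sup>2 + (v t)\<^sup>2 \<in> {r1\<^sup>2..r2\<^sup>2}) -->
    (EX c. ALL t. u t = x (t + c) & v t = y (t + c))"
  and field: "!!a b z. zinv z ==> X (c * a, c * b, z) = (c * F a b, c * G a b, g (c * a) (c * b) - lam * z)"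
  and z: "!!t. (zs has_real_derivative g (c * x t) (c * y t) - lam * zs t) (at t)" "!!t. zs (t + T) = zs t"
   "!!t. zinv (zs t)" "!!t. \<bar>zs t\<bar> < eta"
  and attract: "!!ph. solution_on X UNIV ph ==>
   (!!t. r1\<^sup>2 <= (fst (ph t) / c)\<^sup>2 + (fst (snd (ph t)) / c)\<^sup>2 & (fst (ph t) / c)\<^sup>2 + (fst (snd (ph t)) / c)\<^sup>2 <= r2\<^sup>2 & \<bar>snd (snd (ph t))\<bar> < eta) ==>
   (!!t. zinv (snd (snd (ph t))))"
 shows "limit_cycle X (range (%t. (c * x t, c * y t, zs t)))"
proof -
 define \<Phi> where "\<Phi> t = (c * x t, c * y t, zs t)" for t
 have xy: "(x has_real_derivative F (x t) (y t)) (at t)" "(y has_real_derivative G (x t) (y t)) (at t)" for t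
  using cyc(1) by (auto simp: plane_solution_def)
 have sol: "solution_on X UNIV \<Phi>"
  unfolding solution_on_components \<Phi>_def field[OF z(3)] fst_conv snd_conv
  using xy z(1) by (auto intro!: derivative_eq_intros)
 have per: "periodic_orbit X (range \<Phi>)"
  unfolding periodic_orbit_def
 proof (rule exI[of _ \<Phi>], rule exI[of _ T], intro conjI)
  show "ALL t. \<Phi> (t + T) = \<Phi> t" using cyc(3) z(2) by (simp add: \<Phi>_def)
  show "EX t. \<Phi> t ~= \<Phi> 0" using cyc(5) c by (auto simp: \<Phi>_def)
  show "solution_on X UNIV \<Phi>" "T > 0" "range \<Phi> = range \<Phi>" using sol cyc(2) by auto
 qed
 define N where "N = {p :: space. r1\<^sup>2 < (fst p / c)\<^sup>2 + (fst (snd p) / c)\<^sup>2 & (fst p / c)\<^sup>2 + (fst (snd p) / c)\<^sup>2 < r2\<^sup>2 & \<bar>snd (snd p)\<bar> < eta}"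
 have "open N" unfolding N_def
  using c by (auto intro!: open_Collect_conj open_Collect_less continuous_intros)
 moreover have "range \<Phi> \<subseteq> N"
  using cyc(4) z(4) c by (auto simp: N_def \<Phi>_def)
 moreover have "Gam' = range \<Phi>" if G': "periodic_orbit X Gam'" "Gam' \<subseteq> N" for Gam'
 proof -
  obtain \<psi> where \<psi>: "solution_on X UNIV \<psi>" "Gam' = range \<psi>" using G'(1) by (auto simp: periodic_orbit_def)
  have inN: "\<psi> t \<in> N" for t using \<psi>(2) G'(2) by auto
  define u where "u t = fst (\<psi> t) / c" for t
  define v where "v t = fst (snd (\<psi> t)) / c" for t
  define w where "w t = snd (snd (\<psi> t))" for t
  have \<psi>_eq: "\<psi> t = (c * u t, c * v t, w t)" for t using c by (simp add: u_def v_def w_def)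
  have uv: "r1\<^sup>2 < (u t)\<^sup>2 + (v t)\<^sup>2" "(u t)\<^sup>2 + (v t)\<^sup>2 < r2\<^sup>2" "\<bar>w t\<bar> < eta" for t
   using inN[of t] by (auto simp: N_def u_def v_def w_def)
  have zi: "zinv (w t)" for t
   unfolding w_def by (rule attract[OF \<psi>(1)]) (use uv in \<open>auto simp: u_def v_def w_def less_imp_le\<close>)
  have X\<psi>: "X (\<psi> t) = (c * F (u t) (v t), c * G (u t) (v t), g (c * u t) (c * v t) - lam * w t)" for t
   unfolding \<psi>_eq by (rule field[OF zi])
  have comp: "((%t. fst (\<psi> t)) has_real_derivative c * F (u t) (v t)) (at t)"
   "((%t. fst (snd (\<psi> t))) has_real_derivative c * G (u t) (v t)) (at t)"
   "((%t. snd (snd (\<psi> t))) has_real_derivative g (c * u t) (c * v t) - lam * w t) (at t)" for t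
   using \<psi>(1) unfolding solution_on_components X\<psi> by auto
  have "plane_solution F G u v"
   unfolding plane_solution_def
  proof
   fix t
   have "((%t. fst (\<psi> t) / c) has_real_derivative c * F (u t) (v t) / c) (at t)"
    "((%t. fst (snd (\<psi> t)) / c) has_real_derivative c * G (u t) (v t) / c) (at t)"
    by (intro DERIV_cdivide comp)+
   then show "(u has_real_derivative F (u t) (v t)) (at t) & (v has_real_derivative G (u t) (v t)) (at t)"
    using c unfolding u_def[abs_def] v_def[abs_def] by simp
  qed
  then obtain s where s: "!!t. u t = x (t + s) & v t = y (t + s)" using uniq uv by (meson atLeastAtMost_iff less_imp_le)
  have wd: "(w has_real_derivative g (c * u t) (c * v t) - lam * w t) (at t)" for t
   using comp(3)[of t] unfolding w_def[abs_def] .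
  have "((%t. w t - zs (t + s)) has_real_derivative - lam * (w t - zs (t + s))) (at t)" for t
  proof -
   have "((%t. zs (t + s)) has_real_derivative g (c * x (t + s)) (c * y (t + s)) - lam * zs (t + s)) (at t)"
    by (rule DERIV_shift[THEN iffD1, OF z(1)])
   from DERIV_diff[OF wd[of t] this] show ?thesis using s[of t] by (simp add: algebra_simps)
  qed
  moreover have "\<bar>w t - zs (t + s)\<bar> <= 2 * eta" for t using uv(3)[of t] z(4)[of "t + s"] by linarith
  ultimately have "w t - zs (t + s) = 0" for t by (rule bounded_exponential_zero[OF _ lam])
  then have "\<psi> t = \<Phi> (t + s)" for t unfolding \<psi>_eq \<Phi>_def using s[of t] by simp
  then have "\<psi> = (%t. \<Phi> (t + s))" by blast
  moreover have "range (%t. \<Phi> (t + s)) = range \<Phi>" by (metis (no_types) diff_add_cancel range_composition surj_def image_image surj_plus_right)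
  ultimately show ?thesis using \<psi>(2) by simp
 qed
 ultimately have "limit_cycle X (range \<Phi>)" using per unfolding limit_cycle_def by blast
 then show ?thesis unfolding \<Phi>_def .
qed

text \<open>Each cycle of the plane family lifts to the space because the height equation has a unique bounded
  solution over it; the same uniqueness turns isolation in the plane into isolation in space.\<close>

lemma cyclicity_of_averaged_zeros:
 fixes Fs Gs Vs :: "(real \<times> nat \<times> nat) list list" and H H' g C
 assumes len: "length Gs = length Fs" "length Vs = length Fs" "Fs ~= []"
  and zero: "bipoly (term_at Fs 0) = (%x y. - y)" "bipoly (term_at Gs 0) = (%x y. x)" "bipoly (term_at Vs 0) = (%x y. x\<^sup>2 + y\<^sup>2)"
  and lie: "!!n x y. n < length Fs - 1 ==> (\<Sum>i\<le>n. bipoly (term_at Fs i) x y * bipoly_dx (term_at Vs (n - i)) x y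
    + bipoly (term_at Gs i) x y * bipoly_dy (term_at Vs (n - i)) x y) = 0"
  and lie_m: "!!x y. (\<Sum>i\<le>length Fs - 1. bipoly (term_at Fs i) x y * bipoly_dx (term_at Vs (length Fs - 1 - i)) x y
    + bipoly (term_at Gs i) x y * bipoly_dy (term_at Vs (length Fs - 1 - i)) x y) = H (x\<^sup>2 + y\<^sup>2)"
  and H: "!!s. (H has_real_derivative H' s) (at s)" "continuous_on UNIV H'" "poly2 (%x y. H (x\<^sup>2 + y\<^sup>2))"
  and S: "finite S" "!!s. s \<in> S ==> 1 <= s & H s = 0 & H' s ~= 0" "!!s s'. s \<in> S ==> s' \<in> S ==> s ~= s' ==> 1 <= \<bar>s - s'\<bar>"
  and lam: "lam ~= 0"
  and small: "!!eta. eta > 0 ==> \<exists>c0>0. ALL c. 0 < c & c < c0 --> \<bar>l0 c\<bar> < eta & (ALL j k l. \<bar>G1 c j k l\<bar> < eta & \<bar>G2 c j k l\<bar> < eta)"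
  and field: "!!c a b z. c > 0 ==> zinv z ==>
   system_field (l0 c) lam (%p. P p + hom_quadratic (G1 c) p) (%p. Q p + hom_quadratic (G2 c) p)
     (%p. R p + hom_quadratic (%_ _ _. 0) p) (c * a, c * b, z)
   = (c * plane_family Fs (c\<^sup>2) a b, c * plane_family Gs (c\<^sup>2) a b, g (c * a) (c * b) - lam * z)"
  and g: "poly2 g" "!!x y. \<bar>g x y\<bar> <= C * (x\<^sup>2 + y\<^sup>2)" and zinv: "(ALL z. zinv z) | (zinv 0 & g = (%_ _. 0))"
  and attract: "eta0 > 0" "!!c ph t. c > 0 ==> solution_on (system_field (l0 c) lam (%p. P p + hom_quadratic (G1 c) p) (%p. Q p + hom_quadratic (G2 c) p)
     (%p. R p + hom_quadratic (%_ _ _. 0) p)) UNIV ph ==>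
    (!!t. \<bar>fst (ph t)\<bar> <= eta0 & \<bar>fst (snd (ph t))\<bar> <= eta0 & \<bar>snd (snd (ph t))\<bar> <= eta0) ==> zinv (snd (snd (ph t)))"
 shows "quadratic_cyclicity_at_least (card S) lam P Q R"
 unfolding quadratic_cyclicity_at_least_def
proof (intro allI impI, elim conjE)
 fix U :: "space set" and eps :: real
 assume U: "open U" "(0, 0, 0) \<in> U" and eps: "eps > 0"
 obtain eta1 where eta1: "eta1 > 0" "!!x y z. (abs x) < eta1 ==> (abs y) < eta1 ==> (abs z) < eta1 ==> (x, y, z) \<in> U"
 proof -
  obtain e where e: "e > 0" "ball (0, 0, 0) e \<subseteq> U" using U by (meson openE)
  show thesis
  proof (rule that[of "e / 3"])
   fix x y z :: real assume xyz: "(abs x) < e / 3" "(abs y) < e / 3" "(abs z) < e / 3"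
   have "dist (0, 0, 0) (x, y, z) = norm (x, y, z)" by (metis dist_0_norm zero_prod_def)
   also have "... <= norm x + norm (y, z)" by (rule norm_Pair_le)
   also have "... <= norm x + (norm y + norm z)" by (intro add_left_mono norm_Pair_le)
   also have "... < e" using xyz by simp
   finally show "(x, y, z) \<in> U" using e(2) by auto
  qed (use e in simp)
 qed
 define eta where "eta = min eta0 eta1"
 have eta: "eta > 0" "eta <= eta0" "eta <= eta1" using eta1(1) attract(1) by (auto simp: eta_def)
 define m where "m = length Fs - 1"
 define f where "f n = bipoly (term_at Fs n)" for n
 define g' where "g' n = bipoly (term_at Gs n)" for n
 define V where "V n = bipoly (term_at Vs n)" for n
 define Vx where "Vx n = bipoly_dx (term_at Vs n)" for n
 define Vy where "Vy n = bipoly_dy (term_at Vs n)" for n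
 have lie0: "(\<Sum>i\<le>n. f i x y * Vx (n - i) x y + g' i x y * Vy (n - i) x y) = 0" if "n < m" for n x y
  using lie[of n x y] that unfolding f_def g'_def Vx_def Vy_def m_def by simp
 have liem: "(\<Sum>i\<le>m. f i x y * Vx (m - i) x y + g' i x y * Vy (m - i) x y) = H (x\<^sup>2 + y\<^sup>2)" for x y
  using lie_m[of x y] unfolding f_def g'_def Vx_def Vy_def m_def by simp
 have fam: "(%x y. \<Sum>n\<le>m. e ^ n * f n x y) = plane_family Fs e" "(%x y. \<Sum>n\<le>m. e ^ n * g' n x y) = plane_family Gs e" for e
  unfolding plane_family_def[abs_def] f_def g'_def m_def len by simp_all
 define cyc where "cyc e s r1 r2 x y T \<longleftrightarrow> 0 < r1 & r1 < r2 & s - 1/2 < r1\<^sup>2 & r2\<^sup>2 < s + 1/2 &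
   plane_solution (plane_family Fs e) (plane_family Gs e) x y & T > 0 & (ALL t. x (t + T) = x t & y (t + T) = y t) &
   (ALL t. (x t)\<^sup>2 + (y t)\<^sup>2 \<in> {r1\<^sup>2<..<r2\<^sup>2}) & (EX t. x t ~= x 0) &
   (ALL u v. plane_solution (plane_family Fs e) (plane_family Gs e) u v --> (ALL t. (u t)\<^sup>2 + (v t)\<^sup>2 \<in> {r1\<^sup>2..r2\<^sup>2}) -->
    (EX c. ALL t. u t = x (t + c) & v t = y (t + c)))" for e s r1 r2 x y and T :: real
 have "\<exists>e0>0. ALL e. 0 < e & e < e0 --> (EX r1 r2 x y T. cyc e s r1 r2 x y T)" if s: "s \<in> S" for s
 proof -
  have s': "s > 0" "H s = 0" "H' s ~= 0" using S(2)[OF s] by auto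
  show ?thesis
   by (rule averaged_cycle[of f g' V Vx Vy m H H' s "1/2"])
    (use lie0 liem H s' zero in \<open>auto simp: f_def g'_def V_def Vx_def Vy_def poly2_bipoly has_partials_bipoly fam[unfolded f_def g'_def] cyc_def Let_def\<close>)
 qed
 then obtain E where E: "!!s. s \<in> S ==> E s > 0" "!!s e. s \<in> S ==> 0 < e ==> e < E s ==> EX r1 r2 x y T. cyc e s r1 r2 x y T"
  by metis
 obtain c0 where c0: "c0 > 0" "!!c. 0 < c ==> c < c0 ==> \<bar>l0 c\<bar> < eps & (ALL j k l. \<bar>G1 c j k l\<bar> < eps & \<bar>G2 c j k l\<bar> < eps)"
  using small[OF eps] by metis
 define M where "M = Max (insert 1 ((%s. s + 1) ` S))"
 have M: "M >= 1" "!!s. s \<in> S ==> s + 1 <= M" using S(1) by (auto simp: M_def)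
 define e1 where "e1 = Min (insert 1 (E ` S))"
 have e1: "e1 > 0" "!!s. s \<in> S ==> e1 <= E s" using S(1) E(1) by (auto simp: e1_def)
 define c where "c = Min {c0 / 2, sqrt (e1 / 2), eta / (2 * M), sqrt (eta * (abs lam) / (2 * ((abs C) + 1) * M))}"
 have posn: "eta * (abs lam) / (2 * ((abs C) + 1) * M) > 0" using eta lam M by simp
 have c: "c > 0" "c < c0" "c\<^sup>2 < e1" "c * M < eta" "((abs C) + 1) * (c\<^sup>2 * M) < eta * (abs lam)"
 proof -
  have le: "c <= c0 / 2" "c <= sqrt (e1 / 2)" "c <= eta / (2 * M)" "c <= sqrt (eta * (abs lam) / (2 * ((abs C) + 1) * M))"
   unfolding c_def by (rule Min_le; simp)+
  show cp: "c > 0" using c0 e1 eta M posn lam by (auto simp: c_def)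
  show "c < c0" using le(1) c0(1) by simp
  have "c\<^sup>2 <= (sqrt (e1 / 2))\<^sup>2" using le(2) cp by (intro power_mono) auto
  then show "c\<^sup>2 < e1" using e1(1) by simp
  have "c * M <= eta / (2 * M) * M" using le(3) M by (intro mult_right_mono) auto
  then show "c * M < eta" using M eta by simp
  have "c\<^sup>2 <= (sqrt (eta * (abs lam) / (2 * ((abs C) + 1) * M)))\<^sup>2" using le(4) cp by (intro power_mono) auto
  then have "c\<^sup>2 <= eta * (abs lam) / (2 * ((abs C) + 1) * M)" using posn by simp
  then have "c\<^sup>2 * (2 * ((abs C) + 1) * M) <= eta * (abs lam)" using M by (simp add: pos_le_divide_eq)
  moreover have "eta * (abs lam) > 0" using eta lam by simp
  ultimately show "((abs C) + 1) * (c\<^sup>2 * M) < eta * (abs lam)" by (simp add: algebra_simps)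
 qed
 let ?X = "system_field (l0 c) lam (%p. P p + hom_quadratic (G1 c) p) (%p. Q p + hom_quadratic (G2 c) p)
     (%p. R p + hom_quadratic (%_ _ _. 0) p)"
 have "EX Gam. limit_cycle ?X Gam & Gam ~= {} & Gam \<subseteq> U & (\<forall>p\<in>Gam. c\<^sup>2 * (s - 1/2) < (fst p)\<^sup>2 + (fst (snd p))\<^sup>2 & (fst p)\<^sup>2 + (fst (snd p))\<^sup>2 < c\<^sup>2 * (s + 1/2))"
  if s: "s \<in> S" for s
 proof -
  have "0 < c\<^sup>2" "c\<^sup>2 < E s" using c e1(2)[OF s] by auto
  from E(2)[OF s this] obtain r1 r2 x y T where cy: "cyc (c\<^sup>2) s r1 r2 x y T" by blast
  have sol: "plane_solution (plane_family Fs (c\<^sup>2)) (plane_family Gs (c\<^sup>2)) x y" and T: "T > 0"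
   and pxy: "ALL t. x (t + T) = x t & y (t + T) = y t" and rg: "ALL t. (x t)\<^sup>2 + (y t)\<^sup>2 \<in> {r1\<^sup>2<..<r2\<^sup>2}"
   and r: "0 < r1" "r1 < r2" "s - 1/2 < r1\<^sup>2" "r2\<^sup>2 < s + 1/2"
   using cy by (auto simp: cyc_def)
  have r2M: "r2\<^sup>2 < M" using r(4) M(2)[OF s] by simp
  have xc: "continuous_on UNIV x" "continuous_on UNIV y"
   using sol unfolding plane_solution_def by (meson DERIV_isCont continuous_at_imp_continuous_on)+
  obtain zs where zs: "!!t. (zs has_real_derivative g (c * x t) (c * y t) - lam * zs t) (at t)" "!!t. zs (t + T) = zs t"
  proof (rule periodic_relaxation_exists[of "%t. g (c * x t) (c * y t)" T lam])
   show "continuous_on UNIV (%t. g (c * x t) (c * y t))"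
    by (intro poly2_continuous_on[OF g(1)] continuous_intros xc)
  qed (use pxy T lam in auto)
  have gb: "\<bar>g (c * x t) (c * y t)\<bar> <= ((abs C) + 1) * (c\<^sup>2 * M)" for t
  proof -
   have "\<bar>g (c * x t) (c * y t)\<bar> <= C * ((c * x t)\<^sup>2 + (c * y t)\<^sup>2)" by (rule g)
   also have "... = C * (c\<^sup>2 * ((x t)\<^sup>2 + (y t)\<^sup>2))" by (simp add: power_mult_distrib algebra_simps)
   also have "... <= ((abs C) + 1) * (c\<^sup>2 * ((x t)\<^sup>2 + (y t)\<^sup>2))" by (intro mult_right_mono) auto
   also have "... <= ((abs C) + 1) * (c\<^sup>2 * M)" using rg r2M by (intro mult_left_mono) (auto intro: less_imp_le less_trans)
   finally show ?thesis .
  qed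
  have zb: "\<bar>zs t\<bar> < eta" for t
  proof -
   have "\<bar>zs t\<bar> <= (((abs C) + 1) * (c\<^sup>2 * M)) / (abs lam)" by (rule periodic_relaxation_abs_le[OF zs(1,2) T lam gb])
   also have "... < eta" using c(5) lam by (simp add: divide_less_eq)
   finally show ?thesis .
  qed
  have zi: "zinv (zs t)" for t
   using zinv
  proof
   assume z0: "zinv 0 & g = (%_ _. 0)"
   have "\<bar>zs t\<bar> <= 0 / (abs lam)" by (rule periodic_relaxation_abs_le[OF zs(1,2) T lam]) (use z0 in simp)
   then show ?thesis using z0 by simp
  qed simp
  have small_comp: "(abs a) < eta & (abs b) < eta" if "(a / c)\<^sup>2 + (b / c)\<^sup>2 <= r2\<^sup>2" for a b
  proof -
   have "(a / c)\<^sup>2 <= M\<^sup>2" "(b / c)\<^sup>2 <= M\<^sup>2"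
    using that r2M M(1) self_le_power[of M 2] zero_le_power2[of "a / c"] zero_le_power2[of "b / c"] by linarith+
   then have "\<bar>a / c\<bar> <= M" "\<bar>b / c\<bar> <= M" using M(1) abs_le_square_iff[of "a / c" M] abs_le_square_iff[of "b / c" M] by auto
   then have "(abs a) <= c * M" "(abs b) <= c * M" using c(1) by (auto simp: abs_divide divide_le_eq mult.commute)
   then show ?thesis using c(4) by simp
  qed
  let ?G = "range (%t. (c * x t, c * y t, zs t))"
  have "limit_cycle ?X ?G"
  proof (rule limit_cycle_of_plane_cycle[where F = "plane_family Fs (c\<^sup>2)" and G = "plane_family Gs (c\<^sup>2)" and T = T
     and ?r1.0 = r1 and ?r2.0 = r2 and lam = lam and zinv = zinv and g = g and eta = eta])
   show "zinv (snd (snd (ph t)))" if h: "solution_on ?X UNIV ph"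
    "!!t. r1\<^sup>2 <= (fst (ph t) / c)\<^sup>2 + (fst (snd (ph t)) / c)\<^sup>2 & (fst (ph t) / c)\<^sup>2 + (fst (snd (ph t)) / c)\<^sup>2 <= r2\<^sup>2 & \<bar>snd (snd (ph t))\<bar> < eta"
    for ph t
   proof (rule attract(2)[OF c(1) h(1)])
    fix t
    have "\<bar>fst (ph t)\<bar> < eta & \<bar>fst (snd (ph t))\<bar> < eta" using h(2)[of t] by (intro small_comp) auto
    then show "\<bar>fst (ph t)\<bar> <= eta0 & \<bar>fst (snd (ph t))\<bar> <= eta0 & \<bar>snd (snd (ph t))\<bar> <= eta0"
     using h(2)[of t] eta(2) by linarith
   qed
   show "?X (c * a, c * b, z) = (c * plane_family Fs (c\<^sup>2) a b, c * plane_family Gs (c\<^sup>2) a b, g (c * a) (c * b) - lam * z)"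
    if "zinv z" for a b z by (rule field[OF c(1) that])
   show "(zs has_real_derivative g (c * x t) (c * y t) - lam * zs t) (at t)" for t by (rule zs)
  qed (use cy c(1) lam zs zi zb in \<open>auto simp: cyc_def\<close>)
  moreover have "?G \<subseteq> U"
  proof (rule image_subsetI)
   fix t
   have "(c * x t / c)\<^sup>2 + (c * y t / c)\<^sup>2 <= r2\<^sup>2" using rg c(1) by (simp add: less_imp_le)
   from small_comp[OF this] show "(c * x t, c * y t, zs t) \<in> U" using zb[of t] eta(3) by (intro eta1(2)) auto
  qed
  moreover have "\<forall>p\<in>?G. c\<^sup>2 * (s - 1/2) < (fst p)\<^sup>2 + (fst (snd p))\<^sup>2 & (fst p)\<^sup>2 + (fst (snd p))\<^sup>2 < c\<^sup>2 * (s + 1/2)"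
  proof (rule ballI, elim imageE, simp only: fst_conv snd_conv)
   fix t
   have "s - 1/2 < (x t)\<^sup>2 + (y t)\<^sup>2" "(x t)\<^sup>2 + (y t)\<^sup>2 < s + 1/2" using rg r by (auto intro: less_trans)
   then have "c\<^sup>2 * (s - 1/2) < c\<^sup>2 * ((x t)\<^sup>2 + (y t)\<^sup>2)" "c\<^sup>2 * ((x t)\<^sup>2 + (y t)\<^sup>2) < c\<^sup>2 * (s + 1/2)"
    using c(1) by (auto intro!: mult_strict_left_mono)
   then show "c\<^sup>2 * (s - 1/2) < (c * x t)\<^sup>2 + (c * y t)\<^sup>2 & (c * x t)\<^sup>2 + (c * y t)\<^sup>2 < c\<^sup>2 * (s + 1/2)"
    by (simp add: power_mult_distrib distrib_left)
  qed
  ultimately show ?thesis by (intro exI[of _ ?G]) auto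
 qed
 then have "\<forall>s\<in>S. EX Gam. limit_cycle ?X Gam & Gam ~= {} & Gam \<subseteq> U & (\<forall>p\<in>Gam. c\<^sup>2 * (s - 1/2) < (fst p)\<^sup>2 + (fst (snd p))\<^sup>2 & (fst p)\<^sup>2 + (fst (snd p))\<^sup>2 < c\<^sup>2 * (s + 1/2))"
  by blast
 from bchoice[OF this] obtain Gam where Gam': "\<forall>s\<in>S. limit_cycle ?X (Gam s) & Gam s ~= {} & Gam s \<subseteq> U & (\<forall>p\<in>Gam s. c\<^sup>2 * (s - 1/2) < (fst p)\<^sup>2 + (fst (snd p))\<^sup>2 & (fst p)\<^sup>2 + (fst (snd p))\<^sup>2 < c\<^sup>2 * (s + 1/2))" ..
 have Gam: "limit_cycle ?X (Gam s)" "Gam s ~= {}" "Gam s \<subseteq> U" if "s \<in> S" for s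
  using bspec[OF Gam' that] by blast+
 have Gam4: "c\<^sup>2 * (s - 1/2) < (fst p)\<^sup>2 + (fst (snd p))\<^sup>2 & (fst p)\<^sup>2 + (fst (snd p))\<^sup>2 < c\<^sup>2 * (s + 1/2)"
  if "s \<in> S" "p \<in> Gam s" for s p
  using bspec[OF Gam' that(1)] that(2) by blast
 have "inj_on Gam S"
 proof (rule inj_onI, rule ccontr)
  fix s s' assume ss: "s \<in> S" "s' \<in> S" "Gam s = Gam s'" "s ~= s'"
  obtain p where p: "p \<in> Gam s" using Gam(2)[OF ss(1)] by blast
  have "c\<^sup>2 * (s - 1/2) < c\<^sup>2 * (s' + 1/2)" "c\<^sup>2 * (s' - 1/2) < c\<^sup>2 * (s + 1/2)"
   using Gam4[OF ss(1) p] Gam4[OF ss(2), of p] p ss(3) by (auto intro: less_trans)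
  then have "s - 1/2 < s' + 1/2" "s' - 1/2 < s + 1/2" using c(1) by (simp_all add: mult_less_cancel_left_pos)
  then show False using S(3)[OF ss(1,2,4)] by linarith
 qed
 then have "card (Gam ` S) = card S" by (rule card_image)
 show "EX lam0 g1 g2 g3. (abs lam0) < eps & (ALL j k l. j + k + l = 2 --> \<bar>g1 j k l\<bar> < eps & \<bar>g2 j k l\<bar> < eps & \<bar>g3 j k l\<bar> < eps)
  & (EX S'. finite S' & card S' = card S & (\<forall>Gam\<in>S'. Gam \<subseteq> U & limit_cycle (system_field lam0 lam (%p. P p + hom_quadratic g1 p)
     (%p. Q p + hom_quadratic g2 p) (%p. R p + hom_quadratic g3 p)) Gam))"
 proof (rule exI[of _ "l0 c"], rule exI[of _ "G1 c"], rule exI[of _ "G2 c"], rule exI[of _ "%_ _ _. 0"], intro conjI)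
  note sm = c0(2)[OF c(1,2)]
  show "\<bar>l0 c\<bar> < eps" using sm by blast
  show "ALL j k l. j + k + l = 2 --> \<bar>G1 c j k l\<bar> < eps & \<bar>G2 c j k l\<bar> < eps & \<bar>0\<bar> < eps"
   using sm eps by simp
  show "EX S'. finite S' & card S' = card S & (\<forall>Gam\<in>S'. Gam \<subseteq> U & limit_cycle ?X Gam)"
  proof (rule exI[of _ "Gam ` S"], intro conjI ballI)
   show "finite (Gam ` S)" using S(1) by simp
   show "card (Gam ` S) = card S" by fact
   fix Gam' assume "Gam' \<in> Gam ` S"
   then obtain s where "s \<in> S" "Gam' = Gam s" by blast
   then show "Gam' \<subseteq> U" "limit_cycle ?X Gam'" using Gam(1,3) by simp_all
  qed
 qed
qed

section \<open>Lower bounds for the cyclicity\<close>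

definition bautin_x :: "(real \<times> nat \<times> nat) list list" where
 "bautin_x = [
  [(- 1, 0, 1)],
  [(3, 2, 0), (4, 1, 1), (- 1, 0, 2)],
  [],
  [(135 / 4, 2, 0), (- 135 / 4, 0, 2)],
  [],
  [(825 / 2, 1, 1)],
  [(- 225 / 2, 1, 0)]]"

definition bautin_y :: "(real \<times> nat \<times> nat) list list" where
 "bautin_y = [
  [(1, 1, 0)],
  [(2, 2, 0), (4, 1, 1), (- 2, 0, 2)],
  [],
  [(135 / 2, 1, 1)],
  [],
  [(- 825 / 4, 2, 0), (825 / 4, 0, 2)],
  [(- 225 / 2, 0, 1)]]"

definition bautin_level :: "(real \<times> nat \<times> nat) list list" where
 "bautin_level = [
  [(1, 2, 0), (1, 0, 2)],
  [(4 / 3, 3, 0), (- 6, 2, 1), (- 4, 1, 2), (- 6, 0, 3)],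
  [(- 15, 4, 0), (40, 1, 3), (15, 0, 4)],
  [(- 112 / 3, 5, 0), (180, 4, 1), (80 / 3, 3, 2), (140, 2, 3), (- 135 / 2, 2, 1), (- 160, 1,
  4), (24, 0, 5), (- 135 / 2, 0, 3)],
  [(11915 / 36, 6, 0), (200, 5, 1), (- 1525 / 12, 4, 2), (- 1485 / 4, 4, 0), (- 1000, 3, 3),
  (- 3725 / 12, 2, 4), (- 80, 1, 5), (540, 1, 3), (- 8765 / 36, 0, 6), (1485 / 4, 0, 4)],
  [(12211 / 9, 7, 0), (- 12715 / 2, 6, 1), (- 7819 / 9, 5, 2), (- 1044, 5, 0), (- 62435 / 6,
  4, 3), (6480, 4, 1), (48745 / 9, 3, 4), (360, 3, 2), (825 / 2, 3, 0), (- 11401 / 2, 2, 5),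
  (6390, 2, 3), (9005 / 3, 1, 6), (- 4860, 1, 4), (825 / 2, 1, 2), (- 13317 / 14, 0, 7), (774,
  0, 5)],
  [(- 1740289 / 108, 8, 0), (- 94439 / 6, 7, 1), (- 636119 / 54, 6, 2), (141495 / 8, 6, 0),
  (81167 / 2, 5, 3), (8775, 5, 1), (83615 / 3, 4, 4), (- 58275 / 8, 4, 2), (- 8325 / 8, 4, 0),
  (269351 / 6, 3, 5), (- 36600, 3, 3), (- 9075 / 2, 3, 1), (1443527 / 54, 2, 6), (- 191475 /
  8, 2, 4), (- 2475, 2, 2), (61667 / 6, 1, 7), (2745, 1, 5), (- 9075 / 2, 1, 3), (1251589 /
  108, 0, 8), (- 91545 / 8, 0, 6), (14925 / 8, 0, 4)]]"

definition rigid_x :: "real => real => real => (real \<times> nat \<times> nat) list list" where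
 "rigid_x p q b = [
  [(- 1, 0, 1)],
  [(p, 3, 0), (q, 2, 1), (1, 2, 0), (- 1 * p, 1, 2), (1, 0, 2)],
  [(- 6 * p * b^2 + 6 * p + 6 * q * b, 1, 1)],
  [(2 * p * b^2 - 2 * p - 2 * q * b, 1, 0)]]"

definition rigid_y :: "real => real => real => (real \<times> nat \<times> nat) list list" where
 "rigid_y p q b = [
  [(1, 1, 0)],
  [(p, 2, 1), (b, 2, 0), (q, 1, 2), (- 1 * p, 0, 3), (b, 0, 2)],
  [(3 * p * b^2 - 3 * p - 3 * q * b, 2, 0), (- 3 * p * b^2 + 3 * p + 3 * q * b, 0, 2)],
  [(2 * p * b^2 - 2 * p - 2 * q * b, 0, 1)]]"

definition rigid_level :: "real => real => real => (real \<times> nat \<times> nat) list list" where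
 "rigid_level p q b = [
  [(1, 2, 0), (1, 0, 2)],
  [(1 / 2 * q, 4, 0), (- 2 * p, 3, 1), (2 * b, 3, 0), (- 2, 2, 1), (- 2 * p, 1, 3), (2 * b, 1,
  2), (- 1 / 2 * q, 0, 4), (- 2, 0, 3)],
  [(- 1 / 2 * p^2 + 1 / 8 * q^2, 6, 0), (- 2 * p * q, 5, 1), (- 4 / 3 * p + 2 / 3 * q * b, 5,
  0), (5 / 2 * p^2 - 5 / 8 * q^2, 4, 2), (- 4 * p * b - 2 * q, 4, 1), (b^2 - 1, 4, 0), (8 / 3
  * p - 4 / 3 * q * b, 3, 2), (- 4 * b, 3, 1), (- 6 * p * b^2 + 6 * p + 6 * q * b, 3, 0), (5 /
  2 * p^2 - 5 / 8 * q^2, 2, 4), (- 8 / 3 * p * b - 4 / 3 * q, 2, 3), (2 * p * q, 1, 5), (4 * p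
  - 2 * q * b, 1, 4), (- 4 * b, 1, 3), (- 6 * p * b^2 + 6 * p + 6 * q * b, 1, 2), (- 1 / 2 *
  p^2 + 1 / 8 * q^2, 0, 6), (4 / 3 * p * b + 2 / 3 * q, 0, 5), (- 1 * b^2 + 1, 0, 4)],
  [(- 3 / 4 * p^2 * q - 1 / 16 * q^3, 8, 0), (3 * p^3 - 3 / 4 * p * q^2, 7, 1), (- 49 / 15 *
  p^2 * b - 8 / 5 * p * q - 17 / 20 * q^2 * b, 7, 0), (9 / 2 * p^2 * q - 5 / 8 * q^3, 6, 2),
  (29 / 3 * p^2 - 4 / 3 * p * q * b - 3 / 4 * q^2, 6, 1), (- 5 / 3 * p * b - 11 / 12 * q * b^2
  - 7 / 4 * q, 6, 0), (p^3 + 15 / 4 * p * q^2, 5, 3), (- 59 / 15 * p^2 * b + 116 / 15 * p * q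
  - 241 / 60 * q^2 * b, 5, 2), (2 * p * b^2 + 26 / 3 * p - 10 / 3 * q * b, 5, 1), (- 6 * p * q
  * b^2 + 6 * p * q + 6 * q^2 * b - 8 / 3 * b^3 - 4 * b, 5, 0), (31 / 3 * p^2 + 8 * p * q * b
  + 29 / 12 * q^2, 4, 3), (25 / 3 * p * b - 41 / 12 * q * b^2 + 3 / 4 * q, 4, 2), (24 * p^2 *
  b^2 - 24 * p^2 - 24 * p * q * b + 4, 4, 1), (- 9 * p * b^3 + 9 * p * b + 9 * q * b^2, 4, 0),
  (p^3 + 15 / 4 * p * q^2, 3, 5), (- 31 / 3 * p^2 * b + 8 * p * q - 29 / 12 * q^2 * b, 3, 4),
  (32 / 3 * p * b^2 + 32 / 3 * p, 3, 3), (- 20 / 3 * b^3 - 4 * b, 3, 2), (18 * p * b^2 - 18 *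
  p - 18 * q * b, 3, 1), (- 9 / 2 * p^2 * q + 5 / 8 * q^3, 2, 6), (59 / 15 * p^2 + 116 / 15 *
  p * q * b + 241 / 60 * q^2, 2, 5), (25 / 3 * p * b - 3 / 4 * q * b^2 + 41 / 12 * q, 2, 4),
  (24 * p^2 * b^2 - 24 * p^2 - 24 * p * q * b + 4 * b^2 + 20 / 3, 2, 3), (3 * p^3 - 3 / 4 * p
  * q^2, 1, 7), (- 29 / 3 * p^2 * b - 4 / 3 * p * q + 3 / 4 * q^2 * b, 1, 6), (26 / 3 * p *
  b^2 + 2 * p + 10 / 3 * q * b, 1, 5), (6 * p * q * b^2 - 6 * p * q - 6 * q^2 * b - 4 * b^3,
  1, 4), (18 * p * b^2 - 18 * p - 18 * q * b, 1, 3), (3 / 4 * p^2 * q + 1 / 16 * q^3, 0, 8),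
  (49 / 15 * p^2 - 8 / 5 * p * q * b + 17 / 20 * q^2, 0, 7), (- 5 / 3 * p * b + 7 / 4 * q *
  b^2 + 11 / 12 * q, 0, 6), (4 * b^2 + 8 / 3, 0, 5), (9 * p * b^3 - 9 * p * b - 9 * q * b^2,
  0, 4)]]"

lemma sum_atMost_values:
 fixes h :: "nat => real"
 shows "sum h {..0} = h 0" "sum h {..Suc 0} = h 0 + h 1" "sum h {..2} = h 0 + h 1 + h 2" "sum h {..3} = h 0 + h 1 + h 2 + h 3"
  "sum h {..4} = h 0 + h 1 + h 2 + h 3 + h 4" "sum h {..5} = h 0 + h 1 + h 2 + h 3 + h 4 + h 5"
  "sum h {..6} = h 0 + h 1 + h 2 + h 3 + h 4 + h 5 + h 6"
 by (simp_all add: eval_nat_numeral)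

definition quad_coeffs :: "real => real => real => coeffs" where
 "quad_coeffs a b c j k l = (if (j, k, l) = (2, 0, 0) then a else if (j, k, l) = (1, 1, 0) then b
  else if (j, k, l) = (0, 2, 0) then c else 0)"

lemma hom_quadratic_quad_coeffs: "hom_quadratic (quad_coeffs a b c) (x, y, z) = a * x\<^sup>2 + b * (x * y) + c * y\<^sup>2"
 unfolding hom_quadratic_expand by (simp add: quad_coeffs_def)

lemma quad_coeffs_small: "(abs a) < eta ==> (abs b) < eta ==> (abs c) < eta ==> \<bar>quad_coeffs a b c j k l\<bar> < eta"
 by (auto simp: quad_coeffs_def)

lemma eventually_small:
 fixes u :: "real => real"
 assumes "isCont u 0" "u 0 = 0" "eta > 0"
 shows "\<forall>\<^sub>F c in at_right 0. \<bar>u c\<bar> < eta"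
proof -
 have "(u \<longlongrightarrow> 0) (at_right 0)" using assms(1,2) by (simp add: isCont_def filterlim_at_split)
 from tendstoD[OF this \<open>eta > 0\<close>] show ?thesis by (simp add: dist_real_def)
qed

lemma eventually_right_interval:
 "(\<forall>\<^sub>F c in at_right (0::real). Q c) \<longleftrightarrow> (\<exists>c0>0. ALL c. 0 < c & c < c0 --> Q c)"
 unfolding eventually_at_right_field by auto

lemmas bipoly_unfold = term_at_def bipoly_def bipoly_dx_def bipoly_dy_def

lemma cyclicity_z_factor:
 assumes lam: "lam ~= 0" and a: "a 2 0 0 = 0" "a 1 1 0 = 0" "a 0 2 0 = (0::real)"
  and P: "P = (%(x, y, z). x * hom_quadratic a (x, y, z))"
  and Q: "Q = (%(x, y, z). y * hom_quadratic a (x, y, z))" and R: "R = hom_quadratic a"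
 shows "quadratic_cyclicity_at_least 3 lam P Q R"
proof -
 have hq: "hom_quadratic a (x, y, z) = z * (a 1 0 1 * x + a 0 1 1 * y + a 0 0 2 * z)" for x y z
  unfolding hom_quadratic_expand a by (simp add: algebra_simps power2_eq_square)
 define l0 :: "real => real" where "l0 c = - 225 / 2 * c ^ 12" for c
 define G1 where "G1 c = quad_coeffs (3 * c + 135 / 4 * c ^ 5) (4 * c + 825 / 2 * c ^ 9) (- c - 135 / 4 * c ^ 5)" for c
 define G2 where "G2 c = quad_coeffs (2 * c - 825 / 4 * c ^ 9) (4 * c + 135 / 2 * c ^ 5) (- 2 * c + 825 / 4 * c ^ 9)" for c
 define H :: "real => real" where "H s = 75 / 2 * (s * (s - 1) * (s - 2) * (s - 3))" for s
 define H' :: "real => real" where "H' s = 75 / 2 * (4 * s ^ 3 - 18 * s\<^sup>2 + 22 * s - 6)" for s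
 let ?X = "%c. system_field (l0 c) lam (%p. P p + hom_quadratic (G1 c) p) (%p. Q p + hom_quadratic (G2 c) p)
     (%p. R p + hom_quadratic (%_ _ _. 0) p)"
 have X: "?X c (x, y, z) = (l0 c * x - y + (x * hom_quadratic a (x, y, z) + hom_quadratic (G1 c) (x, y, z)),
   x + l0 c * y + (y * hom_quadratic a (x, y, z) + hom_quadratic (G2 c) (x, y, z)), - lam * z + hom_quadratic a (x, y, z))" for c x y z
  unfolding system_field_def P Q R by (simp add: hom_quadratic_expand)
 define A where "A = \<bar>a 1 0 1\<bar> + \<bar>a 0 1 1\<bar> + \<bar>a 0 0 2\<bar> + 1"
 have A: "A > 0" by (simp add: A_def add_nonneg_pos)
 define eta0 where "eta0 = (abs lam) / (2 * A)"
 have "quadratic_cyclicity_at_least (card {1, 2, 3 :: real}) lam P Q R"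
 proof (rule cyclicity_of_averaged_zeros[where Fs = bautin_x and Gs = bautin_y and Vs = bautin_level and H = H and H' = H'
    and ?l0.0 = l0 and ?G1.0 = G1 and ?G2.0 = G2 and g = "%_ _. 0" and C = 0 and zinv = "%z. z = 0" and ?eta0.0 = eta0])
  show "length bautin_y = length bautin_x" "length bautin_level = length bautin_x" "bautin_x ~= []"
   by (simp_all add: bautin_x_def bautin_y_def bautin_level_def)
  show "bipoly (term_at bautin_x 0) = (%x y. - y)" "bipoly (term_at bautin_y 0) = (%x y. x)"
   "bipoly (term_at bautin_level 0) = (%x y. x\<^sup>2 + y\<^sup>2)"
   by (simp_all add: fun_eq_iff bipoly_unfold bautin_x_def bautin_y_def bautin_level_def)
  have len: "length bautin_x - 1 = 6" by (simp add: bautin_x_def)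
  fix x y :: real
  show "(\<Sum>i\<le>n. bipoly (term_at bautin_x i) x y * bipoly_dx (term_at bautin_level (n - i)) x y
    + bipoly (term_at bautin_y i) x y * bipoly_dy (term_at bautin_level (n - i)) x y) = 0" if "n < length bautin_x - 1" for n
  proof -
   let ?L = "%n. (\<Sum>i\<le>n. bipoly (term_at bautin_x i) x y * bipoly_dx (term_at bautin_level (n - i)) x y
    + bipoly (term_at bautin_y i) x y * bipoly_dy (term_at bautin_level (n - i)) x y)"
   have E: "?L 0 = 0" "?L (Suc 0) = 0" "?L 2 = 0" "?L 3 = 0" "?L 4 = 0" "?L 5 = 0"
    by ((simp only: sum_atMost_values; simp add: bipoly_unfold bautin_x_def bautin_y_def bautin_level_def; algebra?)+)
   have "n = 0 | n = Suc 0 | n = 2 | n = 3 | n = 4 | n = 5" using that unfolding len by linarith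
   then show ?thesis by (elim disjE) (simp_all only: E)
  qed
  show "(\<Sum>i\<le>length bautin_x - 1. bipoly (term_at bautin_x i) x y * bipoly_dx (term_at bautin_level (length bautin_x - 1 - i)) x y
    + bipoly (term_at bautin_y i) x y * bipoly_dy (term_at bautin_level (length bautin_x - 1 - i)) x y) = H (x\<^sup>2 + y\<^sup>2)"
   unfolding len sum_atMost_values H_def
   by (simp add: bipoly_unfold bautin_x_def bautin_y_def bautin_level_def) algebra
  show "(H has_real_derivative H' s) (at s)" for s
   unfolding H_def H'_def by (auto intro!: derivative_eq_intros simp: algebra_simps power2_eq_square power3_eq_cube)
  show "continuous_on UNIV H'" unfolding H'_def by (intro continuous_intros)
  show "poly2 (%x y. H (x\<^sup>2 + y\<^sup>2))" unfolding H_def by (intro poly2_intros)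
  show "finite {1, 2, 3 :: real}" by simp
  show "1 <= s & H s = 0 & H' s ~= 0" if "s \<in> {1, 2, 3}" for s using that by (auto simp: H_def H'_def power3_eq_cube)
  show "1 <= \<bar>s - s'\<bar>" if "s \<in> {1, 2, 3}" "s' \<in> {1, 2, 3}" "s ~= s'" for s s' :: real using that by auto
  show "lam ~= 0" by fact
  show "\<exists>c0>0. ALL c. 0 < c & c < c0 --> \<bar>l0 c\<bar> < eta & (ALL j k l. \<bar>G1 c j k l\<bar> < eta & \<bar>G2 c j k l\<bar> < eta)" if "eta > 0" for eta
  proof -
   have "\<forall>\<^sub>F c in at_right 0. \<bar>l0 c\<bar> < eta & (\<bar>3 * c + 135 / 4 * c ^ 5\<bar> < eta & \<bar>4 * c + 825 / 2 * c ^ 9\<bar> < eta & \<bar>- c - 135 / 4 * c ^ 5\<bar> < eta)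
    & (\<bar>2 * c - 825 / 4 * c ^ 9\<bar> < eta & \<bar>4 * c + 135 / 2 * c ^ 5\<bar> < eta & \<bar>- 2 * c + 825 / 4 * c ^ 9\<bar> < eta)"
    unfolding l0_def by (intro eventually_conj eventually_small continuous_intros that) simp_all
   then have "\<forall>\<^sub>F c in at_right 0. \<bar>l0 c\<bar> < eta & (ALL j k l. \<bar>G1 c j k l\<bar> < eta & \<bar>G2 c j k l\<bar> < eta)"
    by (rule eventually_mono) (auto simp: G1_def G2_def intro!: quad_coeffs_small)
   then show ?thesis unfolding eventually_right_interval .
  qed
  show "?X c (c * u, c * v, z) = (c * plane_family bautin_x (c\<^sup>2) u v, c * plane_family bautin_y (c\<^sup>2) u v, 0 - lam * z)"
   if "c > 0" "z = 0" for c u v z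
  proof -
   have l2: "length bautin_y - 1 = 6" by (simp add: bautin_y_def)
   have "?X c (c * u, c * v, 0) = (l0 c * (c * u) - c * v + hom_quadratic (G1 c) (c * u, c * v, 0),
    c * u + l0 c * (c * v) + hom_quadratic (G2 c) (c * u, c * v, 0), 0)"
    unfolding X hq by simp
   moreover have "c * plane_family bautin_x (c\<^sup>2) u v = l0 c * (c * u) - c * v + hom_quadratic (G1 c) (c * u, c * v, 0)"
    unfolding plane_family_def len sum_atMost_values l0_def G1_def hom_quadratic_quad_coeffs
    by (simp add: bipoly_unfold bautin_x_def) algebra
   moreover have "c * plane_family bautin_y (c\<^sup>2) u v = c * u + l0 c * (c * v) + hom_quadratic (G2 c) (c * u, c * v, 0)"
    unfolding plane_family_def l2 sum_atMost_values l0_def G2_def hom_quadratic_quad_coeffs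
    by (simp add: bipoly_unfold bautin_y_def) algebra
   ultimately show ?thesis using that(2) by simp
  qed
  show "poly2 (%_ _. 0)" by (rule poly2_const)
  show "\<bar>0\<bar> <= (0::real) * (x\<^sup>2 + y\<^sup>2)" by simp
  show "(ALL z. z = (0::real)) | (0::real) = 0 & (%_ _. 0::real) = (%_ _. 0)" by simp
  show "eta0 > 0" using lam A by (simp add: eta0_def)
  fix c :: real and ph t
  assume sol: "solution_on (?X c) UNIV ph"
   and small: "!!t. \<bar>fst (ph t)\<bar> <= eta0 & \<bar>fst (snd (ph t))\<bar> <= eta0 & \<bar>snd (snd (ph t))\<bar> <= eta0"
  define zet where "zet t = snd (snd (ph t))" for t
  define q where "q t = a 1 0 1 * fst (ph t) + a 0 1 1 * fst (snd (ph t)) + a 0 0 2 * zet t" for t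
  have zetd: "(zet has_real_derivative (q t - lam) * zet t) (at t)" for t
  proof -
   have "(zet has_real_derivative snd (snd (?X c (ph t)))) (at t)"
    using sol unfolding solution_on_components zet_def[abs_def] by blast
   moreover have "snd (snd (?X c (ph t))) = (q t - lam) * zet t"
   proof -
    obtain x' y' z' where "ph t = (x', y', z')" by (cases "ph t")
    then show ?thesis unfolding q_def zet_def by (simp add: X hq algebra_simps)
   qed
   ultimately show ?thesis by simp
  qed
  have q: "\<bar>q t\<bar> <= (abs lam) / 2" for t
  proof -
   have "\<bar>q t\<bar> <= \<bar>a 1 0 1\<bar> * \<bar>fst (ph t)\<bar> + \<bar>a 0 1 1\<bar> * \<bar>fst (snd (ph t))\<bar> + \<bar>a 0 0 2\<bar> * \<bar>zet t\<bar>"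
    unfolding q_def abs_mult[symmetric] by linarith
   also have "... <= \<bar>a 1 0 1\<bar> * eta0 + \<bar>a 0 1 1\<bar> * eta0 + \<bar>a 0 0 2\<bar> * eta0"
    using small[of t] unfolding zet_def by (intro add_mono mult_left_mono) auto
   also have "... <= A * eta0" using \<open>eta0 > 0\<close> by (simp add: A_def algebra_simps)
   also have "... = (abs lam) / 2" using A by (simp add: eta0_def)
   finally show ?thesis .
  qed
  have "(zet t)\<^sup>2 = 0"
  proof (rule bounded_dissipation_zero[where w = "%t. (zet t)\<^sup>2" and w' = "%t. 2 * (q t - lam) * (zet t)\<^sup>2" and B = "eta0\<^sup>2" and sg = "sgn lam" and c = "(abs lam)"])
   show "((%t. (zet t)\<^sup>2) has_real_derivative 2 * (q t - lam) * (zet t)\<^sup>2) (at t)" for t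
    using zetd[of t] by (auto intro!: derivative_eq_intros simp: power2_eq_square)
   show "(zet t)\<^sup>2 <= eta0\<^sup>2" for t using small[of t] unfolding zet_def
    by (subst abs_le_square_iff[symmetric]) (use small[of t] abs_ge_self[of eta0] in linarith)
   show "sgn lam = 1 | sgn lam = - 1" "(abs lam) > 0" using lam by (auto simp: sgn_if)
   show "sgn lam * (2 * (q t - lam) * (zet t)\<^sup>2) <= - (abs lam) * (zet t)\<^sup>2" for t
   proof -
    have "sgn lam * (2 * (q t - lam)) <= - (abs lam)" using q[of t] lam by (auto simp: sgn_if abs_if split: if_splits)
    then have "sgn lam * (2 * (q t - lam)) * (zet t)\<^sup>2 <= - (abs lam) * (zet t)\<^sup>2" by (rule mult_right_mono) simp
    then show ?thesis by (simp add: mult.assoc)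
   qed
  qed simp
  then show "snd (snd (ph t)) = 0" by (simp add: zet_def)
 qed
 then show ?thesis by (simp add: eval_nat_numeral)
qed

lemma cyclicity_planar_rate:
 assumes lam: "lam ~= 0" and a: "a 0 2 0 = - a 2 0 0" "a 1 0 1 = 0" "a 0 1 1 = 0" "a 0 0 2 = (0::real)"
  and nz: "a 2 0 0 ~= 0 | a 1 1 0 ~= 0"
  and P: "P = (%(x, y, z). x * hom_quadratic a (x, y, z))"
  and Q: "Q = (%(x, y, z). y * hom_quadratic a (x, y, z))" and R: "R = hom_quadratic a"
 shows "quadratic_cyclicity_at_least 2 lam P Q R"
proof -
 define p where "p = a 2 0 0"
 define q where "q = a 1 1 0"
 define b :: real where "b = (if p ~= 0 then 0 else 1)"
 define h where "h = p * (1 - b\<^sup>2) + q * b"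
 have h: "h ~= 0" using nz by (auto simp: h_def b_def p_def q_def)
 have hq: "hom_quadratic a (x, y, z) = p * x\<^sup>2 + q * (x * y) - p * y\<^sup>2" for x y z
  unfolding hom_quadratic_expand a p_def q_def by simp
 define l0 :: "real => real" where "l0 c = (2 * p * b\<^sup>2 - 2 * p - 2 * q * b) * c ^ 6" for c
 define G1 where "G1 c = quad_coeffs c ((- 6 * p * b\<^sup>2 + 6 * p + 6 * q * b) * c ^ 3) c" for c
 define G2 where "G2 c = quad_coeffs (b * c + (3 * p * b\<^sup>2 - 3 * p - 3 * q * b) * c ^ 3) 0 (b * c + (- 3 * p * b\<^sup>2 + 3 * p + 3 * q * b) * c ^ 3)" for c
 define H :: "real => real" where "H s = - 2 * h * (s * (s - 1) * (s - 2))" for s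
 define H' :: "real => real" where "H' s = - 2 * h * (3 * s\<^sup>2 - 6 * s + 2)" for s
 let ?X = "%c. system_field (l0 c) lam (%p. P p + hom_quadratic (G1 c) p) (%p. Q p + hom_quadratic (G2 c) p)
     (%p. R p + hom_quadratic (%_ _ _. 0) p)"
 have X: "?X c (x, y, z) = (l0 c * x - y + (x * hom_quadratic a (x, y, z) + hom_quadratic (G1 c) (x, y, z)),
   x + l0 c * y + (y * hom_quadratic a (x, y, z) + hom_quadratic (G2 c) (x, y, z)), - lam * z + hom_quadratic a (x, y, z))" for c x y z
  unfolding system_field_def P Q R by (simp add: hom_quadratic_expand)
 let ?Fs = "rigid_x p q b" and ?Gs = "rigid_y p q b" and ?Vs = "rigid_level p q b"
 have "quadratic_cyclicity_at_least (card {1, 2 :: real}) lam P Q R"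
 proof (rule cyclicity_of_averaged_zeros[where Fs = ?Fs and Gs = ?Gs and Vs = ?Vs and H = H and H' = H'
    and ?l0.0 = l0 and ?G1.0 = G1 and ?G2.0 = G2 and g = "%x y. p * x\<^sup>2 + q * (x * y) - p * y\<^sup>2" and C = "(abs p) + (abs q)" and zinv = "%z. True" and ?eta0.0 = 1])
  show "length ?Gs = length ?Fs" "length ?Vs = length ?Fs" "?Fs ~= []"
   by (simp_all add: rigid_x_def rigid_y_def rigid_level_def)
  show "bipoly (term_at ?Fs 0) = (%x y. - y)" "bipoly (term_at ?Gs 0) = (%x y. x)"
   "bipoly (term_at ?Vs 0) = (%x y. x\<^sup>2 + y\<^sup>2)"
   by (simp_all add: fun_eq_iff bipoly_unfold rigid_x_def rigid_y_def rigid_level_def)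
  have len: "length ?Fs - 1 = 3" "length ?Gs - 1 = 3" by (simp_all add: rigid_x_def rigid_y_def)
  fix x y :: real
  show "(\<Sum>i\<le>n. bipoly (term_at ?Fs i) x y * bipoly_dx (term_at ?Vs (n - i)) x y
    + bipoly (term_at ?Gs i) x y * bipoly_dy (term_at ?Vs (n - i)) x y) = 0" if "n < length ?Fs - 1" for n
  proof -
   let ?L = "%n. (\<Sum>i\<le>n. bipoly (term_at ?Fs i) x y * bipoly_dx (term_at ?Vs (n - i)) x y
    + bipoly (term_at ?Gs i) x y * bipoly_dy (term_at ?Vs (n - i)) x y)"
   have E: "?L 0 = 0" "?L (Suc 0) = 0" "?L 2 = 0"
    by ((simp only: sum_atMost_values; simp add: bipoly_unfold rigid_x_def rigid_y_def rigid_level_def; algebra?)+)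
   have "n = 0 | n = Suc 0 | n = 2" using that unfolding len by linarith
   then show ?thesis by (elim disjE) (simp_all only: E)
  qed
  show "(\<Sum>i\<le>length ?Fs - 1. bipoly (term_at ?Fs i) x y * bipoly_dx (term_at ?Vs (length ?Fs - 1 - i)) x y
    + bipoly (term_at ?Gs i) x y * bipoly_dy (term_at ?Vs (length ?Fs - 1 - i)) x y) = H (x\<^sup>2 + y\<^sup>2)"
   unfolding len sum_atMost_values H_def h_def
   by (simp add: bipoly_unfold rigid_x_def rigid_y_def rigid_level_def) algebra
  show "(H has_real_derivative H' s) (at s)" for s
   unfolding H_def H'_def by (auto intro!: derivative_eq_intros simp: algebra_simps power2_eq_square)
  show "continuous_on UNIV H'" unfolding H'_def by (intro continuous_intros)
  show "poly2 (%x y. H (x\<^sup>2 + y\<^sup>2))" unfolding H_def by (intro poly2_intros)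
  show "finite {1, 2 :: real}" by simp
  show "1 <= s & H s = 0 & H' s ~= 0" if "s \<in> {1, 2}" for s using that h by (auto simp: H_def H'_def)
  show "1 <= \<bar>s - s'\<bar>" if "s \<in> {1, 2}" "s' \<in> {1, 2}" "s ~= s'" for s s' :: real using that by auto
  show "lam ~= 0" by fact
  show "\<exists>c0>0. ALL c. 0 < c & c < c0 --> \<bar>l0 c\<bar> < eta & (ALL j k l. \<bar>G1 c j k l\<bar> < eta & \<bar>G2 c j k l\<bar> < eta)" if "eta > 0" for eta
  proof -
   have "\<forall>\<^sub>F c in at_right 0. \<bar>l0 c\<bar> < eta & ((abs c) < eta & \<bar>(- 6 * p * b\<^sup>2 + 6 * p + 6 * q * b) * c ^ 3\<bar> < eta)
    & (\<bar>b * c + (3 * p * b\<^sup>2 - 3 * p - 3 * q * b) * c ^ 3\<bar> < eta & \<bar>b * c + (- 3 * p * b\<^sup>2 + 3 * p + 3 * q * b) * c ^ 3\<bar> < eta)"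
    unfolding l0_def by (intro eventually_conj eventually_small continuous_intros that) simp_all
   then have "\<forall>\<^sub>F c in at_right 0. \<bar>l0 c\<bar> < eta & (ALL j k l. \<bar>G1 c j k l\<bar> < eta & \<bar>G2 c j k l\<bar> < eta)"
    by (rule eventually_mono) (use that in \<open>auto simp: G1_def G2_def intro!: quad_coeffs_small\<close>)
   then show ?thesis unfolding eventually_right_interval .
  qed
  show "?X c (c * u, c * v, z) = (c * plane_family ?Fs (c\<^sup>2) u v, c * plane_family ?Gs (c\<^sup>2) u v,
    p * (c * u)\<^sup>2 + q * (c * u * (c * v)) - p * (c * v)\<^sup>2 - lam * z)" if "c > 0" for c u v z
  proof -
   have "c * plane_family ?Fs (c\<^sup>2) u v = l0 c * (c * u) - c * v + (c * u * hom_quadratic a (c * u, c * v, z) + hom_quadratic (G1 c) (c * u, c * v, z))"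
    unfolding plane_family_def len sum_atMost_values l0_def G1_def hom_quadratic_quad_coeffs hq
    by (simp add: bipoly_unfold rigid_x_def) algebra
   moreover have "c * plane_family ?Gs (c\<^sup>2) u v = c * u + l0 c * (c * v) + (c * v * hom_quadratic a (c * u, c * v, z) + hom_quadratic (G2 c) (c * u, c * v, z))"
    unfolding plane_family_def len sum_atMost_values l0_def G2_def hom_quadratic_quad_coeffs hq
    by (simp add: bipoly_unfold rigid_y_def) algebra
   ultimately show ?thesis unfolding X hq by simp
  qed
  show "poly2 (%x y. p * x\<^sup>2 + q * (x * y) - p * y\<^sup>2)" by (intro poly2_intros)
  show "\<bar>p * x\<^sup>2 + q * (x * y) - p * y\<^sup>2\<bar> <= ((abs p) + (abs q)) * (x\<^sup>2 + y\<^sup>2)"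
  proof -
   have "\<bar>x\<^sup>2 - y\<^sup>2\<bar> <= x\<^sup>2 + y\<^sup>2" by (simp add: abs_le_iff)
   moreover have "\<bar>x * y\<bar> <= x\<^sup>2 + y\<^sup>2"
    using zero_le_power2[of "x - y"] zero_le_power2[of "x + y"] zero_le_power2[of x] zero_le_power2[of y]
    by (simp add: abs_le_iff power2_diff power2_sum)
   ultimately have "(abs p) * \<bar>x\<^sup>2 - y\<^sup>2\<bar> + (abs q) * \<bar>x * y\<bar> <= (abs p) * (x\<^sup>2 + y\<^sup>2) + (abs q) * (x\<^sup>2 + y\<^sup>2)"
    by (intro add_mono mult_left_mono) auto
   moreover have "p * x\<^sup>2 + q * (x * y) - p * y\<^sup>2 = p * (x\<^sup>2 - y\<^sup>2) + q * (x * y)" by (simp add: algebra_simps)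
   moreover have "\<bar>p * (x\<^sup>2 - y\<^sup>2) + q * (x * y)\<bar> <= (abs p) * \<bar>x\<^sup>2 - y\<^sup>2\<bar> + (abs q) * \<bar>x * y\<bar>"
    unfolding abs_mult[symmetric] by (rule abs_triangle_ineq)
   ultimately show ?thesis by (simp only: distrib_right)
  qed
 qed simp_all
 then show ?thesis by (simp add: eval_nat_numeral)
qed

lemma quadratic_cyclicity_mono:
 assumes "quadratic_cyclicity_at_least n lam P Q R" "m <= n"
 shows "quadratic_cyclicity_at_least m lam P Q R"
 unfolding quadratic_cyclicity_at_least_def
proof (intro allI impI)
 fix U :: "space set" and eps :: real
 assume U: "open U & (0, 0, 0) \<in> U & 0 < eps"
 from mp[OF spec[OF spec[OF assms(1)[unfolded quadratic_cyclicity_at_least_def]]] U]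
 obtain lam0 g1 g2 g3 S where *: "(abs lam0) < eps"
  "ALL j k l. j + k + l = 2 --> \<bar>g1 j k l\<bar> < eps & \<bar>g2 j k l\<bar> < eps & \<bar>g3 j k l\<bar> < eps"
  "finite S" "card S = n" "\<forall>Gam\<in>S. Gam \<subseteq> U & limit_cycle (system_field lam0 lam (%p. P p + hom_quadratic g1 p)
     (%p. Q p + hom_quadratic g2 p) (%p. R p + hom_quadratic g3 p)) Gam"
  by (elim exE conjE) (rule that; assumption)
 obtain S' where S': "S' \<subseteq> S" "card S' = m" "finite S'"
  using obtain_subset_with_card_n[of m S] assms(2) *(4) by metis
 have SS: "\<forall>Gam\<in>S'. Gam \<subseteq> U & limit_cycle (system_field lam0 lam (%p. P p + hom_quadratic g1 p)
     (%p. Q p + hom_quadratic g2 p) (%p. R p + hom_quadratic g3 p)) Gam" using *(5) S'(1) by blast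
 show "EX lam0 g1 g2 g3. (abs lam0) < eps & (ALL j k l. j + k + l = 2 --> \<bar>g1 j k l\<bar> < eps & \<bar>g2 j k l\<bar> < eps & \<bar>g3 j k l\<bar> < eps)
  & (EX S. finite S & card S = m & (\<forall>Gam\<in>S. Gam \<subseteq> U & limit_cycle (system_field lam0 lam (%p. P p + hom_quadratic g1 p)
     (%p. Q p + hom_quadratic g2 p) (%p. R p + hom_quadratic g3 p)) Gam))"
  by (rule exI[of _ lam0], rule exI[of _ g1], rule exI[of _ g2], rule exI[of _ g3],
    (intro conjI exI[of _ S']; (fact * | fact S' | fact SS)))
qed

section \<open>Sufficiency of the centre conditions\<close>

lemma solution_on_derivatives:
 assumes "solution_on X I ph" "t \<in> I"
 shows "((%t. fst (ph t)) has_real_derivative fst (X (ph t))) (at t within I)"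
  "((%t. fst (snd (ph t))) has_real_derivative fst (snd (X (ph t)))) (at t within I)"
  "((%t. snd (snd (ph t))) has_real_derivative snd (snd (X (ph t)))) (at t within I)"
proof -
 have d: "(ph has_vector_derivative X (ph t)) (at t within I)" using assms by (auto simp: solution_on_def)
 note s = bounded_linear.has_vector_derivative[OF bounded_linear_snd d]
 from bounded_linear.has_vector_derivative[OF bounded_linear_fst d]
  bounded_linear.has_vector_derivative[OF bounded_linear_fst s]
  bounded_linear.has_vector_derivative[OF bounded_linear_snd s]
 show "((%t. fst (ph t)) has_real_derivative fst (X (ph t))) (at t within I)"
  "((%t. fst (snd (ph t))) has_real_derivative fst (snd (X (ph t)))) (at t within I)"
  "((%t. snd (snd (ph t))) has_real_derivative snd (snd (X (ph t)))) (at t within I)"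
  by (simp_all add: has_real_derivative_iff_has_vector_derivative)
qed

text \<open>Uniqueness for a linear equation, by its integrating factor.  It yields the invariance of both
  centre manifolds.\<close>

lemma linear_equation_stays_zero:
 fixes w g :: "real => real"
 assumes w: "!!t. t \<in> I ==> (w has_real_derivative g t * w t) (at t within I)"
  and g: "continuous_on I g" and I: "is_interval I" "t0 \<in> I" "t \<in> I" and z: "w t0 = 0"
 shows "w t = 0"
proof -
 define a b where "a = min t0 t" and "b = max t0 t"
 have sub: "{a..b} \<subseteq> I"
  using I mem_is_interval_1_I[OF I(1,2,3)] mem_is_interval_1_I[OF I(1,3,2)] by (auto simp: a_def b_def min_def max_def split: if_splits)
 define G where "G s = integral {a..s} g" for s
 have G: "(G has_real_derivative g s) (at s within {a..b})" if "s \<in> {a..b}" for s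
  unfolding G_def using integral_has_real_derivative[OF continuous_on_subset[OF g sub] that] .
 have "((%s. w s * exp (- G s)) has_real_derivative 0) (at s within {a..b})" if "s \<in> {a..b}" for s
 proof -
  have "(w has_real_derivative g s * w s) (at s within {a..b})"
   using w[of s] that sub by (blast intro: DERIV_subset)
  moreover have "((%s. exp (- G s)) has_real_derivative exp (- G s) * - g s) (at s within {a..b})"
   by (auto intro!: derivative_eq_intros G that)
  ultimately have "((%s. w s * exp (- G s)) has_real_derivative g s * w s * exp (- G s) + exp (- G s) * - g s * w s) (at s within {a..b})"
   by (rule DERIV_mult)
  then show ?thesis by (simp add: algebra_simps)
 qed
 then have "EX c. \<forall>s\<in>{a..b}. w s * exp (- G s) = c"
  by (intro has_field_derivative_zero_constant) auto
 then have "w t * exp (- G t) = w t0 * exp (- G t0)" by (auto simp: a_def b_def)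
 then show ?thesis using z by simp
qed

lemma rigid_center_of_z_factor:
 assumes a: "a 2 0 0 = 0" "a 1 1 0 = 0" "a 0 2 0 = (0::real)"
  and P: "P = (%(x, y, z). x * hom_quadratic a (x, y, z))"
  and Q: "Q = (%(x, y, z). y * hom_quadratic a (x, y, z))" and R: "R = hom_quadratic a"
 shows "rigid_center lam P Q R"
proof -
 let ?X = "system_field 0 lam P Q R" and ?h = "%_ :: real \<times> real. 0 :: real"
 have hq: "hom_quadratic a (x, y, z) = z * (a 1 0 1 * x + a 0 1 1 * y + a 0 0 2 * z)" for x y z
  unfolding hom_quadratic_expand a by (simp add: algebra_simps power2_eq_square)
 have X: "?X (x, y, z) = (- y + x * hom_quadratic a (x, y, z), x + y * hom_quadratic a (x, y, z), - lam * z + hom_quadratic a (x, y, z))" for x y z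
  unfolding system_field_def P Q R by simp
 have graph: "p \<in> graph_over UNIV ?h \<longleftrightarrow> snd (snd p) = 0" for p
  by (cases p) (auto simp: graph_over_def)
 have inv: "ph t \<in> graph_over UNIV ?h"
  if I: "is_interval I" and sol: "solution_on ?X I ph" and t: "t0 \<in> I" "ph t0 \<in> graph_over UNIV ?h" "t \<in> I" for ph I t0 t
 proof -
  let ?g = "%t. - lam + (a 1 0 1 * fst (ph t) + a 0 1 1 * fst (snd (ph t)) + a 0 0 2 * snd (snd (ph t)))"
  have "snd (snd (ph t)) = 0"
  proof (rule linear_equation_stays_zero[of I "%t. snd (snd (ph t))" ?g t0])
   fix s assume "s \<in> I"
   from solution_on_derivatives(3)[OF sol this]
   show "((%t. snd (snd (ph t))) has_real_derivative ?g s * snd (snd (ph s))) (at s within I)"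
    by (cases "ph s") (simp add: X hq algebra_simps)
  next
   show "continuous_on I ?g"
    by (intro continuous_on_add continuous_on_mult_left continuous_on_const
      DERIV_continuous_on[OF solution_on_derivatives(1)[OF sol]]
      DERIV_continuous_on[OF solution_on_derivatives(2)[OF sol]]
      DERIV_continuous_on[OF solution_on_derivatives(3)[OF sol]])
  qed (use I t graph in auto)
  then show ?thesis using graph by simp
 qed
 have "local_center_manifold ?X UNIV ?h"
  unfolding local_center_manifold_def
  by (intro conjI exI[of _ "%_. 0"]) (use inv in \<open>auto intro!: derivative_eq_intros\<close>)
 moreover have "rigid_on_graph P Q UNIV ?h" by (auto simp: rigid_on_graph_def P Q)
 moreover have "center_on_graph ?X UNIV ?h"
  unfolding center_on_graph_def
 proof (rule exI[of _ UNIV], intro conjI ballI impI)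
  fix p assume "p \<in> graph_over UNIV ?h \<inter> UNIV" "p ~= (0, 0, 0)"
  then obtain x y where p: "p = (x, y, 0)" "(x, y) ~= (0, 0)" by (cases p) (auto simp: graph)
  define ph where "ph t = (x * cos t - y * sin t, x * sin t + y * cos t, 0 :: real)" for t
  have "solution_on ?X UNIV ph"
   unfolding solution_on_def
  proof
   fix t
   have "(ph has_vector_derivative (- x * sin t - y * cos t, x * cos t - y * sin t, 0)) (at t)"
    unfolding ph_def
    by (intro has_vector_derivative_Pair; unfold has_real_derivative_iff_has_vector_derivative[symmetric])
     (auto intro!: derivative_eq_intros)
   then show "(ph has_vector_derivative ?X (ph t)) (at t)" by (simp add: ph_def X hq)
  qed
  moreover have "ph (t + 2 * pi) = ph t" for t by (simp add: ph_def)
  moreover have "ph pi ~= ph 0" using p(2) by (auto simp: ph_def)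
  ultimately have "periodic_orbit ?X (range ph)"
   unfolding periodic_orbit_def by (intro exI[of _ ph] exI[of _ "2 * pi"]) auto
  moreover have "p = ph 0" using p by (simp add: ph_def)
  moreover have "range ph \<subseteq> graph_over UNIV ?h" by (auto simp: graph ph_def)
  ultimately show "EX Gam. periodic_orbit ?X Gam & p \<in> Gam & Gam \<subseteq> graph_over UNIV ?h" by blast
 qed auto
 ultimately show ?thesis unfolding rigid_center_def by blast
qed

locale planar_rate =
 fixes p q lam :: real
 assumes lam: "lam ~= 0"
begin

definition rate :: "real => real => real" where
 "rate x y = p * (x * x - y * y) + q * (x * y)"

text \<open>Along the rotation \<open>x' = - y, y' = x\<close> this grows at speed \<open>2 * rate\<close>; hence
  \<open>1 / r\<^sup>2 + pot x y / r\<^sup>2\<close> is a first integral of the planar field.\<close>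

definition pot :: "real => real => real" where
 "pot x y = 2 * p * (x * y) - q / 2 * (x * x - y * y)"

definition rotx :: "real => real => real => real" where "rotx s x y = x * cos s + y * sin s"
definition roty :: "real => real => real => real" where "roty s x y = y * cos s - x * sin s"

definition num :: "real => real => real => real" where "num s x y = rate (rotx s x y) (roty s x y)"
definition den :: "real => real => real => real" where "den s x y = 1 + pot x y - pot (rotx s x y) (roty s x y)"

definition num_x where "num_x s x y = (2 * p * rotx s x y + q * roty s x y) * cos s - (q * rotx s x y - 2 * p * roty s x y) * sin s"
definition num_y where "num_y s x y = (2 * p * rotx s x y + q * roty s x y) * sin s + (q * rotx s x y - 2 * p * roty s x y) * cos s"
definition num_s where "num_s s x y = (2 * p * rotx s x y + q * roty s x y) * roty s x y - (q * rotx s x y - 2 * p * roty s x y) * rotx s x y"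
definition den_x where "den_x s x y = (2 * p * y - q * x) - ((2 * p * roty s x y - q * rotx s x y) * cos s - (2 * p * rotx s x y + q * roty s x y) * sin s)"
definition den_y where "den_y s x y = (2 * p * x + q * y) - ((2 * p * roty s x y - q * rotx s x y) * sin s + (2 * p * rotx s x y + q * roty s x y) * cos s)"

lemmas rot_defs = rotx_def roty_def rate_def pot_def

lemma rot_norm: "rotx s x y * rotx s x y + roty s x y * roty s x y = x * x + y * y"
proof -
 have "cos s * cos s + sin s * sin s = 1" using sin_cos_squared_add[of s] by (simp add: power2_eq_square)
 then show ?thesis unfolding rot_defs by algebra
qed

lemma num_deriv: "((%v. num s (fst v) (snd v)) has_derivative (%h. num_x s (fst v) (snd v) * fst h + num_y s (fst v) (snd v) * snd h)) (at v within U)"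
 unfolding num_def num_x_def num_y_def rot_defs
 by (auto intro!: derivative_eq_intros simp: fun_eq_iff algebra_simps)

lemma den_deriv: "((%v. den s (fst v) (snd v)) has_derivative (%h. den_x s (fst v) (snd v) * fst h + den_y s (fst v) (snd v) * snd h)) (at v within U)"
 unfolding den_def den_x_def den_y_def rot_defs
 by (auto intro!: derivative_eq_intros simp: fun_eq_iff algebra_simps)

lemma num_deriv_s: "((%s. num s x y) has_real_derivative num_s s x y) (at s within U)"
 unfolding num_def num_s_def rot_defs
 by (auto intro!: derivative_eq_intros simp: algebra_simps)

lemma den_deriv_s: "((%s. den s x y) has_real_derivative 2 * num s x y) (at s within U)"
 unfolding den_def num_def rot_defs
 by (auto intro!: derivative_eq_intros simp: algebra_simps)

lemma num_transport: "(- y + x * rate x y) * num_x s x y + (x + y * rate x y) * num_y s x y = 2 * rate x y * num s x y - num_s s x y"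
 unfolding num_x_def num_y_def num_s_def num_def rot_defs by algebra

lemma den_transport: "(- y + x * rate x y) * den_x s x y + (x + y * rate x y) * den_y s x y = 2 * rate x y * den s x y - 2 * num s x y"
 unfolding den_x_def den_y_def num_def den_def rot_defs by algebra

lemma pot_bound: "\<bar>pot x y\<bar> <= ((abs p) + (abs q)) * (x * x + y * y)"
proof -
 have "\<bar>x * x - y * y\<bar> <= x * x + y * y" by (simp add: abs_le_iff)
 moreover have "\<bar>2 * (x * y)\<bar> <= x * x + y * y"
  using zero_le_square[of "x - y"] zero_le_square[of "x + y"] by (simp add: abs_le_iff algebra_simps)
 ultimately have "(abs p) * \<bar>2 * (x * y)\<bar> + \<bar>q / 2\<bar> * \<bar>x * x - y * y\<bar> <= (abs p) * (x * x + y * y) + \<bar>q / 2\<bar> * (x * x + y * y)"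
  by (intro add_mono mult_left_mono) auto
 also have "... <= ((abs p) + (abs q)) * (x * x + y * y)"
  unfolding distrib_right by (intro add_mono mult_right_mono) auto
 finally have b: "(abs p) * \<bar>2 * (x * y)\<bar> + \<bar>q / 2\<bar> * \<bar>x * x - y * y\<bar> <= ((abs p) + (abs q)) * (x * x + y * y)" .
 have "pot x y = p * (2 * (x * y)) - q / 2 * (x * x - y * y)" by (simp add: pot_def)
 also have "\<bar>...\<bar> <= (abs p) * \<bar>2 * (x * y)\<bar> + \<bar>q / 2\<bar> * \<bar>x * x - y * y\<bar>"
  unfolding abs_mult[symmetric] by (rule abs_triangle_ineq4)
 finally show ?thesis using b by linarith
qed

definition rad :: real where "rad = sqrt (1 / (4 * ((abs p) + (abs q) + 1)))"
definition dom :: "(real \<times> real) set" where "dom = ball (0, 0) rad"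

lemma rad: "rad > 0" "rad\<^sup>2 = 1 / (4 * ((abs p) + (abs q) + 1))"
 by (simp_all add: rad_def add_nonneg_pos)

lemma dom_iff: "(x, y) \<in> dom \<longleftrightarrow> x * x + y * y < rad\<^sup>2"
proof -
 have "(x, y) \<in> dom \<longleftrightarrow> sqrt (x\<^sup>2 + y\<^sup>2) < rad" unfolding dom_def mem_ball
  by (simp add: dist_Pair_Pair dist_real_def)
 also have "... \<longleftrightarrow> sqrt (x\<^sup>2 + y\<^sup>2) < sqrt (rad\<^sup>2)" using rad(1) by simp
 also have "... \<longleftrightarrow> x\<^sup>2 + y\<^sup>2 < rad\<^sup>2" by (rule real_sqrt_less_iff)
 finally show ?thesis by (simp add: power2_eq_square)
qed

lemma den_bound:
 assumes "(x, y) \<in> dom"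
 shows "den s x y >= 1 / 2"
proof -
 have "((abs p) + (abs q)) * (x * x + y * y) <= ((abs p) + (abs q) + 1) * rad\<^sup>2"
  using assms unfolding dom_iff by (intro mult_mono) auto
 also have "... = 1 / 4"
  unfolding rad(2) using abs_ge_zero[of p] abs_ge_zero[of q] by (simp add: field_simps)
 finally have "((abs p) + (abs q)) * (x * x + y * y) <= 1 / 4" .
 then show ?thesis
  using pot_bound[of x y] pot_bound[of "rotx s x y" "roty s x y"] unfolding rot_norm den_def by linarith
qed

definition kern :: "real => real" where "kern s = exp (- lam * s) / (1 - exp (- lam * (2 * pi)))"

text \<open>The bounded solution of \<open>z' = - lam * z + rate x y\<close> along the planar orbit through
  \<open>(x, y)\<close>: the orbit is \<open>2 * pi\<close>-periodic, so the integral over the whole past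
  collapses to one period weighted by a geometric series.\<close>

definition height :: "real \<times> real => real" where
 "height v = integral (cbox 0 (2 * pi)) (%s. kern s * (num s (fst v) (snd v) / den s (fst v) (snd v)))"

definition grad_x where "grad_x s x y = kern s * ((num_x s x y * den s x y - num s x y * den_x s x y) / (den s x y * den s x y))"
definition grad_y where "grad_y s x y = kern s * ((num_y s x y * den s x y - num s x y * den_y s x y) / (den s x y * den s x y))"

definition grad :: "real \<times> real => real => (real \<times> real) \<Rightarrow>\<^sub>L real" where
 "grad v s = grad_x s (fst v) (snd v) *\<^sub>R fst_blinfun + grad_y s (fst v) (snd v) *\<^sub>R snd_blinfun"

lemma cont_parts:
 fixes f g h :: "'b::t2_space => real"
 assumes c: "continuous_on S f" "continuous_on S g" "continuous_on S h"
 shows "continuous_on S (%w. kern (f w))" "continuous_on S (%w. num (f w) (g w) (h w))" "continuous_on S (%w. den (f w) (g w) (h w))"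
 "continuous_on S (%w. num_x (f w) (g w) (h w))" "continuous_on S (%w. num_y (f w) (g w) (h w))"
 "continuous_on S (%w. den_x (f w) (g w) (h w))" "continuous_on S (%w. den_y (f w) (g w) (h w))"
 "continuous_on S (%w. num_s (f w) (g w) (h w))"
proof -
 show "continuous_on S (%w. kern (f w))" unfolding kern_def by (intro continuous_intros c) (use lam in auto)
 have r: "continuous_on S (%w. rotx (f w) (g w) (h w))" "continuous_on S (%w. roty (f w) (g w) (h w))"
  unfolding rotx_def roty_def
  by (rule continuous_on_add continuous_on_diff continuous_on_mult continuous_on_cos continuous_on_sin c)+
 note rules = continuous_on_add continuous_on_diff continuous_on_mult continuous_on_cos continuous_on_sin continuous_on_const r c
 have rate: "continuous_on S (%w. rate (u w) (v w))" "continuous_on S (%w. pot (u w) (v w))"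
  if "continuous_on S u" "continuous_on S v" for u v
  unfolding rate_def pot_def by (rule continuous_on_add continuous_on_diff continuous_on_mult continuous_on_const that)+
 show "continuous_on S (%w. num (f w) (g w) (h w))" "continuous_on S (%w. den (f w) (g w) (h w))"
  unfolding num_def den_def by (rule rate rules)+
 show "continuous_on S (%w. num_x (f w) (g w) (h w))" "continuous_on S (%w. num_y (f w) (g w) (h w))"
  "continuous_on S (%w. den_x (f w) (g w) (h w))" "continuous_on S (%w. den_y (f w) (g w) (h w))"
  "continuous_on S (%w. num_s (f w) (g w) (h w))"
  unfolding num_x_def num_y_def den_x_def den_y_def num_s_def by (rule rules)+
qed

lemma grad_cont: "continuous_on (dom \<times> cbox 0 (2 * pi)) (%(v, s). grad v s)"
proof -
 have "den s x y ~= 0" if "(x, y) \<in> dom" for s x y using den_bound[OF that, of s] by auto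
 then show ?thesis unfolding grad_def grad_x_def grad_y_def split_beta
  by (intro continuous_intros cont_parts) auto
qed

lemma height_integrable: "v \<in> dom ==> (%s. kern s * (num s (fst v) (snd v) / den s (fst v) (snd v))) integrable_on cbox 0 (2 * pi)"
proof (rule integrable_continuous)
 assume v: "v \<in> dom"
 have "den s (fst v) (snd v) ~= 0" for s using den_bound[of "fst v" "snd v" s] v by auto
 then show "continuous_on (cbox 0 (2 * pi)) (%s. kern s * (num s (fst v) (snd v) / den s (fst v) (snd v)))"
  by (intro continuous_intros cont_parts) auto
qed

lemma quotient_join: "k * (A / M) * u + k * (B / M) * v = k * ((u * A + v * B) / M)" for k :: real
 by (simp add: divide_inverse algebra_simps)

lemma quotient_split: "k * (((A * a + B * b) * D - N * (C * a + E * b)) / M) = k * ((A * D - N * C) / M) * a + k * ((B * D - N * E) / M) * b" for k :: real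
 by (simp add: divide_inverse algebra_simps)

lemma height_deriv: "v \<in> dom ==> (height has_derivative blinfun_apply (integral (cbox 0 (2 * pi)) (grad v))) (at v)"
proof -
 assume v: "v \<in> dom"
 have "((%v. integral (cbox 0 (2 * pi)) (%s. kern s * (num s (fst v) (snd v) / den s (fst v) (snd v))))
  has_derivative blinfun_apply (integral (cbox 0 (2 * pi)) (grad v))) (at v within dom)"
 proof (rule leibniz_rule[OF _ height_integrable grad_cont v])
  fix w :: "real \<times> real" and s :: real assume w: "w \<in> dom"
  have n: "den s (fst w) (snd w) ~= 0" using den_bound[of "fst w" "snd w" s] w by auto
  have "((%v. kern s * (num s (fst v) (snd v) / den s (fst v) (snd v))) has_derivative
   (%h. kern s * (((num_x s (fst w) (snd w) * fst h + num_y s (fst w) (snd w) * snd h) * den s (fst w) (snd w)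
     - num s (fst w) (snd w) * (den_x s (fst w) (snd w) * fst h + den_y s (fst w) (snd w) * snd h)) / (den s (fst w) (snd w) * den s (fst w) (snd w))))) (at w within dom)"
   by (rule has_derivative_mult_right, rule has_derivative_divide'[OF num_deriv den_deriv n])
  moreover have "(%h. kern s * (((num_x s (fst w) (snd w) * fst h + num_y s (fst w) (snd w) * snd h) * den s (fst w) (snd w)
     - num s (fst w) (snd w) * (den_x s (fst w) (snd w) * fst h + den_y s (fst w) (snd w) * snd h)) / (den s (fst w) (snd w) * den s (fst w) (snd w))))
   = blinfun_apply (grad w s)"
   by (simp only: fun_eq_iff grad_def grad_x_def grad_y_def blinfun.add_left blinfun.scaleR_left
     blinfun_apply_fst_blinfun blinfun_apply_snd_blinfun real_scaleR_def quotient_split simp_thms)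
  ultimately show "((%v. kern s * (num s (fst v) (snd v) / den s (fst v) (snd v))) has_derivative blinfun_apply (grad w s)) (at w within dom)" by simp
 qed (auto simp: dom_def)
 then have "(height has_derivative blinfun_apply (integral (cbox 0 (2 * pi)) (grad v))) (at v within dom)"
  by (simp add: height_def[abs_def])
 then show ?thesis using at_within_open[OF v] by (simp add: dom_def)
qed

text \<open>The transport equation of the invariant graph: the derivative along the plane flow of the
  integrand is a derivative in \<open>s\<close>, and integration by parts leaves the boundary term \<open>rate\<close>.\<close>

lemma height_transport:
 assumes "(x, y) \<in> dom"
 shows "blinfun_apply (integral (cbox 0 (2 * pi)) (grad (x, y))) (- y + x * rate x y, x + y * rate x y) = - lam * height (x, y) + rate x y"
  (is "?l = _")
proof -
 have n: "den s x y ~= 0" for s using den_bound[OF assms, of s] by auto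
 let ?d = "%s. (num_s s x y * den s x y - num s x y * (2 * num s x y)) / (den s x y * den s x y)"
 have ci: "grad (x, y) integrable_on cbox 0 (2 * pi)"
  unfolding grad_def grad_x_def grad_y_def by (intro integrable_continuous continuous_intros cont_parts) (use n in auto)
 have "?l = integral (cbox 0 (2 * pi)) ((%B. blinfun_apply B (- y + x * rate x y, x + y * rate x y)) \<circ> grad (x, y))"
  by (rule integral_linear[symmetric, OF ci]) (rule blinfun.bounded_linear_left)
 also have "... = integral (cbox 0 (2 * pi)) (%s. - (kern s * ?d s))"
 proof (rule integral_cong)
  fix s
  have "((%B. blinfun_apply B (- y + x * rate x y, x + y * rate x y)) \<circ> grad (x, y)) s
   = kern s * (((- y + x * rate x y) * (num_x s x y * den s x y - num s x y * den_x s x y)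
     + (x + y * rate x y) * (num_y s x y * den s x y - num s x y * den_y s x y)) / (den s x y * den s x y))"
   by (simp only: o_def grad_def grad_x_def grad_y_def blinfun.add_left blinfun.scaleR_left fst_conv snd_conv
     blinfun_apply_fst_blinfun blinfun_apply_snd_blinfun real_scaleR_def quotient_join)
  also have "(- y + x * rate x y) * (num_x s x y * den s x y - num s x y * den_x s x y)
     + (x + y * rate x y) * (num_y s x y * den s x y - num s x y * den_y s x y)
    = - (num_s s x y * den s x y - num s x y * (2 * num s x y))"
   using num_transport[where s = s and x = x and y = y] den_transport[where s = s and x = x and y = y] by algebra
  finally show "((%B. blinfun_apply B (- y + x * rate x y, x + y * rate x y)) \<circ> grad (x, y)) s = - (kern s * ?d s)"
   by (simp only: minus_divide_left[symmetric] mult_minus_right)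
 qed
 finally have l: "?l = - integral (cbox 0 (2 * pi)) (%s. kern s * ?d s)" by simp
 have kd: "(kern has_real_derivative - lam * kern s) (at s within U)" for s U
  unfolding kern_def using lam by (auto intro!: derivative_eq_intros)
 have gd: "((%s. num s x y / den s x y) has_real_derivative ?d s) (at s within U)" for s U
  by (rule DERIV_divide[OF num_deriv_s den_deriv_s n])
 have "((%s. - lam * kern s * (num s x y / den s x y) + ?d s * kern s) has_integral
   kern (2 * pi) * (num (2 * pi) x y / den (2 * pi) x y) - kern 0 * (num 0 x y / den 0 x y)) {0..2 * pi}"
 proof (rule fundamental_theorem_of_calculus)
  show "((%s. kern s * (num s x y / den s x y)) has_vector_derivative - lam * kern s * (num s x y / den s x y) + ?d s * kern s) (at s within {0..2 * pi})" for s
   unfolding has_real_derivative_iff_has_vector_derivative[symmetric] by (rule DERIV_mult[OF kd gd])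
 qed simp
 moreover have "kern (2 * pi) * (num (2 * pi) x y / den (2 * pi) x y) - kern 0 * (num 0 x y / den 0 x y) = - rate x y"
 proof -
  have "num (2 * pi) x y = rate x y" "num 0 x y = rate x y" "den (2 * pi) x y = 1" "den 0 x y = 1"
   by (simp_all add: num_def den_def rotx_def roty_def)
  moreover have "kern (2 * pi) - kern 0 = - 1" using lam by (simp add: kern_def diff_divide_distrib[symmetric] divide_eq_minus_1_iff)
  ultimately show ?thesis by (simp add: left_diff_distrib[symmetric])
 qed
 ultimately have "integral (cbox 0 (2 * pi)) (%s. - lam * kern s * (num s x y / den s x y) + ?d s * kern s) = - rate x y"
  by (simp add: integral_unique)
 moreover have "integral (cbox 0 (2 * pi)) (%s. - lam * kern s * (num s x y / den s x y) + ?d s * kern s)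
  = - lam * height (x, y) + integral (cbox 0 (2 * pi)) (%s. kern s * ?d s)"
 proof -
  have "(%s. kern s * ?d s) integrable_on cbox 0 (2 * pi)"
   by (intro integrable_continuous continuous_intros cont_parts) (use n in auto)
  moreover have "(%s. - lam * kern s * (num s x y / den s x y)) integrable_on cbox 0 (2 * pi)"
   using integrable_on_mult_right[OF height_integrable[OF assms], of "- lam"] by (simp add: mult.assoc)
  moreover have "integral (cbox 0 (2 * pi)) (%s. - lam * kern s * (num s x y / den s x y)) = - lam * height (x, y)"
   unfolding height_def integral_mult_right[symmetric] by (simp add: mult.assoc)
  ultimately show ?thesis using integral_add[of "%s. - lam * kern s * (num s x y / den s x y)" "cbox 0 (2 * pi)" "%s. kern s * ?d s"]
   by (simp add: mult.commute)
 qed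
 ultimately show ?thesis using l by simp
qed

lemma rigid_center_rate:
 assumes a: "a 2 0 0 = p" "a 1 1 0 = q" "a 0 2 0 = - p" "a 1 0 1 = 0" "a 0 1 1 = 0" "a 0 0 2 = 0"
  and P: "P = (%(x, y, z). x * hom_quadratic a (x, y, z))"
  and Q: "Q = (%(x, y, z). y * hom_quadratic a (x, y, z))" and R: "R = hom_quadratic a"
 shows "rigid_center lam P Q R"
proof -
 let ?X = "system_field 0 lam P Q R"
 have hq: "hom_quadratic a (x, y, z) = rate x y" for x y z
  unfolding hom_quadratic_expand a rate_def by (simp add: algebra_simps power2_eq_square)
 have X: "?X (x, y, z) = (- y + x * rate x y, x + y * rate x y, - lam * z + rate x y)" for x y z
  unfolding system_field_def P Q R by (simp add: hq)
 have graph: "w \<in> graph_over dom height \<longleftrightarrow> (fst w, fst (snd w)) \<in> dom & snd (snd w) = height (fst w, fst (snd w))" for w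
  by (cases w) (auto simp: graph_over_def)
 have z0: "height (0, 0) = 0" by (simp add: height_def num_def rot_defs)
 have g0: "integral (cbox 0 (2 * pi)) (grad (0, 0)) = 0"
 proof -
  have "grad (0, 0) = (%_. 0)"
   by (simp add: fun_eq_iff grad_def grad_x_def grad_y_def num_def num_x_def num_y_def den_x_def den_y_def rot_defs)
  then show ?thesis by simp
 qed
 have chain: "((%t. height (u t, v t)) has_real_derivative - lam * height (u t, v t) + rate (u t) (v t)) (at t within I)"
  if "(u has_real_derivative - v t + u t * rate (u t) (v t)) (at t within I)"
   "(v has_real_derivative u t + v t * rate (u t) (v t)) (at t within I)" "(u t, v t) \<in> dom" for u v t I
 proof -
  have "((%t. (u t, v t)) has_vector_derivative (- v t + u t * rate (u t) (v t), u t + v t * rate (u t) (v t))) (at t within I)"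
   by (intro has_vector_derivative_Pair; unfold has_real_derivative_iff_has_vector_derivative[symmetric]; fact that)
  moreover have "(height has_derivative blinfun_apply (integral (cbox 0 (2 * pi)) (grad (u t, v t)))) (at (u t, v t) within range (%t. (u t, v t)))"
   by (rule has_derivative_at_withinI[OF height_deriv[OF that(3)]])
  ultimately have "((height \<circ> (%t. (u t, v t))) has_vector_derivative blinfun_apply (integral (cbox 0 (2 * pi)) (grad (u t, v t)))
    (- v t + u t * rate (u t) (v t), u t + v t * rate (u t) (v t))) (at t within I)"
   by (intro vector_derivative_diff_chain_within) (auto intro: has_derivative_subset)
  then show ?thesis unfolding height_transport[OF that(3)] has_real_derivative_iff_has_vector_derivative by (simp add: o_def)
 qed
 have inv: "ph t \<in> graph_over dom height"
  if I: "is_interval I" and sol: "solution_on ?X I ph" and t: "t0 \<in> I" "ph t0 \<in> graph_over dom height" "t \<in> I"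
   and d: "!!t. t \<in> I ==> (fst (ph t), fst (snd (ph t))) \<in> dom" for ph I t0 t
 proof -
  let ?u = "%t. fst (ph t)" and ?v = "%t. fst (snd (ph t))" and ?z = "%t. snd (snd (ph t))"
  have "?z t - height (?u t, ?v t) = 0"
  proof (rule linear_equation_stays_zero[of I "%t. ?z t - height (?u t, ?v t)" "%_. - lam" t0])
   fix s assume s: "s \<in> I"
   have e: "?X (ph s) = (- ?v s + ?u s * rate (?u s) (?v s), ?u s + ?v s * rate (?u s) (?v s), - lam * ?z s + rate (?u s) (?v s))"
    by (cases "ph s") (simp add: X)
   note c = solution_on_derivatives[OF sol s, unfolded e fst_conv snd_conv]
   from DERIV_diff[OF c(3) chain[OF c(1,2) d[OF s]]]
   show "((%t. ?z t - height (?u t, ?v t)) has_real_derivative - lam * (?z s - height (?u s, ?v s))) (at s within I)"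
    by (simp add: algebra_simps)
  qed (use I t graph in auto)
  then show ?thesis using graph d[OF t(3)] by simp
 qed
 have "local_center_manifold ?X dom height"
  unfolding local_center_manifold_def
 proof (intro conjI exI[of _ "%v. integral (cbox 0 (2 * pi)) (grad v)"])
  show "open dom" by (simp add: dom_def)
  show "(0, 0) \<in> dom" using rad(1) by (simp add: dom_def)
  show "\<forall>w\<in>dom. (height has_derivative blinfun_apply (integral (cbox 0 (2 * pi)) (grad w))) (at w)" using height_deriv by blast
  show "continuous_on dom (%v. integral (cbox 0 (2 * pi)) (grad v))" by (rule integral_continuous_on_param[OF grad_cont])
  show "height (0, 0) = 0" by (rule z0)
  show "integral (cbox 0 (2 * pi)) (grad (0, 0)) = 0" by (rule g0)
 qed (use inv in blast)
 moreover have "rigid_on_graph P Q dom height" by (auto simp: rigid_on_graph_def P Q)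
 moreover have "center_on_graph ?X dom height"
  unfolding center_on_graph_def
 proof (rule exI[of _ "{w. fst w * fst w + fst (snd w) * fst (snd w) < rad\<^sup>2 / 2}"], intro conjI ballI impI)
  show "open {w :: space. fst w * fst w + fst (snd w) * fst (snd w) < rad\<^sup>2 / 2}"
   by (intro open_Collect_less continuous_intros)
  show "(0, 0, 0) \<in> {w :: space. fst w * fst w + fst (snd w) * fst (snd w) < rad\<^sup>2 / 2}" using rad(1) by simp
  fix w assume w: "w \<in> graph_over dom height \<inter> {w. fst w * fst w + fst (snd w) * fst (snd w) < rad\<^sup>2 / 2}" "w ~= (0, 0, 0)"
  obtain x y z where wxyz: "w = (x, y, z)" by (cases w)
  have xy: "z = height (x, y)" "(x, y) \<in> dom" "x * x + y * y < rad\<^sup>2 / 2" "(x, y) ~= (0, 0)"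
   using w z0 by (auto simp: wxyz graph)
  define X' Y' where "X' t = rotx (- t) x y" and "Y' t = roty (- t) x y" for t
  define D where "D t = sqrt (den (- t) x y)" for t
  define u v where "u t = X' t / D t" and "v t = Y' t / D t" for t
  have dp: "den (- t) x y >= 1 / 2" for t by (rule den_bound[OF xy(2)])
  have Dp: "D t > 0" "D t * D t = den (- t) x y" for t
  proof -
   have "den (- t) x y > 0" using dp[of t] by linarith
   then show "D t > 0" "D t * D t = den (- t) x y" by (simp_all add: D_def)
  qed
  have ru: "rate (u t) (v t) = num (- t) x y / den (- t) x y" for t
  proof -
   have "rate (u t) (v t) = num (- t) x y / (D t * D t)"
    unfolding u_def v_def X'_def Y'_def num_def rate_def using Dp(1)[of t] by (simp add: field_simps)
   then show ?thesis by (simp add: Dp(2))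
  qed
  have dom: "(u t, v t) \<in> dom" for t
  proof -
   have "u t * u t + v t * v t = (X' t * X' t + Y' t * Y' t) / (D t * D t)" unfolding u_def v_def by (simp add: add_divide_distrib)
   also have "... = (x * x + y * y) / den (- t) x y" unfolding X'_def Y'_def rot_norm Dp(2) ..
   also have "... <= (x * x + y * y) / (1 / 2)" by (intro divide_left_mono) (use dp[of t] in auto)
   also have "... < rad\<^sup>2" using xy(3) by simp
   finally show ?thesis by (simp add: dom_iff)
  qed
  have XD: "(X' has_real_derivative - Y' t) (at t)" "(Y' has_real_derivative X' t) (at t)" for t
   unfolding X'_def Y'_def rotx_def roty_def by (auto intro!: derivative_eq_intros)
  have DD: "(D has_real_derivative - (num (- t) x y / D t)) (at t)" for t
  proof -
   have "((%t. den (- t) x y) has_real_derivative 2 * num (- t) x y * (- 1)) (at t)"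
    by (rule DERIV_chain2[OF den_deriv_s]) (auto intro!: derivative_eq_intros)
   moreover have "den (- t) x y > 0" using dp[of t] by linarith
   ultimately have "((%t. sqrt (den (- t) x y)) has_real_derivative (inverse (sqrt (den (- t) x y)) / 2) * (2 * num (- t) x y * (- 1))) (at t)"
    by (intro DERIV_chain2[OF DERIV_real_sqrt])
   moreover have "D = (%t. sqrt (den (- t) x y))" by (simp only: fun_eq_iff D_def simp_thms)
   moreover have "(inverse (sqrt (den (- t) x y)) / 2) * (2 * num (- t) x y * (- 1)) = - (num (- t) x y / D t)"
    by (simp only: D_def divide_inverse) algebra
   ultimately show ?thesis by (simp only:)
  qed
  have ud: "(u has_real_derivative - v t + u t * rate (u t) (v t)) (at t)" for t
  proof -
   have "(u has_real_derivative (- Y' t * D t - X' t * (- (num (- t) x y / D t))) / (D t * D t)) (at t)"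
    unfolding u_def[abs_def] by (rule DERIV_divide[OF XD(1) DD]) (use Dp(1)[of t] in simp)
   moreover have "(- Y' t * D t - X' t * (- (num (- t) x y / D t))) / (D t * D t) = - v t + u t * rate (u t) (v t)"
    unfolding ru unfolding Dp(2)[symmetric] u_def v_def using Dp(1)[of t] by (simp add: field_simps)
   ultimately show ?thesis by simp
  qed
  have vd: "(v has_real_derivative u t + v t * rate (u t) (v t)) (at t)" for t
  proof -
   have "(v has_real_derivative (X' t * D t - Y' t * (- (num (- t) x y / D t))) / (D t * D t)) (at t)"
    unfolding v_def[abs_def] by (rule DERIV_divide[OF XD(2) DD]) (use Dp(1)[of t] in simp)
   moreover have "(X' t * D t - Y' t * (- (num (- t) x y / D t))) / (D t * D t) = u t + v t * rate (u t) (v t)"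
    unfolding ru unfolding Dp(2)[symmetric] u_def v_def using Dp(1)[of t] by (simp add: field_simps)
   ultimately show ?thesis by simp
  qed
  define ph where "ph t = (u t, v t, height (u t, v t))" for t
  have "solution_on ?X UNIV ph"
   unfolding solution_on_def ph_def X
   by (intro ballI has_vector_derivative_Pair; unfold has_real_derivative_iff_has_vector_derivative[symmetric])
    (intro ud vd chain dom)+
  moreover have "ph (t + 2 * pi) = ph t" for t
  proof -
   have "X' (t + 2 * pi) = X' t" "Y' (t + 2 * pi) = Y' t" "den (- (t + 2 * pi)) x y = den (- t) x y"
    unfolding X'_def Y'_def den_def rotx_def roty_def
    by (simp_all only: cos_minus sin_minus cos_periodic sin_periodic)
   then show ?thesis unfolding ph_def u_def v_def D_def by simp
  qed
  moreover have "ph pi ~= ph 0"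
  proof -
   have "D pi = 1" "D 0 = 1" by (simp_all add: D_def den_def rotx_def roty_def pot_def)
   then show ?thesis using xy(4) by (auto simp: ph_def u_def v_def X'_def Y'_def rotx_def roty_def)
  qed
  ultimately have "periodic_orbit ?X (range ph)"
   unfolding periodic_orbit_def by (intro exI[of _ ph] exI[of _ "2 * pi"]) auto
  moreover have "w = ph 0"
   using xy(1) by (simp add: wxyz ph_def u_def v_def X'_def Y'_def D_def den_def rotx_def roty_def)
  moreover have "range ph \<subseteq> graph_over dom height" using dom by (auto simp: graph ph_def)
  ultimately show "EX Gam. periodic_orbit ?X Gam & w \<in> Gam & Gam \<subseteq> graph_over dom height" by blast
 qed
 ultimately show ?thesis unfolding rigid_center_def by blast
qed

end

lemma rigid_center_of_planar_rate:
 assumes "lam ~= 0" "a 0 2 0 = - a 2 0 0" "a 1 0 1 = 0" "a 0 1 1 = 0" "a 0 0 2 = 0"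
  and "P = (%(x, y, z). x * hom_quadratic a (x, y, z))"
  and "Q = (%(x, y, z). y * hom_quadratic a (x, y, z))" and "R = hom_quadratic a"
 shows "rigid_center lam P Q R"
proof -
 interpret planar_rate "a 2 0 0" "a 1 1 0" lam by unfold_locales fact
 show ?thesis by (rule rigid_center_rate[OF refl refl assms(2-)])
qed

section \<open>Small periodic orbits on the centre manifold\<close>

lemma linear_equation_exp:
 fixes g :: "real => real"
 assumes "continuous_on UNIV g"
 obtains Q where "Q 0 = 0" "!!t. (Q has_real_derivative g t) (at t)"
  "!!y t. (!!t. (y has_real_derivative g t * y t) (at t)) ==> y t = y 0 * exp (Q t)"
proof -
 obtain G where G: "!!t. (G has_real_derivative g t) (at t)"
  using continuous_has_antiderivative[OF assms] by blast
 define Q where "Q t = G t - G 0" for t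
 have Q: "(Q has_real_derivative g t) (at t)" for t
  unfolding Q_def by (auto intro!: derivative_eq_intros G)
 have "y t = y 0 * exp (Q t)" if y: "!!t. (y has_real_derivative g t * y t) (at t)" for y t
 proof -
  have "((%t. y t * exp (- Q t)) has_real_derivative 0) (at t)" for t
   by (auto intro!: derivative_eq_intros y Q simp: algebra_simps)
  then have "y t * exp (- Q t) = y 0 * exp (- Q 0)"
   using DERIV_isconst_all[of "%t. y t * exp (- Q t)" t 0] by blast
  then show ?thesis by (simp add: Q_def exp_minus exp_diff field_simps)
 qed
 then show thesis using that[of Q] Q by (simp add: Q_def)
qed

lemma abs_sum4: "\<bar>p + q + r + s\<bar> <= (abs p) + (abs q) + (abs r) + (abs s)" for p :: real
 using abs_triangle_ineq[of "p + q + r" s] abs_triangle_ineq[of "p + q" r] abs_triangle_ineq[of p q] by linarith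

text \<open>Gronwall for the square sum; it replaces a general uniqueness theorem when comparing an orbit with
  its shift by one turn.\<close>

lemma linear_pair_zero:
 fixes w v :: "real => real"
 assumes w: "!!t. (w has_real_derivative A t * w t + B t * v t) (at t)"
  and v: "!!t. (v has_real_derivative C t * w t + D t * v t) (at t)"
  and c: "continuous_on UNIV A" "continuous_on UNIV B" "continuous_on UNIV C" "continuous_on UNIV D"
  and z: "w t1 = 0" "v t1 = 0"
 shows "w t = 0 & v t = 0"
proof -
 define a b where "a = min t1 t" and "b = max t1 t"
 have "continuous_on {a..b} (%s. \<bar>A s\<bar> + \<bar>B s\<bar> + \<bar>C s\<bar> + \<bar>D s\<bar>)"
  by (intro continuous_intros continuous_on_subset[OF c(1)] continuous_on_subset[OF c(2)]
    continuous_on_subset[OF c(3)] continuous_on_subset[OF c(4)]) auto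
 then have "\<exists>x\<in>{a..b}. \<forall>y\<in>{a..b}. \<bar>A y\<bar> + \<bar>B y\<bar> + \<bar>C y\<bar> + \<bar>D y\<bar> <= \<bar>A x\<bar> + \<bar>B x\<bar> + \<bar>C x\<bar> + \<bar>D x\<bar>"
  by (intro continuous_attains_sup) (auto simp: a_def b_def)
 then obtain K where K: "!!s. s \<in> {a..b} ==> \<bar>A s\<bar> + \<bar>B s\<bar> + \<bar>C s\<bar> + \<bar>D s\<bar> <= K" by blast
 define S where "S s = w s * w s + v s * v s" for s
 define S' where "S' s = 2 * (A s * (w s * w s) + B s * (w s * v s) + C s * (w s * v s) + D s * (v s * v s))" for s
 have S: "(S has_real_derivative S' s) (at s)" for s
  unfolding S_def S'_def by (auto intro!: derivative_eq_intros w v simp: algebra_simps)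
 have S0: "S s >= 0" for s by (simp add: S_def)
 have bd: "\<bar>S' s\<bar> <= 2 * K * S s" if "s \<in> {a..b}" for s
 proof -
  have wv: "\<bar>w s * v s\<bar> <= S s"
   using zero_le_square[of "w s - v s"] zero_le_square[of "w s + v s"] zero_le_square[of "w s"] zero_le_square[of "v s"]
   by (simp add: S_def abs_le_iff algebra_simps)
  have ww: "\<bar>w s * w s\<bar> <= S s" "\<bar>v s * v s\<bar> <= S s" by (simp_all add: S_def)
  have "\<bar>S' s\<bar> <= 2 * (\<bar>A s * (w s * w s)\<bar> + \<bar>B s * (w s * v s)\<bar> + \<bar>C s * (w s * v s)\<bar> + \<bar>D s * (v s * v s)\<bar>)"
   unfolding S'_def abs_mult[of "2 :: real"] abs_numeral by (intro mult_left_mono abs_sum4) simp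
  also have "... = 2 * (\<bar>A s\<bar> * \<bar>w s * w s\<bar> + \<bar>B s\<bar> * \<bar>w s * v s\<bar> + \<bar>C s\<bar> * \<bar>w s * v s\<bar> + \<bar>D s\<bar> * \<bar>v s * v s\<bar>)"
   by (simp only: abs_mult)
  also have "... <= 2 * (\<bar>A s\<bar> * S s + \<bar>B s\<bar> * S s + \<bar>C s\<bar> * S s + \<bar>D s\<bar> * S s)"
   by (intro mult_left_mono add_mono wv ww) auto
  also have "... = 2 * ((\<bar>A s\<bar> + \<bar>B s\<bar> + \<bar>C s\<bar> + \<bar>D s\<bar>) * S s)" by (simp add: algebra_simps)
  also have "... <= 2 * (K * S s)" by (intro mult_left_mono mult_right_mono K that S0) auto
  finally show ?thesis by (simp add: mult.assoc)
 qed
 have "S t <= 0"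
 proof (cases "t1 <= t")
  case True
  have "S t * exp (- (2 * K) * t) <= S t1 * exp (- (2 * K) * t1)"
  proof (rule DERIV_nonpos_imp_nonincreasing[where f = "%s. S s * exp (- (2 * K) * s)", OF True])
   fix s assume s: "t1 <= s" "s <= t"
   have "((%s. S s * exp (- (2 * K) * s)) has_real_derivative (S' s - 2 * K * S s) * exp (- (2 * K) * s)) (at s)"
    by (auto intro!: derivative_eq_intros S simp: algebra_simps)
   moreover have "(S' s - 2 * K * S s) * exp (- (2 * K) * s) <= 0"
    using bd[of s] s by (intro mult_nonpos_nonneg) (auto simp: a_def b_def)
   ultimately show "EX y. ((%s. S s * exp (- (2 * K) * s)) has_real_derivative y) (at s) & y <= 0" by blast
  qed
  then show ?thesis using z by (simp add: S_def mult_le_0_iff)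
 next
  case False
  have "S t * exp (2 * K * t) <= S t1 * exp (2 * K * t1)"
  proof (rule DERIV_nonneg_imp_nondecreasing[where f = "%s. S s * exp (2 * K * s)"])
   show "t <= t1" using False by simp
   fix s assume s: "t <= s" "s <= t1"
   have "((%s. S s * exp (2 * K * s)) has_real_derivative (S' s + 2 * K * S s) * exp (2 * K * s)) (at s)"
    by (auto intro!: derivative_eq_intros S simp: algebra_simps)
   moreover have "(S' s + 2 * K * S s) * exp (2 * K * s) >= 0"
    using bd[of s] s by (intro mult_nonneg_nonneg) (auto simp: a_def b_def)
   ultimately show "EX y. ((%s. S s * exp (2 * K * s)) has_real_derivative y) (at s) & y >= 0" by blast
  qed
  then show ?thesis using z by (simp add: S_def mult_le_0_iff)
 qed
 then have "S t = 0" using S0[of t] by (rule antisym)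
 then have "w t * w t + v t * v t = 0" by (simp only: S_def)
 then show ?thesis by (simp add: sum_squares_eq_zero_iff)
qed

definition polar_rate :: "coeffs => real => real => real => real" where
 "polar_rate a t r z = (a 2 0 0 * (cos t)\<^sup>2 + a 1 1 0 * (cos t * sin t) + a 0 2 0 * (sin t)\<^sup>2) * r\<^sup>2
  + (a 1 0 1 * cos t + a 0 1 1 * sin t) * (r * z) + a 0 0 2 * z\<^sup>2"

lemma polar_rate_periodic: "polar_rate a (t + 2 * pi) r z = polar_rate a t r z"
 by (simp add: polar_rate_def)

lemma three_products:
 fixes u v w :: real
 assumes "(abs u) <= A" "(abs v) <= A" "(abs w) <= A" "(abs p) <= B" "(abs q) <= B" "(abs s) <= B"
 shows "\<bar>u * p + v * q + w * s\<bar> <= 3 * A * B"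
proof -
 have m: "\<bar>x * y\<bar> <= A * B" if "(abs x) <= A" "(abs y) <= B" for x y :: real
  unfolding abs_mult by (rule mult_mono) (use that abs_ge_zero[of x] in linarith)+
 show ?thesis using m[OF assms(1,4)] m[OF assms(2,5)] m[OF assms(3,6)] by linarith
qed

lemma polar_rate_bound:
 assumes "(abs z) <= r" and A: "A = \<bar>a 2 0 0\<bar> + \<bar>a 1 1 0\<bar> + \<bar>a 0 2 0\<bar> + \<bar>a 1 0 1\<bar> + \<bar>a 0 1 1\<bar> + \<bar>a 0 0 2\<bar> + 1"
 shows "\<bar>polar_rate a t r z\<bar> <= 3 * A * r\<^sup>2"
proof -
 have m: "\<bar>b * s\<bar> <= (abs b)" if "(abs s) <= 1" for b s :: real
  using mult_left_mono[OF that, of "(abs b)"] by (simp add: abs_mult)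
 have cs: "\<bar>cos t * sin t\<bar> <= 1" using mult_mono[of "\<bar>cos t\<bar>" 1 "\<bar>sin t\<bar>" 1] by (simp add: abs_mult)
 have c2: "\<bar>(cos t)\<^sup>2\<bar> <= 1" "\<bar>(sin t)\<^sup>2\<bar> <= 1" by (simp_all add: abs_square_le_1)
 have 1: "\<bar>a 2 0 0 * (cos t)\<^sup>2 + a 1 1 0 * (cos t * sin t) + a 0 2 0 * (sin t)\<^sup>2\<bar> <= A"
  using m[OF c2(1), of "a 2 0 0"] m[OF cs, of "a 1 1 0"] m[OF c2(2), of "a 0 2 0"] unfolding A by linarith
 have 2: "\<bar>a 1 0 1 * cos t + a 0 1 1 * sin t\<bar> <= A"
  using m[OF abs_cos_le_one, of "a 1 0 1" t] m[OF abs_sin_le_one, of "a 0 1 1" t] unfolding A by linarith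
 have 3: "\<bar>a 0 0 2\<bar> <= A" unfolding A by linarith
 have r: "r >= 0" "A >= 0" using assms(1) unfolding A by auto
 have "\<bar>r * z\<bar> <= r\<^sup>2" using mult_left_mono[OF assms(1) r(1)] r by (simp add: abs_mult power2_eq_square)
 moreover have "\<bar>z\<^sup>2\<bar> <= r\<^sup>2" using power_mono[OF assms(1), of 2] by simp
 moreover have "\<bar>r\<^sup>2\<bar> <= r\<^sup>2" by simp
 ultimately show ?thesis unfolding polar_rate_def by (intro three_products 1 2 3)
qed

text \<open>An orbit on the graph has some period \<open>2 * pi * k\<close>.  Since the increments of the radius over one
  turn add up to zero over \<open>k\<close> turns, one of them vanishes; there the orbit meets its shift, because
  the height is determined by the plane coordinates.  Hence one turn is already a period.\<close>

lemma center_polar_family: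
 assumes rc: "rigid_center lam P Q R"
  and P: "P = (%(x, y, z). x * hom_quadratic a (x, y, z))"
  and Q: "Q = (%(x, y, z). y * hom_quadratic a (x, y, z))" and R: "R = hom_quadratic a"
 obtains e0 where "e0 > 0" "!!eps. 0 < eps ==> eps < e0 ==> EX r z. ALL t.
   (r has_real_derivative r t * polar_rate a t (r t) (z t)) (at t)
   & (z has_real_derivative - lam * z t + polar_rate a t (r t) (z t)) (at t)
   & r (t + 2 * pi) = r t & z (t + 2 * pi) = z t & eps / 2 <= r t & r t <= 2 * eps & \<bar>z t\<bar> <= r t"
proof -
 let ?X = "system_field 0 lam P Q R"
 have X: "?X (x, y, z) = (- y + x * hom_quadratic a (x, y, z), x + y * hom_quadratic a (x, y, z), - lam * z + hom_quadratic a (x, y, z))" for x y z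
  unfolding system_field_def P Q R by simp
 obtain V h where lcm: "local_center_manifold ?X V h" and cg: "center_on_graph ?X V h"
  using rc unfolding rigid_center_def by blast
 obtain h' :: "real \<times> real => (real \<times> real) \<Rightarrow>\<^sub>L real" where V: "open V" "(0, 0) \<in> V" and h: "h (0, 0) = 0" "h' (0, 0) = 0"
  and hd: "!!p. p \<in> V ==> (h has_derivative blinfun_apply (h' p)) (at p)"
  using lcm unfolding local_center_manifold_def by blast
 obtain N where N: "open N" "(0, 0, 0) \<in> N" and per: "!!p. p \<in> graph_over V h ==> p \<in> N ==> p ~= (0, 0, 0)
  ==> EX Gam. periodic_orbit ?X Gam & p \<in> Gam & Gam \<subseteq> graph_over V h"
  using cg unfolding center_on_graph_def by blast
 obtain dlt where dlt: "dlt > 0" "!!p. norm p < dlt ==> \<bar>h p\<bar> <= norm p"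
 proof -
  have "\<forall>e>0. \<exists>d>0. ALL y. norm (y - (0, 0)) < d --> norm (h y - h (0, 0) - blinfun_apply (h' (0, 0)) (y - (0, 0))) <= e * norm (y - (0, 0))"
   using hd[OF V(2)] unfolding has_derivative_at_alt by blast
  from this[rule_format, of 1] obtain d where "d > 0"
   "!!y. norm (y - (0, 0)) < d ==> norm (h y - h (0, 0) - blinfun_apply (h' (0, 0)) (y - (0, 0))) <= 1 * norm (y - (0, 0))" by auto
  then show thesis using that[of d] h by (simp add: zero_prod_def[symmetric])
 qed
 obtain e1 where e1: "e1 > 0" "ball (0, 0, 0) e1 \<subseteq> N" using N by (meson openE)
 obtain e2 where e2: "e2 > 0" "ball (0, 0) e2 \<subseteq> V" using V by (meson openE)
 define A where "A = \<bar>a 2 0 0\<bar> + \<bar>a 1 1 0\<bar> + \<bar>a 0 2 0\<bar> + \<bar>a 1 0 1\<bar> + \<bar>a 0 1 1\<bar> + \<bar>a 0 0 2\<bar> + 1"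
 have A: "A > 0" unfolding A_def by linarith
 define e0 where "e0 = min (min (dlt / 2) (min (e1 / 2) e2)) (min 1 (1 / (48 * pi * A)))"
 have e0: "e0 > 0" using dlt e1 e2 A by (simp add: e0_def)
 show thesis
 proof (rule that[OF e0])
  fix eps :: real assume eps: "0 < eps" "eps < e0"
  have small: "eps < dlt / 2" "eps < e1 / 2" "eps < e2" "eps < 1" "eps < 1 / (48 * pi * A)" using eps(2) by (simp_all add: e0_def)
  have neps: "norm (eps, 0 :: real) = eps" using eps by (simp add: norm_Pair)
  have "(eps, 0) \<in> V" using e2(2) small(3) neps by (auto simp: subset_iff dist_norm norm_minus_commute zero_prod_def[symmetric])
  moreover have "(eps, 0, h (eps, 0)) \<in> N"
  proof -
   have "norm (eps, 0 :: real, h (eps, 0)) <= norm eps + norm (0 :: real, h (eps, 0))" by (rule norm_Pair_le)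
   also have "... <= eps + (norm (0 :: real) + norm (h (eps, 0)))" using eps by (intro add_mono norm_Pair_le) auto
   also have "... <= eps + (0 + eps)" using dlt(2)[of "(eps, 0)"] neps small(1) eps by simp
   also have "... < e1" using small(2) by simp
   finally show ?thesis using e1(2) by (auto simp: subset_iff dist_norm norm_minus_commute zero_prod_def[symmetric])
  qed
  ultimately obtain Gam where Gam: "periodic_orbit ?X Gam" "(eps, 0, h (eps, 0)) \<in> Gam" "Gam \<subseteq> graph_over V h"
   using per[of "(eps, 0, h (eps, 0))"] eps by (auto simp: graph_over_def)
  obtain ph T where ph: "solution_on ?X UNIV ph" "T > 0" "!!t. ph (t + T) = ph t" "Gam = range ph"
   using Gam(1) unfolding periodic_orbit_def by blast
  obtain t0 where t0: "ph t0 = (eps, 0, h (eps, 0))" using Gam(2) ph(4) by (metis imageE)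
  define x y z where "x t = fst (ph (t + t0))" and "y t = fst (snd (ph (t + t0)))" and "z t = snd (snd (ph (t + t0)))" for t
  define q where "q t = hom_quadratic a (x t, y t, z t)" for t
  have phxyz: "ph (t + t0) = (x t, y t, z t)" for t by (simp add: x_def y_def z_def)
  have d: "(x has_real_derivative - y t + x t * q t) (at t)" "(y has_real_derivative x t + y t * q t) (at t)"
   "(z has_real_derivative - lam * z t + q t) (at t)" for t
   using solution_on_derivatives[OF ph(1) UNIV_I, of "t + t0"] unfolding DERIV_shift phxyz X fst_conv snd_conv q_def
   by (simp_all add: x_def[abs_def] y_def[abs_def] z_def[abs_def])
  have V': "(x t, y t) \<in> V" and zh: "z t = h (x t, y t)" for t
  proof -
   have "(x t, y t, z t) \<in> graph_over V h" using Gam(3) ph(4) phxyz[of t] by (metis rangeI subsetD)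
   then show "(x t, y t) \<in> V" "z t = h (x t, y t)" by (auto simp: graph_over_def)
  qed
  have init: "x 0 = eps" "y 0 = 0" by (simp_all add: x_def y_def t0)
  have perT: "x (t + T) = x t" "y (t + T) = y t" "z (t + T) = z t" for t
   using ph(3)[of "t + t0"] by (simp_all add: x_def y_def z_def add_ac)
  have cont: "continuous_on UNIV x" "continuous_on UNIV y" "continuous_on UNIV z"
   by (meson d DERIV_isCont continuous_at_imp_continuous_on)+
  have "continuous_on UNIV q" unfolding q_def hom_quadratic_expand
   by (intro continuous_on_add continuous_on_mult continuous_on_power continuous_on_const cont)
  then obtain Qi where Qi: "Qi 0 = 0" "!!t. (Qi has_real_derivative q t) (at t)"
   "!!y t. (!!t. (y has_real_derivative q t * y t) (at t)) ==> y t = y 0 * exp (Qi t)"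
   by (rule linear_equation_exp) blast
  define r s where "r t = x t * cos t + y t * sin t" and "s t = y t * cos t - x t * sin t" for t
  have rd: "(r has_real_derivative q t * r t) (at t)" and sd: "(s has_real_derivative q t * s t) (at t)" for t
   unfolding r_def s_def by (auto intro!: derivative_eq_intros d simp: algebra_simps)
  have rQ: "r t = eps * exp (Qi t)" and s0: "s t = 0" for t
   using Qi(3)[OF rd, of t] Qi(3)[OF sd, of t] by (simp_all add: r_def s_def init)
  have rpos: "r t > 0" for t using eps by (simp add: rQ)
  have xr: "x t = r t * cos t" and yr: "y t = r t * sin t" for t
  proof -
   have "(cos t)\<^sup>2 + (sin t)\<^sup>2 = 1" by simp
   then have "x t = r t * cos t - s t * sin t" "y t = r t * sin t + s t * cos t" unfolding r_def s_def by algebra+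
   then show "x t = r t * cos t" "y t = r t * sin t" by (simp_all add: s0)
  qed
  have qF: "q t = polar_rate a t (r t) (z t)" for t
   unfolding q_def hom_quadratic_expand polar_rate_def xr yr by algebra
  have rsq: "(r t)\<^sup>2 = (x t)\<^sup>2 + (y t)\<^sup>2" for t
   unfolding xr yr using sin_cos_squared_add2[of t] by algebra
  have rT: "r (t + T) = r t" for t
   by (rule power2_eq_imp_eq) (use rpos less_imp_le in \<open>auto simp: rsq perT\<close>)
  have "cos T = 1"
   using perT(1)[of 0] xr[of 0] xr[of T] rT[of 0] rpos[of 0] by simp
  then obtain n :: int where n: "T = of_int n * 2 * pi" unfolding cos_one_2pi_int by blast
  have "n > 0" using n ph(2) by (simp add: zero_less_mult_iff)
  then obtain k where k: "n = int k" "k > 0" by (metis zero_less_imp_eq_int)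
  have contr: "continuous_on UNIV r" by (meson rd DERIV_isCont continuous_at_imp_continuous_on)
  obtain t1 where t1: "r (t1 + 2 * pi) = r t1"
  proof -
   let ?D = "%t. r (t + 2 * pi) - r t"
   have "(\<Sum>j<k. r (real (Suc j) * (2 * pi)) - r (real j * (2 * pi))) = r (real k * (2 * pi)) - r (real 0 * (2 * pi))"
    by (rule sum_lessThan_telescope)
   also have "... = 0" using rT[of 0] n k by (simp add: mult.assoc)
   also have "(\<Sum>j<k. r (real (Suc j) * (2 * pi)) - r (real j * (2 * pi))) = (\<Sum>j<k. ?D (real j * (2 * pi)))"
    by (intro sum.cong refl) (simp add: algebra_simps)
   finally have sum0: "(\<Sum>j<k. ?D (real j * (2 * pi))) = 0" .
   have ne: "finite {..<k}" "{..<k} ~= {}" using k(2) by auto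
   have "\<exists>j\<in>{..<k}. ?D (real j * (2 * pi)) <= 0"
   proof (rule ccontr)
    assume "~ ?thesis"
    then have "(\<Sum>j<k. ?D (real j * (2 * pi))) > 0" by (intro sum_pos ne) (auto simp: not_le)
    then show False using sum0 by simp
   qed
   moreover have "\<exists>j\<in>{..<k}. ?D (real j * (2 * pi)) >= 0"
   proof (rule ccontr)
    assume "~ ?thesis"
    then have "(\<Sum>j<k. - ?D (real j * (2 * pi))) > 0" by (intro sum_pos ne) (auto simp: not_le)
    then show False using sum0 by (simp add: sum_negf[symmetric] sum_subtractf)
   qed
   ultimately obtain u v where uv: "?D u <= 0" "0 <= ?D v" by blast
   have "continuous_on UNIV ?D"
    by (intro continuous_on_diff contr continuous_on_compose2[OF contr] continuous_intros) auto
   then have "connected (range ?D)" by (rule connected_continuous_image) (rule connected_UNIV)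
   then have "0 \<in> range ?D" by (rule connectedD_interval[of _ "?D u" "?D v"]) (use uv in auto)
   then show thesis using that by auto
  qed
  let ?f = "%t. a 2 0 0 * (cos t)\<^sup>2 + a 1 1 0 * (cos t * sin t) + a 0 2 0 * (sin t)\<^sup>2"
  let ?l = "%t. a 1 0 1 * cos t + a 0 1 1 * sin t"
  define r2 z2 where "r2 t = r (t + 2 * pi)" and "z2 t = z (t + 2 * pi)" for t
  have rz2: "(r2 has_real_derivative r2 t * polar_rate a t (r2 t) (z2 t)) (at t)"
   "(z2 has_real_derivative - lam * z2 t + polar_rate a t (r2 t) (z2 t)) (at t)" for t
   using rd[of "t + 2 * pi"] d(3)[of "t + 2 * pi"] unfolding DERIV_shift qF polar_rate_periodic
   by (simp_all add: r2_def[abs_def] z2_def[abs_def] mult.commute)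
  have rz: "(r has_real_derivative r t * polar_rate a t (r t) (z t)) (at t)"
   "(z has_real_derivative - lam * z t + polar_rate a t (r t) (z t)) (at t)" for t
   using rd[of t] d(3)[of t] unfolding qF by (simp_all add: mult.commute)
  have cont2: "continuous_on UNIV r2" "continuous_on UNIV z2"
   by (meson rz2 DERIV_isCont continuous_at_imp_continuous_on)+
  have ctr: "continuous_on UNIV (cos :: real => real)" "continuous_on UNIV (sin :: real => real)"
   by (intro continuous_intros)+
  have same: "r2 t - r t = 0 & z2 t - z t = 0" for t
  proof (rule linear_pair_zero[where t = t and ?t1.0 = t1 and w = "%t. r2 t - r t" and v = "%t. z2 t - z t"
     and A = "%t. ?f t * ((r2 t)\<^sup>2 + r2 t * r t + (r t)\<^sup>2) + ?l t * ((r2 t + r t) * z2 t) + a 0 0 2 * (z2 t)\<^sup>2"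
     and B = "%t. ?l t * (r t)\<^sup>2 + a 0 0 2 * (r t * (z2 t + z t))"
     and C = "%t. ?f t * (r2 t + r t) + ?l t * z2 t"
     and D = "%t. - lam + ?l t * r t + a 0 0 2 * (z2 t + z t)"])
   fix t
   have "r2 t * polar_rate a t (r2 t) (z2 t) - r t * polar_rate a t (r t) (z t)
    = (?f t * ((r2 t)\<^sup>2 + r2 t * r t + (r t)\<^sup>2) + ?l t * ((r2 t + r t) * z2 t) + a 0 0 2 * (z2 t)\<^sup>2) * (r2 t - r t)
     + (?l t * (r t)\<^sup>2 + a 0 0 2 * (r t * (z2 t + z t))) * (z2 t - z t)"
    unfolding polar_rate_def by algebra
   with DERIV_diff[OF rz2(1)[of t] rz(1)[of t]]
   show "((%t. r2 t - r t) has_real_derivative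
    (?f t * ((r2 t)\<^sup>2 + r2 t * r t + (r t)\<^sup>2) + ?l t * ((r2 t + r t) * z2 t) + a 0 0 2 * (z2 t)\<^sup>2) * (r2 t - r t)
     + (?l t * (r t)\<^sup>2 + a 0 0 2 * (r t * (z2 t + z t))) * (z2 t - z t)) (at t)" by (simp only:)
   have "(- lam * z2 t + polar_rate a t (r2 t) (z2 t)) - (- lam * z t + polar_rate a t (r t) (z t))
    = (?f t * (r2 t + r t) + ?l t * z2 t) * (r2 t - r t) + (- lam + ?l t * r t + a 0 0 2 * (z2 t + z t)) * (z2 t - z t)"
    unfolding polar_rate_def by algebra
   with DERIV_diff[OF rz2(2)[of t] rz(2)[of t]]
   show "((%t. z2 t - z t) has_real_derivative
    (?f t * (r2 t + r t) + ?l t * z2 t) * (r2 t - r t) + (- lam + ?l t * r t + a 0 0 2 * (z2 t + z t)) * (z2 t - z t)) (at t)" by (simp only:)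
  next
   show "r2 t1 - r t1 = 0" by (simp add: r2_def t1)
   have "x (t1 + 2 * pi) = x t1" "y (t1 + 2 * pi) = y t1" by (simp_all add: xr yr t1)
   then show "z2 t1 - z t1 = 0" by (simp add: z2_def zh)
  next
   have fc: "continuous_on UNIV ?f" "continuous_on UNIV ?l" by (intro continuous_intros)+
   have sq: "continuous_on UNIV (%t. (r t)\<^sup>2)" "continuous_on UNIV (%t. (r2 t)\<^sup>2)" "continuous_on UNIV (%t. (z2 t)\<^sup>2)"
    by (rule continuous_on_power contr cont2)+
   have rr: "continuous_on UNIV (%t. r2 t * r t)" "continuous_on UNIV (%t. r2 t + r t)" "continuous_on UNIV (%t. z2 t + z t)"
    by (rule continuous_on_mult continuous_on_add contr cont2 cont(3))+
   show "continuous_on UNIV (%t. ?f t * ((r2 t)\<^sup>2 + r2 t * r t + (r t)\<^sup>2) + ?l t * ((r2 t + r t) * z2 t) + a 0 0 2 * (z2 t)\<^sup>2)"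
    by (rule continuous_on_add[OF continuous_on_add[OF continuous_on_mult[OF fc(1) continuous_on_add[OF continuous_on_add[OF sq(2) rr(1)] sq(1)]]
      continuous_on_mult[OF fc(2) continuous_on_mult[OF rr(2) cont2(2)]]] continuous_on_mult_left[OF sq(3)]])
   show "continuous_on UNIV (%t. ?l t * (r t)\<^sup>2 + a 0 0 2 * (r t * (z2 t + z t)))"
    by (rule continuous_on_add[OF continuous_on_mult[OF fc(2) sq(1)] continuous_on_mult_left[OF continuous_on_mult[OF contr rr(3)]]])
   show "continuous_on UNIV (%t. ?f t * (r2 t + r t) + ?l t * z2 t)"
    by (rule continuous_on_add[OF continuous_on_mult[OF fc(1) rr(2)] continuous_on_mult[OF fc(2) cont2(2)]])
   show "continuous_on UNIV (%t. - lam + ?l t * r t + a 0 0 2 * (z2 t + z t))"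
    by (rule continuous_on_add[OF continuous_on_add[OF continuous_on_const continuous_on_mult[OF fc(2) contr]] continuous_on_mult_left[OF rr(3)]])
  qed
  have per2: "r (t + 2 * pi) = r t" "z (t + 2 * pi) = z t" for t
   using same[of t] by (simp_all add: r2_def z2_def)
  have nr: "norm (x t, y t) = r t" for t
   using rsq[of t] rpos[of t] by (simp add: norm_Pair real_sqrt_unique)
  have zr: "\<bar>z t\<bar> <= r t" if "r t < 2 * eps" for t
   using dlt(2)[of "(x t, y t)"] that small(1) unfolding zh nr by simp
  have Qb: "\<bar>Qi t\<bar> <= 1 / 2" if t: "0 <= t" "t <= 2 * pi" and b: "!!u. 0 < u ==> u < t ==> r u < 2 * eps" for t
  proof (cases "t = 0")
   case False
   with t have "0 < t" by simp
   from MVT2[OF this, of Qi q] Qi(2) obtain u where u: "0 < u" "u < t" "Qi t - Qi 0 = (t - 0) * q u" by blast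
   have "\<bar>q u\<bar> <= 3 * A * (r u)\<^sup>2" unfolding qF by (rule polar_rate_bound[OF zr[OF b[OF u(1,2)]] A_def])
   also have "... <= 3 * A * (2 * eps)\<^sup>2"
    using A b[OF u(1,2)] rpos[of u] by (intro mult_left_mono power_mono) auto
   finally have "\<bar>t * q u\<bar> <= 2 * pi * (3 * A * (2 * eps)\<^sup>2)"
    unfolding abs_mult using t A by (intro mult_mono) auto
   also have "... = 24 * pi * A * eps * eps" by (simp add: power2_eq_square)
   also have "... <= 24 * pi * A * (1 / (48 * pi * A)) * 1" using small eps A by (intro mult_mono) auto
   also have "... = 1 / 2" using A by simp
   finally show ?thesis using u(3) Qi(1) by simp
  qed (simp add: Qi(1))
  have ex: "exp (1 / 2 :: real) < 2"
  proof -
   have "exp (1 / 2 :: real) * exp (1 / 2) = exp 1" unfolding exp_add[symmetric] by simp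
   then have "(exp (1 / 2 :: real))\<^sup>2 < 2\<^sup>2" using exp_le by (simp add: power2_eq_square)
   then show ?thesis by (rule power_less_imp_less_base) simp
  qed
  have up: "r t < 2 * eps" if t: "t \<in> {0..2 * pi}" for t
  proof (rule ccontr)
   assume "~ ?thesis"
   then have "t \<in> {0..2 * pi} \<inter> {t. 2 * eps <= r t}" using t by simp
   moreover have "closed {t. 2 * eps <= r t}" by (intro closed_Collect_le continuous_on_const contr)
   then have "compact ({0..2 * pi} \<inter> {t. 2 * eps <= r t})" by (intro compact_Int_closed) auto
   ultimately obtain u where u: "u \<in> {0..2 * pi}" "2 * eps <= r u" "!!s. s \<in> {0..2 * pi} ==> 2 * eps <= r s ==> u <= s"
    using compact_attains_inf[of "{0..2 * pi} \<inter> {t. 2 * eps <= r t}"] by blast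
   have "r v < 2 * eps" if "0 < v" "v < u" for v using u(3)[of v] u(1) that by force
   then have "\<bar>Qi u\<bar> <= 1 / 2" using u(1) by (intro Qb) auto
   then have "r u <= eps * exp (1 / 2)" unfolding rQ using eps by (intro mult_left_mono) auto
   also have "... < eps * 2" using ex eps by (intro mult_strict_left_mono)
   finally show False using u(2) by simp
  qed
  have lo: "eps / 2 <= r t" if t: "t \<in> {0..2 * pi}" for t
  proof -
   have "\<bar>Qi t\<bar> <= 1 / 2" by (rule Qb) (use t up in auto)
   then have 1: "exp (- (1 / 2)) <= exp (Qi t)" by (simp only: exp_le_cancel_iff)
   moreover have "exp (- (1 / 2) :: real) >= 1 / 2" using ex by (simp add: exp_minus field_simps)
   ultimately have "1 / 2 <= exp (Qi t)" by linarith
   then have "eps * (1 / 2) <= eps * exp (Qi t)" using eps(1) by (rule mult_left_mono[OF _ less_imp_le])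
   then show ?thesis by (simp add: rQ)
  qed
  have all: "eps / 2 <= r t & r t <= 2 * eps & \<bar>z t\<bar> <= r t" for t
  proof -
   obtain u where u: "u \<in> {0..2 * pi}" "(r u, z u) = (r t, z t)"
    using periodic_representative[of "%t. (r t, z t)" "2 * pi" t] per2 by auto
   show ?thesis using lo[OF u(1)] up[OF u(1)] zr[OF up[OF u(1)]] u(2) by simp
  qed
  show "EX r z. ALL t. (r has_real_derivative r t * polar_rate a t (r t) (z t)) (at t)
   & (z has_real_derivative - lam * z t + polar_rate a t (r t) (z t)) (at t)
   & r (t + 2 * pi) = r t & z (t + 2 * pi) = z t & eps / 2 <= r t & r t <= 2 * eps & \<bar>z t\<bar> <= r t"
   using rz per2 all by blast
 qed
qed

section \<open>Balance equations of a formal centre\<close>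

definition conv :: "(nat => nat => complex) => (nat => nat => complex) => nat => nat => complex" where
 "conv X Y i j = dsum i (%k k'. dsum j (%l l'. X k l * Y k' l'))"

definition rate_array :: "complex => complex => complex => complex => complex => complex =>
  (nat => nat => complex) => (nat => nat => complex) => nat => nat => complex" where
 "rate_array c c' c0 m m' d R Z i j =
  (if 2 <= i then c * conv R R (i - 2) j else 0) + (if 2 <= j then c' * conv R R i (j - 2) else 0)
  + (if 1 <= i & 1 <= j then c0 * conv R R (i - 1) (j - 1) else 0)
  + (if 1 <= i then m * conv R Z (i - 1) j else 0) + (if 1 <= j then m' * conv R Z i (j - 1) else 0)
  + d * conv Z Z i j"

locale center_arrays =
 fixes L c c' m m' d :: complex and R Z :: "nat => nat => complex"
 assumes nonres: "!!h. h \<in> {1..6::nat} ==> L + of_nat h ~= 0 & L - of_nat h ~= 0" and L0: "L ~= 0"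
  and init: "R 0 0 = 1" "Z 0 0 = 0" "Z 1 0 = 0" "Z 0 1 = 0"
  and diag: "!!k. k \<in> {1..6} ==> Z k k = 0" "!!k. k \<in> {1..6} ==> R k k = 0"
   "!!k. k \<in> {1..6} ==> rate_array c c' 0 m m' d R Z k k = 0"
  and Zeq: "!!i j. i <= 6 ==> j <= 6 ==> i ~= j ==> rate_array c c' 0 m m' d R Z i j = (L + of_nat i - of_nat j) * Z i j"
  and Req: "!!i j. i <= 6 ==> j <= 6 ==> i ~= j ==> conv R (%k l. (L + of_nat k - of_nat l) * Z k l) i j = (of_nat i - of_nat j) * R i j"
begin

lemmas expand = rate_array_def conv_def dsum_values nat_facts One_nat_def if_True if_False HOL.simp_thms

lemma nr: "L + 1 ~= 0" "L + 2 ~= 0" "L + 3 ~= 0" "L + 4 ~= 0" "L + 5 ~= 0" "L + 6 ~= 0"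
 "L - 1 ~= 0" "L - 2 ~= 0" "L - 3 ~= 0" "L - 4 ~= 0" "L - 5 ~= 0" "L - 6 ~= 0"
 using nonres[of 1] nonres[of 2] nonres[of 3] nonres[of 4] nonres[of 5] nonres[of 6] by simp_all

lemma R1: "R (Suc 0) 0 = 0" "R 0 (Suc 0) = 0"
 using Req[of 1 0] Req[of 0 1] init by (simp_all add: expand)

lemma deg2: "c = (L + 2) * Z 2 0" "c' = (L - 2) * Z 0 2" "2 * R 2 0 = (L + 2) * Z 2 0" "2 * R 0 2 = - ((L - 2) * Z 0 2)"
proof -
 have z: "R 0 0 = 1" "Z 0 0 = 0" "Z (Suc 0) 0 = 0" "Z 0 (Suc 0) = 0" "Z (Suc 0) (Suc 0) = 0"
  "R (Suc 0) 0 = 0" "R 0 (Suc 0) = 0" "R (Suc 0) (Suc 0) = 0" "Z 2 2 = 0" "R 2 2 = 0"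
  using init diag(1,2)[of 1] diag(1,2)[of 2] R1 by simp_all
 show "c = (L + 2) * Z 2 0" "c' = (L - 2) * Z 0 2"
  using Zeq[of 2 0] Zeq[of 0 2] by (simp_all add: expand z)
 show "2 * R 2 0 = (L + 2) * Z 2 0" "2 * R 0 2 = - ((L - 2) * Z 0 2)"
  using Req[of 2 0] Req[of 0 2] by (simp_all add: expand z) (algebra+)?
qed

lemma low_zero: "R 0 0 = 1" "Z 0 0 = 0" "Z (Suc 0) 0 = 0" "Z 0 (Suc 0) = 0" "Z (Suc 0) (Suc 0) = 0"
  "R (Suc 0) 0 = 0" "R 0 (Suc 0) = 0" "R (Suc 0) (Suc 0) = 0" "Z 2 2 = 0" "R 2 2 = 0" "Z 3 3 = 0" "R 3 3 = 0"
 using init diag(1,2)[of 1] diag(1,2)[of 2] diag(1,2)[of 3] R1 by simp_all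

lemma deg3: "(L + 3) * Z 3 0 = m * Z 2 0" "(L + 1) * Z 2 (Suc 0) = m' * Z 2 0" "(L - 1) * Z (Suc 0) 2 = m * Z 0 2" "(L - 3) * Z 0 3 = m' * Z 0 2"
 "3 * R 3 0 = m * Z 2 0" "R 2 (Suc 0) = m' * Z 2 0" "R (Suc 0) 2 = - (m * Z 0 2)" "3 * R 0 3 = - (m' * Z 0 2)"
proof -
 show z: "(L + 3) * Z 3 0 = m * Z 2 0" "(L + 1) * Z 2 (Suc 0) = m' * Z 2 0" "(L - 1) * Z (Suc 0) 2 = m * Z 0 2" "(L - 3) * Z 0 3 = m' * Z 0 2"
  using Zeq[of 3 0] Zeq[of 2 1] Zeq[of 1 2] Zeq[of 0 3] by (simp_all add: expand low_zero algebra_simps)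
 show "3 * R 3 0 = m * Z 2 0" "R 2 (Suc 0) = m' * Z 2 0" "R (Suc 0) 2 = - (m * Z 0 2)" "3 * R 0 3 = - (m' * Z 0 2)"
  using Req[of 3 0] Req[of 2 1] Req[of 1 2] Req[of 0 3] z by (simp_all add: expand low_zero algebra_simps) (algebra+)?
qed

lemma deg4: "(L + 2) * Z 3 (Suc 0) = m * Z 2 (Suc 0) + m' * Z 3 0" "(L - 2) * Z (Suc 0) 3 = m * Z 0 3 + m' * Z (Suc 0) 2"
 "2 * R 3 (Suc 0) = m * Z 2 (Suc 0) + m' * Z 3 0" "2 * R (Suc 0) 3 = - (m * Z 0 3 + m' * Z (Suc 0) 2)"
proof -
 show z: "(L + 2) * Z 3 (Suc 0) = m * Z 2 (Suc 0) + m' * Z 3 0" "(L - 2) * Z (Suc 0) 3 = m * Z 0 3 + m' * Z (Suc 0) 2"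
  using Zeq[of 3 1] Zeq[of 1 3] by (simp_all add: expand low_zero algebra_simps)
 show "2 * R 3 (Suc 0) = m * Z 2 (Suc 0) + m' * Z 3 0" "2 * R (Suc 0) 3 = - (m * Z 0 3 + m' * Z (Suc 0) 2)"
  using Req[of 3 1] Req[of 1 3] z by (simp_all add: expand low_zero algebra_simps) (algebra+)?
qed

lemma deg5:
 "(L - 1) * Z 2 3 = c * (2 * R 0 3) + c' * (2 * R 2 (Suc 0)) + m * Z (Suc 0) 3 + m' * (R 2 0 * Z 0 2 + R 0 2 * Z 2 0) + d * (2 * (Z 2 0 * Z 0 3 + Z 0 2 * Z 2 (Suc 0)))"
 "(L + 1) * Z 3 2 = c * (2 * R (Suc 0) 2) + c' * (2 * R 3 0) + m' * Z 3 (Suc 0) + m * (R 2 0 * Z 0 2 + R 0 2 * Z 2 0) + d * (2 * (Z 2 0 * Z (Suc 0) 2 + Z 0 2 * Z 3 0))"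
 using Zeq[of 2 3] Zeq[of 3 2] by (simp_all add: expand low_zero algebra_simps)

lemma rate22: "m * Z (Suc 0) 2 + m' * Z 2 (Suc 0) + 2 * d * (Z 2 0 * Z 0 2) + 2 * c * R 0 2 + 2 * c' * R 2 0 = 0"
 using diag(3)[of 2] by (simp add: expand low_zero algebra_simps)

lemma rate33: "2 * c * R (Suc 0) 3 + 2 * c' * R 3 (Suc 0)
  + m * (Z 2 3 + R 2 0 * Z 0 3 + R 0 2 * Z 2 (Suc 0) + R 2 (Suc 0) * Z 0 2 + R 0 3 * Z 2 0)
  + m' * (Z 3 2 + R 0 2 * Z 3 0 + R 2 0 * Z (Suc 0) 2 + R (Suc 0) 2 * Z 2 0 + R 3 0 * Z 0 2)
  + 2 * d * (Z 2 0 * Z (Suc 0) 3 + Z 0 2 * Z 3 (Suc 0) + Z 3 0 * Z 0 3 + Z 2 (Suc 0) * Z (Suc 0) 2) = 0"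
 using diag(3)[of 3] by (simp add: expand low_zero algebra_simps)

lemma first_balance: "(L + 1) * (m * m * Z 0 2) + (L - 1) * (m' * m' * Z 2 0) + 2 * d * ((L + 1) * (L - 1)) * (Z 2 0 * Z 0 2) = 0"
 using rate22 deg2 deg3 by algebra

lemma second_balance:
 "m * m' * ((L + 1)^2 * (L + 3) * (m * m * Z 0 2) + (L - 1)^2 * (L - 3) * (m' * m' * Z 2 0)
  + (10 * d * (L^2 - 1) + 34 * L - 6 * L^3) * ((L + 1) * (L - 1)) * (Z 2 0 * Z 0 2)) = 0"
proof -
 obtain u v A B where uvAB: "(L + 1) * u = 1" "(L - 1) * v = 1" "(L + 3) * A = 1" "(L - 3) * B = 1"
  using nr by (metis right_inverse)
 define s t where "s = Z 2 0" and "t = Z 0 2"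
 have Z3: "Z 3 0 = A * m * s" "Z 2 (Suc 0) = u * m' * s" "Z (Suc 0) 2 = v * m * t" "Z 0 3 = B * m' * t"
  using deg3(1-4) uvAB unfolding s_def t_def by algebra+
 have dv: "x = y / n" if "n * x = y" "n ~= 0" for n x y :: complex
  using that by auto
 have R2: "R 2 0 = (L + 2) * s / 2" "R 0 2 = - ((L - 2) * t / 2)"
 proof -
  show "R 2 0 = (L + 2) * s / 2" by (rule dv) (simp_all only: s_def deg2(3), simp)
  show "R 0 2 = - ((L - 2) * t / 2)" unfolding minus_divide_left by (rule dv) (simp_all only: t_def deg2(4), simp)
 qed
 have R3: "R 3 0 = m * s / 3" "R 2 (Suc 0) = m' * s" "R (Suc 0) 2 = - (m * t)" "R 0 3 = - (m' * t / 3)"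
 proof -
  show "R 3 0 = m * s / 3" by (rule dv) (simp_all only: s_def deg3(5), simp)
  show "R 0 3 = - (m' * t / 3)" unfolding minus_divide_left by (rule dv) (simp_all only: t_def deg3(8), simp)
 qed (simp_all only: s_def t_def deg3(6,7))
 have "(L + 2) * Z 3 (Suc 0) = (L + 2) * (2 * u * A * (m * m') * s)" "(L - 2) * Z (Suc 0) 3 = (L - 2) * (2 * v * B * (m * m') * t)"
  unfolding deg4(1,2) Z3 using uvAB by algebra+
 then have Z4: "Z 3 (Suc 0) = 2 * u * A * (m * m') * s" "Z (Suc 0) 3 = 2 * v * B * (m * m') * t"
  using nr by simp_all
 have R4: "R 3 (Suc 0) = (L + 2) * u * A * (m * m') * s" "R (Suc 0) 3 = - ((L - 2) * v * B * (m * m') * t)"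
 proof -
  have UA: "u + A = (2 * L + 4) * u * A" and VB: "v + B = (2 * L - 4) * v * B" using uvAB by algebra+
  have "2 * R 3 (Suc 0) = m * m' * s * (u + A)" unfolding deg4(3) Z3 by (simp add: algebra_simps)
  moreover have "2 * R (Suc 0) 3 = - (m * m' * t * (v + B))"
   unfolding deg4(4) Z3 by (simp add: algebra_simps)
  ultimately have r: "2 * R 3 (Suc 0) = 2 * ((L + 2) * u * A * (m * m') * s)" "2 * R (Suc 0) 3 = 2 * (- ((L - 2) * v * B * (m * m') * t))"
   unfolding UA VB by algebra+
  have cancel: "x = y" if "2 * x = 2 * y" for x y :: complex using that by simp
  show "R 3 (Suc 0) = (L + 2) * u * A * (m * m') * s" by (rule cancel) (rule r(1))
  show "R (Suc 0) 3 = - ((L - 2) * v * B * (m * m') * t)" by (rule cancel) (rule r(2))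
 qed
 have c: "c = (L + 2) * s" "c' = (L - 2) * t" using deg2 by (simp_all add: s_def t_def)
 have Z5: "Z 2 3 = v * (s * t * m' * ((4 * L - 10) / 3) + 2 * v * B * (m * m * m') * t + 2 * d * (s * t) * m' * (B + u))"
  "Z 3 2 = u * (- (s * t * m * ((4 * L + 10) / 3)) + 2 * u * A * (m * m' * m') * s + 2 * d * (s * t) * m * (v + A))"
 proof -
  have "(L - 1) * Z 2 3 = s * t * m' * ((4 * L - 10) / 3) + 2 * v * B * (m * m * m') * t + 2 * d * (s * t) * m' * (B + u)"
   unfolding deg5(1) c R3 R2 Z3 Z4 s_def[symmetric] t_def[symmetric] by (simp add: field_simps)
  moreover have "(L + 1) * Z 3 2 = - (s * t * m * ((4 * L + 10) / 3)) + 2 * u * A * (m * m' * m') * s + 2 * d * (s * t) * m * (v + A)"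
   unfolding deg5(2) c R3 R2 Z3 Z4 s_def[symmetric] t_def[symmetric] by (simp add: field_simps)
  ultimately show "Z 2 3 = v * (s * t * m' * ((4 * L - 10) / 3) + 2 * v * B * (m * m * m') * t + 2 * d * (s * t) * m' * (B + u))"
   "Z 3 2 = u * (- (s * t * m * ((4 * L + 10) / 3)) + 2 * u * A * (m * m' * m') * s + 2 * d * (s * t) * m * (v + A))"
   using uvAB by algebra+
 qed
 define K where "K = 2 * (L^2 - 4) * (u * A - v * B) + v * ((4 * L - 10) / 3) - u * ((4 * L + 10) / 3) + (L + 2) * (B + v) / 2 - (L - 2) * (u + A) / 2"
 have "2 * c * R (Suc 0) 3 + 2 * c' * R 3 (Suc 0)
  + m * (Z 2 3 + R 2 0 * Z 0 3 + R 0 2 * Z 2 (Suc 0) + R 2 (Suc 0) * Z 0 2 + R 0 3 * Z 2 0)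
  + m' * (Z 3 2 + R 0 2 * Z 3 0 + R 2 0 * Z (Suc 0) 2 + R (Suc 0) 2 * Z 2 0 + R 3 0 * Z 0 2)
  + 2 * d * (Z 2 0 * Z (Suc 0) 3 + Z 0 2 * Z 3 (Suc 0) + Z 3 0 * Z 0 3 + Z 2 (Suc 0) * Z (Suc 0) 2)
  = m * m' * (s * t * K + 2 * v^2 * B * (m * m * t) + 2 * u^2 * A * (m' * m' * s) + 2 * d * (s * t) * (3 * v * B + 3 * u * A + 3 * u * v + A * B))"
  unfolding c R4 R3 R2 Z3 Z4 Z5 s_def[symmetric] t_def[symmetric] K_def by (simp add: field_simps power2_eq_square)
 then have E: "m * m' * (s * t * K + 2 * v^2 * B * (m * m * t) + 2 * u^2 * A * (m' * m' * s) + 2 * d * (s * t) * (3 * v * B + 3 * u * A + 3 * u * v + A * B)) = 0"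
  unfolding rate33 by (rule sym)
 have K: "(L^2 - 9) * (L^2 - 1) * K = 2 * (34 * L - 6 * L^3)"
 proof -
  have "6 * ((L^2 - 9) * (L^2 - 1) * K) = (L^2 - 9) * (L^2 - 1) * (12 * (L^2 - 4) * (u * A - v * B) + 2 * v * (4 * L - 10) - 2 * u * (4 * L + 10) + 3 * (L + 2) * (B + v) - 3 * (L - 2) * (u + A))"
   unfolding K_def by (simp add: field_simps)
  also have "... = 6 * (2 * (34 * L - 6 * L^3))" using uvAB by algebra
  finally have k6: "6 * ((L^2 - 9) * (L^2 - 1) * K) = 6 * (2 * (34 * L - 6 * L^3))" .
  have cancel: "x = y" if "6 * x = 6 * y" for x y :: complex using that by simp
  show ?thesis by (rule cancel[OF k6])
 qed
 have V: "(L^2 - 9) * (L^2 - 1) * ((L^2 - 1) * (2 * v^2 * B)) = 2 * ((L + 1)^2 * (L + 3))"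
  "(L^2 - 9) * (L^2 - 1) * ((L^2 - 1) * (2 * u^2 * A)) = 2 * ((L - 1)^2 * (L - 3))"
  "(L^2 - 9) * (L^2 - 1) * (3 * v * B + 3 * u * A + 3 * u * v + A * B) = 10 * (L^2 - 1)"
  using uvAB by algebra+
 have comb: "D * N * (g * (st * K' + a * X + b * Y + 2 * d' * st * h)) = g * (st * N * (D * K') + D * (N * a) * X + D * (N * b) * Y + 2 * d' * st * N * (D * h))"
  for D N g st K' a X b Y d' h :: complex by (simp add: algebra_simps)
 have "m * m' * (s * t * (L^2 - 1) * (2 * (34 * L - 6 * L^3)) + 2 * ((L + 1)^2 * (L + 3)) * (m * m * t)
   + 2 * ((L - 1)^2 * (L - 3)) * (m' * m' * s) + 2 * d * (s * t) * (L^2 - 1) * (10 * (L^2 - 1))) = 0"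
  using comb[of "(L^2 - 9) * (L^2 - 1)" "L^2 - 1" "m * m'" "s * t" K "2 * v^2 * B" "m * m * t" "2 * u^2 * A" "m' * m' * s" d
    "3 * v * B + 3 * u * A + 3 * u * v + A * B"] unfolding E K V mult_zero_right by (rule sym)
 moreover have "2 * (m * m' * ((L + 1)^2 * (L + 3) * (m * m * t) + (L - 1)^2 * (L - 3) * (m' * m' * s)
  + (10 * d * (L^2 - 1) + 34 * L - 6 * L^3) * ((L + 1) * (L - 1)) * (s * t)))
  = m * m' * (s * t * (L^2 - 1) * (2 * (34 * L - 6 * L^3)) + 2 * ((L + 1)^2 * (L + 3)) * (m * m * t)
   + 2 * ((L - 1)^2 * (L - 3)) * (m' * m' * s) + 2 * d * (s * t) * (L^2 - 1) * (10 * (L^2 - 1)))" by algebra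
 ultimately have z: "2 * (m * m' * ((L + 1)^2 * (L + 3) * (m * m * t) + (L - 1)^2 * (L - 3) * (m' * m' * s)
  + (10 * d * (L^2 - 1) + 34 * L - 6 * L^3) * ((L + 1) * (L - 1)) * (s * t))) = 0" by (simp only:)
 have half: "x = 0" if "2 * x = 0" for x :: complex using that by simp
 show ?thesis unfolding s_def[symmetric] t_def[symmetric] by (rule half[OF z])
qed

end

text \<open>Weights absorbing both the rescaling freedom \<open>a \<mapsto> \<alpha> a\<close> and the small divisors, so that the
  rescaled arrays have polynomial entries.\<close>

definition weight :: "complex => complex => complex => nat => complex" where
 "weight L m tau i = [1, 2 * m, m^2 / (tau * (2 * (L + 1))), m^3 / (tau * (6 * (L + 1) * (L + 3))),
  m^4 / (tau^2 * (48 * (L + 1)^2 * (L + 2) * (L + 3) * (L + 4))),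
  m^5 / (tau^2 * (120 * (L + 1)^2 * (L + 2) * (L + 3)^2 * (L + 4) * (L + 5))),
  m^6 / (tau^3 * (2880 * (L + 1)^3 * (L + 2)^2 * (L + 3)^3 * (L + 4)^2 * (L + 5) * (L + 6)))] ! i"

lemma weight_nonzero:
 assumes "!!h. h \<in> {1..6::nat} ==> L + of_nat h ~= 0" "m ~= 0" "tau ~= 0" "i <= 6"
 shows "weight L m tau i ~= 0"
proof -
 have nz: "L + 1 ~= 0" "L + 2 ~= 0" "L + 3 ~= 0" "L + 4 ~= 0" "L + 5 ~= 0" "L + 6 ~= 0"
  using assms(1)[of 1] assms(1)[of 2] assms(1)[of 3] assms(1)[of 4] assms(1)[of 5] assms(1)[of 6] by simp_all
 have "i = 0 | i = Suc 0 | i = 2 | i = 3 | i = 4 | i = 5 | i = 6" using assms(4) by linarith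
 then show ?thesis using nz assms(2,3) by (elim disjE) (simp_all add: weight_def del: distrib_left_numeral)
qed

lemma weight_twist:
 assumes nz: "!!h. h \<in> {1..6::nat} ==> L + of_nat h ~= 0" "m ~= 0" "tau ~= 0"
  and tau: "4 * tau = (L - 1) * weight_poly L e" and i: "i <= 6" "k <= i"
 shows "weight L m tau k * weight L m tau (i - k) = twist L e i k * weight L m tau i"
proof -
 have n: "L + 1 ~= 0" "L + 2 ~= 0" "L + 3 ~= 0" "L + 4 ~= 0" "L + 5 ~= 0" "L + 6 ~= 0"
  using nz(1)[of 1] nz(1)[of 2] nz(1)[of 3] nz(1)[of 4] nz(1)[of 5] nz(1)[of 6] by simp_all
 define p where "p = L + 1"
 define q where "q = L + 2"
 define r where "r = L + 3"
 define s where "s = L + 4"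
 define t where "t = L + 5"
 define u where "u = L + 6"
 have pn: "p ~= 0" "q ~= 0" "r ~= 0" "s ~= 0" "t ~= 0" "u ~= 0" using n by (simp_all add: p_def q_def r_def s_def t_def u_def)
 have tw: "x * (L - 1) * weight_poly L e = 4 * tau * x" for x unfolding tau by (simp add: mult_ac)
 have "i = 0 | i = Suc 0 | i = 2 | i = 3 | i = 4 | i = 5 | i = 6" using i(1) by linarith
 moreover have "k = 0 | k = Suc 0 | k = 2 | k = 3 | k = 4 | k = 5 | k = 6" using i by linarith
 ultimately show ?thesis using i(2)
  by (elim disjE; simp only: twist_values weight_def tw p_def[symmetric] q_def[symmetric] r_def[symmetric] s_def[symmetric] t_def[symmetric] u_def[symmetric];
    simp add: pn nz(2,3) field_simps eval_nat_numeral)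
qed

lemma gauge_conv:
 assumes nz: "!!i. i <= 6 ==> w i ~= 0" "!!i. i <= 6 ==> w' i ~= 0"
  and tw: "!!i k. i <= 6 ==> k <= i ==> w k * w (i - k) = T i k * w i" "!!i k. i <= 6 ==> k <= i ==> w' k * w' (i - k) = T' i k * w' i"
  and ij: "i <= 6" "j <= 6"
 shows "tconv T T' (%i j. X i j / (w i * w' j)) (%i j. Y i j / (w i * w' j)) i j = conv X Y i j / (w i * w' j)"
 unfolding tconv_def conv_def dsum_def sum_divide_distrib
proof (intro sum.cong refl)
 fix k l assume kl: "k \<in> {..i}" "l \<in> {..j}"
 have n: "w k ~= 0" "w (i - k) ~= 0" "w' l ~= 0" "w' (j - l) ~= 0" "w i ~= 0" "w' j ~= 0" using nz ij kl by auto
 have t: "T i k = w k * w (i - k) / w i" "T' j l = w' l * w' (j - l) / w' j"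
  using tw(1)[of i k] tw(2)[of j l] ij kl n by simp_all
 show "T i k * T' j l * (X k l / (w k * w' l) * (Y (i - k) (j - l) / (w (i - k) * w' (j - l)))) = X k l * Y (i - k) (j - l) / (w i * w' j)"
  unfolding t using n by (simp add: field_simps)
qed

text \<open>The first two balance equations are linear in the ratios \<open>m\<^sup>2 / Z 2 0\<close> and \<open>m'\<^sup>2 / Z 0 2\<close>; solving
  them fixes the weights and turns the arrays into rescaled ones.\<close>

lemma center_arrays_focus:
 assumes ca: "center_arrays L c c' m m' d R Z" and m: "m ~= 0" "m' ~= 0" and z: "Z 2 0 ~= 0" "Z 0 2 ~= 0"
 shows "EX Z R. focus_arrays L (d / L) Z R"
proof -
 interpret center_arrays L c c' m m' d R Z by fact
 define e where "e = d / L"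
 have d: "d = L * e" using L0 by (simp add: e_def)
 define tau where "tau = m^2 / Z 2 0"
 define tau' where "tau' = m'^2 / Z 0 2"
 have t: "tau * Z 2 0 = m * m" "tau' * Z 0 2 = m' * m'" using z by (simp_all add: tau_def tau'_def power2_eq_square)
 have tnz: "tau ~= 0" "tau' ~= 0" using m z by (simp_all add: tau_def tau'_def)
 have st: "Z 2 0 * Z 0 2 ~= 0" using z by simp
 have "Z 2 0 * Z 0 2 * ((L + 1) * tau + (L - 1) * tau' + 2 * d * ((L + 1) * (L - 1))) = 0"
  using first_balance unfolding t[symmetric] by algebra
 then have b1: "(L + 1) * tau + (L - 1) * tau' + 2 * d * ((L + 1) * (L - 1)) = 0" using st by simp
 have "m * m' * (Z 2 0 * Z 0 2 * ((L + 1)^2 * (L + 3) * tau + (L - 1)^2 * (L - 3) * tau' + (10 * d * (L^2 - 1) + 34 * L - 6 * L^3) * ((L + 1) * (L - 1)))) = 0"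
  using second_balance t by algebra
 then have b2: "(L + 1)^2 * (L + 3) * tau + (L - 1)^2 * (L - 3) * tau' + (10 * d * (L^2 - 1) + 34 * L - 6 * L^3) * ((L + 1) * (L - 1)) = 0"
  using st m by simp
 have "2 * L * (L + 1) * (4 * tau) = 2 * L * (L + 1) * ((L - 1) * weight_poly L e)"
  using b1 b2 unfolding d weight_poly_def by algebra
 then have T: "4 * tau = (L - 1) * weight_poly L e" using L0 nr(1) by simp
 have "2 * L * (L - 1) * (4 * tau') = 2 * L * (L - 1) * ((- L - 1) * weight_poly (- L) e)"
  using b1 b2 unfolding d weight_poly_def by algebra
 then have T': "4 * tau' = (- L - 1) * weight_poly (- L) e" using L0 nr(7) by simp
 have n1: "!!h. h \<in> {1..6::nat} ==> L + of_nat h ~= 0" and n2: "!!h. h \<in> {1..6::nat} ==> - L + of_nat h ~= 0"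
  using nonres by (auto simp: add_eq_0_iff)
 define w where "w = weight L m tau"
 define w' where "w' = weight (- L) (- m') tau'"
 have wn: "i <= 6 ==> w i ~= 0" "i <= 6 ==> w' i ~= 0" for i
  using weight_nonzero[OF n1 m(1) tnz(1)] weight_nonzero[OF n2 _ tnz(2), of "- m'"] m by (auto simp: w_def w'_def)
 have wt: "i <= 6 ==> k <= i ==> w k * w (i - k) = twist L e i k * w i"
  "i <= 6 ==> k <= i ==> w' k * w' (i - k) = twist (- L) e i k * w' i" for i k
  using weight_twist[OF n1 m(1) tnz(1) T, of i k] weight_twist[OF n2 _ tnz(2) T', of "- m'" i k] m by (auto simp: w_def w'_def)
 have gc: "i <= 6 ==> j <= 6 ==> tconv (twist L e) (twist (- L) e) (%i j. X i j / (w i * w' j)) (%i j. Y i j / (w i * w' j)) i j = conv X Y i j / (w i * w' j)" for X Y i j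
  by (rule gauge_conv) (use wn wt in auto)
 define Z' R' where "Z' i j = Z i j / (w i * w' j)" and "R' i j = R i j / (w i * w' j)" for i j
 have cs: "c = w 2 * (2 * (L + 1) * (L + 2))" "m = w 1 / 2" "c' = - (w' 2 * (2 * (1 - L) * (2 - L)))" "m' = - (w' 1 / 2)"
 proof -
  have "w 2 = Z 2 0 / (2 * (L + 1))" using m z by (simp add: w_def weight_def tau_def del: distrib_left_numeral)
  then show "c = w 2 * (2 * (L + 1) * (L + 2))" using deg2(1) nr(1) by (simp del: distrib_left_numeral)
  have n: "1 - L ~= 0" using nr(7) by auto
  have "w' 2 = Z 0 2 / (2 * (1 - L))" using m z by (simp add: w'_def weight_def tau'_def del: distrib_left_numeral)
  then have "w' 2 * (2 * (1 - L) * (2 - L)) = Z 0 2 * (2 - L)" using n by (simp del: distrib_left_numeral)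
  moreover have "(L - 2) * Z 0 2 = - (Z 0 2 * (2 - L))" by (simp add: algebra_simps)
  ultimately show "c' = - (w' 2 * (2 * (1 - L) * (2 - L)))" using deg2(2) by (simp only:)
 qed (simp_all add: w_def w'_def weight_def)
 have rc: "rate_coeff L e Z' R' i j = rate_array c c' 0 m m' d R Z i j / (w i * w' j)" if ij: "i <= 6" "j <= 6" for i j
 proof -
  have n: "w i ~= 0" "w' j ~= 0" using wn ij by auto
  have A: "2 * (L + 1) * (L + 2) * twist L e i 2 * (X / (w (i - 2) * w' j)) = c * X / (w i * w' j)" if "2 <= i" for X
   using wt(1)[of i 2] that ij n wn(1)[of "i - 2"] unfolding cs by (simp add: field_simps)
  have B: "2 * (1 - L) * (2 - L) * twist (- L) e j 2 * (X / (w i * w' (j - 2))) = - (c' * X / (w i * w' j))" if "2 <= j" for X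
   using wt(2)[of j 2] that ij n wn(2)[of "j - 2"] unfolding cs by (simp add: field_simps)
  have C: "twist L e i 1 / 2 * (X / (w (i - 1) * w' j)) = m * X / (w i * w' j)" if "1 <= i" for X
   using wt(1)[of i 1] that ij n wn(1)[of "i - 1"] unfolding cs by (simp add: field_simps)
  have D: "twist (- L) e j 1 / 2 * (X / (w i * w' (j - 1))) = - (m' * X / (w i * w' j))" if "1 <= j" for X
   using wt(2)[of j 1] that ij n wn(2)[of "j - 1"] unfolding cs by (simp add: field_simps)
  have R'e: "R' = (%i j. R i j / (w i * w' j))" and Z'e: "Z' = (%i j. Z i j / (w i * w' j))"
   by (simp_all add: fun_eq_iff R'_def Z'_def)
  have g: "tconv (twist L e) (twist (- L) e) R' R' i j = conv R R i j / (w i * w' j)"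
   "tconv (twist L e) (twist (- L) e) R' Z' i j = conv R Z i j / (w i * w' j)"
   "tconv (twist L e) (twist (- L) e) Z' Z' i j = conv Z Z i j / (w i * w' j)" if "i <= 6" "j <= 6" for i j
   unfolding R'e Z'e by (rule gc[OF that])+
  have t1: "(if 2 <= i then 2 * (L + 1) * (L + 2) * twist L e i 2 * tconv (twist L e) (twist (- L) e) R' R' (i - 2) j else 0)
    = (if 2 <= i then c * conv R R (i - 2) j else 0) / (w i * w' j)"
  proof (cases "2 <= i")
   case True
   have "i - 2 <= 6" using ij by simp
   then show ?thesis by (simp only: True if_True g(1)[OF _ ij(2)] A[OF True])
  qed simp
  have t2: "(if 2 <= j then 2 * (1 - L) * (2 - L) * twist (- L) e j 2 * tconv (twist L e) (twist (- L) e) R' R' i (j - 2) else 0)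
    = - ((if 2 <= j then c' * conv R R i (j - 2) else 0) / (w i * w' j))"
  proof (cases "2 <= j")
   case True
   have "j - 2 <= 6" using ij by simp
   then show ?thesis by (simp only: True if_True g(1)[OF ij(1)] B[OF True])
  qed simp
  have t3: "(if 1 <= i then twist L e i 1 / 2 * tconv (twist L e) (twist (- L) e) R' Z' (i - 1) j else 0)
    = (if 1 <= i then m * conv R Z (i - 1) j else 0) / (w i * w' j)"
  proof (cases "1 <= i")
   case True
   have "i - 1 <= 6" using ij by simp
   then show ?thesis by (simp only: True if_True g(2)[OF _ ij(2)] C[OF True])
  qed simp
  have t4: "(if 1 <= j then twist (- L) e j 1 / 2 * tconv (twist L e) (twist (- L) e) R' Z' i (j - 1) else 0)
    = - ((if 1 <= j then m' * conv R Z i (j - 1) else 0) / (w i * w' j))"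
  proof (cases "1 <= j")
   case True
   have "j - 1 <= 6" using ij by simp
   then show ?thesis by (simp only: True if_True g(2)[OF ij(1)] D[OF True])
  qed simp
  have comb: "a / W - - (b / W) + p / W - - (q / W) + L * e * (z / W) = (a + b + (if P then 0 * x else 0) + p + q + L * e * z) / W"
   for a b p q z W x :: complex and P by (simp add: add_divide_distrib)
  show ?thesis
   unfolding rate_coeff_def rate_array_def Let_def t1 t2 t3 t4 g(3)[OF ij] d by (rule comb)
 qed
 have "focus_arrays L e Z' R'"
  unfolding focus_arrays_def
 proof (intro conjI ballI allI impI)
  show "R' 0 0 = 1" using init by (simp add: R'_def w_def w'_def weight_def)
  show "R' 1 0 = 0" "R' 0 1 = 0" using R1 by (simp_all add: R'_def)
  show "Z' 0 0 = 0" "Z' 1 0 = 0" "Z' 0 1 = 0" using init by (simp_all add: Z'_def)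
  fix k :: nat assume k: "k \<in> {1..6}"
  show "L + of_nat k ~= 0" "L - of_nat k ~= 0" using nonres[OF k] by auto
  show "Z' k k = 0" "R' k k = 0" using diag(1,2)[OF k] by (simp_all add: Z'_def R'_def)
  show "rate_coeff L e Z' R' k k = 0" using rc[of k k] diag(3)[OF k] k by simp
 next
  fix i j :: nat assume ij: "i <= 6" "j <= 6" "i ~= j"
  show "rate_coeff L e Z' R' i j = (L + of_nat i - of_nat j) * Z' i j"
   using rc[OF ij(1,2)] Zeq[OF ij] by (simp add: Z'_def)
  have "(%k l. (L + of_nat k - of_nat l) * Z' k l) = (%k l. ((L + of_nat k - of_nat l) * Z k l) / (w k * w' l))"
   by (simp add: Z'_def fun_eq_iff)
  then show "tconv (twist L e) (twist (- L) e) R' (%k l. (L + of_nat k - of_nat l) * Z' k l) i j = (of_nat i - of_nat j) * R' i j"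
   using gc[OF ij(1,2), of R "%k l. (L + of_nat k - of_nat l) * Z k l"] Req[OF ij] by (simp add: R'_def[abs_def])
 qed
 then show ?thesis unfolding e_def by blast
qed

lemma center_arrays_no_coupling:
 assumes "center_arrays L c c' 0 0 d R Z" "c ~= 0" "c' ~= 0"
 shows "d = 0"
proof -
 interpret center_arrays L c c' 0 0 d R Z by fact
 have "Z 2 0 ~= 0" "Z 0 2 ~= 0" using deg2(1,2) assms(2,3) by auto
 then show ?thesis using first_balance nr by simp
qed

section \<open>Uniform expansions along small orbits\<close>

lemma conv_sum: "conv X Y i j = (\<Sum>k\<le>i. \<Sum>l\<le>j. X k l * Y (i - k) (j - l))"
 by (simp add: conv_def dsum_def)

definition hom :: "(nat => nat => complex) => nat => real => complex" where
 "hom X n t = (\<Sum>i\<le>n. X i (n - i) * cis ((real i - real (n - i)) * t))"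

lemma hom_conv: "(\<Sum>k\<le>n. hom X k t * hom Y (n - k) t) = hom (conv X Y) n t"
proof -
 let ?A = "SIGMA k:{..n}. {..k} \<times> {..n - k}"
 have "(\<Sum>k\<le>n. hom X k t * hom Y (n - k) t)
  = (\<Sum>(k, i, j)\<in>?A. X i (k - i) * cis ((real i - real (k - i)) * t) * (Y j (n - k - j) * cis ((real j - real (n - k - j)) * t)))"
  unfolding hom_def sum_product by (simp add: sum.cartesian_product sum.Sigma split_def del: of_nat_diff)
 also have "... = (\<Sum>(s, i, l)\<in>?A. X i l * Y (s - i) (n - s - l) * cis ((real s - real (n - s)) * t))"
 proof (rule sum.reindex_bij_witness[where i = "%(s, i, l). (i + l, i, s - i)" and j = "%(k, i, j). (i + j, i, k - i)"])
  fix p assume "p \<in> ?A"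
  then obtain k i j where p: "p = (k, i, j)" "k <= n" "i <= k" "j <= n - k" by auto
  have "n - (i + j) - (k - i) = n - k - j" using p by auto
  moreover have "(real i - real (k - i)) * t + (real j - real (n - k - j)) * t = (real (i + j) - real (n - (i + j))) * t"
   using p by (simp add: of_nat_diff algebra_simps)
  ultimately show "(case (case p of (k, i, j) => (i + j, i, k - i)) of (s, i, l) => X i l * Y (s - i) (n - s - l) * cis ((real s - real (n - s)) * t))
   = (case p of (k, i, j) => X i (k - i) * cis ((real i - real (k - i)) * t) * (Y j (n - k - j) * cis ((real j - real (n - k - j)) * t)))"
   unfolding p by (simp add: cis_mult[symmetric] mult_ac del: of_nat_add)
    (metis cis_mult mult.commute mult.left_commute)
 qed auto
 also have "... = hom (conv X Y) n t"
  unfolding hom_def conv_sum sum_distrib_right by (simp add: sum.cartesian_product sum.Sigma split_def del: of_nat_diff)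
 finally show ?thesis .
qed

lemma cis_deriv: "((%t. cis (a * t)) has_vector_derivative \<i> * of_real a * cis (a * t)) (at t within S)"
proof -
 have "((%z. exp (\<i> * of_real a * z)) has_field_derivative \<i> * of_real a * exp (\<i> * of_real a * of_real t)) (at (of_real t))"
  by (auto intro!: derivative_eq_intros)
 from has_vector_derivative_real_field[OF this] show ?thesis
  by (simp add: cis_conv_exp mult_ac has_vector_derivative_at_within)
qed

lemma hom_cont: "continuous_on S (hom X n)"
 unfolding hom_def[abs_def] cis_conv_exp by (intro continuous_intros)

lemma hom_deriv: "(hom X n has_vector_derivative hom (%i j. \<i> * (of_nat i - of_nat j) * X i j) n t) (at t within S)"
proof -
 have "((%t. \<Sum>i\<le>n. X i (n - i) * cis ((real i - real (n - i)) * t)) has_vector_derivative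
   (\<Sum>i\<le>n. X i (n - i) * (\<i> * of_real (real i - real (n - i)) * cis ((real i - real (n - i)) * t)))) (at t within S)"
  by (intro has_vector_derivative_sum has_vector_derivative_mult_right cis_deriv)
 then show ?thesis by (simp add: hom_def[abs_def] mult_ac)
qed

lemma hom_periodic: "hom X n (t + 2 * pi) = hom X n t"
proof -
 have "cis ((real i - real j) * (t + 2 * pi)) = cis ((real i - real j) * t)" for i j
 proof -
  have "cis ((real i - real j) * (t + 2 * pi)) = cis ((real i - real j) * t) * cis (2 * pi * (real i - real j))"
   by (simp add: cis_mult algebra_simps)
  then show ?thesis by simp
 qed
 then show ?thesis by (simp only: hom_def)
qed

lemma hom_integral: "(hom X n has_integral (\<Sum>i\<le>n. if i = n - i then X i (n - i) * (2 * pi) else 0)) {0..2 * pi}"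
proof -
 have c: "((%t. cis ((real i - real j) * t)) has_integral (if i = j then 2 * pi else 0)) {0..2 * pi}" for i j
 proof (cases "i = j")
  case True
  then show ?thesis using has_integral_const_real[of "1 :: complex" 0 "2 * pi"] by (simp add: scaleR_conv_of_real)
 next
  case False
  let ?a = "real i - real j"
  have a: "complex_of_real ?a ~= 0" using False by simp
  have "((%t. cis (?a * t)) has_integral cis (?a * (2 * pi)) / (\<i> * of_real ?a) - cis (?a * 0) / (\<i> * of_real ?a)) {0..2 * pi}"
  proof (rule fundamental_theorem_of_calculus)
   show "((%t. cis (?a * t) / (\<i> * of_real ?a)) has_vector_derivative cis (?a * t)) (at t within {0..2 * pi})" for t
    using has_vector_derivative_divide[OF cis_deriv[of ?a t "{0..2 * pi}"], of "\<i> * of_real ?a"] a by simp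
  qed simp
  moreover have "cis (?a * (2 * pi)) = 1" using cis_multiple_2pi[of ?a] by (simp add: mult.commute)
  ultimately show ?thesis using False by simp
 qed
 have "(hom X n has_integral (\<Sum>i\<le>n. X i (n - i) * (if i = n - i then 2 * pi else 0))) {0..2 * pi}"
  unfolding hom_def[abs_def] by (intro has_integral_sum has_integral_mult_right c) auto
 moreover have "(\<Sum>i\<le>n. X i (n - i) * (if i = n - i then 2 * pi else 0)) = (\<Sum>i\<le>n. if i = n - i then X i (n - i) * (2 * pi) else 0)"
  by (intro sum.cong) auto
 ultimately show ?thesis by (simp only:)
qed

lemma hom_integral_diag: "integral {0..2 * pi} (hom X (2 * k)) = X k k * (2 * pi)"
proof -
 have "(\<Sum>i\<le>2 * k. if i = 2 * k - i then X i (2 * k - i) * (2 * pi) else 0) = (\<Sum>i\<le>2 * k. if i = k then X k k * (2 * pi) else 0)"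
  by (intro sum.cong refl) auto
 then show ?thesis using integral_unique[OF hom_integral[of X "2 * k"]] by simp
qed

lemma hom_integral_zero: "(!!k. n = 2 * k ==> X k k = 0) ==> integral {0..2 * pi} (hom X n) = 0"
 using integral_unique[OF hom_integral[of X n]] by (simp) (rule sum.neutral, auto)

definition bdd_fam :: "real => (real => real => complex) => bool" where
 "bdd_fam e x \<longleftrightarrow> (EX B. ALL eps t. 0 < eps --> eps < e --> cmod (x eps t) <= B)
  & (ALL eps. 0 < eps --> eps < e --> continuous_on UNIV (x eps))"

lemma bdd_fam_add: "bdd_fam e x ==> bdd_fam e y ==> bdd_fam e (%eps t. x eps t + y eps t)"
proof -
 assume a: "bdd_fam e x" "bdd_fam e y"
 obtain B C where "ALL eps t. 0 < eps --> eps < e --> cmod (x eps t) <= B" "ALL eps t. 0 < eps --> eps < e --> cmod (y eps t) <= C"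
  using a unfolding bdd_fam_def by blast
 then have "ALL eps t. 0 < eps --> eps < e --> cmod (x eps t + y eps t) <= B + C" by (blast intro: norm_triangle_mono)
 then show ?thesis using a unfolding bdd_fam_def by (blast intro: continuous_on_add)
qed

lemma bdd_fam_mult: "bdd_fam e x ==> bdd_fam e y ==> bdd_fam e (%eps t. x eps t * y eps t)"
proof -
 assume a: "bdd_fam e x" "bdd_fam e y"
 obtain B C where BC: "ALL eps t. 0 < eps --> eps < e --> cmod (x eps t) <= B" "ALL eps t. 0 < eps --> eps < e --> cmod (y eps t) <= C"
  using a unfolding bdd_fam_def by blast
 have "cmod (x eps t * y eps t) <= (abs B) * (abs C)" if "0 < eps" "eps < e" for eps t
  unfolding norm_mult using BC that by (intro mult_mono) (auto intro: order_trans[OF _ abs_ge_self])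
 then show ?thesis using a unfolding bdd_fam_def by (blast intro: continuous_on_mult)
qed

lemma bdd_fam_const: "continuous_on UNIV g ==> (!!t. cmod (g t) <= B) ==> bdd_fam e (%_. g)"
 unfolding bdd_fam_def by blast

locale small_orbits =
 fixes e :: real and rho :: "real => real"
 assumes e: "e > 0" and rho: "!!eps. 0 < eps ==> eps < e ==> 0 < rho eps & rho eps <= 1 & rho eps <= 2 * eps"
begin

text \<open>\<open>expn n x X\<close> says \<open>x = X 0 + \<rho> X 1 + \<dots> + \<rho>\<^sup>n O(1)\<close> uniformly; unfolding one remainder at a
  time makes products and differential equations amenable to induction on \<open>n\<close>.\<close>

primrec expn :: "nat => (real => real => complex) => (nat => real => complex) => bool" where
 "expn 0 x X = bdd_fam e x"
| "expn (Suc n) x X = (bdd_fam e (%_. X 0) &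
  (EX y. (ALL eps t. 0 < eps --> eps < e --> x eps t = X 0 t + of_real (rho eps) * y eps t) & expn n y (%k. X (Suc k))))"

lemma bdd_fam_cong: "(!!eps t. 0 < eps ==> eps < e ==> x eps t = y eps t) ==> bdd_fam e y ==> bdd_fam e x"
proof -
 assume a: "!!eps t. 0 < eps ==> eps < e ==> x eps t = y eps t" "bdd_fam e y"
 have "x eps = y eps" if "0 < eps" "eps < e" for eps using a(1)[OF that] by blast
 then show ?thesis using a(2) unfolding bdd_fam_def by metis
qed

lemma expn_cong:
 assumes xy: "!!eps t. 0 < eps ==> eps < e ==> x eps t = y eps t" and y: "expn n y X"
 shows "expn n x X"
proof (cases n)
 case 0
 then show ?thesis using bdd_fam_cong[of x y, OF xy] y by simp
next
 case (Suc k)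
 then obtain z where z: "bdd_fam e (%_. X 0)" "ALL eps t. 0 < eps --> eps < e --> y eps t = X 0 t + of_real (rho eps) * z eps t"
  "expn k z (%k. X (Suc k))" using y by auto
 have "ALL eps t. 0 < eps --> eps < e --> x eps t = X 0 t + of_real (rho eps) * z eps t" using z(2) xy by metis
 then show ?thesis unfolding Suc expn.simps using z(1,3) by blast
qed

lemma rho_bounded: "bdd_fam e (%eps _. of_real (rho eps))"
proof -
 have "cmod (of_real (rho eps)) <= 1" if "0 < eps" "eps < e" for eps
  using rho[OF that] by (auto simp: abs_if)
 then show ?thesis unfolding bdd_fam_def using continuous_on_const by blast
qed

lemma expn_bounded: "expn n x X ==> bdd_fam e x"
proof (induction n arbitrary: x X)
 case (Suc n)
 obtain y where y: "!!eps t. 0 < eps ==> eps < e ==> x eps t = X 0 t + of_real (rho eps) * y eps t"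
  "expn n y (%k. X (Suc k))" "bdd_fam e (%_. X 0)" using Suc.prems by auto
 from bdd_fam_add[OF y(3) bdd_fam_mult[OF rho_bounded Suc.IH[OF y(2)]]]
 show ?case by (rule bdd_fam_cong[rotated]) (rule y(1))
qed simp

lemma expn_weaken: "expn (Suc n) x X ==> expn n x X"
proof (induction n arbitrary: x X)
 case 0
 then show ?case using expn_bounded[of "Suc 0" x X] by (simp only: expn.simps(1))
next
 case (Suc n)
 then show ?case by (subst expn.simps) (subst (asm) expn.simps, blast)
qed

lemma expn_add: "expn n x X ==> expn n y Y ==> expn n (%eps t. x eps t + y eps t) (%k t. X k t + Y k t)"
proof (induction n arbitrary: x X y Y)
 case (Suc n)
 obtain x' where x': "!!eps t. 0 < eps ==> eps < e ==> x eps t = X 0 t + of_real (rho eps) * x' eps t" "expn n x' (%k. X (Suc k))" "bdd_fam e (%_. X 0)"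
  using Suc.prems(1) by auto
 obtain y' where y': "!!eps t. 0 < eps ==> eps < e ==> y eps t = Y 0 t + of_real (rho eps) * y' eps t" "expn n y' (%k. Y (Suc k))" "bdd_fam e (%_. Y 0)"
  using Suc.prems(2) by auto
 show ?case
  unfolding expn.simps
  by (intro conjI exI[of _ "%eps t. x' eps t + y' eps t"] Suc.IH[OF x'(2) y'(2)] bdd_fam_add[OF x'(3) y'(3)])
   (auto simp: x'(1) y'(1) algebra_simps)
qed (simp add: bdd_fam_add)

lemma expn_scale: "bdd_fam e (%_. g) ==> expn n x X ==> expn n (%eps t. g t * x eps t) (%k t. g t * X k t)"
proof (induction n arbitrary: x X)
 case 0
 then show ?case using bdd_fam_mult[of e "%_. g" x] by simp
next
 case (Suc n)
 obtain x' where x': "!!eps t. 0 < eps ==> eps < e ==> x eps t = X 0 t + of_real (rho eps) * x' eps t" "expn n x' (%k. X (Suc k))" "bdd_fam e (%_. X 0)"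
  using Suc.prems(2) by auto
 show ?case
  unfolding expn.simps
  by (intro conjI exI[of _ "%eps t. g t * x' eps t"] Suc.IH[OF Suc.prems(1) x'(2)] bdd_fam_mult[OF Suc.prems(1) x'(3)])
   (auto simp: x'(1) algebra_simps)
qed

lemma expn_mult: "expn n x X ==> expn n y Y ==> expn n (%eps t. x eps t * y eps t) (%k t. \<Sum>i\<le>k. X i t * Y (k - i) t)"
proof (induction n arbitrary: x X y Y)
 case (Suc n)
 obtain x' where x': "!!eps t. 0 < eps ==> eps < e ==> x eps t = X 0 t + of_real (rho eps) * x' eps t" "expn n x' (%k. X (Suc k))" "bdd_fam e (%_. X 0)"
  using Suc.prems(1) by auto
 obtain y' where y': "!!eps t. 0 < eps ==> eps < e ==> y eps t = Y 0 t + of_real (rho eps) * y' eps t" "expn n y' (%k. Y (Suc k))" "bdd_fam e (%_. Y 0)"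
  using Suc.prems(2) by auto
 have 1: "expn n (%eps t. X 0 t * y' eps t + x' eps t * y eps t) (%k t. X 0 t * Y (Suc k) t + (\<Sum>i\<le>k. X (Suc i) t * Y (k - i) t))"
  by (rule expn_add[OF expn_scale[OF x'(3) y'(2)] Suc.IH[OF x'(2) expn_weaken[OF Suc.prems(2)]]])
 have 2: "(%k t. X 0 t * Y (Suc k) t + (\<Sum>i\<le>k. X (Suc i) t * Y (k - i) t)) = (%k t. \<Sum>i\<le>Suc k. X i t * Y (Suc k - i) t)"
  by (simp add: sum.atMost_Suc_shift del: sum.atMost_Suc)
 have 3: "bdd_fam e (%_ t. X 0 t * Y 0 t)" by (rule bdd_fam_mult[OF x'(3) y'(3)])
 have 4: "x eps t * y eps t = X 0 t * Y 0 t + of_real (rho eps) * (X 0 t * y' eps t + x' eps t * y eps t)" if "0 < eps" "eps < e" for eps t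
  using x'(1)[OF that, of t] y'(1)[OF that, of t] by algebra
 show ?case
  unfolding expn.simps using 1[unfolded 2] 3 4 by (intro conjI exI[of _ "%eps t. X 0 t * y' eps t + x' eps t * y eps t"]) auto
qed (simp add: bdd_fam_mult)

lemma integrable_family: "bdd_fam e x ==> 0 < eps ==> eps < e ==> x eps integrable_on {0..2 * pi}"
 unfolding bdd_fam_def by (blast intro: integrable_continuous_interval continuous_on_subset)

text \<open>The coefficients of a family with mean zero have mean zero, one order at a time: divide by
  the power of \<open>\<rho>\<close> and let \<open>\<rho>\<close> tend to zero.\<close>

lemma expn_mean:
 assumes "expn (Suc n) x X" "!!eps. 0 < eps ==> eps < e ==> integral {0..2 * pi} (x eps) = 0" "!!k. k < n ==> integral {0..2 * pi} (X k) = 0"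
 shows "integral {0..2 * pi} (X n) = 0"
 using assms
proof (induction n arbitrary: x X)
 have split: "integral {0..2 * pi} (X 0) + of_real (rho eps) * integral {0..2 * pi} (y eps) = 0"
  if y: "!!eps t. 0 < eps ==> eps < e ==> x eps t = X 0 t + of_real (rho eps) * y eps t" "bdd_fam e y" "bdd_fam e (%_. X 0)"
   and z: "integral {0..2 * pi} (x eps) = 0" and eps: "0 < eps" "eps < e" for x X y eps
 proof -
  have "x eps = (%t. X 0 t + of_real (rho eps) * y eps t)" using y(1)[OF eps] by blast
  then have "integral {0..2 * pi} (x eps) = integral {0..2 * pi} (X 0) + integral {0..2 * pi} (%t. of_real (rho eps) * y eps t)"
   using integral_add[OF integrable_family[OF y(3) eps] integrable_on_mult_right[OF integrable_family[OF y(2) eps], of "of_real (rho eps)"]] by simp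
  then show ?thesis using z by simp
 qed
 {
  case 0
  then obtain y where y: "!!eps t. 0 < eps ==> eps < e ==> x eps t = X 0 t + of_real (rho eps) * y eps t" "bdd_fam e y" "bdd_fam e (%_. X 0)"
   by auto
  obtain B where B: "!!eps t. 0 < eps ==> eps < e ==> cmod (y eps t) <= B" using y(2) unfolding bdd_fam_def by blast
  show ?case
  proof (rule ccontr)
   let ?I = "integral {0..2 * pi} (X 0)"
   assume "?I ~= 0"
   then have I: "cmod ?I > 0" by simp
   have b: "cmod ?I <= 2 * eps * ((abs B) * (2 * pi))" if eps: "0 < eps" "eps < e" for eps
   proof -
    have "cmod (integral {0..2 * pi} (y eps)) <= (abs B) * (2 * pi - 0)"
     using y(2) B[OF eps] eps by (intro integral_bound) (auto simp: bdd_fam_def intro: continuous_on_subset order_trans[OF _ abs_ge_self])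
    moreover have "?I = - (of_real (rho eps) * integral {0..2 * pi} (y eps))"
     using split[of x X y eps, OF y 0(2)[OF eps] eps] by (simp add: eq_neg_iff_add_eq_0)
    ultimately have "cmod ?I <= rho eps * ((abs B) * (2 * pi))" using rho[OF eps] by (simp add: norm_mult mult_left_mono)
    also have "... <= 2 * eps * ((abs B) * (2 * pi))" using rho[OF eps] by (intro mult_right_mono) auto
    finally show ?thesis .
   qed
   define K where "K = 2 * ((abs B) * (2 * pi)) + 1"
   have K: "K > 0" unfolding K_def by (intro add_nonneg_pos) auto
   define eps where "eps = min (e / 2) (cmod ?I / (2 * K))"
   have eps: "0 < eps" "eps < e" "eps <= cmod ?I / (2 * K)" using e I K by (auto simp: eps_def)
   have "cmod ?I <= eps * K" using b[OF eps(1,2)] eps(1) by (simp add: K_def algebra_simps)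
   also have "... <= cmod ?I / (2 * K) * K" using eps(3) K by (intro mult_right_mono) auto
   also have "... = cmod ?I / 2" using K by simp
   finally show False using I by simp
  qed
 next
  case (Suc n)
  obtain y where y: "!!eps t. 0 < eps ==> eps < e ==> x eps t = X 0 t + of_real (rho eps) * y eps t" "expn (Suc n) y (%k. X (Suc k))" "bdd_fam e (%_. X 0)"
   using Suc.prems(1)[unfolded expn.simps(2)[of "Suc n" x X]] by blast
  have "integral {0..2 * pi} (y eps) = 0" if eps: "0 < eps" "eps < e" for eps
   using split[of x X y eps, OF y(1) expn_bounded[OF y(2)] y(3) Suc.prems(2)[OF eps] eps] Suc.prems(3)[of 0] rho[OF eps] by simp
  from Suc.IH[OF y(2) this] Suc.prems(3) show ?case by simp
 }
qed

text \<open>A periodic solution of a linear equation with nonzero rate is controlled by its forcing; at an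
  extremum the derivative vanishes.\<close>

lemma relaxation_bound:
 fixes y G :: "real => complex"
 assumes y: "!!t. (y has_vector_derivative G t - of_real lam * y t) (at t)" and p: "!!t. y (t + 2 * pi) = y t"
  and lam: "lam ~= 0" and G: "!!t. cmod (G t) <= B"
 shows "cmod (y t) <= 2 * B / (abs lam)"
proof -
 have r: "\<bar>Re (y t)\<bar> <= B / (abs lam)"
 proof (rule periodic_relaxation_abs_le[where g = "%t. Re (G t)" and p = "2 * pi" and m = lam and y = "%t. Re (y t)"])
  show "((%t. Re (y t)) has_real_derivative Re (G t) - lam * Re (y t)) (at t)" for t
   using bounded_linear.has_vector_derivative[OF bounded_linear_Re y[of t]] by (simp add: has_real_derivative_iff_has_vector_derivative)
  show "\<bar>Re (G t)\<bar> <= B" for t using abs_Re_le_cmod[of "G t"] G[of t] by linarith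
 qed (use p lam in auto)
 have i: "\<bar>Im (y t)\<bar> <= B / (abs lam)"
 proof (rule periodic_relaxation_abs_le[where g = "%t. Im (G t)" and p = "2 * pi" and m = lam and y = "%t. Im (y t)"])
  show "((%t. Im (y t)) has_real_derivative Im (G t) - lam * Im (y t)) (at t)" for t
   using bounded_linear.has_vector_derivative[OF bounded_linear_Im y[of t]] by (simp add: has_real_derivative_iff_has_vector_derivative)
  show "\<bar>Im (G t)\<bar> <= B" for t using abs_Im_le_cmod[of "G t"] G[of t] by linarith
 qed (use p lam in auto)
 show ?thesis using r i cmod_le[of "y t"] by simp
qed

lemma vector_deriv_cont: "(!!t. (y has_vector_derivative y' t) (at t)) ==> continuous_on UNIV y"
 by (meson continuous_at_imp_continuous_on has_vector_derivative_continuous)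

lemma expn_relaxation:
 assumes lam: "lam ~= 0"
 assumes "expn n G Gk"
  and "!!eps t. 0 < eps ==> eps < e ==> (y eps has_vector_derivative G eps t - of_real lam * y eps t) (at t)" "!!eps t. 0 < eps ==> eps < e ==> y eps (t + 2 * pi) = y eps t"
  and "!!k t. (H k has_vector_derivative Gk k t - of_real lam * H k t) (at t)" "!!k t. H k (t + 2 * pi) = H k t"
 shows "expn n y H"
 using assms(2-)
proof (induction n arbitrary: G Gk y H)
 case 0
 obtain B where B: "!!eps t. 0 < eps ==> eps < e ==> cmod (G eps t) <= B" using 0(1) unfolding expn.simps bdd_fam_def by blast
 have "cmod (y eps t) <= 2 * B / (abs lam)" if "0 < eps" "eps < e" for eps t
  by (rule relaxation_bound[OF 0(2)[OF that] 0(3)[OF that] lam B[OF that]])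
 then show ?case unfolding expn.simps bdd_fam_def using vector_deriv_cont[OF 0(2)] by blast
next
 case (Suc n)
 obtain G' where G': "!!eps t. 0 < eps ==> eps < e ==> G eps t = Gk 0 t + of_real (rho eps) * G' eps t" "expn n G' (%k. Gk (Suc k))" "bdd_fam e (%_. Gk 0)"
  using Suc.prems(1) by auto
 define y' where "y' eps t = (y eps t - H 0 t) / of_real (rho eps)" for eps t
 have "expn n y' (%k. H (Suc k))"
 proof (rule Suc.IH[OF G'(2)])
  fix eps t assume eps: "0 < eps" "eps < e"
  have r: "complex_of_real (rho eps) ~= 0" using rho[OF eps] by simp
  have "(y' eps has_vector_derivative (G eps t - of_real lam * y eps t - (Gk 0 t - of_real lam * H 0 t)) / of_real (rho eps)) (at t)"
   unfolding y'_def[abs_def] by (intro has_vector_derivative_divide has_vector_derivative_diff Suc.prems(2,4) eps)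
  moreover have "(G eps t - of_real lam * y eps t - (Gk 0 t - of_real lam * H 0 t)) / of_real (rho eps) = G' eps t - of_real lam * y' eps t"
   using r unfolding G'(1)[OF eps] y'_def by (simp add: field_simps)
  ultimately show "(y' eps has_vector_derivative G' eps t - of_real lam * y' eps t) (at t)" by simp
  show "y' eps (t + 2 * pi) = y' eps t" by (simp add: y'_def Suc.prems(3,5) eps)
 qed (rule Suc.prems)+
 moreover have "bdd_fam e (%_. H 0)"
 proof -
  obtain B where "!!t. cmod (Gk 0 t) <= B" using G'(3) e unfolding bdd_fam_def by (metis dense)
  from relaxation_bound[OF Suc.prems(4)[of 0] Suc.prems(5)[of 0] lam this] show ?thesis
   using vector_deriv_cont[OF Suc.prems(4)] by (blast intro: bdd_fam_const)
 qed
 moreover have "y eps t = H 0 t + of_real (rho eps) * y' eps t" if "0 < eps" "eps < e" for eps t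
  using rho[OF that] by (simp add: y'_def)
 ultimately show ?case by auto
qed

lemma primitive_bound:
 fixes v W :: "real => complex"
 assumes v: "!!t. (v has_vector_derivative W t) (at t)" and p: "!!t. v (t + 2 * pi) = v t"
  and z: "integral {0..2 * pi} v = 0" and W: "!!t. cmod (W t) <= B"
 shows "cmod (v t) <= B * (2 * pi)"
proof -
 obtain s where s: "s \<in> {0..2 * pi}" "v s = v t" using periodic_representative[of v "2 * pi" t] p by auto
 have B: "B >= 0" using W[of 0] norm_ge_zero order_trans by blast
 have d: "cmod (v s - v u) <= B * (2 * pi)" if "u \<in> {0..2 * pi}" for u
 proof -
  have "cmod (v s - v u) <= B * cmod (complex_of_real s - complex_of_real u)"
  proof -
   have on: "onorm (%h. h *\<^sub>R W t) <= B" for t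
   proof (rule onorm_le)
    show "norm (h *\<^sub>R W t) <= B * norm h" for h
     using mult_left_mono[OF W[of t] abs_ge_zero[of h]] by (simp add: mult.commute)
   qed
   have "norm (v s - v u) <= B * norm (s - u)"
    by (rule differentiable_bound[where S = UNIV and f' = "%t h. h *\<^sub>R W t"])
     (use v on in \<open>auto simp: has_vector_derivative_def\<close>)
   then show ?thesis by (simp add: of_real_diff[symmetric] del: of_real_diff)
  qed
  also have "... = B * \<bar>s - u\<bar>" by (simp add: of_real_diff[symmetric] del: of_real_diff)
  also have "... <= B * (2 * pi)" using that s(1) B by (intro mult_left_mono) auto
  finally show ?thesis .
 qed
 have c: "continuous_on {0..2 * pi} v" using vector_deriv_cont[OF v] continuous_on_subset by blast
 have "cmod (integral {0..2 * pi} (%u. v s - v u)) <= B * (2 * pi) * (2 * pi - 0)"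
  by (rule integral_bound) (auto intro!: continuous_intros c d)
 moreover have "integral {0..2 * pi} (%u. v s - v u) = of_real (2 * pi) * v s"
 proof -
  have "integral {0..2 * pi} (%u. v s - v u) = integral {0..2 * pi} (%u. v s) - integral {0..2 * pi} v"
   by (rule integral_diff[OF integrable_const_ivl integrable_continuous_interval[OF c]])
  then show ?thesis using z by (simp add: scaleR_conv_of_real)
 qed
 ultimately have "(2 * pi) * cmod (v s) <= (2 * pi) * (B * (2 * pi))" by (simp add: norm_mult mult_ac)
 then show ?thesis using s(2) by simp
qed

lemma expn_primitive:
 assumes "expn n W Wk"
  and "!!eps t. 0 < eps ==> eps < e ==> (v eps has_vector_derivative W eps t) (at t)" "!!eps t. 0 < eps ==> eps < e ==> v eps (t + 2 * pi) = v eps t"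
  and "!!eps. 0 < eps ==> eps < e ==> integral {0..2 * pi} (v eps) = 0"
  and "!!k t. k < n ==> (V k has_vector_derivative Wk k t) (at t)" "!!k t. V k (t + 2 * pi) = V k t" "!!k. integral {0..2 * pi} (V k) = 0"
 shows "expn n v V"
 using assms
proof (induction n arbitrary: W Wk v V)
 case 0
 obtain B where B: "!!eps t. 0 < eps ==> eps < e ==> cmod (W eps t) <= B" using 0(1) unfolding expn.simps bdd_fam_def by blast
 have "cmod (v eps t) <= B * (2 * pi)" if "0 < eps" "eps < e" for eps t
  by (rule primitive_bound[OF 0(2)[OF that] 0(3)[OF that] 0(4)[OF that] B[OF that]])
 then show ?case unfolding expn.simps bdd_fam_def using vector_deriv_cont[OF 0(2)] by blast
next
 case (Suc n)
 obtain W' where W': "!!eps t. 0 < eps ==> eps < e ==> W eps t = Wk 0 t + of_real (rho eps) * W' eps t" "expn n W' (%k. Wk (Suc k))" "bdd_fam e (%_. Wk 0)"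
  using Suc.prems(1) by auto
 define v' where "v' eps t = (v eps t - V 0 t) / of_real (rho eps)" for eps t
 have cV: "continuous_on UNIV (V 0)" by (rule vector_deriv_cont[OF Suc.prems(5)]) simp
 have "expn n v' (%k. V (Suc k))"
 proof (rule Suc.IH[OF W'(2)])
  fix eps assume eps: "0 < eps" "eps < e"
  have r: "complex_of_real (rho eps) ~= 0" using rho[OF eps] by simp
  fix t
  have "(v' eps has_vector_derivative (W eps t - Wk 0 t) / of_real (rho eps)) (at t)"
   unfolding v'_def[abs_def] by (intro has_vector_derivative_divide has_vector_derivative_diff Suc.prems(2,5) eps) simp
  then show "(v' eps has_vector_derivative W' eps t) (at t)" using r unfolding W'(1)[OF eps] by simp
  show "v' eps (t + 2 * pi) = v' eps t" by (simp add: v'_def Suc.prems(3,6) eps)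
 next
  fix eps assume eps: "0 < eps" "eps < e"
  have "integral {0..2 * pi} (%t. v eps t - V 0 t) = integral {0..2 * pi} (v eps) - integral {0..2 * pi} (V 0)"
   by (intro integral_diff integrable_continuous_interval continuous_on_subset[OF vector_deriv_cont[OF Suc.prems(2)[OF eps]]] continuous_on_subset[OF cV]) auto
  then show "integral {0..2 * pi} (v' eps) = 0" unfolding v'_def[abs_def] by (simp add: Suc.prems(4,7) eps)
 qed (use Suc.prems(5-7) in auto)
 moreover have "bdd_fam e (%_. V 0)"
 proof -
  obtain B where "!!t. cmod (Wk 0 t) <= B" using W'(3) e unfolding bdd_fam_def by (metis dense)
  from primitive_bound[OF Suc.prems(5)[of 0] Suc.prems(6)[of 0] Suc.prems(7)[of 0] this] show ?thesis
   using cV by (blast intro: bdd_fam_const)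
 qed
 moreover have "v eps t = V 0 t + of_real (rho eps) * v' eps t" if "0 < eps" "eps < e" for eps t
  using rho[OF that] by (simp add: v'_def)
 ultimately show ?case by auto
qed

end

text \<open>Course-of-values recursion; the values at arguments not below \<open>n\<close> are cut off.\<close>

lemma recursion_exists:
 fixes \<Phi> :: "nat => (nat => 'b) => 'b"
 obtains f where "!!n. f n = \<Phi> n (%k. if k < n then f k else u)"
proof -
 define f where "f = wfrec less_than (%g n. \<Phi> n (%k. if k < n then g k else u))"
 have "f n = \<Phi> n (%k. if k < n then f k else u)" for n
 proof -
  have "f n = \<Phi> n (%k. if k < n then cut f less_than n k else u)"
   unfolding f_def by (subst wfrec[OF wf_less_than]) (rule refl)
  also have "(%k. if k < n then cut f less_than n k else u) = (%k. if k < n then f k else u)"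
   by (rule ext) (simp add: cut_def)
  finally show ?thesis .
 qed
 then show thesis by (rule that)
qed

lemma conv_cong:
 assumes "!!k l. k <= i ==> l <= j ==> X k l * Y (i - k) (j - l) = X' k l * Y' (i - k) (j - l)"
 shows "conv X Y i j = conv X' Y' i j"
 unfolding conv_sum by (intro sum.cong refl) (use assms in auto)

lemma rate_array_cong:
 assumes RX: "!!i' j'. i' + j' < i + j ==> R i' j' = R' i' j'" and ZX: "!!i' j'. i' + j' < i + j ==> Z i' j' = Z' i' j'"
  and z: "Z 0 0 = 0" "Z' 0 0 = 0"
 shows "rate_array c c' c0 m m' d R Z i j = rate_array c c' c0 m m' d R' Z' i j"
proof -
 have 1: "conv R R (i - 2) j = conv R' R' (i - 2) j" if "2 <= i"
  by (rule conv_cong) (use that in \<open>simp add: RX\<close>)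
 have 2: "conv R R i (j - 2) = conv R' R' i (j - 2)" if "2 <= j"
  by (rule conv_cong) (use that in \<open>simp add: RX\<close>)
 have 3: "conv R R (i - 1) (j - 1) = conv R' R' (i - 1) (j - 1)" if "1 <= i" "1 <= j"
  by (rule conv_cong) (use that in \<open>simp add: RX\<close>)
 have 4: "conv R Z (i - 1) j = conv R' Z' (i - 1) j" if "1 <= i"
  by (rule conv_cong) (use that in \<open>simp add: RX ZX\<close>)
 have 5: "conv R Z i (j - 1) = conv R' Z' i (j - 1)" if "1 <= j"
  by (rule conv_cong) (use that in \<open>simp add: RX ZX\<close>)
 have 6: "conv Z Z i j = conv Z' Z' i j"
 proof (rule conv_cong)
  fix k l assume kl: "k <= i" "l <= j"
  consider "k + l = 0" | "(i - k) + (j - l) = 0" | "k + l < i + j" "(i - k) + (j - l) < i + j" using kl by linarith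
  then show "Z k l * Z (i - k) (j - l) = Z' k l * Z' (i - k) (j - l)"
   by cases (use z ZX in auto)
 qed
 show ?thesis unfolding rate_array_def using 1 2 3 4 5 6 by auto
qed

lemma rate_array_low:
 assumes "i + j <= 1" "!!k l. k + l <= 1 ==> Z k l = 0"
 shows "rate_array c c' c0 m m' d R Z i j = 0"
proof -
 have z: "conv X Z i' j' = 0" if "i' + j' <= 1" for X i' j'
  unfolding conv_sum using assms(2) that by (intro sum.neutral ballI) auto
 have "i < 2" "j < 2" "~ (1 <= i & 1 <= j)" using assms(1) by auto
 then show ?thesis unfolding rate_array_def using z[of "i - 1" j R] z[of i "j - 1" R] z[of i j Z] assms(1) by simp
qed

lemma center_series_exists:
 assumes lam: "(lam :: real) ~= 0"
 obtains R Z where "R 0 0 = 1" "!!k. 1 <= k ==> R k k = 0" "!!i j. i + j <= 1 ==> Z i j = 0"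
  "!!i j. (of_real lam + \<i> * (of_nat i - of_nat j)) * Z i j = rate_array c c' c0 m m' d R Z i j"
  "!!i j. i ~= j ==> \<i> * (of_nat i - of_nat j) * R i j = conv R (rate_array c c' c0 m m' d R Z) i j"
proof -
 define \<Phi> where "\<Phi> n f = (let R = (%i j. fst (f (i + j)) i); Z = (%i j. snd (f (i + j)) i); F = rate_array c c' c0 m m' d R Z in
  ((%i. if n = 0 then 1 else if i = n - i then 0 else conv R F i (n - i) / (\<i> * (of_nat i - of_nat (n - i)))),
   (%i. if n <= 1 then 0 else F i (n - i) / (of_real lam + \<i> * (of_nat i - of_nat (n - i))))))"
  for n and f :: "nat => (nat => complex) \<times> (nat => complex)"
 obtain f where f: "!!n. f n = \<Phi> n (%k. if k < n then f k else (%_. 0, %_. 0))" using recursion_exists[of \<Phi>] by blast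
 define R Z where "R i j = fst (f (i + j)) i" and "Z i j = snd (f (i + j)) i" for i j
 define Rc where "Rc n i j = (if i + j < n then R i j else 0)" for n i j :: nat
 define Zc where "Zc n i j = (if i + j < n then Z i j else 0)" for n i j :: nat
 have cut: "(%i j. fst ((%k. if k < n then f k else (%_. 0, %_. 0)) (i + j)) i) = Rc n"
  "(%i j. snd ((%k. if k < n then f k else (%_. 0, %_. 0)) (i + j)) i) = Zc n" for n
  by (auto simp: fun_eq_iff Rc_def Zc_def R_def Z_def)
 let ?F = "rate_array c c' c0 m m' d"
 have Req: "R i j = (if i + j = 0 then 1 else if i = j then 0 else conv (Rc (i + j)) (?F (Rc (i + j)) (Zc (i + j))) i j / (\<i> * (of_nat i - of_nat j)))"
  and Zeq: "Z i j = (if i + j <= 1 then 0 else ?F (Rc (i + j)) (Zc (i + j)) i j / (of_real lam + \<i> * (of_nat i - of_nat j)))" for i j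
  unfolding R_def[of i j] Z_def[of i j] f[of "i + j"] \<Phi>_def Let_def cut by simp_all
 have zl: "Z i j = 0" if "i + j <= 1" for i j using Zeq[of i j] that by simp
 have zl': "Zc n 0 0 = 0" for n using zl[of 0 0] by (simp add: Zc_def)
 have Fc: "?F (Rc n) (Zc n) i j = ?F R Z i j" if "i + j <= n" for n i j
  by (rule rate_array_cong) (use that zl[of 0 0] zl' in \<open>auto simp: Rc_def Zc_def\<close>)
 have F00: "?F R Z 0 0 = 0" by (rule rate_array_low) (use zl in auto)
 have cc: "conv (Rc (i + j)) (?F (Rc (i + j)) (Zc (i + j))) i j = conv R (?F R Z) i j" for i j
 proof (rule conv_cong)
  fix k l assume kl: "k <= i" "l <= j"
  have F: "?F (Rc (i + j)) (Zc (i + j)) (i - k) (j - l) = ?F R Z (i - k) (j - l)" by (rule Fc) auto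
  show "Rc (i + j) k l * ?F (Rc (i + j)) (Zc (i + j)) (i - k) (j - l) = R k l * ?F R Z (i - k) (j - l)"
  proof (cases "k + l < i + j")
   case True then show ?thesis unfolding F by (simp add: Rc_def)
  next
   case False
   then have "i - k = 0" "j - l = 0" using kl by auto
   then show ?thesis unfolding F using F00 by simp
  qed
 qed
 have nz: "of_real lam + \<i> * (of_nat i - of_nat j) ~= 0" for i j :: nat
  using lam by (auto simp: complex_eq_iff)
 show thesis
 proof (rule that[of R Z])
  show "R 0 0 = 1" using Req[of 0 0] by simp
  show "R k k = 0" if "1 <= k" for k using Req[of k k] that by simp
  show "Z i j = 0" if "i + j <= 1" for i j by (rule zl[OF that])
  show "(of_real lam + \<i> * (of_nat i - of_nat j)) * Z i j = ?F R Z i j" for i j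
  proof (cases "i + j <= 1")
   case True
   then show ?thesis using zl[OF True] rate_array_low[OF True, of Z] zl by simp
  next
   case False
   then show ?thesis using Zeq[of i j] Fc[of i j "i + j"] nz[of i j] by simp
  qed
  show "\<i> * (of_nat i - of_nat j) * R i j = conv R (?F R Z) i j" if "i ~= j" for i j
  proof -
   have "i + j ~= 0" "\<i> * (of_nat i - of_nat j) ~= (0 :: complex)" using that by auto
   have n: "(i + j = 0) = False" "(i = j) = False" using that by auto
   have "R i j = conv R (?F R Z) i j / (\<i> * (of_nat i - of_nat j))"
    using Req[of i j] unfolding n if_False cc .
   then show ?thesis using \<open>\<i> * (of_nat i - of_nat j) ~= (0 :: complex)\<close> by simp
  qed
 qed
qed

lemma hom_add: "hom (%i j. X i j + Y i j) n t = hom X n t + hom Y n t"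
 by (simp add: hom_def sum.distrib distrib_right)

lemma hom_cmult: "hom (%i j. a * X i j) n t = a * hom X n t"
 by (simp add: hom_def sum_distrib_left mult.assoc)

definition shift_a :: "(nat => nat => complex) => nat => nat => complex" where
 "shift_a X = (%i j. if 1 <= i then X (i - 1) j else 0)"

definition shift_b :: "(nat => nat => complex) => nat => nat => complex" where
 "shift_b X = (%i j. if 1 <= j then X i (j - 1) else 0)"

lemma hom_shift_left: "hom (shift_a X) (Suc n) t = cis t * hom X n t"
proof -
 have "hom (shift_a X) (Suc n) t = (\<Sum>i\<le>n. X i (n - i) * cis ((real (Suc i) - real (n - i)) * t))"
  unfolding hom_def shift_a_def by (subst sum.atMost_Suc_shift) simp
 also have "... = (\<Sum>i\<le>n. cis t * (X i (n - i) * cis ((real i - real (n - i)) * t)))"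
 proof (intro sum.cong refl)
  fix i
  have "cis ((real (Suc i) - real (n - i)) * t) = cis t * cis ((real i - real (n - i)) * t)" by (simp add: cis_mult algebra_simps)
  then show "X i (n - i) * cis ((real (Suc i) - real (n - i)) * t) = cis t * (X i (n - i) * cis ((real i - real (n - i)) * t))" by (simp only: mult_ac)
 qed
 finally show ?thesis by (simp add: hom_def sum_distrib_left)
qed

lemma hom_shift_right: "hom (shift_b X) (Suc n) t = cis (- t) * hom X n t"
proof -
 have "hom (shift_b X) (Suc n) t = (\<Sum>i\<le>n. X i (n - i) * cis ((real i - real (Suc n - i)) * t))"
  unfolding hom_def shift_b_def by (subst sum.atMost_Suc) (auto intro!: sum.cong simp: Suc_diff_le)
 also have "... = (\<Sum>i\<le>n. cis (- t) * (X i (n - i) * cis ((real i - real (n - i)) * t)))"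
 proof (intro sum.cong refl)
  fix i assume "i \<in> {..n}"
  then have "cis ((real i - real (Suc n - i)) * t) = cis (- t) * cis ((real i - real (n - i)) * t)" by (simp add: cis_mult Suc_diff_le algebra_simps)
  then show "X i (n - i) * cis ((real i - real (Suc n - i)) * t) = cis (- t) * (X i (n - i) * cis ((real i - real (n - i)) * t))" by (simp only: mult_ac)
 qed
 finally show ?thesis by (simp add: hom_def sum_distrib_left)
qed

lemma hom_rate_array:
 assumes z: "!!i j. i + j <= 1 ==> Z i j = 0"
 shows "hom (rate_array c c' c0 m m' d R Z) (Suc (Suc n)) t =
  (c * (cis t * cis t) + c' * (cis (- t) * cis (- t)) + c0) * (\<Sum>k\<le>n. hom R k t * hom R (n - k) t)
  + (m * cis t + m' * cis (- t)) * (\<Sum>k\<le>n. hom R k t * hom Z (Suc (n - k)) t)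
  + d * (\<Sum>k\<le>n. hom Z (Suc k) t * hom Z (Suc (n - k)) t)"
proof -
 let ?S = shift_a and ?T = shift_b
 have e: "rate_array c c' c0 m m' d R Z = (%i j. c * ?S (?S (conv R R)) i j + c' * ?T (?T (conv R R)) i j + c0 * ?S (?T (conv R R)) i j
   + m * ?S (conv R Z) i j + m' * ?T (conv R Z) i j + d * conv Z Z i j)"
  by (rule ext)+ (auto simp: rate_array_def numeral_2_eq_2 shift_a_def shift_b_def)
 have z0: "hom Z 0 t = 0" using z[of 0 0] by (simp add: hom_def)
 have rz: "hom (conv R Z) (Suc n) t = (\<Sum>k\<le>n. hom R k t * hom Z (Suc (n - k)) t)"
  unfolding hom_conv[symmetric] by (subst sum.atMost_Suc) (auto simp: z0 Suc_diff_le intro!: sum.cong)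
 have zz: "hom (conv Z Z) (Suc (Suc n)) t = (\<Sum>k\<le>n. hom Z (Suc k) t * hom Z (Suc (n - k)) t)"
  unfolding hom_conv[symmetric] by (subst sum.atMost_Suc, subst sum.atMost_Suc_shift) (auto simp: z0 Suc_diff_le intro!: sum.cong)
 have cc: "cis t * cis (- t) = 1" by (simp add: cis_mult)
 show ?thesis
  unfolding e hom_add hom_cmult hom_shift_left hom_shift_right rz zz
  unfolding hom_conv[symmetric] using cc by algebra
qed

context small_orbits
begin

text \<open>The expansion gains one order in each round: \<open>G\<close> is known as far as \<open>u\<close> and \<open>y\<close>, the relaxation
  equation then improves \<open>y\<close> by one order and the radial equation improves \<open>u\<close> by two.  The exact
  means of \<open>G\<close> and \<open>u G\<close> are zero, which settles the resonant coefficients on the way.\<close>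

lemma orbit_balance:
 fixes u y :: "real => real => complex"
 assumes lam: "lam ~= 0"
  and R0: "R 0 0 = 1" and Rd: "!!k. 1 <= k ==> R k k = 0" and Zl: "!!i j. i + j <= 1 ==> Z i j = 0"
  and Zeq: "!!i j. (of_real lam + \<i> * (of_nat i - of_nat j)) * Z i j = rate_array c c' c0 m m' d R Z i j"
  and Req: "!!i j. i ~= j ==> \<i> * (of_nat i - of_nat j) * R i j = conv R (rate_array c c' c0 m m' d R Z) i j"
  and G: "!!eps t. G eps t = (c * (cis t * cis t) + c' * (cis (- t) * cis (- t)) + c0) * (u eps t * u eps t)
    + (m * cis t + m' * cis (- t)) * (u eps t * y eps t) + d * (y eps t * y eps t)"
  and u: "!!eps t. 0 < eps ==> eps < e ==> (u eps has_vector_derivative of_real (rho eps) * of_real (rho eps) * (u eps t * G eps t)) (at t)"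
  and y: "!!eps t. 0 < eps ==> eps < e ==> (y eps has_vector_derivative of_real (rho eps) * G eps t - of_real lam * y eps t) (at t)"
  and per: "!!eps t. 0 < eps ==> eps < e ==> u eps (t + 2 * pi) = u eps t" "!!eps t. 0 < eps ==> eps < e ==> y eps (t + 2 * pi) = y eps t"
  and um: "!!eps. 0 < eps ==> eps < e ==> integral {0..2 * pi} (u eps) = of_real (2 * pi)"
  and bd: "bdd_fam e u" "bdd_fam e y"
  and Gm: "!!eps. 0 < eps ==> eps < e ==> integral {0..2 * pi} (G eps) = 0"
  and k: "1 <= k"
 shows "rate_array c c' c0 m m' d R Z k k = 0"
proof -
 define F where "F = rate_array c c' c0 m m' d R Z"
 define f where "f t = c * (cis t * cis t) + c' * (cis (- t) * cis (- t)) + c0" for t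
 define l where "l t = m * cis t + m' * cis (- t)" for t
 define U where "U k = hom R k" for k
 define Y where "Y k = hom Z (Suc k)" for k
 define Gk where "Gk k = hom F (Suc (Suc k))" for k
 define Wk where "Wk k = hom (conv R F) (Suc (Suc k))" for k
 define W where "W eps t = u eps t * G eps t" for eps t
 have Fl: "F i j = 0" if "i + j <= 1" for i j unfolding F_def by (rule rate_array_low[OF that Zl])
 have Rl: "R 1 0 = 0" "R 0 1 = 0"
  using Req[of 1 0] Req[of 0 1] Fl[of 0 0] Fl[of 1 0] Fl[of 0 1] by (simp_all add: conv_sum F_def)
 have homF: "hom F 0 t = 0" "hom F (Suc 0) t = 0" for t using Fl[of 0 0] Fl[of 1 0] Fl[of 0 1] by (simp_all add: hom_def)
 have bfl: "bdd_fam e (%_. f)" "bdd_fam e (%_. l)" "bdd_fam e (%_ _. d)"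
 proof -
  have "cmod (f t) <= cmod c + cmod c' + cmod c0" for t
   unfolding f_def by (rule order_trans[OF norm_triangle_ineq add_mono[OF order_trans[OF norm_triangle_ineq] order_refl]]) (simp add: norm_mult)
  moreover have "continuous_on UNIV f" unfolding f_def[abs_def] cis_conv_exp by (intro continuous_intros)
  ultimately show "bdd_fam e (%_. f)" by (blast intro: bdd_fam_const)
  have "cmod (l t) <= cmod m + cmod m'" for t
   unfolding l_def by (rule order_trans[OF norm_triangle_ineq]) (simp add: norm_mult)
  moreover have "continuous_on UNIV l" unfolding l_def[abs_def] cis_conv_exp by (intro continuous_intros)
  ultimately show "bdd_fam e (%_. l)" by (blast intro: bdd_fam_const)
  show "bdd_fam e (%_ _. d)" by (rule bdd_fam_const[OF continuous_on_const order_refl])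
 qed
 have GkE: "Gk k t = f t * (\<Sum>i\<le>k. U i t * U (k - i) t) + l t * (\<Sum>i\<le>k. U i t * Y (k - i) t) + d * (\<Sum>i\<le>k. Y i t * Y (k - i) t)" for k t
  unfolding Gk_def F_def f_def l_def U_def Y_def by (rule hom_rate_array[OF Zl])
 have WkE: "Wk k t = (\<Sum>i\<le>k. U i t * Gk (k - i) t)" for k t
  unfolding Wk_def hom_conv[symmetric] U_def Gk_def by (simp add: homF Suc_diff_le)
 have GE: "expn n G Gk" if "expn n u U" "expn n y Y" for n
 proof -
  have "expn n (%eps t. f t * (u eps t * u eps t) + l t * (u eps t * y eps t) + d * (y eps t * y eps t))
    (%k t. f t * (\<Sum>i\<le>k. U i t * U (k - i) t) + l t * (\<Sum>i\<le>k. U i t * Y (k - i) t) + d * (\<Sum>i\<le>k. Y i t * Y (k - i) t))"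
   by (intro expn_add expn_scale bfl expn_mult that)
  moreover have "G = (%eps t. f t * (u eps t * u eps t) + l t * (u eps t * y eps t) + d * (y eps t * y eps t))"
   by (rule ext)+ (simp only: G f_def l_def)
  moreover have "Gk = (%k t. f t * (\<Sum>i\<le>k. U i t * U (k - i) t) + l t * (\<Sum>i\<le>k. U i t * Y (k - i) t) + d * (\<Sum>i\<le>k. Y i t * Y (k - i) t))"
   by (rule ext)+ (rule GkE)
  ultimately show ?thesis by simp
 qed
 have WE: "expn n W Wk" if "expn n u U" "expn n y Y" for n
 proof -
  have "expn n (%eps t. u eps t * G eps t) (%k t. \<Sum>i\<le>k. U i t * Gk (k - i) t)"
   by (rule expn_mult[OF that(1) GE[OF that]])
  moreover have "W = (%eps t. u eps t * G eps t)" by (rule ext)+ (rule W_def)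
  moreover have "Wk = (%k t. \<Sum>i\<le>k. U i t * Gk (k - i) t)" by (rule ext)+ (rule WkE)
  ultimately show ?thesis by simp
 qed
 have Wm: "integral {0..2 * pi} (W eps) = 0" if eps: "0 < eps" "eps < e" for eps
 proof -
  let ?r = "of_real (rho eps) * of_real (rho eps) :: complex"
  have r: "?r ~= 0" using rho[OF eps] by simp
  have "((%t. ?r * W eps t) has_integral u eps (2 * pi) - u eps 0) {0..2 * pi}"
   unfolding W_def by (rule fundamental_theorem_of_calculus) (use u[OF eps] in \<open>auto intro: has_vector_derivative_at_within\<close>)
  moreover have "u eps (2 * pi) - u eps 0 = 0" using per(1)[OF eps, of 0] by simp
  ultimately have "((%t. ?r * W eps t) has_integral 0) {0..2 * pi}" by (simp only:)
  then have "integral {0..2 * pi} (%t. ?r * W eps t) = 0" by (rule integral_unique)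
  then have "?r * integral {0..2 * pi} (W eps) = 0" by (simp only: integral_mult_right)
  then show ?thesis using r by (metis mult_eq_0_iff)
 qed
 have Hd: "(hom Z (Suc (Suc k)) has_vector_derivative Gk k t - of_real lam * hom Z (Suc (Suc k)) t) (at t)" for k t
 proof -
  have "(%i j. \<i> * (of_nat i - of_nat j) * Z i j) = (%i j. F i j + (- of_real lam) * Z i j)"
   by (rule ext)+ (simp add: F_def Zeq[symmetric] algebra_simps)
  then show ?thesis using hom_deriv[of Z "Suc (Suc k)" t UNIV] by (simp only: hom_add hom_cmult Gk_def) simp
 qed
 have P: "expn n u U & expn n y Y & (\<forall>k<n. integral {0..2 * pi} (Gk k) = 0 & integral {0..2 * pi} (Wk k) = 0)" for n
 proof (induction n)
  case 0
  then show ?case using bd by simp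
 next
  case (Suc n)
  then have n: "expn n u U" "expn n y Y" "!!k. k < n ==> integral {0..2 * pi} (Gk k) = 0" "!!k. k < n ==> integral {0..2 * pi} (Wk k) = 0" by auto
  have "expn n (%eps t. y eps t / of_real (rho eps)) (%k. hom Z (Suc (Suc k)))"
  proof (rule expn_relaxation[OF lam GE[OF n(1,2)]])
   fix eps t assume eps: "0 < eps" "eps < e"
   have r: "complex_of_real (rho eps) ~= 0" using rho[OF eps] by simp
   show "((%t. y eps t / of_real (rho eps)) has_vector_derivative G eps t - of_real lam * (y eps t / of_real (rho eps))) (at t)"
    using has_vector_derivative_divide[OF y[OF eps, of t], of "of_real (rho eps)"] r by (simp add: diff_divide_distrib)
   show "y eps (t + 2 * pi) / of_real (rho eps) = y eps t / of_real (rho eps)" by (simp add: per(2)[OF eps])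
  qed (rule Hd hom_periodic)+
  then have yy: "expn n (%eps t. y eps t / of_real (rho eps)) (%k. Y (Suc k))" by (simp only: Y_def)
  have Y0: "Y 0 = (%_. 0)" using Zl[of 1 0] Zl[of 0 1] by (simp add: fun_eq_iff Y_def hom_def)
  have b1: "bdd_fam e (%_ _. 1)" "bdd_fam e (%_ _. 0)" by (rule bdd_fam_const[OF continuous_on_const order_refl])+
  have y1: "expn (Suc n) y Y"
   unfolding expn.simps
  proof (intro conjI exI[of _ "%eps t. y eps t / of_real (rho eps)"] allI impI)
   show "bdd_fam e (%_. Y 0)" using b1 Y0 by simp
   show "y eps t = Y 0 t + of_real (rho eps) * (y eps t / of_real (rho eps))" if "0 < eps" "eps < e" for eps t
    using rho[OF that] by (simp add: Y0)
  qed (rule yy)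
  have "expn n (%eps t. (u eps t - 1) / (of_real (rho eps) * of_real (rho eps))) (%k. hom R (Suc (Suc k)))"
  proof (rule expn_primitive[OF WE[OF n(1,2)]])
   fix eps t assume eps: "0 < eps" "eps < e"
   let ?r = "of_real (rho eps) * of_real (rho eps) :: complex"
   have r: "?r ~= 0" using rho[OF eps] by simp
   have "((%t. (u eps t - 1) / ?r) has_vector_derivative (?r * (u eps t * G eps t) - 0) / ?r) (at t)"
    by (intro has_vector_derivative_divide has_vector_derivative_diff u eps has_vector_derivative_const)
   then show "((%t. (u eps t - 1) / ?r) has_vector_derivative W eps t) (at t)" using r by (simp add: W_def)
   show "(u eps (t + 2 * pi) - 1) / ?r = (u eps t - 1) / ?r" by (simp add: per(1)[OF eps])
  next
   fix eps assume eps: "0 < eps" "eps < e"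
   have "integral {0..2 * pi} (%t. u eps t - 1) = integral {0..2 * pi} (u eps) - integral {0..2 * pi} (%t. 1)"
    by (intro integral_diff integrable_family[OF bd(1) eps]) (rule integrable_const_ivl)
   also have "... = 0" by (simp add: um[OF eps] scaleR_conv_of_real)
   finally show "integral {0..2 * pi} (%t. (u eps t - 1) / (of_real (rho eps) * of_real (rho eps))) = 0" by simp
  next
   fix k t assume k: "k < n"
   have "integral {0..2 * pi} (hom (conv R F) (2 * i)) = 0" if "2 * i = Suc (Suc k)" for i
    using n(4)[OF k] that by (simp add: Wk_def)
   then have "conv R F i i = 0" if "2 * i = Suc (Suc k)" for i using that hom_integral_diag[of "conv R F" i] by simp
   then have "hom (%i j. \<i> * (of_nat i - of_nat j) * R i j) (Suc (Suc k)) t = hom (conv R F) (Suc (Suc k)) t"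
    unfolding hom_def
   proof (intro sum.cong refl)
    fix i assume i: "i \<in> {..Suc (Suc k)}" and dz: "!!i. 2 * i = Suc (Suc k) ==> conv R F i i = 0"
    show "\<i> * (of_nat i - of_nat (Suc (Suc k) - i)) * R i (Suc (Suc k) - i) * cis ((real i - real (Suc (Suc k) - i)) * t)
     = conv R F i (Suc (Suc k) - i) * cis ((real i - real (Suc (Suc k) - i)) * t)"
    proof (cases "i = Suc (Suc k) - i")
     case True
     then have "conv R F i i = 0" using i by (intro dz) auto
     then show ?thesis using True by simp
    next
     case False
     then show ?thesis using Req[OF False] by (simp add: F_def)
    qed
   qed
   then show "(hom R (Suc (Suc k)) has_vector_derivative Wk k t) (at t)"
    using hom_deriv[of R "Suc (Suc k)" t UNIV] by (simp add: Wk_def)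
  next
   fix k t show "hom R (Suc (Suc k)) (t + 2 * pi) = hom R (Suc (Suc k)) t" by (rule hom_periodic)
   show "integral {0..2 * pi} (hom R (Suc (Suc k))) = 0" by (rule hom_integral_zero) (use Rd in auto)
  qed
  then have v: "expn n (%eps t. (u eps t - 1) / (of_real (rho eps) * of_real (rho eps))) (%k. U (Suc (Suc k)))" by (simp add: U_def)
  have U01: "U 0 = (%_. 1)" "U (Suc 0) = (%_. 0)" using R0 Rl by (simp_all add: fun_eq_iff U_def hom_def)
  have "expn (Suc n) (%eps t. (u eps t - 1) / of_real (rho eps)) (%k. U (Suc k))"
   unfolding expn.simps
  proof (intro conjI exI[of _ "%eps t. (u eps t - 1) / (of_real (rho eps) * of_real (rho eps))"] allI impI)
   show "bdd_fam e (%_. U (Suc 0))" using b1 U01 by simp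
   show "(u eps t - 1) / of_real (rho eps) = U (Suc 0) t + of_real (rho eps) * ((u eps t - 1) / (of_real (rho eps) * of_real (rho eps)))"
    if "0 < eps" "eps < e" for eps t using rho[OF that] by (simp add: U01)
  qed (rule v)
  then have "expn (Suc (Suc n)) u U"
   unfolding expn.simps(2)[of "Suc n"]
  proof (intro conjI exI[of _ "%eps t. (u eps t - 1) / of_real (rho eps)"] allI impI)
   show "bdd_fam e (%_. U 0)" using b1 U01 by simp
   show "u eps t = U 0 t + of_real (rho eps) * ((u eps t - 1) / of_real (rho eps))" if "0 < eps" "eps < e" for eps t
    using rho[OF that] by (simp add: U01)
  qed
  then have u1: "expn (Suc n) u U" by (rule expn_weaken)
  have g: "integral {0..2 * pi} (Gk n) = 0" by (rule expn_mean[OF GE[OF u1 y1] Gm n(3)])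
  have w: "integral {0..2 * pi} (Wk n) = 0" by (rule expn_mean[OF WE[OF u1 y1] Wm n(4)])
  show ?case using u1 y1 g w n(3,4) less_Suc_eq by auto
 qed
 have "integral {0..2 * pi} (Gk (2 * k - 2)) = 0" using P[of "Suc (2 * k - 2)"] by simp
 moreover have "Suc (Suc (2 * k - 2)) = 2 * k" using k by simp
 ultimately show ?thesis using hom_integral_diag[of F k] by (simp add: Gk_def F_def)
qed

end

section \<open>Necessity of the centre conditions\<close>

lemma fa_impossible:
 assumes lam: "lam ~= 0" and s: "focus_arrays (- (\<i> * of_real lam)) (of_real er) Z R"
 shows False
proof -
 define L where "L = - (\<i> * complex_of_real lam)"
 define x where "x = lam\<^sup>2"
 have x: "x > 0" using lam by (simp add: x_def)
 have hx: "complex_of_real x = - (L ^ 2)" by (simp add: L_def x_def power_mult_distrib)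
 note s = s[folded L_def]
 have nz: "L ~= 0" "L + 1 ~= 0" "L - 1 ~= 0" "L + 3 ~= 0" "L - 3 ~= 0"
  using lam by (simp_all add: L_def complex_eq_iff)
 have m0: "b = 0" if "a * b = 0" "a ~= 0" for a b :: complex using that by simp
 have k4: "48 * L * (L + 1) * (L - 1) ~= 0" and k5: "600 * L * (L + 3) * (L - 3) ~= 0"
  and k6: "4320 * L * (L + 1) * (L - 1) * (L + 3) * (L - 3) ~= 0"
  unfolding mult_eq_0_iff using nz by simp_all
 note P4 = m0[OF focus_quantity_4[OF s] k4]
 note P5 = m0[OF focus_quantity_5[OF s] k5]
 note P6 = m0[OF focus_quantity_6[OF s] k6]
 have re: "r = 0" if "complex_of_real r = 0" for r using that by simp
 show False
 proof (rule focus_quantities_no_common_zero[of x er, OF x], goal_cases)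
  case 1
  show ?case by (rule re, unfold of_real_add of_real_diff of_real_mult of_real_power of_real_numeral of_real_minus hx, insert P4, algebra)
 next
  case 2
  show ?case by (rule re, unfold of_real_add of_real_diff of_real_mult of_real_power of_real_numeral of_real_minus hx, insert P5, algebra)
 next
  case 3
  show ?case by (rule re, unfold of_real_add of_real_diff of_real_mult of_real_power of_real_numeral of_real_minus hx, insert P6, algebra)
 qed
qed

lemma rigid_center_necessary:
 assumes lam: "lam ~= 0" and rc: "rigid_center lam P Q R"
  and P: "P = (%(x, y, z). x * hom_quadratic a (x, y, z))"
  and Q: "Q = (%(x, y, z). y * hom_quadratic a (x, y, z))" and R: "R = hom_quadratic a"
 shows "(a 2 0 0 = 0 & a 1 1 0 = 0 & a 0 2 0 = 0)
    | (a 0 2 0 = - a 2 0 0 & a 1 0 1 = 0 & a 0 1 1 = 0 & a 0 0 2 = 0)"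
proof -
 obtain e0 where e0: "e0 > 0" and fam: "!!eps. 0 < eps ==> eps < e0 ==> EX r z. ALL t.
   (r has_real_derivative r t * polar_rate a t (r t) (z t)) (at t)
   & (z has_real_derivative - lam * z t + polar_rate a t (r t) (z t)) (at t)
   & r (t + 2 * pi) = r t & z (t + 2 * pi) = z t & eps / 2 <= r t & r t <= 2 * eps & \<bar>z t\<bar> <= r t"
  by (rule center_polar_family[OF rc P Q R]) blast
 define good where "good eps p \<longleftrightarrow> (ALL t. (fst p has_real_derivative fst p t * polar_rate a t (fst p t) (snd p t)) (at t)
   & (snd p has_real_derivative - lam * snd p t + polar_rate a t (fst p t) (snd p t)) (at t)
   & fst p (t + 2 * pi) = fst p t & snd p (t + 2 * pi) = snd p t & eps / 2 <= fst p t & fst p t <= 2 * eps & \<bar>snd p t\<bar> <= fst p t)"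
  for eps and p :: "(real => real) \<times> (real => real)"
 have "ALL eps. EX p. 0 < eps & eps < e0 --> good eps p"
 proof
  fix eps
  show "EX p. 0 < eps & eps < e0 --> good eps p"
  proof (cases "0 < eps & eps < e0")
   case True
   then obtain r z where "good eps (r, z)" using fam[of eps] unfolding good_def fst_conv snd_conv by blast
   then show ?thesis by blast
  qed blast
 qed
 then obtain rz where rz: "ALL eps. 0 < eps & eps < e0 --> good eps (rz eps)" by (rule choice[elim_format]) blast
 define r z where "r eps = fst (rz eps)" and "z eps = snd (rz eps)" for eps
 define e where "e = min e0 (1 / 2)"
 have e: "e > 0" using e0 by (simp add: e_def)
 have g: "(r eps has_real_derivative r eps t * polar_rate a t (r eps t) (z eps t)) (at t)"
   "(z eps has_real_derivative - lam * z eps t + polar_rate a t (r eps t) (z eps t)) (at t)"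
   "r eps (t + 2 * pi) = r eps t" "z eps (t + 2 * pi) = z eps t" "eps / 2 <= r eps t" "r eps t <= 2 * eps" "\<bar>z eps t\<bar> <= r eps t"
  if "0 < eps" "eps < e" for eps t
 proof -
  have "good eps (rz eps)" using rz that by (simp add: e_def)
  then show "(r eps has_real_derivative r eps t * polar_rate a t (r eps t) (z eps t)) (at t)"
   "(z eps has_real_derivative - lam * z eps t + polar_rate a t (r eps t) (z eps t)) (at t)"
   "r eps (t + 2 * pi) = r eps t" "z eps (t + 2 * pi) = z eps t" "eps / 2 <= r eps t" "r eps t <= 2 * eps" "\<bar>z eps t\<bar> <= r eps t"
   unfolding good_def r_def z_def by blast+
 qed
 have rpos: "r eps t > 0" if "0 < eps" "eps < e" for eps t using g(5)[OF that, of t] that by linarith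
 have rc: "continuous_on UNIV (r eps)" "continuous_on UNIV (z eps)" if "0 < eps" "eps < e" for eps
  by (meson g(1)[OF that] g(2)[OF that] DERIV_isCont continuous_at_imp_continuous_on)+
 define rho where "rho eps = integral {0..2 * pi} (r eps) / (2 * pi)" for eps
 have ri: "r eps integrable_on {0..2 * pi}" if "0 < eps" "eps < e" for eps
  by (rule integrable_continuous_interval[OF continuous_on_subset[OF rc(1)[OF that]]]) simp
 have rhob: "eps / 2 <= rho eps & rho eps <= 2 * eps" if eps: "0 < eps" "eps < e" for eps
 proof -
  have "integral {0..2 * pi} (%t. eps / 2) <= integral {0..2 * pi} (r eps)"
   by (rule integral_le[OF integrable_const_ivl ri[OF eps]]) (rule g(5)[OF eps])
  moreover have "integral {0..2 * pi} (r eps) <= integral {0..2 * pi} (%t. 2 * eps)"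
   by (rule integral_le[OF ri[OF eps] integrable_const_ivl]) (rule g(6)[OF eps])
  ultimately show ?thesis by (simp add: rho_def field_simps)
 qed
 interpret small_orbits e rho
 proof
  show "0 < rho eps & rho eps <= 1 & rho eps <= 2 * eps" if "0 < eps" "eps < e" for eps
   using rhob[OF that] that by (simp add: e_def)
 qed (rule e)
 define c where "c = Complex ((a 2 0 0 - a 0 2 0) / 4) (- a 1 1 0 / 4)"
 define c0 where "c0 = complex_of_real ((a 2 0 0 + a 0 2 0) / 2)"
 define m where "m = Complex (a 1 0 1 / 2) (- a 0 1 1 / 2)"
 define d where "d = complex_of_real (a 0 0 2)"
 define u y where "u eps t = complex_of_real (r eps t / rho eps)" and "y eps t = complex_of_real (z eps t / rho eps)" for eps t
 define G where "G eps t = (c * (cis t * cis t) + cnj c * (cis (- t) * cis (- t)) + c0) * (u eps t * u eps t)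
    + (m * cis t + cnj m * cis (- t)) * (u eps t * y eps t) + d * (y eps t * y eps t)" for eps t
 have F2: "c * (cis t * cis t) + cnj c * (cis (- t) * cis (- t)) + c0
   = of_real (a 2 0 0 * (cos t)\<^sup>2 + a 1 1 0 * (cos t * sin t) + a 0 2 0 * (sin t)\<^sup>2)" for t
 proof -
  have half_angle: "2 * ((p - r) / 4 * (C * C - S * S) + q / 4 * (2 * (C * S))) + (p + r) / 2 * (S * S + C * C) = p * (C * C) + q * (C * S) + r * (S * S)"
   for p q r C S :: real by (simp add: field_simps)
  have s: "sin t * sin t + cos t * cos t = 1" using sin_cos_squared_add[of t] by (simp add: power2_eq_square)
  show ?thesis
  proof (rule complex_eqI)
   have "Re (c * (cis t * cis t) + cnj c * (cis (- t) * cis (- t)) + c0)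
    = 2 * ((a 2 0 0 - a 0 2 0) / 4 * (cos t * cos t - sin t * sin t) + a 1 1 0 / 4 * (2 * (cos t * sin t))) + (a 2 0 0 + a 0 2 0) / 2 * 1"
    by (simp add: c_def c0_def field_simps)
   also have "... = 2 * ((a 2 0 0 - a 0 2 0) / 4 * (cos t * cos t - sin t * sin t) + a 1 1 0 / 4 * (2 * (cos t * sin t)))
     + (a 2 0 0 + a 0 2 0) / 2 * (sin t * sin t + cos t * cos t)" by (simp only: s)
   also have "... = a 2 0 0 * (cos t)\<^sup>2 + a 1 1 0 * (cos t * sin t) + a 0 2 0 * (sin t)\<^sup>2"
    unfolding power2_eq_square by (rule half_angle)
   finally show "Re (c * (cis t * cis t) + cnj c * (cis (- t) * cis (- t)) + c0)
    = Re (of_real (a 2 0 0 * (cos t)\<^sup>2 + a 1 1 0 * (cos t * sin t) + a 0 2 0 * (sin t)\<^sup>2))" by (simp only: Re_complex_of_real)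
   show "Im (c * (cis t * cis t) + cnj c * (cis (- t) * cis (- t)) + c0)
    = Im (of_real (a 2 0 0 * (cos t)\<^sup>2 + a 1 1 0 * (cos t * sin t) + a 0 2 0 * (sin t)\<^sup>2))"
    by (simp add: c_def c0_def algebra_simps)
  qed
 qed
 have F1: "m * cis t + cnj m * cis (- t) = of_real (a 1 0 1 * cos t + a 0 1 1 * sin t)" for t
  by (simp add: complex_eq_iff m_def)
 have GF: "G eps t = of_real (polar_rate a t (r eps t) (z eps t) / (rho eps * rho eps))" if "0 < eps" "eps < e" for eps t
 proof -
  have n: "rho eps ~= 0" using rho[OF that] by simp
  have "polar_rate a t (r eps t) (z eps t) / (rho eps * rho eps)
   = (a 2 0 0 * (cos t)\<^sup>2 + a 1 1 0 * (cos t * sin t) + a 0 2 0 * (sin t)\<^sup>2) * (r eps t / rho eps * (r eps t / rho eps))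
    + (a 1 0 1 * cos t + a 0 1 1 * sin t) * (r eps t / rho eps * (z eps t / rho eps)) + a 0 0 2 * (z eps t / rho eps * (z eps t / rho eps))"
   unfolding polar_rate_def by (simp add: add_divide_distrib power2_eq_square)
  then show ?thesis unfolding G_def F2 F1 u_def y_def d_def by (simp only: of_real_add of_real_mult)
 qed
 obtain RR ZZ where arr: "RR 0 0 = 1" "!!k. 1 <= k ==> RR k k = 0" "!!i j. i + j <= 1 ==> ZZ i j = 0"
  "!!i j. (of_real lam + \<i> * (of_nat i - of_nat j)) * ZZ i j = rate_array c (cnj c) c0 m (cnj m) d RR ZZ i j"
  "!!i j. i ~= j ==> \<i> * (of_nat i - of_nat j) * RR i j = conv RR (rate_array c (cnj c) c0 m (cnj m) d RR ZZ) i j"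
  by (rule center_series_exists[OF lam, of c "cnj c" c0 m "cnj m" d]) blast
 let ?F = "rate_array c (cnj c) c0 m (cnj m) d RR ZZ"
 have bal: "?F k k = 0" if k: "1 <= k" for k
 proof (rule orbit_balance[where u = u and y = y and G = G, OF lam arr G_def _ _ _ _ _ _ _ _ k])
  fix eps t assume eps: "0 < eps" "eps < e"
  have n: "rho eps ~= 0" using rho[OF eps] by simp
  have "((%t. r eps t / rho eps) has_real_derivative r eps t * polar_rate a t (r eps t) (z eps t) / rho eps) (at t)"
   by (rule DERIV_cdivide[OF g(1)[OF eps]])
  from has_vector_derivative_of_real[OF this, where 'a = complex]
  show "(u eps has_vector_derivative of_real (rho eps) * of_real (rho eps) * (u eps t * G eps t)) (at t)"
   unfolding GF[OF eps] u_def[abs_def] using n by (simp add: field_simps)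
  have "((%t. z eps t / rho eps) has_real_derivative (- lam * z eps t + polar_rate a t (r eps t) (z eps t)) / rho eps) (at t)"
   by (rule DERIV_cdivide[OF g(2)[OF eps]])
  from has_vector_derivative_of_real[OF this, where 'a = complex]
  show "(y eps has_vector_derivative of_real (rho eps) * G eps t - of_real lam * y eps t) (at t)"
   unfolding GF[OF eps] y_def[abs_def] using n by (simp add: field_simps)
  show "u eps (t + 2 * pi) = u eps t" "y eps (t + 2 * pi) = y eps t" by (simp_all add: u_def y_def g(3,4)[OF eps])
 next
  fix eps assume eps: "0 < eps" "eps < e"
  have n: "rho eps ~= 0" using rho[OF eps] by simp
  have "(r eps has_integral rho eps * (2 * pi)) {0..2 * pi}" using integrable_integral[OF ri[OF eps]] by (simp add: rho_def)
  from has_integral_divide[OF this, of "rho eps"] n have "((%t. r eps t / rho eps) has_integral 2 * pi) {0..2 * pi}" by simp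
  from has_integral_of_real[OF this, where 'b = complex] show "integral {0..2 * pi} (u eps) = of_real (2 * pi)"
   unfolding u_def[abs_def] by (rule integral_unique)
  have "((%t. polar_rate a t (r eps t) (z eps t)) has_integral ln (r eps (2 * pi)) - ln (r eps 0)) {0..2 * pi}"
  proof (rule fundamental_theorem_of_calculus)
   fix t
   have "((%t. ln (r eps t)) has_real_derivative 1 / r eps t * (r eps t * polar_rate a t (r eps t) (z eps t))) (at t)"
    by (rule DERIV_chain2[OF DERIV_ln_divide[OF rpos[OF eps]] g(1)[OF eps]])
   then show "((%t. ln (r eps t)) has_vector_derivative polar_rate a t (r eps t) (z eps t)) (at t within {0..2 * pi})"
    using rpos[OF eps, of t] by (simp add: has_real_derivative_iff_has_vector_derivative has_vector_derivative_at_within)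
  qed simp
  then have "((%t. polar_rate a t (r eps t) (z eps t)) has_integral 0) {0..2 * pi}" using g(3)[OF eps, of 0] by simp
  from has_integral_of_real[OF has_integral_divide[OF this, of "rho eps * rho eps"], where 'b = complex]
  have "((%t. G eps t) has_integral 0) {0..2 * pi}" unfolding GF[OF eps] by simp
  then show "integral {0..2 * pi} (G eps) = 0" by (rule integral_unique)
 next
  have q: "r eps t / rho eps <= 4" "0 <= r eps t / rho eps" "\<bar>z eps t / rho eps\<bar> <= 4" if eps: "0 < eps" "eps < e" for eps t
  proof -
   have p: "rho eps > 0" using rho[OF eps] by simp
   have "r eps t <= 4 * rho eps" using g(6)[OF eps, of t] rhob[OF eps] by linarith
   then show 1: "r eps t / rho eps <= 4" using p by (simp add: pos_divide_le_eq)
   show "0 <= r eps t / rho eps" using p rpos[OF eps, of t] by simp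
   have "\<bar>z eps t / rho eps\<bar> = \<bar>z eps t\<bar> / rho eps" using p by (simp add: abs_divide)
   also have "... <= r eps t / rho eps" using g(7)[OF eps, of t] p by (intro divide_right_mono) auto
   finally show "\<bar>z eps t / rho eps\<bar> <= 4" using 1 by linarith
  qed
  have cu: "continuous_on UNIV (u eps)" "continuous_on UNIV (y eps)" if "0 < eps" "eps < e" for eps
  proof -
   have "rho eps ~= 0" using rho[OF that] by simp
   then show "continuous_on UNIV (u eps)" "continuous_on UNIV (y eps)" unfolding u_def[abs_def] y_def[abs_def]
    by (auto intro!: continuous_on_of_real continuous_on_divide continuous_on_const rc[OF that])
  qed
  have b: "cmod (u eps t) <= 4" "cmod (y eps t) <= 4" if "0 < eps" "eps < e" for eps t
   unfolding u_def y_def norm_of_real using q(1,2)[OF that, of t] q(3)[OF that, of t] by linarith+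
  show "bdd_fam e u" "bdd_fam e y" unfolding bdd_fam_def using b cu by blast+
 qed
 have c00: "?F 1 1 = c0"
  using arr(1) arr(3)[of 0 0] arr(3)[of 1 0] arr(3)[of 0 1]
  by (simp add: rate_array_def conv_def dsum_def)
 then have "c0 = 0" using bal[of 1] by simp
 then have "(a 2 0 0 + a 0 2 0) / 2 = 0" unfolding c0_def of_real_eq_0_iff .
 then have a020: "a 0 2 0 = - a 2 0 0" by (simp add: eq_neg_iff_add_eq_0 add.commute)
 show ?thesis
 proof (cases "c = 0")
  case True
  then have "a 2 0 0 = a 0 2 0" "a 1 1 0 = 0" by (simp_all add: c_def complex_eq_iff)
  then show ?thesis using a020 by simp
 next
  case False
  define L where "L = - (\<i> * complex_of_real lam)"
  let ?H = "rate_array (- \<i> * c) (- \<i> * cnj c) 0 (- \<i> * m) (- \<i> * cnj m) (- \<i> * d) RR ZZ"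
  have H: "?H i j = - \<i> * ?F i j" for i j
   unfolding rate_array_def \<open>c0 = 0\<close> by (simp add: algebra_simps)
  have HZ: "?H i j = (L + of_nat i - of_nat j) * ZZ i j" for i j
   unfolding H arr(4)[symmetric] L_def by (simp add: algebra_simps)
  have ca: "center_arrays L (- \<i> * c) (- \<i> * cnj c) (- \<i> * m) (- \<i> * cnj m) (- \<i> * d) RR ZZ"
  proof
   show "L + of_nat h ~= 0 & L - of_nat h ~= 0" if "h \<in> {1..6}" for h :: nat
    using that by (auto simp: L_def complex_eq_iff)
   show "L ~= 0" using lam by (simp add: L_def)
   show "RR 0 0 = 1" by (rule arr(1))
   show "ZZ 0 0 = 0" "ZZ 1 0 = 0" "ZZ 0 1 = 0" by (rule arr(3); simp)+
   fix k :: nat assume k: "k \<in> {1..6}"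
   show "ZZ k k = 0" using arr(4)[of k k] bal[of k] k lam by simp
   show "RR k k = 0" using arr(2)[of k] k by simp
   show "?H k k = 0" using bal[of k] k unfolding H by simp
  next
   fix i j :: nat assume ij: "i ~= j"
   show "?H i j = (L + of_nat i - of_nat j) * ZZ i j" by (rule HZ)
   have "conv RR (%k l. (L + of_nat k - of_nat l) * ZZ k l) i j = conv RR (%k l. - \<i> * ?F k l) i j"
    unfolding HZ[symmetric] H ..
   also have "... = - \<i> * conv RR ?F i j"
    unfolding conv_sum sum_distrib_left by (simp add: mult_ac)
   also have "... = (of_nat i - of_nat j) * RR i j"
    unfolding arr(5)[OF ij, symmetric] by (simp add: mult.assoc[symmetric])
   finally show "conv RR (%k l. (L + of_nat k - of_nat l) * ZZ k l) i j = (of_nat i - of_nat j) * RR i j" .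
  qed
  show ?thesis
  proof (cases "m = 0")
   case True
   have "- \<i> * d = 0"
    by (rule center_arrays_no_coupling[of L "- \<i> * c" "- \<i> * cnj c" "- \<i> * d" RR ZZ]) (use ca True False in auto)
   then show ?thesis using a020 True by (simp add: d_def m_def complex_eq_iff)
  next
   case m: False
   have z: "ZZ 2 0 ~= 0" "ZZ 0 2 ~= 0"
    using center_arrays.deg2(1,2)[OF ca] False by auto
   obtain Z' R' where "focus_arrays L (- \<i> * d / L) Z' R'"
    using center_arrays_focus[OF ca _ _ z] m by auto
   moreover have "- \<i> * d / L = of_real (a 0 0 2 / lam)" using lam by (simp add: L_def d_def)
   ultimately show ?thesis using fa_impossible[OF lam] unfolding L_def by metis
  qed
 qed
qed

section \<open>Centre conditions and cyclicity\<close>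

theorem theorem10:
  fixes lam :: real and a :: coeffs
    and P Q R :: "space \<Rightarrow> real"
  assumes "lam \<noteq> 0"
    and P: "P = (\<lambda>(x, y, z). x * hom_quadratic a (x, y, z))"
    and Q: "Q = (\<lambda>(x, y, z). y * hom_quadratic a (x, y, z))"
    and R: "R = hom_quadratic a"
  shows
    "(rigid_center lam P Q R \<longleftrightarrow>
        (a 2 0 0 = 0 \<and> a 1 1 0 = 0 \<and> a 0 2 0 = 0)
        \<or> (a 0 2 0 = - a 2 0 0 \<and> a 1 0 1 = 0 \<and> a 0 1 1 = 0 \<and> a 0 0 2 = 0))
     \<and> (a 2 0 0 = 0 \<and> a 1 1 0 = 0 \<and> a 0 2 0 = 0
          \<longrightarrow> quadratic_cyclicity_at_least 3 lam P Q R)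
     \<and> (a 0 2 0 = - a 2 0 0 \<and> a 1 0 1 = 0 \<and> a 0 1 1 = 0 \<and> a 0 0 2 = 0
          \<longrightarrow> quadratic_cyclicity_at_least 2 lam P Q R)"
proof -
  let ?C1 = "a 2 0 0 = 0 \<and> a 1 1 0 = 0 \<and> a 0 2 0 = 0"
  let ?C2 = "a 0 2 0 = - a 2 0 0 \<and> a 1 0 1 = 0 \<and> a 0 1 1 = 0 \<and> a 0 0 2 = 0"
  have suff1: "rigid_center lam P Q R" if ?C1
    using rigid_center_of_z_factor[OF _ _ _ P Q R] that by blast
  have suff2: "rigid_center lam P Q R" if ?C2
    using rigid_center_of_planar_rate[OF assms(1) _ _ _ _ P Q R] that by blast
  have nec: "?C1 \<or> ?C2" if "rigid_center lam P Q R"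
    by (rule rigid_center_necessary[OF assms(1) that P Q R])
  have cyc3: "quadratic_cyclicity_at_least 3 lam P Q R" if ?C1
    using cyclicity_z_factor[OF assms(1) _ _ _ P Q R] that by blast
  have cyc2: "quadratic_cyclicity_at_least 2 lam P Q R" if c: ?C2
  proof (cases "a 2 0 0 = 0 \<and> a 1 1 0 = 0")
    case True
    with c have ?C1 by simp
    from quadratic_cyclicity_mono[OF cyc3[OF this], of 2] show ?thesis by simp
  next
    case False
    show ?thesis
      by (rule cyclicity_planar_rate) (use assms(1) c False P Q R in auto)
  qed
  show ?thesis using suff1 suff2 nec cyc3 cyc2 by blast
qed

end
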